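(* For every $m\in\mathbb N=\{0,1,2,\dots\}$ there exist positive constants $c_m$ and $C_m$, depending only on $m$, such that for every $k\in\mathbb Z$, every axisymmetric domain $\breve\Omega\subset\mathbb R^3$ with meridian domain $\Omega\subset\mathbb R_+\times\mathbb R$, and every $w\in L^2_1(\Omega)$, $$ c_m\,\|w\|^2_{H^m_{(k)}(\Omega)}\;\le\;\sum_{\ell=0}^{\min\{|k|,m\}}\Big\|\Big(\tfrac{|k|}{r}\Big)^{\ell}w\Big\|^2_{H^{m-\ell}_1(\Omega)}+\sum_{1\le \ell\le (m-|k|)/2}\Big\|\Big(\tfrac1r\partial_r\Big)^{\ell}\Big(\tfrac1r\Big)^{|k|}w\Big\|^2_{H^{m-|k|-2\ell}_1(\Omega)}\;\le\; C_m\,\|w\|^2_{H^m_{(k)}(\Omega)} . $$ (The second sum runs over the integers $\ell$ with $1\le\ell\le(m-|k|)/2$ and is empty if there are none.) The same result holds in the same form if $\Omega\subset\mathbb R_+$ is an interval and $\breve\Omega\subset\mathbb R^2$ is the corresponding disc or annulus, i.e. the 2D axisymmetric domain with meridian domain $\Omega$.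
   Context: Functions are complex valued; $\mathbb R_+=(0,\infty)$. An axisymmetric domain $\breve\Omega\subset\mathbb R^3$ is a domain (nonempty connected open set) invariant under all rotations around the $z$-axis; its meridian domain is $\Omega=\{(r,z): r>0,\ (r,0,z)\in\breve\Omega\}$. Cylindrical coordinates: $x=r\cos\theta$, $y=r\sin\theta$, $z$. (Whether points of the axis $\{r=0\}$ are included in $\breve\Omega$ is immaterial for the spaces considered.) $L^2_1(\Omega)$ is the space of measurable functions with $\|v\|^2_{L^2_1(\Omega)}=2\pi\int_\Omega|v(r,z)|^2\,r\,dr\,dz<\infty$. For $j\in\mathbb N$, $\|v\|^2_{H^j_1(\Omega)}=\sum_{a+b\le j}\|\partial_r^a\partial_z^b v\|^2_{L^2_1(\Omega)}$ with distributional derivatives in $\Omega$. $\|\breve u\|^2_{H^m(\breve\Omega)}=\sum_{|\alpha|\le m}\|\partial^\alpha_{(x,y,z)}\breve u\|^2_{L^2(\breve\Omega)}$ (sum over multi-indices $\alpha\in\mathbb N^3$). For $w\in L^2_1(\Omega)$ set $\breve w_k(x,y,z)=e^{ik\theta}w(r,z)$; then $H^m_{(k)}(\Omega)=\{w\in L^2_1(\Omega):\breve w_k\in H^m(\breve\Omega)\}$ with $\|w\|_{H^m_{(k)}(\Omega)}:=\|\breve w_k\|_{H^m(\breve\Omega)}$. Norms take values in $[0,+\infty]$, being $+\infty$ when a required distributional derivative is not in the corresponding $L^2$ space. Convention: $(|k|/r)^0\equiv1$ for all $k$, including $k=0$. In an expression such as $(\tfrac1r\partial_r)^\ell(\tfrac1r)^{|k|}w$,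 the function $r^{-|k|}w$ is formed first, then the operator $\tfrac1r\partial_r$ is applied $\ell$ times. In the 2D case the variable $z$ is absent: $\breve\Omega=\{(x,y)\}$ is a disc or annulus centered at the origin, $\Omega=\{r>0:(r,0)\in\breve\Omega\}$, $\|v\|^2_{L^2_1(\Omega)}=2\pi\int_\Omega|v|^2r\,dr$, and $\|v\|^2_{H^j_1(\Omega)}=\sum_{a\le j}\|\partial_r^a v\|^2_{L^2_1(\Omega)}$. *)

theory Defs
  imports "HOL-Analysis.Analysis"
begin

section \<open>Distributions\<close>

definition pdiff :: "'a::euclidean_space \<Rightarrow> ('a \<Rightarrow> complex) \<Rightarrow> 'a \<Rightarrow> complex" where
  "pdiff e f x = frechet_derivative f (at x) e"

text \<open>Differentiability of all iterated partial derivatives forces their continuity, so this is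
  \<open>C\<close>-infinity on the whole space.\<close>

definition smooth :: "('a::euclidean_space \<Rightarrow> complex) \<Rightarrow> bool" where
  "smooth f \<longleftrightarrow> (\<forall>es. set es \<subseteq> Basis \<longrightarrow> fold pdiff es f differentiable_on UNIV)"

definition test_functions :: "'a::euclidean_space set \<Rightarrow> ('a \<Rightarrow> complex) set" where
  "test_functions \<Omega> =
     {\<phi>. smooth \<phi> \<and> compact (closure {x. \<phi> x \<noteq> 0}) \<and> closure {x. \<phi> x \<noteq> 0} \<subseteq> \<Omega>}"

text \<open>A distribution on \<open>\<Omega>\<close> is represented by a functional of which only the values on
  \<open>test_functions \<Omega>\<close> matter. Working with functionals lets operators such as
  \<open>(1/r) \<partial>\<^sub>r\<close> be iterated without assuming that the intermediate results are functions.\<close>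

type_synonym 'a distr = "('a \<Rightarrow> complex) \<Rightarrow> complex"

definition distr_of :: "'a::euclidean_space set \<Rightarrow> ('a \<Rightarrow> complex) \<Rightarrow> 'a distr" where
  "distr_of \<Omega> f \<phi> = (\<integral>x. f x * \<phi> x \<partial>lebesgue_on \<Omega>)"

definition distr_diff :: "'a::euclidean_space \<Rightarrow> 'a distr \<Rightarrow> 'a distr" where
  "distr_diff e T \<phi> = - T (pdiff e \<phi>)"

text \<open>Meaningful when \<open>h\<close> is smooth on the domain under consideration.\<close>

definition distr_mult :: "('a::euclidean_space \<Rightarrow> real) \<Rightarrow> 'a distr \<Rightarrow> 'a distr" where
  "distr_mult h T \<phi> = T (\<lambda>x. of_real (h x) * \<phi> x)"

definition locally_integrable_on ::
    "('a::euclidean_space \<Rightarrow> complex) \<Rightarrow> 'a set \<Rightarrow> bool" (infixr \<open>locally'_integrable'_on\<close> 46) where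
  "f locally_integrable_on \<Omega> \<longleftrightarrow>
     (\<forall>K. compact K \<and> K \<subseteq> \<Omega> \<longrightarrow> f absolutely_integrable_on K)"


section \<open>Weighted \<open>L\<^sup>2\<close> and Sobolev norms\<close>

text \<open>All norms below are squared norms with values in \<open>[0, \<infinity>]\<close>; \<open>\<rho>\<close> is the weight.\<close>

definition L2_sq :: "'a::euclidean_space set \<Rightarrow> ('a \<Rightarrow> real) \<Rightarrow> ('a \<Rightarrow> complex) \<Rightarrow> ennreal" where
  "L2_sq \<Omega> \<rho> f = (\<integral>\<^sup>+x. ennreal (\<rho> x * (norm (f x))\<^sup>2) \<partial>lebesgue_on \<Omega>)"

text \<open>The function representing a distribution is unique almost everywhere, so the infimum
  ranges over at most one value; it is \<open>\<infinity>\<close> if the distribution is not a function.\<close>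

definition distr_L2_sq :: "'a::euclidean_space set \<Rightarrow> ('a \<Rightarrow> real) \<Rightarrow> 'a distr \<Rightarrow> ennreal" where
  "distr_L2_sq \<Omega> \<rho> T =
     (INF g \<in> {g. g locally_integrable_on \<Omega> \<and> (\<forall>\<phi>\<in>test_functions \<Omega>. T \<phi> = distr_of \<Omega> g \<phi>)}.
        L2_sq \<Omega> \<rho> g)"


section \<open>Domains in \<open>\<real>\<^sup>3\<close>\<close>

definition rot_z :: "real \<Rightarrow> real \<times> real \<times> real \<Rightarrow> real \<times> real \<times> real" where
  "rot_z t = (\<lambda>(x, y, z). (x * cos t - y * sin t, x * sin t + y * cos t, z))"

definition axisymmetric_domain :: "(real \<times> real \<times> real) set \<Rightarrow> bool" where
  "axisymmetric_domain D \<longleftrightarrow>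
     open D \<and> connected D \<and> D \<noteq> {} \<and> (\<forall>t. rot_z t ` D = D)"

definition meridian :: "(real \<times> real \<times> real) set \<Rightarrow> (real \<times> real) set" where
  "meridian D = {(r, z). r > 0 \<and> (r, 0, z) \<in> D}"

definition weight_rz :: "real \<times> real \<Rightarrow> real" where
  "weight_rz = (\<lambda>(r, z). 2 * pi * r)"

definition L2_1 :: "(real \<times> real) set \<Rightarrow> (real \<times> real \<Rightarrow> complex) set" where
  "L2_1 \<Omega> = {w. w \<in> borel_measurable (lebesgue_on \<Omega>) \<and> L2_sq \<Omega> weight_rz w < \<infinity>}"

definition H1_sq :: "nat \<Rightarrow> (real \<times> real) set \<Rightarrow> (real \<times> real) distr \<Rightarrow> ennreal" where
  "H1_sq j \<Omega> T = (\<Sum>(a, b) \<in> {(a, b). a + b \<le> j}.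
     distr_L2_sq \<Omega> weight_rz ((distr_diff (1, 0) ^^ a) ((distr_diff (0, 1) ^^ b) T)))"

definition H_sq_3d ::
    "nat \<Rightarrow> (real \<times> real \<times> real) set \<Rightarrow> (real \<times> real \<times> real \<Rightarrow> complex) \<Rightarrow> ennreal" where
  "H_sq_3d m D u = (\<Sum>(a, b, c) \<in> {(a, b, c). a + b + c \<le> m}.
     distr_L2_sq D (\<lambda>_. 1)
       ((distr_diff (1, 0, 0) ^^ a) ((distr_diff (0, 1, 0) ^^ b) ((distr_diff (0, 0, 1) ^^ c)
         (distr_of D u)))))"

definition lift :: "int \<Rightarrow> (real \<times> real \<Rightarrow> complex) \<Rightarrow> real \<times> real \<times> real \<Rightarrow> complex" where
  "lift k w = (\<lambda>(x, y, z). cis (of_int k * Arg (Complex x y)) * w (sqrt (x\<^sup>2 + y\<^sup>2), z))"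

definition Hk_sq ::
    "nat \<Rightarrow> int \<Rightarrow> (real \<times> real \<times> real) set \<Rightarrow> (real \<times> real \<Rightarrow> complex) \<Rightarrow> ennreal" where
  "Hk_sq m k D w = H_sq_3d m D (lift k w)"

definition rinv_dr :: "(real \<times> real) distr \<Rightarrow> (real \<times> real) distr" where
  "rinv_dr T = distr_mult (\<lambda>(r, z). 1 / r) (distr_diff (1, 0) T)"


section \<open>Discs and annuli in \<open>\<real>\<^sup>2\<close>\<close>

text \<open>The outer radius may be infinite, and the inner radius of an annulus may be zero, so that
  every nonempty open interval of positive reals occurs as a meridian domain.\<close>

definition disc_or_annulus :: "(real \<times> real) set \<Rightarrow> bool" where
  "disc_or_annulus D \<longleftrightarrow>
     (\<exists>R::ereal. 0 < R \<and> D = {p. ereal (norm p) < R}) \<or>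
     (\<exists>(\<rho>::real) (R::ereal). 0 \<le> \<rho> \<and> ereal \<rho> < R \<and> D = {p. \<rho> < norm p \<and> ereal (norm p) < R})"

definition meridian_2d :: "(real \<times> real) set \<Rightarrow> real set" where
  "meridian_2d D = {r. r > 0 \<and> (r, 0) \<in> D}"

definition weight_r :: "real \<Rightarrow> real" where
  "weight_r r = 2 * pi * r"

definition L2_1_2d :: "real set \<Rightarrow> (real \<Rightarrow> complex) set" where
  "L2_1_2d \<Omega> = {w. w \<in> borel_measurable (lebesgue_on \<Omega>) \<and> L2_sq \<Omega> weight_r w < \<infinity>}"

definition H1_sq_2d :: "nat \<Rightarrow> real set \<Rightarrow> real distr \<Rightarrow> ennreal" where
  "H1_sq_2d j \<Omega> T = (\<Sum>a\<le>j. distr_L2_sq \<Omega> weight_r ((distr_diff 1 ^^ a) T))"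

definition H_sq_2d ::
    "nat \<Rightarrow> (real \<times> real) set \<Rightarrow> (real \<times> real \<Rightarrow> complex) \<Rightarrow> ennreal" where
  "H_sq_2d m D u = (\<Sum>(a, b) \<in> {(a, b). a + b \<le> m}.
     distr_L2_sq D (\<lambda>_. 1) ((distr_diff (1, 0) ^^ a) ((distr_diff (0, 1) ^^ b) (distr_of D u))))"

definition lift_2d :: "int \<Rightarrow> (real \<Rightarrow> complex) \<Rightarrow> real \<times> real \<Rightarrow> complex" where
  "lift_2d k w = (\<lambda>(x, y). cis (of_int k * Arg (Complex x y)) * w (sqrt (x\<^sup>2 + y\<^sup>2)))"

definition Hk_sq_2d ::
    "nat \<Rightarrow> int \<Rightarrow> (real \<times> real) set \<Rightarrow> (real \<Rightarrow> complex) \<Rightarrow> ennreal" where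
  "Hk_sq_2d m k D w = H_sq_2d m D (lift_2d k w)"

definition rinv_dr_2d :: "real distr \<Rightarrow> real distr" where
  "rinv_dr_2d T = distr_mult (\<lambda>r. 1 / r) (distr_diff 1 T)"

end

theory Submission
  imports Defs "HOL-Computational_Algebra.Polynomial"
begin

text \<open>Apply \<open>\<partial>\<^sub>x \<plusminus> \<i> \<partial>\<^sub>y\<close> repeatedly to \<open>e\<^sup>i\<^sup>k\<^sup>\<theta> w\<close>: each application shifts the frequency by one, and after \<open>j\<close> of them
  \<open>w\<close> has been replaced by \<open>r\<^bsup>-j\<^esup> p(r \<partial>\<^sub>r) w\<close> for an explicit product \<open>p\<close> of linear factors. Angular orthogonality and
  \<open>\<bar>e\<^sup>i\<^sup>k\<^sup>\<theta>\<bar> = 1\<close> thus turn the order \<open>j\<close> part of the Sobolev norm, away from the axis, into a sum of weighted norms of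
  \<open>r\<^bsup>-j\<^esup> p(r \<partial>\<^sub>r) w\<close> over \<open>j + 1\<close> polynomials \<open>p\<close>. The terms of the radial expression have the same shape with other polynomials.
  Both families of polynomials span the same space, and each is a combination of the other with coefficients bounded
  independently of \<open>k\<close>; for this one divides by the common zeros \<open>\<bar>k\<bar>, \<bar>k\<bar> + 2, \<dots>\<close> and compares the quotients as forms in
  \<open>r \<partial>\<^sub>r\<close> and \<open>\<bar>k\<bar> + 1\<close>. Derivatives in \<open>z\<close> commute with everything. Finally, the axis has codimension two, so a weak
  derivative in \<open>L\<^sup>2\<close> off the axis is a weak derivative across it.\<close>

section \<open>Smooth functions and test functions\<close>

text \<open>The obstacle is uniformity in k, since the coefficients of both polynomial families grow
  like powers of |k|. They are bounded on the scale of forms: with s = r d_r and N = |k| + 1, the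
  coefficient of s^i in degree m may be as large as N^(m-i), and on this scale the transition
  coefficients depend on the order only. The common zeros have a reason: r^(|k|+2i) e^(ik \<theta>)
  is a polynomial in x and y of degree |k| + 2i, so every derivative of larger order kills it.
  Dividing them out keeps the gap between neighbouring Cartesian quotients away from 0, which could
  fail for |k| below the order. All frequency components can be recovered from d_x^j alone, because
  its expansion has only nonzero binomial coefficients. Intermediate objects such as (1/r d_r)^l
  r^(-|k|) w need not be functions. Hence every operator acts on functionals, through its transpose
  on test functions, and every estimate is one between infima over representatives, where both sides
  may be infinite.\<close>

primrec smooth_upto :: "nat \<Rightarrow> 'a::euclidean_space set \<Rightarrow> ('a \<Rightarrow> complex) \<Rightarrow> bool" where
  "smooth_upto 0 S f \<longleftrightarrow> f differentiable_on S"
| "smooth_upto (Suc n) S f \<longleftrightarrow> f differentiable_on S \<and> (\<forall>e\<in>Basis. smooth_upto n S (pdiff e f))"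

text \<open>\<open>fold\<close> applies the head of the list innermost, which is the order in which
  \<open>smooth_upto\<close> peels off derivatives. The order-by-order form admits induction and
  makes sense on open subsets, where functions such as 1/r live.\<close>

lemma smooth_upto_iff_fold:
  "smooth_upto n S f \<longleftrightarrow>
     (\<forall>es. set es \<subseteq> Basis \<and> length es \<le> n \<longrightarrow> fold pdiff es f differentiable_on S)"
proof (induction n arbitrary: f)
  case 0
  then show ?case by auto
next
  case (Suc n)
  show ?case
  proof
    assume L: "smooth_upto (Suc n) S f"
    show "\<forall>es. set es \<subseteq> Basis \<and> length es \<le> Suc n \<longrightarrow> fold pdiff es f differentiable_on S"
    proof (intro allI impI)
      fix es :: "'a list" assume es: "set es \<subseteq> Basis \<and> length es \<le> Suc n"
      show "fold pdiff es f differentiable_on S"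
        using L es Suc.IH by (cases es) auto
    qed
  next
    assume R: "\<forall>es. set es \<subseteq> Basis \<and> length es \<le> Suc n \<longrightarrow> fold pdiff es f differentiable_on S"
    have "f differentiable_on S" using R[rule_format, of "[]"] by simp
    moreover have "smooth_upto n S (pdiff e f)" if "e \<in> Basis" for e
      unfolding Suc.IH using R[rule_format, of "e # es" for es] that by auto
    ultimately show "smooth_upto (Suc n) S f" by simp
  qed
qed

lemma smooth_iff: "smooth f \<longleftrightarrow> (\<forall>n. smooth_upto n UNIV f)"
  unfolding smooth_def smooth_upto_iff_fold by auto

lemma pdiff_eq: "(f has_derivative D) (at x) \<Longrightarrow> pdiff e f x = D e"
  unfolding pdiff_def by (metis frechet_derivative_at)

lemma pdiff_eq_vector:
  fixes f :: "real \<Rightarrow> complex"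
  shows "(f has_vector_derivative D) (at x) \<Longrightarrow> pdiff 1 f x = D"
  using pdiff_eq[of f "\<lambda>h. h *\<^sub>R D" x 1] by (simp add: has_vector_derivative_def)

text \<open>\<open>frechet_derivative\<close> is a choice from the set of derivatives, and locally
  equal functions have the same set. So the values agree even at points where neither function is
  differentiable.\<close>

lemma pdiff_cong:
  assumes "open S" "x \<in> S" "\<And>y. y \<in> S \<Longrightarrow> f y = g y"
  shows "pdiff e f x = pdiff e g x"
proof -
  have "(f has_derivative D) (at x) \<longleftrightarrow> (g has_derivative D) (at x)" for D
    using assms has_derivative_transform_within_open[of f D x UNIV S g]
      has_derivative_transform_within_open[of g D x UNIV S f] by auto
  then show ?thesis unfolding pdiff_def frechet_derivative_def by simp
qed

lemma differentiable_cong_open: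
  assumes "f differentiable (at x)" "open S" "x \<in> S" "\<And>y. y \<in> S \<Longrightarrow> f y = g y"
  shows "g differentiable (at x)"
  using assms has_derivative_transform_within_open[of f _ x UNIV S g]
  unfolding differentiable_def by auto

lemma smooth_upto_differentiable: "smooth_upto n S f \<Longrightarrow> f differentiable_on S"
  by (cases n) auto

lemma smooth_upto_at:
  "smooth_upto n S f \<Longrightarrow> open S \<Longrightarrow> x \<in> S \<Longrightarrow> f differentiable (at x)"
  using smooth_upto_differentiable differentiable_on_eq_differentiable_at by blast

lemma smooth_upto_has_derivative:
  "smooth_upto n S f \<Longrightarrow> open S \<Longrightarrow> x \<in> S \<Longrightarrow> (f has_derivative (\<lambda>e. pdiff e f x)) (at x)"
  using smooth_upto_at[of n S f x] frechet_derivative_works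
  unfolding pdiff_def by fastforce

lemma smooth_upto_SucD: "smooth_upto (Suc n) S f \<Longrightarrow> smooth_upto n S f"
  by (induction n arbitrary: f) auto

lemma smooth_upto_subset: "smooth_upto n S f \<Longrightarrow> T \<subseteq> S \<Longrightarrow> smooth_upto n T f"
  by (induction n arbitrary: f) (auto intro: differentiable_on_subset)

lemma smooth_upto_cong:
  assumes "open S" "\<And>y. y \<in> S \<Longrightarrow> f y = g y"
  shows "smooth_upto n S f \<longleftrightarrow> smooth_upto n S g"
proof -
  have *: "smooth_upto n S g" if "smooth_upto n S f" "\<And>y. y \<in> S \<Longrightarrow> f y = g y" for f g
    using that
  proof (induction n arbitrary: f g)
    case 0
    then show ?case
      using assms(1) differentiable_cong_open[of f _ S g]
      by (auto simp: differentiable_on_eq_differentiable_at)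
  next
    case (Suc n)
    have "g differentiable_on S"
      using Suc.prems assms(1) differentiable_cong_open[of f _ S g]
      by (auto simp: differentiable_on_eq_differentiable_at)
    moreover have "smooth_upto n S (pdiff e g)" if "e \<in> Basis" for e
      using Suc.IH[of "pdiff e f" "pdiff e g"] Suc.prems that pdiff_cong[OF assms(1), of _ f g]
      by auto
    ultimately show ?case by simp
  qed
  show ?thesis using *[of f g] *[of g f] assms(2) by auto
qed

lemma pdiff_const: "pdiff e (\<lambda>x. c) x = 0"
  by (rule pdiff_eq[where D="\<lambda>_. 0", simplified]) (auto intro: derivative_intros)

lemma pdiff_add:
  "f differentiable (at x) \<Longrightarrow> g differentiable (at x)
    \<Longrightarrow> pdiff e (\<lambda>x. f x + g x) x = pdiff e f x + pdiff e g x"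
  unfolding pdiff_def
  by (rule pdiff_eq[unfolded pdiff_def, where D="\<lambda>e. frechet_derivative f (at x) e + frechet_derivative g (at x) e"])
     (auto intro!: derivative_eq_intros simp: frechet_derivative_works)

lemma pdiff_mult:
  assumes "f differentiable (at x)" "g differentiable (at x)"
  shows "pdiff e (\<lambda>x. f x * g x) x = f x * pdiff e g x + pdiff e f x * g x"
  unfolding pdiff_def
  by (rule pdiff_eq[unfolded pdiff_def, where D="\<lambda>e. f x * frechet_derivative g (at x) e + frechet_derivative f (at x) e * g x"])
     (use assms in \<open>auto intro!: derivative_eq_intros simp: frechet_derivative_works\<close>)

lemma pdiff_cmult:
  "g differentiable (at x) \<Longrightarrow> pdiff e (\<lambda>x. c * g x) x = c * pdiff e g x"
  using pdiff_mult[of "\<lambda>_. c" x g e] by (simp add: pdiff_const)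

lemma smooth_upto_const [simp]: "smooth_upto n S (\<lambda>x. c)"
proof (induction n arbitrary: c)
  case (Suc n)
  have "pdiff e (\<lambda>x::'a. c) = (\<lambda>x. 0)" for e by (auto simp: pdiff_const)
  then show ?case using Suc by (simp add: differentiable_on_const)
qed (simp add: differentiable_on_const)

lemma smooth_upto_add:
  assumes "open S" "smooth_upto n S f" "smooth_upto n S g"
  shows "smooth_upto n S (\<lambda>x. f x + g x)"
  using assms(2,3)
proof (induction n arbitrary: f g)
  case (Suc n)
  have "smooth_upto n S (pdiff e (\<lambda>x. f x + g x))" if "e \<in> Basis" for e
    using Suc.IH[of "pdiff e f" "pdiff e g"] Suc.prems that assms(1)
      smooth_upto_cong[OF assms(1), of "pdiff e (\<lambda>x. f x + g x)" "\<lambda>x. pdiff e f x + pdiff e g x" n]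
      pdiff_add[of f _ g e] smooth_upto_at[OF Suc.prems(1) assms(1)] smooth_upto_at[OF Suc.prems(2) assms(1)]
    by simp
  then show ?case using Suc.prems by (auto intro: derivative_intros)
qed (auto intro: derivative_intros)

lemma smooth_upto_mult:
  assumes "open S" "smooth_upto n S f" "smooth_upto n S g"
  shows "smooth_upto n S (\<lambda>x. f x * g x)"
  using assms(2,3)
proof (induction n arbitrary: f g)
  case (Suc n)
  have "smooth_upto n S (pdiff e (\<lambda>x. f x * g x))" if "e \<in> Basis" for e
  proof -
    have "smooth_upto n S (\<lambda>x. f x * pdiff e g x + pdiff e f x * g x)"
      using Suc.prems that smooth_upto_SucD
      by (intro smooth_upto_add[OF assms(1)] Suc.IH) auto
    then show ?thesis
      using smooth_upto_cong[OF assms(1), of "pdiff e (\<lambda>x. f x * g x)" "\<lambda>x. f x * pdiff e g x + pdiff e f x * g x" n]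
      pdiff_mult[of f _ g e] smooth_upto_at[OF Suc.prems(1) assms(1)] smooth_upto_at[OF Suc.prems(2) assms(1)]
      by simp
  qed
  then show ?case using Suc.prems by (auto intro: derivative_intros)
qed (auto intro: derivative_intros)

lemma smooth_upto_uminus:
  "open S \<Longrightarrow> smooth_upto n S f \<Longrightarrow> smooth_upto n S (\<lambda>x. - f x)"
  using smooth_upto_mult[of S n "\<lambda>_. -1" f] by simp

lemma smooth_upto_sum:
  "open S \<Longrightarrow> (\<And>i. i \<in> I \<Longrightarrow> smooth_upto n S (f i)) \<Longrightarrow> smooth_upto n S (\<lambda>x. \<Sum>i\<in>I. f i x)"
  by (induction I rule: infinite_finite_induct) (auto intro: smooth_upto_add)

lemma smooth_upto_power:
  "open S \<Longrightarrow> smooth_upto n S f \<Longrightarrow> smooth_upto n S (\<lambda>x. f x ^ j)"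
  by (induction j) (auto intro: smooth_upto_mult)

lemma smooth_upto_linear:
  fixes L :: "'a::euclidean_space \<Rightarrow> complex"
  assumes "bounded_linear L"
  shows "smooth_upto n S L"
proof (cases n)
  case 0
  then show ?thesis
    using assms by (simp add: bounded_linear_imp_differentiable_on)
next
  case (Suc m)
  have "pdiff e L = (\<lambda>x. L e)" for e
    by (rule ext, rule pdiff_eq[OF bounded_linear_imp_has_derivative[OF assms]])
  then show ?thesis
    using assms by (simp add: bounded_linear_imp_differentiable_on Suc)
qed

lemma smooth_upto_inner: "smooth_upto n S (\<lambda>x. complex_of_real (x \<bullet> b))"
  by (intro smooth_upto_linear bounded_linear_compose[OF bounded_linear_of_real bounded_linear_inner_left])

text \<open>Smoothness is defined for complex-valued functions, so the inner map enters through its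
  coordinates, embedded into the complex numbers. In this form \<open>smooth_upto_compose\<close>
  can differentiate the coordinates again.\<close>

lemma pdiff_compose:
  fixes g :: "'a::euclidean_space \<Rightarrow> 'b::euclidean_space"
  assumes "f differentiable (at (g x))"
    "\<And>b. b \<in> Basis \<Longrightarrow> (\<lambda>x. complex_of_real (g x \<bullet> b)) differentiable (at x)"
  shows "(\<lambda>x. f (g x)) differentiable (at x)"
    "pdiff e (\<lambda>x. f (g x)) x = (\<Sum>b\<in>Basis. pdiff b f (g x) * pdiff e (\<lambda>x. complex_of_real (g x \<bullet> b)) x)"
proof -
  have d: "((\<lambda>x. complex_of_real (g x \<bullet> b)) has_derivative
      (\<lambda>e. pdiff e (\<lambda>x. complex_of_real (g x \<bullet> b)) x)) (at x)" if "b \<in> Basis" for b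
    using assms(2)[OF that] frechet_derivative_works unfolding pdiff_def by fastforce
  have dr: "((\<lambda>x. g x \<bullet> b) has_derivative
      (\<lambda>e. Re (pdiff e (\<lambda>x. complex_of_real (g x \<bullet> b)) x))) (at x)" if "b \<in> Basis" for b
    using bounded_linear.has_derivative[OF bounded_linear_Re d[OF that]] by simp
  \<comment> \<open>A real function has a real derivative, by uniqueness of derivatives; hence the
    real coefficients of the chain rule are the values of \<open>pdiff\<close> on the
    coordinates.\<close>
  have im: "Im (pdiff e (\<lambda>x. complex_of_real (g x \<bullet> b)) x) = 0" if "b \<in> Basis" for b e
  proof -
    have "((\<lambda>x. 0::real) has_derivative (\<lambda>e. Im (pdiff e (\<lambda>x. complex_of_real (g x \<bullet> b)) x))) (at x)"
      using bounded_linear.has_derivative[OF bounded_linear_Im d[OF that]] by simp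
    then have "(\<lambda>e. Im (pdiff e (\<lambda>x. complex_of_real (g x \<bullet> b)) x)) = (\<lambda>_. 0)"
      using has_derivative_unique has_derivative_const by blast
    then show ?thesis by metis
  qed
  have g: "(g has_derivative (\<lambda>e. \<Sum>b\<in>Basis. Re (pdiff e (\<lambda>x. complex_of_real (g x \<bullet> b)) x) *\<^sub>R b)) (at x)"
    unfolding has_derivative_componentwise_within[of g] using dr by (simp add: inner_sum_left inner_Basis if_distrib cong: if_cong)
  have f: "(f has_derivative (\<lambda>e. pdiff e f (g x))) (at (g x))"
    using assms(1) frechet_derivative_works unfolding pdiff_def by fastforce
  have fg: "((\<lambda>x. f (g x)) has_derivative
    (\<lambda>e. pdiff (\<Sum>b\<in>Basis. Re (pdiff e (\<lambda>x. complex_of_real (g x \<bullet> b)) x) *\<^sub>R b) f (g x))) (at x)"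
    using diff_chain_at[OF g f] by (simp add: o_def)
  then show "(\<lambda>x. f (g x)) differentiable (at x)" by (auto simp: differentiable_def)
  have lin: "linear (\<lambda>e. pdiff e f (g x))"
    using f has_derivative_linear by blast
  show "pdiff e (\<lambda>x. f (g x)) x = (\<Sum>b\<in>Basis. pdiff b f (g x) * pdiff e (\<lambda>x. complex_of_real (g x \<bullet> b)) x)"
    unfolding pdiff_eq[OF fg] linear_sum[OF lin] linear_cmul[OF lin]
  proof (rule sum.cong)
    fix b :: 'b assume "b \<in> Basis"
    then have "complex_of_real (Re (pdiff e (\<lambda>x. complex_of_real (g x \<bullet> b)) x)) = pdiff e (\<lambda>x. complex_of_real (g x \<bullet> b)) x"
      using im by (simp add: complex_eq_iff)
    then show "Re (pdiff e (\<lambda>x. complex_of_real (g x \<bullet> b)) x) *\<^sub>R pdiff b f (g x)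
      = pdiff b f (g x) * pdiff e (\<lambda>x. complex_of_real (g x \<bullet> b)) x"
      by (simp add: scaleR_conv_of_real mult.commute)
  qed simp
qed

lemma smooth_upto_compose:
  fixes g :: "'a::euclidean_space \<Rightarrow> 'b::euclidean_space"
  assumes S: "open S" "open T" "g ` S \<subseteq> T"
    and g: "\<And>b n. b \<in> Basis \<Longrightarrow> smooth_upto n S (\<lambda>x. complex_of_real (g x \<bullet> b))"
    and f: "smooth_upto n T f"
  shows "smooth_upto n S (\<lambda>x. f (g x))"
  using f
proof (induction n arbitrary: f)
  have dg: "(\<lambda>x. complex_of_real (g x \<bullet> b)) differentiable (at x)" if "x \<in> S" "b \<in> Basis" for x b
    by (rule smooth_upto_at[OF g[OF that(2), of 0] S(1) that(1)])
  have gT: "g x \<in> T" if "x \<in> S" for x using S that by blast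
  {
    case 0
    have "(\<lambda>x. f (g x)) differentiable (at x)" if "x \<in> S" for x
      by (rule pdiff_compose(1)[OF smooth_upto_at[OF 0 S(2) gT[OF that]] dg[OF that]])
    then show ?case by (simp add: differentiable_on_eq_differentiable_at[OF S(1)])
  next
    case (Suc n)
    note df = smooth_upto_at[OF Suc.prems S(2) gT]
    have eq: "pdiff e (\<lambda>x. f (g x)) x = (\<Sum>b\<in>Basis. pdiff b f (g x) * pdiff e (\<lambda>x. complex_of_real (g x \<bullet> b)) x)"
      if "x \<in> S" for e x
      by (rule pdiff_compose(2)[OF df[OF that] dg[OF that]])
    have "smooth_upto n S (pdiff e (\<lambda>x. f (g x)))" if e: "e \<in> Basis" for e
    proof (rule iffD2[OF smooth_upto_cong[OF S(1) eq]], assumption, intro smooth_upto_sum smooth_upto_mult S)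
      fix b :: 'b assume b: "b \<in> Basis"
      show "smooth_upto n S (\<lambda>x. pdiff b f (g x))" using Suc b by simp
      show "smooth_upto n S (pdiff e (\<lambda>x. complex_of_real (g x \<bullet> b)))"
        using g[OF b, of "Suc n"] e by simp
    qed
    moreover have "(\<lambda>x. f (g x)) differentiable (at x)" if "x \<in> S" for x
      by (rule pdiff_compose(1)[OF df[OF that] dg[OF that]])
    ultimately show ?case by (simp add: differentiable_on_eq_differentiable_at[OF S(1)])
  }
qed

lemma smooth_upto_powr: "smooth_upto n {0<..} (\<lambda>x::real. complex_of_real (x powr a))"
proof (induction n arbitrary: a)
  have D: "((\<lambda>x. complex_of_real (x powr a)) has_vector_derivative complex_of_real (a * x powr (a - 1))) (at x)"
    if "x > 0" for a x :: real
    using that by (auto intro!: derivative_eq_intros has_vector_derivative_real_field simp: has_real_derivative_iff_has_vector_derivative[symmetric] )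
  {
    case 0
    show ?case using D
      by (auto simp: differentiable_on_eq_differentiable_at has_vector_derivative_def differentiable_def)
  next
    case (Suc n)
    have eq: "pdiff 1 (\<lambda>x. complex_of_real (x powr a)) x = complex_of_real a * complex_of_real (x powr (a - 1))"
      if "x \<in> {0<..}" for x
      using pdiff_eq_vector[OF D] that by simp
    have "smooth_upto n {0<..} (pdiff 1 (\<lambda>x. complex_of_real (x powr a)))"
      using smooth_upto_mult[OF _ smooth_upto_const Suc] by (subst smooth_upto_cong[OF open_greaterThan eq]) auto
    moreover have "(\<lambda>x. complex_of_real (x powr a)) differentiable_on {0<..}"
      using D by (auto simp: differentiable_on_eq_differentiable_at has_vector_derivative_def differentiable_def)
    ultimately show ?case by simp
  }
qed

text \<open>Extension by zero. The function vanishes on the open complement of \<open>K\<close>, so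
  its partial derivatives vanish there as well and satisfy the same support condition, which carries
  the induction.\<close>

lemma smooth_upto_compact_support:
  assumes "open S" "closed K" "K \<subseteq> S" "\<And>x. x \<notin> K \<Longrightarrow> f x = 0" "smooth_upto n S f"
  shows "smooth_upto n UNIV f"
  using assms(4,5)
proof (induction n arbitrary: f)
  have d: "f differentiable_on UNIV" if 0: "\<And>x. x \<notin> K \<Longrightarrow> f x = 0" and "f differentiable_on S" for f :: "'a \<Rightarrow> complex"
  proof -
    have "f differentiable (at x)" for x
    proof (cases "x \<in> K")
      case True
      then show ?thesis using that assms by (auto simp: differentiable_on_eq_differentiable_at)
    next
      case False
      have "(\<lambda>x. 0::complex) differentiable (at x)" by simp
      then show ?thesis
        by (rule differentiable_cong_open[where S="- K"]) (use assms(2) False 0 in auto)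
    qed
    then show ?thesis by (simp add: differentiable_on_def)
  qed
  {
    case 0
    then show ?case using d by simp
  next
    case (Suc n)
    have "pdiff e f x = 0" if "x \<notin> K" for e x
      using pdiff_cong[of "- K" x f "\<lambda>_. 0" e] assms(2) that Suc.prems(1) by (auto simp: pdiff_const)
    then show ?case using Suc d by auto
  }
qed

section \<open>Closure properties of test functions\<close>

lemma test_functionsI:
  assumes "smooth \<phi>" "compact K" "K \<subseteq> \<Omega>" "\<And>x. x \<notin> K \<Longrightarrow> \<phi> x = 0"
  shows "\<phi> \<in> test_functions \<Omega>"
proof -
  have "closure {x. \<phi> x \<noteq> 0} \<subseteq> K"
    using assms by (intro closure_minimal) (auto simp: compact_imp_closed)
  then show ?thesis
    using assms compact_Int_closed[of K "closure {x. \<phi> x \<noteq> 0}"]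
    by (auto simp: test_functions_def Int_absorb1)
qed

lemma test_functionsE:
  assumes "\<phi> \<in> test_functions \<Omega>"
  obtains K where "smooth \<phi>" "compact K" "K \<subseteq> \<Omega>" "\<And>x. x \<notin> K \<Longrightarrow> \<phi> x = 0"
proof (rule that[of "closure {x. \<phi> x \<noteq> 0}"])
  show "\<phi> x = 0" if "x \<notin> closure {x. \<phi> x \<noteq> 0}" for x
    using that closure_subset[of "{x. \<phi> x \<noteq> 0}"] by blast
qed (use assms in \<open>auto simp: test_functions_def\<close>)

lemma test_smooth_upto: "\<phi> \<in> test_functions \<Omega> \<Longrightarrow> smooth_upto n S \<phi>"
  using smooth_iff smooth_upto_subset test_functionsE by (metis subset_UNIV)

lemma test_differentiable: "\<phi> \<in> test_functions \<Omega> \<Longrightarrow> \<phi> differentiable (at x)"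
  using test_smooth_upto[of \<phi> \<Omega> 0 UNIV] smooth_upto_at by blast

lemma test_continuous: "\<phi> \<in> test_functions \<Omega> \<Longrightarrow> continuous_on S \<phi>"
  using test_differentiable differentiable_imp_continuous_within
  by (metis continuous_at_imp_continuous_on)

lemma test_measurable: "\<phi> \<in> test_functions \<Omega> \<Longrightarrow> \<phi> \<in> borel_measurable borel"
  using test_continuous borel_measurable_continuous_onI by blast

lemma test_zero_outside: "\<phi> \<in> test_functions \<Omega> \<Longrightarrow> x \<notin> \<Omega> \<Longrightarrow> \<phi> x = 0"
  by (meson subsetD test_functionsE)

lemma test_mono: "\<phi> \<in> test_functions \<Omega> \<Longrightarrow> \<Omega> \<subseteq> \<Omega>' \<Longrightarrow> \<phi> \<in> test_functions \<Omega>'"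
  by (auto simp: test_functions_def)

lemma test_bounded:
  assumes "\<phi> \<in> test_functions \<Omega>"
  obtains B where "B > 0" "\<And>x. norm (\<phi> x) \<le> B"
proof -
  obtain K where K: "compact K" "\<And>x. x \<notin> K \<Longrightarrow> \<phi> x = 0" using assms test_functionsE by metis
  have "compact (\<phi> ` K)" using K test_continuous[OF assms] compact_continuous_image by blast
  then obtain B where "B > 0" "\<And>y. y \<in> \<phi> ` K \<Longrightarrow> norm y \<le> B"
    using compact_imp_bounded bounded_pos by metis
  then show ?thesis using K by (intro that[of B]) (force simp: less_imp_le)+
qed

lemma test_pdiff:
  assumes "\<phi> \<in> test_functions \<Omega>" "e \<in> Basis"
  shows "pdiff e \<phi> \<in> test_functions \<Omega>"
proof -
  obtain K where K: "smooth \<phi>" "compact K" "K \<subseteq> \<Omega>" "\<And>x. x \<notin> K \<Longrightarrow> \<phi> x = 0"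
    using assms test_functionsE by metis
  show ?thesis
  proof (rule test_functionsI[OF _ K(2,3)])
    show "smooth (pdiff e \<phi>)" using K(1) assms(2) smooth_upto.simps(2) unfolding smooth_iff by blast
    show "pdiff e \<phi> x = 0" if "x \<notin> K" for x
      using pdiff_cong[of "- K" x \<phi> "\<lambda>_. 0" e] K that
      by (simp add: pdiff_const compact_imp_closed open_Compl)
  qed
qed

lemma test_add:
  assumes "\<phi> \<in> test_functions \<Omega>" "\<psi> \<in> test_functions \<Omega>"
  shows "(\<lambda>x. \<phi> x + \<psi> x) \<in> test_functions \<Omega>"
proof -
  obtain K where K: "smooth \<phi>" "compact K" "K \<subseteq> \<Omega>" "\<And>x. x \<notin> K \<Longrightarrow> \<phi> x = 0"
    using assms test_functionsE by metis
  obtain L where L: "smooth \<psi>" "compact L" "L \<subseteq> \<Omega>" "\<And>x. x \<notin> L \<Longrightarrow> \<psi> x = 0"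
    using assms test_functionsE by metis
  show ?thesis
    by (rule test_functionsI[of _ "K \<union> L"])
      (use K L in \<open>auto simp: smooth_iff intro: smooth_upto_add\<close>)
qed

text \<open>Smoothness of \<open>h\<close> is asked on \<Omega> only, as for 1/r on r > 0: the
  product vanishes off a compact subset of \<Omega> and extends smoothly by zero.\<close>

lemma test_mult:
  assumes "\<phi> \<in> test_functions \<Omega>" "open \<Omega>" "\<And>n. smooth_upto n \<Omega> h"
  shows "(\<lambda>x. h x * \<phi> x) \<in> test_functions \<Omega>"
proof -
  obtain K where K: "smooth \<phi>" "compact K" "K \<subseteq> \<Omega>" "\<And>x. x \<notin> K \<Longrightarrow> \<phi> x = 0"
    using assms test_functionsE by metis
  show ?thesis
  proof (rule test_functionsI[OF _ K(2,3)])
    have "smooth_upto n UNIV (\<lambda>x. h x * \<phi> x)" for n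
      by (rule smooth_upto_compact_support[OF assms(2) compact_imp_closed[OF K(2)] K(3)])
        (use K assms test_smooth_upto[OF assms(1)] in \<open>auto intro: smooth_upto_mult\<close>)
    then show "smooth (\<lambda>x. h x * \<phi> x)" by (simp add: smooth_iff)
  qed (use K in auto)
qed

lemma test_cmult: "\<phi> \<in> test_functions \<Omega> \<Longrightarrow> (\<lambda>x. c * \<phi> x) \<in> test_functions \<Omega>"
  using test_functionsE[of \<phi> \<Omega>] test_functionsI[of "\<lambda>x. c * \<phi> x"] smooth_upto_mult[OF open_UNIV smooth_upto_const]
  unfolding smooth_iff by (metis mult_zero_right)

lemma test_zero: "(\<lambda>x. 0) \<in> test_functions \<Omega>"
  by (rule test_functionsI[of _ "{}"]) (auto simp: smooth_iff)

lemma smooth_continuous: "smooth f \<Longrightarrow> continuous_on S f"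
  using smooth_upto_differentiable[of 0 UNIV f] differentiable_imp_continuous_on continuous_on_subset
  unfolding smooth_iff by blast

lemma smooth_pdiff: "smooth f \<Longrightarrow> e \<in> Basis \<Longrightarrow> smooth (pdiff e f)"
  unfolding smooth_iff using smooth_upto.simps(2) by blast

lemma smooth_has_derivative: "smooth f \<Longrightarrow> (f has_derivative (\<lambda>e. pdiff e f x)) (at x)"
  using smooth_upto_has_derivative[OF _ open_UNIV] smooth_iff by blast

lemma pdiff_sum_Basis:
  fixes f :: "'a::euclidean_space \<Rightarrow> complex"
  assumes "f differentiable (at x)"
  shows "pdiff h f x = (\<Sum>b\<in>Basis. (h \<bullet> b) *\<^sub>R pdiff b f x)"
proof -
  have lin: "linear (\<lambda>e. pdiff e f x)"
    using linear_frechet_derivative[OF assms] unfolding pdiff_def .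
  have "pdiff (\<Sum>b\<in>Basis. (h \<bullet> b) *\<^sub>R b) f x = (\<Sum>b\<in>Basis. (h \<bullet> b) *\<^sub>R pdiff b f x)"
    unfolding linear_sum[OF lin] linear_cmul[OF lin] ..
  then show ?thesis by (simp add: euclidean_representation)
qed

section \<open>Differentiation under an integral over a family of linear maps\<close>

context
  fixes L :: "real \<Rightarrow> 'b::euclidean_space \<Rightarrow> 'a::euclidean_space" and \<alpha> \<beta> :: real
  assumes L: "\<And>t. linear (L t)" "\<And>e. continuous_on UNIV (\<lambda>t. L t e)"
begin

lemma continuous_linear_family:
  assumes gh: "continuous_on S g" "continuous_on S h"
  shows "continuous_on S (\<lambda>z. L (g z) (h z))"
proof -
  have rep: "L t x = (\<Sum>e\<in>Basis. (x \<bullet> e) *\<^sub>R L t e)" for t x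
    using linear_sum[OF L(1), of t "\<lambda>e. (x \<bullet> e) *\<^sub>R e" Basis] linear_cmul[OF L(1)]
    by (simp add: euclidean_representation)
  have "continuous_on S (\<lambda>z. \<Sum>e\<in>Basis. (h z \<bullet> e) *\<^sub>R L (g z) e)"
    by (intro continuous_on_sum continuous_on_scaleR continuous_on_inner gh continuous_on_const
        continuous_on_compose2[OF L(2) gh(1)]) auto
  then show ?thesis
    by (rule continuous_on_eq) (rule rep[symmetric])
qed

lemma integrable_param:
  assumes a: "continuous_on UNIV a" and \<phi>: "smooth \<phi>"
  shows "(\<lambda>t. a t * \<phi> (L t x)) integrable_on {\<alpha>..\<beta>}"
proof -
  have "continuous_on {\<alpha>..\<beta>} (\<lambda>t. \<phi> (L t x))"
    by (rule continuous_on_compose2[OF smooth_continuous[OF \<phi>] continuous_on_subset[OF L(2)]]) auto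
  then show ?thesis
    by (intro integrable_continuous_interval continuous_on_mult continuous_on_subset[OF a]) auto
qed

lemma has_derivative_param_integral:
  assumes a: "continuous_on UNIV a" and \<phi>: "smooth \<phi>"
  shows "((\<lambda>x. integral {\<alpha>..\<beta>} (\<lambda>t. a t * \<phi> (L t x))) has_derivative
    (\<lambda>h. integral {\<alpha>..\<beta>} (\<lambda>t. a t * pdiff (L t h) \<phi> (L t x)))) (at x)"
proof -
  \<comment> \<open>\<open>leibniz_rule\<close> takes the derivative as a bounded linear operator,
    jointly continuous in the point and the parameter. \<open>B\<close> assembles it from its values
    on the basis, so that its continuity reduces to that of the scalars
    \<open>c e t y\<close>.\<close>
  define c where "c e t y = a t * pdiff (L t e) \<phi> (L t y)" for e t y
  define B where "B y t = (\<Sum>e\<in>Basis. blinfun_scaleR_left (c e t y) o\<^sub>L blinfun_inner_left e)" for y t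
  have ceq: "c e t y = a t * (\<Sum>b\<in>Basis. (L t e \<bullet> b) *\<^sub>R pdiff b \<phi> (L t y))" for e t y
  proof -
    have "\<phi> differentiable (at (L t y))"
      using smooth_has_derivative[OF \<phi>, of "L t y"] unfolding differentiable_def by blast
    from pdiff_sum_Basis[OF this, of "L t e"] show ?thesis
      by (simp only: c_def)
  qed
  have cc: "continuous_on S (\<lambda>z. c e (snd z) (fst z))" for e S
    unfolding ceq
  proof (intro continuous_intros)
    show "continuous_on S (\<lambda>z. a (snd z))"
      by (rule continuous_on_compose2[OF a]) (auto intro: continuous_intros)
    show "continuous_on S (\<lambda>z. L (snd z) e)"
      by (rule continuous_on_compose2[OF L(2)]) (auto intro: continuous_intros)
    show "continuous_on S (\<lambda>z. pdiff b \<phi> (L (snd z) (fst z)))" if "b \<in> Basis" for b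
      by (rule continuous_on_compose2[OF smooth_continuous[OF smooth_pdiff[OF \<phi> that], of UNIV]])
        (auto intro!: continuous_linear_family continuous_intros)
  qed
  have Bapp: "blinfun_apply (B y t) h = a t * pdiff (L t h) \<phi> (L t y)" for y t h
  proof -
    have lin: "linear (\<lambda>h. pdiff (L t h) \<phi> (L t y))"
      using linear_compose[OF L(1)[of t] has_derivative_linear[OF smooth_has_derivative[OF \<phi>, of "L t y"]]] by (simp add: o_def)
    have "blinfun_apply (B y t) h = a t * (\<Sum>e\<in>Basis. (h \<bullet> e) *\<^sub>R pdiff (L t e) \<phi> (L t y))"
      unfolding B_def c_def by (simp add: blinfun.sum_left sum_distrib_left inner_commute)
    also have "(\<Sum>e\<in>Basis. (h \<bullet> e) *\<^sub>R pdiff (L t e) \<phi> (L t y)) = pdiff (L t (\<Sum>e\<in>Basis. (h \<bullet> e) *\<^sub>R e)) \<phi> (L t y)"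
      by (simp add: linear_sum[OF lin] linear_cmul[OF lin])
    finally show ?thesis by (simp add: euclidean_representation)
  qed
  have Beq: "blinfun_apply (B y t) = (\<lambda>h. a t * pdiff (L t h) \<phi> (L t y))" for y t
    by (rule ext) (rule Bapp)
  have Bc: "continuous_on S (\<lambda>(y, t). B y t)" for S
    unfolding B_def split_beta by (intro continuous_intros cc)
  have D: "((\<lambda>x. integral (cbox \<alpha> \<beta>) (\<lambda>t. a t * \<phi> (L t x))) has_derivative integral (cbox \<alpha> \<beta>) (B x)) (at x within UNIV)"
  proof (rule leibniz_rule)
    show "((\<lambda>x. a t * \<phi> (L t x)) has_derivative blinfun_apply (B y t)) (at y within UNIV)" for y t
    proof -
      have "((\<lambda>x. \<phi> (L t x)) has_derivative (\<lambda>h. pdiff (L t h) \<phi> (L t y))) (at y)"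
        using diff_chain_at[OF linear_imp_has_derivative[OF L(1)] smooth_has_derivative[OF \<phi>]] by (simp add: o_def)
      from has_derivative_mult_right[OF this, of "a t"] show ?thesis
        by (simp add: Beq)
    qed
    show "(\<lambda>t. a t * \<phi> (L t y)) integrable_on cbox \<alpha> \<beta>" for y
      using integrable_param[OF a \<phi>] by (simp add: cbox_interval)
  qed (use Bc in auto)
  have "continuous_on (cbox \<alpha> \<beta>) (Pair x)"
    using continuous_on_Pair[OF continuous_on_const[of _ x] continuous_on_id] by (simp add: id_def)
  from continuous_on_compose2[OF Bc[of UNIV] this] have "B x integrable_on cbox \<alpha> \<beta>"
    by (intro integrable_continuous) simp
  have "blinfun_apply (integral (cbox \<alpha> \<beta>) (B x)) h = integral (cbox \<alpha> \<beta>) (\<lambda>t. blinfun_apply (B x t) h)" for h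
    using integral_linear[OF \<open>B x integrable_on _\<close> blinfun.bounded_linear_left[of h]] by (simp add: o_def)
  then have "blinfun_apply (integral (cbox \<alpha> \<beta>) (B x)) = (\<lambda>h. integral (cbox \<alpha> \<beta>) (\<lambda>t. a t * pdiff (L t h) \<phi> (L t x)))"
    by (auto simp: Bapp)
  then show ?thesis using D by (simp add: cbox_interval)
qed

text \<open>The derivative is a sum of integrals of the same shape, with weight \<open>a t\<close>
  times a coordinate of \<open>L t h\<close> and with \<open>pdiff b \<phi>\<close> in place of
  \<open>\<phi>\<close>. This closure drives the induction in
  \<open>smooth_upto_param_integral\<close>.\<close>

lemma pdiff_param_integral:
  assumes a: "continuous_on UNIV a" and \<phi>: "smooth \<phi>"
  shows "pdiff h (\<lambda>x. integral {\<alpha>..\<beta>} (\<lambda>t. a t * \<phi> (L t x))) x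
    = (\<Sum>b\<in>Basis. integral {\<alpha>..\<beta>} (\<lambda>t. (a t * complex_of_real (L t h \<bullet> b)) * pdiff b \<phi> (L t x)))"
proof -
  have eq: "a t * pdiff (L t h) \<phi> (L t x) = (\<Sum>b\<in>Basis. (a t * complex_of_real (L t h \<bullet> b)) * pdiff b \<phi> (L t x))" for t
  proof -
    have "\<phi> differentiable (at (L t x))"
      using smooth_has_derivative[OF \<phi>, of "L t x"] unfolding differentiable_def by blast
    then have "pdiff (L t h) \<phi> (L t x) = (\<Sum>b\<in>Basis. (L t h \<bullet> b) *\<^sub>R pdiff b \<phi> (L t x))"
      by (rule pdiff_sum_Basis)
    then show ?thesis
      by (simp only: sum_distrib_left scaleR_conv_of_real mult.assoc)
  qed
  have "(\<lambda>t. (a t * complex_of_real (L t h \<bullet> b)) * pdiff b \<phi> (L t x)) integrable_on {\<alpha>..\<beta>}" if "b \<in> Basis" for b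
    by (intro integrable_param smooth_pdiff[OF \<phi> that] continuous_on_mult a continuous_on_of_real continuous_on_inner L(2) continuous_on_const)
  then show ?thesis
    unfolding pdiff_eq[OF has_derivative_param_integral[OF a \<phi>]] eq by (intro integral_sum) auto
qed

lemma smooth_upto_param_integral:
  assumes a: "continuous_on UNIV a" and \<phi>: "smooth \<phi>"
  shows "smooth_upto n UNIV (\<lambda>x. integral {\<alpha>..\<beta>} (\<lambda>t. a t * \<phi> (L t x)))"
  using assms
proof (induction n arbitrary: a \<phi>)
  case 0
  show ?case
    unfolding smooth_upto.simps differentiable_on_def differentiable_def
    using has_derivative_param_integral[OF 0] by blast
next
  case (Suc n)
  have "smooth_upto n UNIV (pdiff e (\<lambda>x. integral {\<alpha>..\<beta>} (\<lambda>t. a t * \<phi> (L t x))))" for e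
    unfolding pdiff_param_integral[OF Suc.prems, abs_def]
  proof (intro smooth_upto_sum open_UNIV Suc.IH)
    fix b :: 'a assume b: "b \<in> Basis"
    show "smooth (pdiff b \<phi>)" by (rule smooth_pdiff[OF Suc.prems(2) b])
    show "continuous_on UNIV (\<lambda>t. a t * complex_of_real (L t e \<bullet> b))"
      by (intro continuous_intros Suc.prems L(2))
  qed
  then show ?case
    unfolding smooth_upto.simps differentiable_on_def differentiable_def
    using has_derivative_param_integral[OF Suc.prems] by blast
qed

end

text \<open>Symmetry of second derivatives, by differentiating an integral representation of the
  increment. It lets derivatives in directions other than \<open>er\<close> commute with the Euler
  operator.\<close>

lemma pdiff_commute:
  fixes f :: "'a::euclidean_space \<Rightarrow> complex"
  assumes f: "smooth f" and e: "e \<in> Basis" and h: "h \<in> Basis"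
  shows "pdiff e (pdiff h f) x = pdiff h (pdiff e f) x"
proof -
  define F where "F s y = f (y + s *\<^sub>R e)" for s y
  have line: "((\<lambda>t. g (y + t *\<^sub>R e)) has_vector_derivative pdiff e g (y + t *\<^sub>R e)) (at t within T)"
    if "smooth g" for g :: "'a \<Rightarrow> complex" and y t T
  proof -
    have "((\<lambda>t. g (y + t *\<^sub>R e)) has_derivative (\<lambda>s. pdiff (s *\<^sub>R e) g (y + t *\<^sub>R e))) (at t)"
    proof -
      have "((\<lambda>t. y + t *\<^sub>R e) has_derivative (\<lambda>s. s *\<^sub>R e)) (at t)"
        by (auto intro!: derivative_eq_intros)
      from diff_chain_at[OF this smooth_has_derivative[OF that]] show ?thesis by (simp add: o_def)
    qed
    moreover have "pdiff (s *\<^sub>R e) g z = s *\<^sub>R pdiff e g z" for s z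
      using linear_cmul[OF has_derivative_linear[OF smooth_has_derivative[OF that]]] .
    ultimately show ?thesis
      by (simp add: has_vector_derivative_def has_derivative_at_withinI)
  qed
  have cont: "continuous_on UNIV (\<lambda>(r, s). pdiff k g (x + r *\<^sub>R h + s *\<^sub>R e))"
    if "smooth g" "k \<in> Basis" for g and k :: 'a
    unfolding split_beta
    by (intro continuous_on_compose2[OF smooth_continuous[OF smooth_pdiff[OF that], of UNIV]] continuous_intros) auto
  \<comment> \<open>The function r -> f(x + r h + t e) - f(x + r h) is the integral of
    \<open>pdiff e f\<close> over a segment. Its derivative at r = 0 is computed from both
    expressions.\<close>
  have key: "pdiff h f (x + t *\<^sub>R e) - pdiff h f x = integral {0..t} (\<lambda>s. pdiff h (pdiff e f) (x + s *\<^sub>R e))"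
    if t: "t > 0" for t
  proof -
    have ftc: "integral {0..t} (\<lambda>s. pdiff e f (x + r *\<^sub>R h + s *\<^sub>R e)) = f (x + r *\<^sub>R h + t *\<^sub>R e) - f (x + r *\<^sub>R h)" for r
      using fundamental_theorem_of_calculus[of 0 t "\<lambda>s. f (x + r *\<^sub>R h + s *\<^sub>R e)"] line[OF f] t
      by (auto intro!: integral_unique)
    have D: "((\<lambda>r. g (x + r *\<^sub>R h + v)) has_vector_derivative pdiff h g (x + r *\<^sub>R h + v)) (at r within T)" if "smooth g" for g r v T
    proof -
      have "((\<lambda>r. g (x + r *\<^sub>R h + v)) has_derivative (\<lambda>s. pdiff (s *\<^sub>R h) g (x + r *\<^sub>R h + v))) (at r)"
      proof -
        have "((\<lambda>r. x + r *\<^sub>R h + v) has_derivative (\<lambda>s. s *\<^sub>R h)) (at r)"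
          by (auto intro!: derivative_eq_intros)
        from diff_chain_at[OF this smooth_has_derivative[OF that]] show ?thesis by (simp add: o_def)
      qed
      moreover have "pdiff (s *\<^sub>R h) g z = s *\<^sub>R pdiff h g z" for s z
        using linear_cmul[OF has_derivative_linear[OF smooth_has_derivative[OF that]]] .
      ultimately show ?thesis
        by (simp add: has_vector_derivative_def has_derivative_at_withinI)
    qed
    have "((\<lambda>r. integral (cbox 0 t) (\<lambda>s. pdiff e f (x + r *\<^sub>R h + s *\<^sub>R e))) has_vector_derivative
        integral (cbox 0 t) (\<lambda>s. pdiff h (pdiff e f) (x + 0 *\<^sub>R h + s *\<^sub>R e))) (at 0 within UNIV)"
    proof (rule leibniz_rule_vector_derivative)
      show "((\<lambda>r. pdiff e f (x + r *\<^sub>R h + s *\<^sub>R e)) has_vector_derivative pdiff h (pdiff e f) (x + r *\<^sub>R h + s *\<^sub>R e)) (at r within UNIV)" for r s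
        by (rule D[OF smooth_pdiff[OF f e]])
      show "(\<lambda>s. pdiff e f (x + r *\<^sub>R h + s *\<^sub>R e)) integrable_on cbox 0 t" for r
        by (intro integrable_continuous continuous_on_compose2[OF smooth_continuous[OF smooth_pdiff[OF f e], of UNIV]] continuous_intros) auto
      show "continuous_on (UNIV \<times> cbox 0 t) (\<lambda>(r, s). pdiff h (pdiff e f) (x + r *\<^sub>R h + s *\<^sub>R e))"
        by (rule continuous_on_subset[OF cont[OF smooth_pdiff[OF f e] h]]) auto
    qed auto
    moreover have "((\<lambda>r. f (x + r *\<^sub>R h + t *\<^sub>R e) - f (x + r *\<^sub>R h)) has_vector_derivative
        pdiff h f (x + t *\<^sub>R e) - pdiff h f x) (at 0)"
      using has_vector_derivative_diff[OF D[OF f, of "t *\<^sub>R e" 0] D[OF f, of 0 0]] by simp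
    ultimately show ?thesis
      by (simp add: ftc cbox_interval vector_derivative_unique_at)
  qed
  have i: "continuous_on {0..1} (\<lambda>s. pdiff h (pdiff e f) (x + s *\<^sub>R e))"
    by (intro continuous_on_compose2[OF smooth_continuous[OF smooth_pdiff[OF smooth_pdiff[OF f e] h], of UNIV]] continuous_intros) auto
  \<comment> \<open>The integral is differentiated at its lower end. A one-sided derivative
    determines the value, since 0 is a limit point of the interval.\<close>
  have "((\<lambda>t. integral {0..t} (\<lambda>s. pdiff h (pdiff e f) (x + s *\<^sub>R e))) has_vector_derivative
      pdiff h (pdiff e f) (x + 0 *\<^sub>R e)) (at 0 within {0..1})"
    by (rule integral_has_vector_derivative[OF i]) auto
  then have "((\<lambda>t. pdiff h f (x + t *\<^sub>R e) - pdiff h f x) has_vector_derivative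
      pdiff h (pdiff e f) (x + 0 *\<^sub>R e)) (at 0 within {0..1})"
    by (rule has_vector_derivative_transform[rotated 2]) (use key in \<open>auto simp: le_less\<close>)
  moreover have "((\<lambda>t. pdiff h f (x + t *\<^sub>R e) - pdiff h f x) has_vector_derivative
      pdiff e (pdiff h f) x - 0) (at 0 within {0..1})"
    using has_vector_derivative_diff[OF line[OF smooth_pdiff[OF f h], of x 0] has_vector_derivative_const] by simp
  ultimately have "pdiff h (pdiff e f) (x + 0 *\<^sub>R e) = pdiff e (pdiff h f) x - 0"
    by (intro vector_derivative_unique_within[of "0::real" "{0..1}"]) (simp_all add: trivial_limit_within islimpt_Icc)
  then show ?thesis by simp
qed

section \<open>\<open>L\<^sup>2\<close> norms of distributions\<close>

text \<open>Lebesgue measurability is not stable under composition with maps such as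
  \<open>rad\<close> and \<open>pol\<close>. So functions are replaced by Borel ones that agree
  almost everywhere on \<Omega>, separately in real and imaginary part.\<close>

lemma lebesgue_on_borel_version:
  fixes f :: "'a::euclidean_space \<Rightarrow> complex"
  assumes \<Omega>: "\<Omega> \<in> sets borel" and f: "f \<in> borel_measurable (lebesgue_on \<Omega>)"
  obtains g where "g \<in> borel_measurable borel" "AE x in lborel. x \<in> \<Omega> \<longrightarrow> f x = g x"
proof -
  let ?f = "\<lambda>x. indicator \<Omega> x *\<^sub>R f x"
  have m: "?f \<in> borel_measurable lebesgue"
    using f \<Omega> by (subst borel_measurable_restrict_space_iff[symmetric]) auto
  obtain p where p: "p \<in> borel_measurable lborel" "AE x in lborel. Re (?f x) = p x"
    using completion_ex_borel_measurable_real[OF measurable_compose[OF m borel_measurable_Re]] by blast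
  obtain q where q: "q \<in> borel_measurable lborel" "AE x in lborel. Im (?f x) = q x"
    using completion_ex_borel_measurable_real[OF measurable_compose[OF m borel_measurable_Im]] by blast
  show ?thesis
  proof
    show "(\<lambda>x. Complex (p x) (q x)) \<in> borel_measurable borel"
      using p(1) q(1) unfolding Complex_eq by measurable
    show "AE x in lborel. x \<in> \<Omega> \<longrightarrow> f x = Complex (p x) (q x)"
      using p(2) q(2) by eventually_elim (auto simp: complex_eq_iff)
  qed
qed

lemma AE_lebesgue_on:
  assumes "\<Omega> \<in> sets borel" "AE x in lborel. x \<in> \<Omega> \<longrightarrow> P x"
  shows "AE x in lebesgue_on \<Omega>. P x"
  using assms AE_completion[OF assms(2)] by (subst AE_restrict_space_iff) auto

lemma distr_of_cong_AE:
  assumes "\<Omega> \<in> sets borel" "AE x in lborel. x \<in> \<Omega> \<longrightarrow> f x = g x"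
    "f \<in> borel_measurable (lebesgue_on \<Omega>)" "g \<in> borel_measurable (lebesgue_on \<Omega>)"
    "\<phi> \<in> borel_measurable borel"
  shows "distr_of \<Omega> f \<phi> = distr_of \<Omega> g \<phi>"
  unfolding distr_of_def
proof (rule integral_cong_AE)
  have [measurable]: "\<phi> \<in> borel_measurable (lebesgue_on \<Omega>)"
    using assms(5) by (intro measurable_restrict_space1 measurable_completion) simp
  show "(\<lambda>x. f x * \<phi> x) \<in> borel_measurable (lebesgue_on \<Omega>)"
    "(\<lambda>x. g x * \<phi> x) \<in> borel_measurable (lebesgue_on \<Omega>)"
    using assms by measurable
  show "AE x in lebesgue_on \<Omega>. f x * \<phi> x = g x * \<phi> x"
    using AE_lebesgue_on[OF assms(1,2)] by eventually_elim simp
qed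

lemma borel_measurable_lebesgue_on:
  "f \<in> borel_measurable borel \<Longrightarrow> f \<in> borel_measurable (lebesgue_on \<Omega>)"
  by (intro measurable_restrict_space1 measurable_completion) simp

lemma distr_of_lborel:
  fixes g :: "'a::euclidean_space \<Rightarrow> complex"
  assumes "\<Omega> \<in> sets borel" "g \<in> borel_measurable borel" "\<phi> \<in> test_functions \<Omega>"
  shows "distr_of \<Omega> g \<phi> = (\<integral>x. g x * \<phi> x \<partial>lborel)"
proof -
  have "distr_of \<Omega> g \<phi> = (\<integral>x. indicator \<Omega> x *\<^sub>R (g x * \<phi> x) \<partial>lebesgue)"
    unfolding distr_of_def using assms by (intro integral_restrict_space) auto
  also have "\<dots> = (\<integral>x. g x * \<phi> x \<partial>lebesgue)"
    using test_zero_outside[OF assms(3)] by (intro Bochner_Integration.integral_cong) (auto split: split_indicator)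
  also have "\<dots> = (\<integral>x. g x * \<phi> x \<partial>lborel)"
    using assms(2) test_measurable[OF assms(3)] by (intro integral_completion) simp
  finally show ?thesis .
qed

lemma L2_sq_cong_AE:
  assumes "\<Omega> \<in> sets borel" "AE x in lborel. x \<in> \<Omega> \<longrightarrow> f x = g x"
  shows "L2_sq \<Omega> \<rho> f = L2_sq \<Omega> \<rho> g"
  unfolding L2_sq_def
  by (rule nn_integral_cong_AE) (use AE_lebesgue_on[OF assms] in \<open>eventually_elim, simp\<close>)

lemma L2_sq_lborel:
  assumes "\<Omega> \<in> sets borel"
  shows "L2_sq \<Omega> \<rho> f = (\<integral>\<^sup>+x. ennreal (\<rho> x * (norm (f x))\<^sup>2) * indicator \<Omega> x \<partial>lborel)"
  unfolding L2_sq_def using assms by (subst nn_integral_restrict_space) (auto simp: nn_integral_completion)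

section \<open>Weighted L2 representatives of a distribution\<close>

definition pos_weight :: "'a::euclidean_space set \<Rightarrow> ('a \<Rightarrow> real) \<Rightarrow> bool" where
  "pos_weight \<Omega> \<rho> \<longleftrightarrow> continuous_on UNIV \<rho> \<and> (\<forall>x\<in>\<Omega>. 0 < \<rho> x)"

text \<open>The candidates that count in the infimum \<open>distr_L2_sq\<close>: those of infinite
  norm do not lower it, and the others have Borel versions. The pairing may run over the whole space
  because test functions vanish off \<Omega>.\<close>

definition L2_reps :: "'a::euclidean_space set \<Rightarrow> ('a \<Rightarrow> real) \<Rightarrow> 'a distr \<Rightarrow> ('a \<Rightarrow> complex) set" where
  "L2_reps \<Omega> \<rho> T = {g \<in> borel_measurable borel. L2_sq \<Omega> \<rho> g < \<infinity> \<and>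
     (\<forall>\<phi>\<in>test_functions \<Omega>. T \<phi> = (\<integral>x. g x * \<phi> x \<partial>lborel))}"

text \<open>On the compact set the continuous weight has a positive minimum c, and |g| <= 1 + |g|^2
  <= 1 + (1/c) \<rho> |g|^2.\<close>

lemma L2_integrable_on_compact:
  fixes g :: "'a::euclidean_space \<Rightarrow> complex"
  assumes \<Omega>: "\<Omega> \<in> sets borel" and \<rho>: "pos_weight \<Omega> \<rho>" and K: "compact K" "K \<subseteq> \<Omega>"
    and g: "g \<in> borel_measurable borel" "L2_sq \<Omega> \<rho> g < \<infinity>"
  shows "integrable lborel (\<lambda>x. indicator K x *\<^sub>R g x)"
proof (cases "K = {}")
  case False
  have Kb [measurable]: "K \<in> sets borel" using K by (simp add: borel_compact)
  obtain x0 where x0: "x0 \<in> K" "\<And>x. x \<in> K \<Longrightarrow> \<rho> x0 \<le> \<rho> x"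
    using continuous_attains_inf[OF K(1) False, of \<rho>] \<rho> continuous_on_subset
    unfolding pos_weight_def by (metis subset_UNIV)
  define c where "c = \<rho> x0"
  have c: "c > 0" using x0 K \<rho> by (auto simp: c_def pos_weight_def)
  have fin: "emeasure lborel K < \<infinity>" by (rule emeasure_compact_finite[OF K(1)])
  have "(\<integral>\<^sup>+x. ennreal (norm (indicator K x *\<^sub>R g x)) \<partial>lborel)
      \<le> (\<integral>\<^sup>+x. indicator K x + ennreal (1 / c) * (ennreal (\<rho> x * (norm (g x))\<^sup>2) * indicator \<Omega> x) \<partial>lborel)"
  proof (rule nn_integral_mono)
    fix x
    show "ennreal (norm (indicator K x *\<^sub>R g x)) \<le> indicator K x + ennreal (1 / c) * (ennreal (\<rho> x * (norm (g x))\<^sup>2) * indicator \<Omega> x)"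
    proof (cases "x \<in> K")
      case True
      have "2 * norm (g x) \<le> 1 + (norm (g x))\<^sup>2" using sum_squares_bound[of 1 "norm (g x)"] by simp
      then have "norm (g x) \<le> 1 + (norm (g x))\<^sup>2" using norm_ge_zero[of "g x"] by linarith
      also have "(norm (g x))\<^sup>2 \<le> (1 / c) * (\<rho> x * (norm (g x))\<^sup>2)"
        using x0(2)[OF True] c by (simp add: c_def[symmetric] field_simps mult_right_mono)
      finally have "ennreal (norm (g x)) \<le> ennreal (1 + (1 / c) * (\<rho> x * (norm (g x))\<^sup>2))"
        by (intro ennreal_leI) simp
      also have "\<dots> = 1 + ennreal (1 / c) * ennreal (\<rho> x * (norm (g x))\<^sup>2)"
      proof -
        have "0 \<le> \<rho> x * (norm (g x))\<^sup>2" using c x0(2)[OF True] by (simp add: c_def)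
        then show ?thesis
          using c ennreal_mult[of "1 / c" "\<rho> x * (norm (g x))\<^sup>2"] by (subst ennreal_plus) auto
      qed
      finally show ?thesis using True K(2) by (auto simp: indicator_def)
    qed auto
  qed
  also have "\<dots> = emeasure lborel K + ennreal (1 / c) * L2_sq \<Omega> \<rho> g"
  proof -
    have [measurable]: "\<rho> \<in> borel_measurable borel" "\<Omega> \<in> sets borel" "g \<in> borel_measurable borel"
      using \<rho> \<Omega> g by (auto simp: pos_weight_def intro: borel_measurable_continuous_onI)
    show ?thesis by (simp add: nn_integral_add nn_integral_cmult L2_sq_lborel[OF \<Omega>])
  qed
  also have "\<dots> < \<infinity>" using fin g(2) by (simp add: ennreal_mult_less_top)
  finally show ?thesis using g(1) by (intro integrableI_bounded) auto
qed simp

lemma L2_integrable_test: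
  fixes g :: "'a::euclidean_space \<Rightarrow> complex"
  assumes \<Omega>: "\<Omega> \<in> sets borel" and \<rho>: "pos_weight \<Omega> \<rho>" and \<phi>: "\<phi> \<in> test_functions \<Omega>"
    and g: "g \<in> borel_measurable borel" "L2_sq \<Omega> \<rho> g < \<infinity>"
  shows "integrable lborel (\<lambda>x. g x * \<phi> x)"
proof -
  obtain K where K: "compact K" "K \<subseteq> \<Omega>" "\<And>x. x \<notin> K \<Longrightarrow> \<phi> x = 0" using test_functionsE[OF \<phi>] by metis
  obtain B where B: "\<And>x. norm (\<phi> x) \<le> B" using test_bounded[OF \<phi>] by metis
  have [measurable]: "g \<in> borel_measurable borel" "\<phi> \<in> borel_measurable borel"
    using g test_measurable[OF \<phi>] by auto
  show ?thesis
  proof (rule Bochner_Integration.integrable_bound)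
    show "integrable lborel (\<lambda>x. B *\<^sub>R (indicator K x *\<^sub>R g x))"
      by (intro integrable_scaleR_right L2_integrable_on_compact[OF \<Omega> \<rho> K(1,2) g])
    have "norm (g x * \<phi> x) \<le> norm (B *\<^sub>R (indicator K x *\<^sub>R g x))" for x
    proof (cases "x \<in> K")
      case True
      have "norm (g x) * norm (\<phi> x) \<le> norm (g x) * \<bar>B\<bar>" using B[of x] by (intro mult_left_mono) auto
      then show ?thesis using True by (simp add: norm_mult mult.commute)
    qed (simp add: K)
    then show "AE x in lborel. norm (g x * \<phi> x) \<le> norm (B *\<^sub>R (indicator K x *\<^sub>R g x))" by simp
  qed measurable
qed

lemma open_compact_exhaustion:
  fixes \<Omega> :: "'a::euclidean_space set"
  assumes "open \<Omega>"
  obtains C where "countable C" "\<And>K. K \<in> C \<Longrightarrow> compact K" "\<And>K. K \<in> C \<Longrightarrow> K \<subseteq> \<Omega>" "\<Union>C = \<Omega>"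
proof -
  obtain D where D: "countable D" "D \<subseteq> Pow \<Omega>" "\<And>X. X \<in> D \<Longrightarrow> \<exists>a b. X = cbox a b" "\<Union>D = \<Omega>"
    using open_countable_Union_open_cbox[OF assms] by metis
  show ?thesis
    by (rule that[of D]) (use D in \<open>auto, metis compact_cbox\<close>)
qed

text \<open>An open set is a countable union of compact boxes, and integrability on each of them
  includes measurability.\<close>

lemma locally_integrable_measurable:
  fixes g :: "'a::euclidean_space \<Rightarrow> complex"
  assumes "open \<Omega>" "g locally_integrable_on \<Omega>"
  shows "g \<in> borel_measurable (lebesgue_on \<Omega>)"
proof -
  obtain C where C: "countable C" "\<And>K. K \<in> C \<Longrightarrow> compact K" "\<And>K. K \<in> C \<Longrightarrow> K \<subseteq> \<Omega>" "\<Union>C = \<Omega>"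
    using open_compact_exhaustion[OF assms(1)] by metis
  have \<Omega>: "\<Omega> \<in> sets lebesgue" using assms(1) by simp
  have Kl: "K \<in> sets lebesgue" if "K \<in> C" for K using C(2)[OF that] by (simp add: borel_compact)
  have m: "g \<in> borel_measurable (lebesgue_on K)" if "K \<in> C" for K
    using assms(2) C that absolutely_integrable_measurable[OF Kl[OF that], of g]
    by (auto simp: locally_integrable_on_def)
  show ?thesis
  proof (rule measurable_piecewise_restrict[OF C(1)])
    show "K \<inter> space (lebesgue_on \<Omega>) \<in> sets (lebesgue_on \<Omega>)" if "K \<in> C" for K
      using Kl[OF that] \<Omega> by (auto simp: sets_restrict_space)
    show "space (lebesgue_on \<Omega>) \<subseteq> \<Union>C" using C(4) by simp
    show "g \<in> borel_measurable (restrict_space (lebesgue_on \<Omega>) K)" if "K \<in> C" for K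
      using m[OF that] C(3)[OF that] \<Omega> Kl[OF that]
      by (simp add: restrict_restrict_space Int_absorb1)
  qed
qed

text \<open>Finite weighted norm forces local integrability, which gives one inequality. Conversely
  a locally integrable candidate of finite norm has a Borel version with the same norm and the same
  pairings.\<close>

lemma distr_L2_sq_eq_INF:
  fixes \<Omega> :: "'a::euclidean_space set"
  assumes \<Omega>: "open \<Omega>" and \<rho>: "pos_weight \<Omega> \<rho>"
  shows "distr_L2_sq \<Omega> \<rho> T = (INF g \<in> L2_reps \<Omega> \<rho> T. L2_sq \<Omega> \<rho> g)"
proof (rule antisym)
  have \<Omega>b: "\<Omega> \<in> sets borel" using \<Omega> by simp
  show "distr_L2_sq \<Omega> \<rho> T \<le> (INF g \<in> L2_reps \<Omega> \<rho> T. L2_sq \<Omega> \<rho> g)"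
    unfolding distr_L2_sq_def
  proof (rule INF_superset_mono[OF _ order_refl], rule subsetI)
    fix g assume g: "g \<in> L2_reps \<Omega> \<rho> T"
    have "g absolutely_integrable_on K" if "compact K" "K \<subseteq> \<Omega>" for K
      using L2_integrable_on_compact[OF \<Omega>b \<rho> that, of g] g integrable_completion[of "\<lambda>x. indicator K x *\<^sub>R g x" lborel] that(1)
      by (simp add: L2_reps_def set_integrable_def borel_compact)
    moreover have "T \<phi> = distr_of \<Omega> g \<phi>" if "\<phi> \<in> test_functions \<Omega>" for \<phi>
      using g that distr_of_lborel[OF \<Omega>b _ that, of g] by (simp add: L2_reps_def)
    ultimately show "g \<in> {g. g locally_integrable_on \<Omega> \<and> (\<forall>\<phi>\<in>test_functions \<Omega>. T \<phi> = distr_of \<Omega> g \<phi>)}"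
      by (simp add: locally_integrable_on_def)
  qed
  show "(INF g \<in> L2_reps \<Omega> \<rho> T. L2_sq \<Omega> \<rho> g) \<le> distr_L2_sq \<Omega> \<rho> T"
    unfolding distr_L2_sq_def
  proof (rule INF_greatest)
    fix g assume g: "g \<in> {g. g locally_integrable_on \<Omega> \<and> (\<forall>\<phi>\<in>test_functions \<Omega>. T \<phi> = distr_of \<Omega> g \<phi>)}"
    show "(INF g \<in> L2_reps \<Omega> \<rho> T. L2_sq \<Omega> \<rho> g) \<le> L2_sq \<Omega> \<rho> g"
    proof (cases "L2_sq \<Omega> \<rho> g < \<infinity>")
      case True
      have gm: "g \<in> borel_measurable (lebesgue_on \<Omega>)"
        using locally_integrable_measurable[OF \<Omega>] g by simp
      obtain h where h: "h \<in> borel_measurable borel" "AE x in lborel. x \<in> \<Omega> \<longrightarrow> g x = h x"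
        using lebesgue_on_borel_version[OF \<Omega>b gm] by metis
      have eq: "L2_sq \<Omega> \<rho> g = L2_sq \<Omega> \<rho> h" by (rule L2_sq_cong_AE[OF \<Omega>b h(2)])
      have "T \<phi> = (\<integral>x. h x * \<phi> x \<partial>lborel)" if \<phi>: "\<phi> \<in> test_functions \<Omega>" for \<phi>
        using g \<phi> distr_of_cong_AE[OF \<Omega>b h(2) gm borel_measurable_lebesgue_on[OF h(1)] test_measurable[OF \<phi>]]
          distr_of_lborel[OF \<Omega>b h(1) \<phi>] by simp
      then have "h \<in> L2_reps \<Omega> \<rho> T" using h True eq by (simp add: L2_reps_def)
      then show ?thesis unfolding eq by (rule INF_lower)
    qed (simp add: not_less top.extremum_unique)
  qed
qed

lemma distr_L2_sq_less_obtain: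
  assumes "open \<Omega>" "pos_weight \<Omega> \<rho>" "distr_L2_sq \<Omega> \<rho> T < y"
  obtains g where "g \<in> L2_reps \<Omega> \<rho> T" "L2_sq \<Omega> \<rho> g < y"
  using assms(3) unfolding distr_L2_sq_eq_INF[OF assms(1,2)] INF_less_iff by blast

lemma distr_L2_sq_le:
  "open \<Omega> \<Longrightarrow> pos_weight \<Omega> \<rho> \<Longrightarrow> g \<in> L2_reps \<Omega> \<rho> T \<Longrightarrow> distr_L2_sq \<Omega> \<rho> T \<le> L2_sq \<Omega> \<rho> g"
  by (simp add: distr_L2_sq_eq_INF INF_lower)

lemma distr_L2_sq_cong:
  assumes "\<And>\<phi>. \<phi> \<in> test_functions \<Omega> \<Longrightarrow> S \<phi> = T \<phi>"
  shows "distr_L2_sq \<Omega> \<rho> S = distr_L2_sq \<Omega> \<rho> T"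
  using assms by (simp add: distr_L2_sq_def cong: conj_cong)

lemma distr_L2_sq_mono_domain:
  assumes "open U" "open D" "U \<subseteq> D" "pos_weight D \<rho>"
  shows "distr_L2_sq U \<rho> T \<le> distr_L2_sq D \<rho> T"
proof -
  have \<rho>: "pos_weight U \<rho>" using assms by (auto simp: pos_weight_def)
  show ?thesis
    unfolding distr_L2_sq_eq_INF[OF assms(1) \<rho>] distr_L2_sq_eq_INF[OF assms(2,4)]
  proof (rule INF_mono)
    fix g assume g: "g \<in> L2_reps D \<rho> T"
    have le: "L2_sq U \<rho> g \<le> L2_sq D \<rho> g"
      using assms by (subst (1 2) L2_sq_lborel) (auto intro!: nn_integral_mono mult_left_mono simp: indicator_def)
    then have "g \<in> L2_reps U \<rho> T"
      using g test_mono[OF _ assms(3)] by (auto simp: L2_reps_def)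
    then show "\<exists>h\<in>L2_reps U \<rho> T. L2_sq U \<rho> h \<le> L2_sq D \<rho> g" using le by blast
  qed
qed

lemma norm_sum_square_le:
  fixes c g :: "'i \<Rightarrow> complex"
  assumes "\<And>i. i \<in> I \<Longrightarrow> norm (c i) \<le> C"
  shows "(norm (\<Sum>i\<in>I. c i * g i))\<^sup>2 \<le> C\<^sup>2 * real (card I) * (\<Sum>i\<in>I. (norm (g i))\<^sup>2)"
proof -
  have "norm (\<Sum>i\<in>I. c i * g i) \<le> (\<Sum>i\<in>I. C * norm (g i))"
    using assms by (intro sum_norm_le) (simp add: norm_mult mult_right_mono)
  then have "(norm (\<Sum>i\<in>I. c i * g i))\<^sup>2 \<le> (\<Sum>i\<in>I. C * norm (g i))\<^sup>2"
    by (intro power_mono) auto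
  also have "\<dots> \<le> (\<Sum>i\<in>I. C\<^sup>2) * (\<Sum>i\<in>I. (norm (g i))\<^sup>2)"
    by (rule Cauchy_Schwarz_ineq_sum)
  finally show ?thesis by (simp add: mult.commute)
qed

text \<open>The infima are not known to be attained, so representatives of the \<open>S i\<close>
  are taken within \<open>d\<close> of optimal and combined. Cauchy-Schwarz gives the factor C^2
  card I pointwise.\<close>

lemma distr_L2_sq_lincomb:
  fixes \<Omega> :: "'a::euclidean_space set"
  assumes \<Omega>: "open \<Omega>" and \<rho>: "pos_weight \<Omega> \<rho>" and I: "finite I" "I \<noteq> {}" and C: "C > 0"
    and c: "\<And>i. i \<in> I \<Longrightarrow> norm (c i) \<le> C"
    and T: "\<And>\<phi>. \<phi> \<in> test_functions \<Omega> \<Longrightarrow> T \<phi> = (\<Sum>i\<in>I. c i * S i \<phi>)"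
  shows "distr_L2_sq \<Omega> \<rho> T \<le> ennreal (C\<^sup>2 * card I) * (\<Sum>i\<in>I. distr_L2_sq \<Omega> \<rho> (S i))"
proof (rule ennreal_le_epsilon)
  fix \<epsilon> :: real
  define M where "M = C\<^sup>2 * real (card I)"
  have M: "M > 0" using C I by (simp add: M_def card_gt_0_iff)
  assume fin: "ennreal (C\<^sup>2 * card I) * (\<Sum>i\<in>I. distr_L2_sq \<Omega> \<rho> (S i)) < top" and "0 < \<epsilon>"
  have \<Omega>b [measurable]: "\<Omega> \<in> sets borel" using \<Omega> by simp
  have \<rho>b [measurable]: "\<rho> \<in> borel_measurable borel" using \<rho> by (simp add: pos_weight_def borel_measurable_continuous_onI)
  \<comment> \<open>Chosen so that card I errors of size \<open>d\<close>, multiplied by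
    \<open>M\<close>, add up to \<epsilon>.\<close>
  define d where "d = \<epsilon> / (M * card I)"
  have d: "d > 0" using \<open>0 < \<epsilon>\<close> M I by (simp add: d_def card_gt_0_iff)
  have "distr_L2_sq \<Omega> \<rho> (S i) < top" if "i \<in> I" for i
  proof -
    have "(\<Sum>i\<in>I. distr_L2_sq \<Omega> \<rho> (S i)) < top" using fin M by (auto simp: ennreal_mult_less_top M_def[symmetric])
    then show ?thesis using that I(1) by (simp add: ennreal_sum_less_top)
  qed
  then have "\<exists>g. g \<in> L2_reps \<Omega> \<rho> (S i) \<and> L2_sq \<Omega> \<rho> g < distr_L2_sq \<Omega> \<rho> (S i) + ennreal d" if "i \<in> I" for i
    using distr_L2_sq_less_obtain[OF \<Omega> \<rho>, of "S i" "distr_L2_sq \<Omega> \<rho> (S i) + ennreal d"] d that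
    by (metis ennreal_add_left_cancel_less add.right_neutral ennreal_less_zero_iff infinity_ennreal_def less_irrefl)
  then obtain g where g: "\<And>i. i \<in> I \<Longrightarrow> g i \<in> L2_reps \<Omega> \<rho> (S i)"
    "\<And>i. i \<in> I \<Longrightarrow> L2_sq \<Omega> \<rho> (g i) < distr_L2_sq \<Omega> \<rho> (S i) + ennreal d" by metis
  have gm [measurable]: "g i \<in> borel_measurable borel" if "i \<in> I" for i using g(1)[OF that] by (simp add: L2_reps_def)
  define G where "G x = (\<Sum>i\<in>I. c i * g i x)" for x
  have Gm: "G \<in> borel_measurable borel" unfolding G_def by measurable
  have pt: "ennreal (\<rho> x * (norm (G x))\<^sup>2) * indicator \<Omega> x
    \<le> ennreal M * (\<Sum>i\<in>I. ennreal (\<rho> x * (norm (g i x))\<^sup>2) * indicator \<Omega> x)" for x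
  proof (cases "x \<in> \<Omega>")
    case True
    then have \<rho>x: "\<rho> x > 0" using \<rho> by (simp add: pos_weight_def)
    have "\<rho> x * (norm (G x))\<^sup>2 \<le> \<rho> x * (M * (\<Sum>i\<in>I. (norm (g i x))\<^sup>2))"
      unfolding G_def M_def using norm_sum_square_le[of I c C "\<lambda>i. g i x"] c \<rho>x by (intro mult_left_mono) auto
    also have "\<dots> = M * (\<Sum>i\<in>I. \<rho> x * (norm (g i x))\<^sup>2)" by (simp add: sum_distrib_left mult_ac)
    finally have "ennreal (\<rho> x * (norm (G x))\<^sup>2) \<le> ennreal (M * (\<Sum>i\<in>I. \<rho> x * (norm (g i x))\<^sup>2))"
      by (rule ennreal_leI)
    also have "\<dots> = ennreal M * (\<Sum>i\<in>I. ennreal (\<rho> x * (norm (g i x))\<^sup>2))"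
      using M \<rho>x by (subst ennreal_mult') (auto simp: sum_ennreal)
    finally show ?thesis using True by simp
  qed simp
  have "L2_sq \<Omega> \<rho> G \<le> (\<integral>\<^sup>+x. ennreal M * (\<Sum>i\<in>I. ennreal (\<rho> x * (norm (g i x))\<^sup>2) * indicator \<Omega> x) \<partial>lborel)"
    unfolding L2_sq_lborel[OF \<Omega>b] by (rule nn_integral_mono) (rule pt)
  also have "\<dots> = ennreal M * (\<Sum>i\<in>I. L2_sq \<Omega> \<rho> (g i))"
    unfolding L2_sq_lborel[OF \<Omega>b] by (subst nn_integral_cmult, measurable, subst nn_integral_sum) auto
  finally have GL: "L2_sq \<Omega> \<rho> G \<le> ennreal M * (\<Sum>i\<in>I. L2_sq \<Omega> \<rho> (g i))" .
  also have "\<dots> < \<infinity>"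
    using g(1) I(1) by (auto simp: L2_reps_def ennreal_mult_less_top ennreal_sum_less_top)
  finally have Gfin: "L2_sq \<Omega> \<rho> G < \<infinity>" .
  have "T \<phi> = (\<integral>x. G x * \<phi> x \<partial>lborel)" if \<phi>: "\<phi> \<in> test_functions \<Omega>" for \<phi>
  proof -
    have i: "integrable lborel (\<lambda>x. g i x * \<phi> x)" if "i \<in> I" for i
      using g(1)[OF that] by (intro L2_integrable_test[OF \<Omega>b \<rho> \<phi>]) (auto simp: L2_reps_def)
    have "(\<integral>x. G x * \<phi> x \<partial>lborel) = (\<integral>x. (\<Sum>i\<in>I. c i * (g i x * \<phi> x)) \<partial>lborel)"
      by (simp add: G_def sum_distrib_right mult.assoc)
    also have "\<dots> = (\<Sum>i\<in>I. c i * (\<integral>x. g i x * \<phi> x \<partial>lborel))"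
      using i by (subst Bochner_Integration.integral_sum) auto
    also have "\<dots> = T \<phi>" using T[OF \<phi>] g(1) \<phi> by (auto simp: L2_reps_def intro!: sum.cong)
    finally show ?thesis ..
  qed
  then have "G \<in> L2_reps \<Omega> \<rho> T" using Gfin Gm by (simp add: L2_reps_def)
  then have "distr_L2_sq \<Omega> \<rho> T \<le> L2_sq \<Omega> \<rho> G" by (rule distr_L2_sq_le[OF \<Omega> \<rho>])
  also have "\<dots> \<le> ennreal M * (\<Sum>i\<in>I. distr_L2_sq \<Omega> \<rho> (S i) + ennreal d)"
  proof (rule order_trans[OF GL mult_left_mono])
    show "(\<Sum>i\<in>I. L2_sq \<Omega> \<rho> (g i)) \<le> (\<Sum>i\<in>I. distr_L2_sq \<Omega> \<rho> (S i) + ennreal d)"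
      by (intro sum_mono less_imp_le g(2))
  qed simp
  also have "\<dots> = ennreal M * (\<Sum>i\<in>I. distr_L2_sq \<Omega> \<rho> (S i)) + ennreal (M * (card I * d))"
    using d M by (simp add: sum.distrib distrib_left ennreal_mult'' ennreal_of_nat_eq_real_of_nat)
  also have "M * (card I * d) = \<epsilon>" using M I by (simp add: d_def card_gt_0_iff)
  finally show "distr_L2_sq \<Omega> \<rho> T \<le> ennreal (C\<^sup>2 * card I) * (\<Sum>i\<in>I. distr_L2_sq \<Omega> \<rho> (S i)) + ennreal \<epsilon>"
    by (simp add: M_def)
qed

section \<open>Two families of polynomials in the Euler operator\<close>

text \<open>The bound \<open>C\<close> on the coefficients is what makes the final constants independent of \<open>k\<close>.\<close>

definition bspan :: "real \<Rightarrow> 'i set \<Rightarrow> ('i \<Rightarrow> real poly) \<Rightarrow> real poly set" where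
  "bspan C I q = {\<Sum>i\<in>I. smult (c i) (q i) | c. \<forall>i\<in>I. \<bar>c i\<bar> \<le> C}"

lemma bspanI: "(\<And>i. i \<in> I \<Longrightarrow> \<bar>c i\<bar> \<le> C) \<Longrightarrow> p = (\<Sum>i\<in>I. smult (c i) (q i)) \<Longrightarrow> p \<in> bspan C I q"
  by (auto simp: bspan_def)

lemma bspanE:
  assumes "p \<in> bspan C I q"
  obtains c where "\<And>i. i \<in> I \<Longrightarrow> \<bar>c i\<bar> \<le> C" "p = (\<Sum>i\<in>I. smult (c i) (q i))"
  using assms by (auto simp: bspan_def)

lemma bspan_mono: "p \<in> bspan C I q \<Longrightarrow> C \<le> D \<Longrightarrow> p \<in> bspan D I q"
  unfolding bspan_def by fastforce

lemma bspan_zero: "0 \<le> C \<Longrightarrow> 0 \<in> bspan C I q"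
  by (rule bspanI[of _ "\<lambda>_. 0"]) auto

lemma bspan_elem: "finite I \<Longrightarrow> i \<in> I \<Longrightarrow> q i \<in> bspan 1 I q"
  by (rule bspanI[of _ "\<lambda>k. if k = i then 1 else 0"])
    (auto simp: if_distrib[of "\<lambda>x. smult x _"] cong: if_cong)

lemma bspan_add: "p \<in> bspan C I q \<Longrightarrow> p' \<in> bspan D I q \<Longrightarrow> p + p' \<in> bspan (C + D) I q"
proof -
  assume "p \<in> bspan C I q" "p' \<in> bspan D I q"
  then obtain c d where "\<And>i. i \<in> I \<Longrightarrow> \<bar>c i\<bar> \<le> C" "p = (\<Sum>i\<in>I. smult (c i) (q i))"
    "\<And>i. i \<in> I \<Longrightarrow> \<bar>d i\<bar> \<le> D" "p' = (\<Sum>i\<in>I. smult (d i) (q i))"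
    by (auto elim!: bspanE)
  then show ?thesis
    by (intro bspanI[of _ "\<lambda>i. c i + d i"]) (force simp: sum.distrib smult_add_left)+
qed

lemma smult_sum_right: "smult a (\<Sum>i\<in>I. f i) = (\<Sum>i\<in>I. smult a (f i))"
  by (induction I rule: infinite_finite_induct) (auto simp: smult_add_right)

lemma bspan_smult:
  assumes "p \<in> bspan C I q" "\<bar>a\<bar> \<le> A" "0 \<le> C"
  shows "smult a p \<in> bspan (A * C) I q"
proof -
  obtain c where "\<And>i. i \<in> I \<Longrightarrow> \<bar>c i\<bar> \<le> C" "p = (\<Sum>i\<in>I. smult (c i) (q i))"
    using assms(1) by (auto elim!: bspanE)
  then show ?thesis
    using assms by (intro bspanI[of _ "\<lambda>i. a * c i"]) (auto simp: abs_mult smult_sum_right intro!: mult_mono)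
qed

lemma bspan_mult:
  assumes "p \<in> bspan C I q"
  shows "u * p \<in> bspan C I (\<lambda>i. u * q i)"
proof -
  obtain c where "\<And>i. i \<in> I \<Longrightarrow> \<bar>c i\<bar> \<le> C" "p = (\<Sum>i\<in>I. smult (c i) (q i))"
    using assms(1) by (auto elim!: bspanE)
  then show ?thesis
    by (intro bspanI[of _ c]) (auto simp: sum_distrib_left)
qed

lemma bspan_trans:
  fixes K B :: real
  assumes p: "p \<in> bspan K I q" and I: "finite I" and q: "\<And>i. i \<in> I \<Longrightarrow> q i \<in> bspan B J r" and "0 \<le> K" "0 \<le> B"
  shows "p \<in> bspan (card I * (K * B)) J r"
proof -
  obtain c where c: "\<And>i. i \<in> I \<Longrightarrow> \<bar>c i\<bar> \<le> K" "p = (\<Sum>i\<in>I. smult (c i) (q i))"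
    using p by (auto elim!: bspanE)
  have "(\<Sum>i\<in>I'. smult (c i) (q i)) \<in> bspan (card I' * (K * B)) J r" if "I' \<subseteq> I" for I'
    using finite_subset[OF that I] that
  proof (induction I' rule: finite_induct)
    case (insert i I')
    have "smult (c i) (q i) \<in> bspan (K * B) J r"
      using insert c q assms by (intro bspan_smult) auto
    then show ?case
      using bspan_add[of "smult (c i) (q i)" "K * B" J r "\<Sum>i\<in>I'. smult (c i) (q i)" "card I' * (K * B)"] insert
      by (simp add: algebra_simps)
  qed (simp add: bspan_zero)
  then show ?thesis using c(2) by blast
qed

text \<open>\<open>p\<close> is the dehomogenisation, at \<open>N\<close>, of a form of degree \<open>m\<close> with coefficients bounded by \<open>C\<close>.\<close>

definition bounded_coeffs :: "real \<Rightarrow> nat \<Rightarrow> real \<Rightarrow> real poly \<Rightarrow> bool" where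
  "bounded_coeffs N m C p \<longleftrightarrow> degree p \<le> m \<and> (\<forall>i\<le>m. \<bar>coeff p i\<bar> \<le> C * N ^ (m - i))"

text \<open>Coefficient i of the product is a p_i + p_(i-1). The first summand is at most C A
  N^(m+1-i), the second at most C N^(m+1-i).\<close>

lemma bounded_coeffs_linear:
  assumes p: "bounded_coeffs N m C p" and a: "\<bar>a\<bar> \<le> A * N" and N: "1 \<le> N" "0 \<le> C" "0 \<le> A"
  shows "bounded_coeffs N (Suc m) (C * (A + 1)) ([:a, 1:] * p)"
  unfolding bounded_coeffs_def
proof (intro conjI allI impI)
  show "degree ([:a, 1:] * p) \<le> Suc m"
    using p degree_mult_le[of "[:a, 1:]" p] by (simp add: bounded_coeffs_def)
  fix i assume i: "i \<le> Suc m"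
  have cp: "\<bar>coeff p k\<bar> \<le> C * N ^ (m - k)" if "k \<le> m" for k using p that by (simp add: bounded_coeffs_def)
  have c: "coeff ([:a, 1:] * p) i = a * coeff p i + (case i of 0 \<Rightarrow> 0 | Suc k \<Rightarrow> coeff p k)"
    by (simp add: coeff_pCons)
  have 1: "\<bar>a * coeff p i\<bar> \<le> C * A * N ^ (Suc m - i)"
  proof (cases "i \<le> m")
    case True
    have "\<bar>a * coeff p i\<bar> \<le> (A * N) * (C * N ^ (m - i))"
      unfolding abs_mult using a cp[OF True] N by (intro mult_mono) auto
    then show ?thesis using True by (simp add: Suc_diff_le mult_ac)
  next
    case False
    then have "coeff p i = 0" using p by (intro coeff_eq_0) (auto simp: bounded_coeffs_def)
    then show ?thesis using N by simp
  qed
  have 2: "\<bar>case i of 0 \<Rightarrow> 0 | Suc k \<Rightarrow> coeff p k\<bar> \<le> C * N ^ (Suc m - i)"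
    using cp i N by (cases i) auto
  show "\<bar>coeff ([:a, 1:] * p) i\<bar> \<le> C * (A + 1) * N ^ (Suc m - i)"
    unfolding c using 1 2 by (simp add: algebra_simps)
qed

lemma bounded_coeffs_prod:
  assumes "finite I" "\<And>i. i \<in> I \<Longrightarrow> \<bar>a i\<bar> \<le> A * N" "1 \<le> N" "0 \<le> A"
  shows "bounded_coeffs N (card I) ((A + 1) ^ card I) (\<Prod>i\<in>I. [:a i, 1:])"
  using assms(1,2)
proof (induction I rule: finite_induct)
  case empty
  then show ?case by (simp add: bounded_coeffs_def)
next
  case (insert i I)
  then show ?case
    using bounded_coeffs_linear[of N "card I" "(A + 1) ^ card I" "\<Prod>i\<in>I. [:a i, 1:]" "a i" A] assms(3,4)
    by (simp add: mult.commute)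
qed

text \<open>A scalar of size N^l counts as l degrees of the form; surplus degrees are harmless
  because N >= 1.\<close>

lemma bounded_coeffs_smult_power:
  assumes "bounded_coeffs N m C p" "\<bar>a\<bar> \<le> N ^ l" "m + l \<le> m'" "1 \<le> N" "0 \<le> C"
  shows "bounded_coeffs N m' C (smult a p)"
  unfolding bounded_coeffs_def
proof (intro conjI allI impI)
  show "degree (smult a p) \<le> m'" using assms by (auto simp: bounded_coeffs_def)
  fix i
  show "\<bar>coeff (smult a p) i\<bar> \<le> C * N ^ (m' - i)"
  proof (cases "i \<le> m")
    case True
    have "\<bar>a * coeff p i\<bar> \<le> N ^ l * (C * N ^ (m - i))"
      unfolding abs_mult using assms True by (intro mult_mono) (auto simp: bounded_coeffs_def)
    also have "\<dots> = C * N ^ (l + (m - i))" by (simp add: power_add)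
    also have "\<dots> \<le> C * N ^ (m' - i)" using assms True by (intro mult_left_mono power_increasing) auto
    finally show ?thesis by simp
  next
    case False
    then have "coeff p i = 0" using assms(1) by (intro coeff_eq_0) (auto simp: bounded_coeffs_def)
    then show ?thesis using assms by simp
  qed
qed

lemma bounded_coeffs_mono: "bounded_coeffs N m C p \<Longrightarrow> C \<le> D \<Longrightarrow> 0 \<le> N \<Longrightarrow> bounded_coeffs N m D p"
  unfolding bounded_coeffs_def by (meson mult_right_mono order_trans zero_le_power)

text \<open>With \<open>s = r \<partial>\<^sub>r\<close>, the operator \<open>(\<partial>\<^sub>x + \<i> \<partial>\<^sub>y)\<^sup>a (\<partial>\<^sub>x - \<i> \<partial>\<^sub>y)\<^sup>b\<close> sends \<open>e\<^sup>i\<^sup>k\<^sup>\<theta> w\<close> to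
  \<open>e\<^bsup>i(k + a - b)\<theta>\<^esup> r\<^bsup>-(a + b)\<^esup> p(s) w\<close>, where \<open>p\<close> is this polynomial.\<close>

definition cart_poly :: "real \<Rightarrow> nat \<Rightarrow> nat \<Rightarrow> real poly" where
  "cart_poly k a b = (\<Prod>i<a. [:- (k + 2 * real i), 1:]) * (\<Prod>i<b. [:k - 2 * real i, 1:])"

text \<open>Complex conjugation exchanges the two families of factors. This reduces the comparison
  to k >= 0.\<close>

lemma cart_poly_uminus: "cart_poly (- k) a b = cart_poly k b a"
  by (simp add: cart_poly_def mult.commute algebra_simps)

text \<open>The terms of total order j, where (n/r)^l counts l and (1/r d_r)^l r^(-n) counts n + 2
  l. With t = (j + 1 - n) div 2 there are j - t + 1 of them, which is the dimension of the space
  left after division by the common zeros.\<close>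

definition rad_index :: "nat \<Rightarrow> nat \<Rightarrow> (nat + nat) set" where
  "rad_index n j = Inl ` {..min n j} \<union> Inr ` {l. 1 \<le> l \<and> n + 2 * l \<le> j}"

text \<open>\<open>r\<^bsup>-j\<^esup> p(r \<partial>\<^sub>r) w\<close> with \<open>p = rad_poly n j (Inl l)\<close> is \<open>\<partial>\<^sub>r\<^bsup>j - l\<^esup> (n / r)\<^sup>l w\<close>, and with \<open>p = rad_poly n j (Inr l)\<close> it is
  \<open>\<partial>\<^sub>r\<^bsup>j - n - 2 l\<^esup> (r\<^bsup>-1\<^esup> \<partial>\<^sub>r)\<^sup>l r\<^bsup>-n\<^esup> w\<close>.\<close>

definition rad_poly :: "nat \<Rightarrow> nat \<Rightarrow> nat + nat \<Rightarrow> real poly" where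
  "rad_poly n j x = (case x of
      Inl l \<Rightarrow> smult (real n ^ l) (\<Prod>i=l..<j. [:- real i, 1:])
    | Inr l \<Rightarrow> (\<Prod>i<l. [:- real (n + 2 * i), 1:]) * (\<Prod>i=n+2*l..<j. [:- real i, 1:]))"

lemma finite_rad_index: "finite (rad_index n j)"
proof -
  have "{l. 1 \<le> l \<and> n + 2 * l \<le> j} \<subseteq> {..j}" by auto
  then show ?thesis unfolding rad_index_def by (auto intro: finite_subset)
qed

lemma card_rad_index: "card (rad_index n j) \<le> 2 * (j + 1)"
proof -
  have "{l. 1 \<le> l \<and> n + 2 * l \<le> j} \<subseteq> {..j}" by auto
  then have "card {l. 1 \<le> l \<and> n + 2 * l \<le> j} \<le> j + 1" using card_mono[of "{..j}"] by auto
  then have "card (Inl ` {..min n j} :: (nat + nat) set) + card (Inr ` {l. 1 \<le> l \<and> n + 2 * l \<le> j} :: (nat + nat) set) \<le> 2 * (j + 1)"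
    by (simp add: card_image)
  then show ?thesis unfolding rad_index_def using card_Un_le order_trans by blast
qed

text \<open>The common divisor of both families in degree \<open>j\<close>, for \<open>t = (j + 1 - n) div 2\<close>. The quotients span, with bounded
  coefficients, all polynomials of the remaining degree.\<close>

definition root_poly :: "nat \<Rightarrow> nat \<Rightarrow> real poly" where
  "root_poly n t = (\<Prod>i<t. [:- real (n + 2 * i), 1:])"

context
  fixes j n t :: nat and N :: real
  defines "t \<equiv> (j + 1 - n) div 2" and "N \<equiv> real n + 1"
begin

lemma t_le: "t \<le> j" unfolding t_def by linarith
lemma N_ge: "1 \<le> N" by (simp add: N_def)

section \<open>Factoring the common zeros out of both families\<close>

lemma prod_split:
  assumes "finite I" "J \<subseteq> I"
  shows "(\<Prod>i\<in>I. f i) = (\<Prod>i\<in>J. f i) * (\<Prod>i\<in>I - J. f i :: real poly)"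
  using assms by (metis mult.commute prod.subset_diff)

text \<open>The first product vanishes at n, n + 2, ..., n + 2(a-1), the second at 2i - n for i < j
  - a. Together they supply all of n, ..., n + 2(t-1). Every root is at most 2j + n, hence at most
  (2j + 1) N, in modulus, which bounds the quotient.\<close>

lemma cart_poly_factor:
  assumes "a \<le> j"
  shows "\<exists>p. cart_poly n a (j - a) = root_poly n t * p \<and> bounded_coeffs N (j - t) ((2 * real j + 2) ^ (j - t)) p"
proof -
  define A where "A = 2 * real j + 1"
  have A: "0 \<le> A" "2 * real j + 2 = A + 1" by (auto simp: A_def)
  have AN: "x \<le> A * N" if "x \<le> 2 * real j + real n" for x
  proof -
    have "0 \<le> real j * real n" by simp
    moreover have "A * N = 2 * (real j * real n) + 2 * real j + real n + 1" by (simp add: A_def N_def algebra_simps)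
    ultimately show ?thesis using that by linarith
  qed
  show ?thesis
  proof (cases "t \<le> a")
    case True
    have 1: "(\<Prod>i<a. [:- (real n + 2 * real i), 1:]) = root_poly n t * (\<Prod>i\<in>{..<a} - {..<t}. [:- (real n + 2 * real i), 1:])"
      unfolding root_poly_def using True by (subst prod_split[of _ "{..<t}"]) (auto simp: algebra_simps)
    have "bounded_coeffs N (card ({t..<a} <+> {..<j - a})) ((A + 1) ^ card ({t..<a} <+> {..<j - a}))
       (\<Prod>x\<in>{t..<a} <+> {..<j - a}. [:case x of Inl i \<Rightarrow> - (real n + 2 * real i) | Inr i \<Rightarrow> real n - 2 * real i, 1:])"
      using assms A(1) N_ge by (intro bounded_coeffs_prod) (auto intro!: AN simp: abs_le_iff)
    moreover have "card ({t..<a} <+> {..<j - a}) = j - t"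
      using True assms by (simp add: card_Plus)
    moreover have "(\<Prod>x\<in>{t..<a} <+> {..<j - a}. [:case x of Inl i \<Rightarrow> - (real n + 2 * real i) | Inr i \<Rightarrow> real n - 2 * real i, 1:])
      = (\<Prod>i\<in>{..<a} - {..<t}. [:- (real n + 2 * real i), 1:]) * (\<Prod>i<j - a. [:real n - 2 * real i, 1:])"
    proof -
      have "{..<a} - {..<t} = {t..<a}" by auto
      then show ?thesis by (subst prod.Plus) auto
    qed
    ultimately have "bounded_coeffs N (j - t) ((A + 1) ^ (j - t))
      ((\<Prod>i\<in>{..<a} - {..<t}. [:- (real n + 2 * real i), 1:]) * (\<Prod>i<j - a. [:real n - 2 * real i, 1:]))"
      by (simp only:)
    then show ?thesis
      unfolding A(2) by (intro exI conjI) (simp_all only: cart_poly_def 1 mult.assoc)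
  next
    case False
    \<comment> \<open>The factors of the second product with zeros n + 2a, ..., n + 2(t-1). They are
      present because a < t and 2t <= j + 1 - n give n + t <= j - a.\<close>
    define S where "S = {n + a..<n + t}"
    have S: "S \<subseteq> {..<j - a}" using False assms unfolding S_def t_def by auto
    have "(\<Prod>i\<in>S. [:real n - 2 * real i, 1:]) = (\<Prod>i\<in>{a..<t}. [:- real (n + 2 * i), 1:])"
      unfolding S_def by (rule prod.reindex_bij_witness[of _ "\<lambda>i. i + n" "\<lambda>i. i - n"]) auto
    moreover have "(\<Prod>i<a. [:- real (n + 2 * i), 1:]) * (\<Prod>i\<in>{a..<t}. [:- real (n + 2 * i), 1:]) = root_poly n t"
    proof -
      have "{..<t} - {..<a} = {a..<t}" by auto
      then show ?thesis unfolding root_poly_def using False by (subst prod_split[of "{..<t}" "{..<a}"]) auto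
    qed
    ultimately have "cart_poly n a (j - a) = root_poly n t * (\<Prod>i\<in>{..<j - a} - S. [:real n - 2 * real i, 1:])"
      unfolding cart_poly_def by (subst prod_split[OF _ S]) (auto simp: mult.assoc[symmetric])
    moreover have "card ({..<j - a} - S) = j - t"
      using False assms S by (subst card_Diff_subset) (auto simp: S_def)
    moreover have "bounded_coeffs N (card ({..<j - a} - S)) ((A + 1) ^ card ({..<j - a} - S)) (\<Prod>i\<in>{..<j - a} - S. [:real n - 2 * real i, 1:])"
      using assms A(1) N_ge by (intro bounded_coeffs_prod) (auto intro!: AN simp: abs_le_iff)
    ultimately show ?thesis unfolding A(2) by auto
  qed
qed

lemma rad_poly_factor:
  assumes "finite I" "(\<lambda>i. n + 2 * i) ` {..<t} \<subseteq> I" "\<And>i. i \<in> I \<Longrightarrow> i \<le> j"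
  shows "\<exists>p. (\<Prod>i\<in>I. [:- real i, 1:]) = root_poly n t * p \<and> lead_coeff p = 1 \<and> degree p = card I - t
    \<and> bounded_coeffs N (card I - t) ((real j + 1) ^ (card I - t)) p"
proof (intro exI[of _ "\<Prod>i\<in>I - (\<lambda>i. n + 2 * i) ` {..<t}. [:- real i, 1:]"] conjI)
  let ?J = "I - (\<lambda>i. n + 2 * i) ` {..<t}"
  have r: "root_poly n t = (\<Prod>i\<in>(\<lambda>i. n + 2 * i) ` {..<t}. [:- real i, 1:])"
    unfolding root_poly_def by (subst prod.reindex) (auto simp: inj_on_def)
  show "(\<Prod>i\<in>I. [:- real i, 1:]) = root_poly n t * (\<Prod>i\<in>?J. [:- real i, 1:])"
    unfolding r by (rule prod_split[OF assms(1,2)])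
  have c: "card ?J = card I - t"
    using assms by (subst card_Diff_subset) (auto simp: card_image inj_on_def)
  show "lead_coeff (\<Prod>i\<in>?J. [:- real i, 1:]) = 1" by (simp add: lead_coeff_prod)
  show "degree (\<Prod>i\<in>?J. [:- real i, 1:]) = card I - t"
    unfolding c[symmetric] by (subst degree_prod_eq_sum_degree) auto
  have jN: "real i \<le> real j * N" if "i \<in> I" for i
  proof -
    have "real i \<le> real j" using assms(3)[OF that] by simp
    also have "\<dots> \<le> real j * N" using N_ge by (simp add: mult_le_cancel_left1)
    finally show ?thesis .
  qed
  show "bounded_coeffs N (card I - t) ((real j + 1) ^ (card I - t)) (\<Prod>i\<in>?J. [:- real i, 1:])"
    unfolding c[symmetric] using assms N_ge jN by (intro bounded_coeffs_prod) auto
qed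

text \<open>The zeros are n, n + 2, ..., n + 2(l-1) followed by all integers from n + 2l up to j -
  1, without repetition. So every n + 2i below j is among them, whatever l is.\<close>

lemma rad_poly_set:
  "(\<Prod>i<l. [:- real (n + 2 * i), 1:]) * (\<Prod>i=n+2*l..<j. [:- real i, 1:])
     = (\<Prod>i\<in>(\<lambda>i. n + 2 * i) ` {..<l} \<union> {n+2*l..<j}. [:- real i, 1:])"
  by (subst prod.union_disjoint) (auto simp: prod.reindex inj_on_def)

text \<open>The scalar n^l makes up for the degrees missing in \<open>p\<close>, so that every
  radial quotient is a form of degree at most j - t, like the Cartesian ones.\<close>

lemma rad_poly_cases:
  assumes "x \<in> rad_index n j"
  shows "\<exists>p l. rad_poly n j x = root_poly n t * smult (real n ^ l) p \<and> l + degree p \<le> j - t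
    \<and> bounded_coeffs N (degree p) ((real j + 1) ^ j) p"
proof -
  have C: "(real j + 1) ^ k \<le> (real j + 1) ^ j" if "k \<le> j" for k using that by (intro power_increasing) auto
  show ?thesis
  proof (cases x)
    case (Inl l)
    then have l: "l \<le> n" "l \<le> j" using assms by (auto simp: rad_index_def)
    have "(\<lambda>i. n + 2 * i) ` {..<t} \<subseteq> {l..<j}" using l unfolding t_def by auto
    then obtain p where p: "(\<Prod>i=l..<j. [:- real i, 1:]) = root_poly n t * p"
      "degree p = j - l - t" "bounded_coeffs N (j - l - t) ((real j + 1) ^ (j - l - t)) p"
      using rad_poly_factor[of "{l..<j}"] unfolding card_atLeastLessThan by auto
    have "card ((\<lambda>i. n + 2 * i) ` {..<t}) \<le> card {l..<j}"
      using \<open>_ \<subseteq> {l..<j}\<close> by (intro card_mono) auto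
    then have "l + t \<le> j" using l by (simp add: card_image inj_on_def)
    then show ?thesis
      using p l C[of "j - l - t"] N_ge bounded_coeffs_mono[OF p(3), of "(real j + 1) ^ j"]
      by (intro exI[of _ p] exI[of _ l]) (auto simp: Inl rad_poly_def)
  next
    case (Inr l)
    then have l: "1 \<le> l" "n + 2 * l \<le> j" using assms by (auto simp: rad_index_def)
    define I where "I = (\<lambda>i. n + 2 * i) ` {..<l} \<union> {n+2*l..<j}"
    have lt: "l \<le> t" "2 * t \<le> j + 1 - n" using l unfolding t_def by auto
    have sub: "(\<lambda>i. n + 2 * i) ` {..<t} \<subseteq> I"
    proof
      fix y assume "y \<in> (\<lambda>i. n + 2 * i) ` {..<t}"
      then obtain i where i: "i < t" "y = n + 2 * i" by auto
      show "y \<in> I" using i lt by (cases "i < l") (auto simp: I_def)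
    qed
    have "card I = l + (j - (n + 2 * l))"
      unfolding I_def by (subst card_Un_disjoint) (auto simp: card_image inj_on_def)
    then have ci: "card I = j - n - l" using l by simp
    have "finite I" "\<And>i. i \<in> I \<Longrightarrow> i \<le> j" using l by (auto simp: I_def)
    from rad_poly_factor[OF this(1) sub this(2)] obtain p where p: "(\<Prod>i\<in>I. [:- real i, 1:]) = root_poly n t * p"
      "degree p = card I - t" "bounded_coeffs N (card I - t) ((real j + 1) ^ (card I - t)) p" by blast
    have Ieq: "rad_poly n j x = root_poly n t * p"
      using p(1) rad_poly_set[of l] by (simp only: Inr rad_poly_def sum.case I_def)
    show ?thesis
      using p l C[of "card I - t"] ci N_ge bounded_coeffs_mono[OF p(3), of "(real j + 1) ^ j"]
      by (intro exI[of _ p] exI[of _ 0]) (auto simp: Ieq)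
  qed
qed

text \<open>With l = j - t - d, the radial term whose quotient has degree d is \<open>Inl l\<close>
  while l <= n, and \<open>Inr (l - n)\<close> beyond. Its leading coefficient \<open>u\<close> is
  n^l in the one case and 1 in the other; both are comparable with N^l from below, which elimination
  by degree requires.\<close>

lemma rad_poly_of_degree:
  assumes "d \<le> j - t"
  shows "\<exists>x\<in>rad_index n j. \<exists>p u. rad_poly n j x = root_poly n t * smult u p \<and> lead_coeff p = 1 \<and> degree p = d
    \<and> bounded_coeffs N d ((real j + 1) ^ j) p \<and> 0 < u \<and> N ^ (j - t - d) \<le> (2 * real j + 2) ^ j * u"
proof -
  have C: "(real j + 1) ^ k \<le> (real j + 1) ^ j" if "k \<le> j" for k using that by (intro power_increasing) auto
  define l where "l = j - t - d"
  show ?thesis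
  proof (cases "l \<le> n")
    case True
    have l: "l \<le> j" by (simp add: l_def)
    have "(\<lambda>i. n + 2 * i) ` {..<t} \<subseteq> {l..<j}" using l True unfolding t_def by auto
    then obtain p where p: "(\<Prod>i=l..<j. [:- real i, 1:]) = root_poly n t * p"
      "degree p = j - l - t" "lead_coeff p = 1" "bounded_coeffs N (j - l - t) ((real j + 1) ^ (j - l - t)) p"
    proof -
      assume *: "(\<lambda>i. n + 2 * i) ` {..<t} \<subseteq> {l..<j}"
      have "finite {l..<j}" "\<And>i. i \<in> {l..<j} \<Longrightarrow> i \<le> j" by auto
      from rad_poly_factor[OF this(1) * this(2)] that show thesis unfolding card_atLeastLessThan by blast
    qed
    have d: "j - l - t = d" using assms t_le by (simp add: l_def)
    have u: "0 < real n ^ l" using True by (cases "n = 0") auto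
    \<comment> \<open>For n >= 1 one has N <= 2n. For n = 0 the case assumption l <= n leaves only l
      = 0, where 0^0 = 1.\<close>
    have "N ^ l \<le> 2 ^ l * real n ^ l"
    proof (cases "n = 0")
      case False
      then show ?thesis unfolding power_mult_distrib[symmetric] by (intro power_mono) (auto simp: N_def)
    qed (use True in simp)
    also have "\<dots> \<le> (2 * real j + 2) ^ j * real n ^ l"
    proof (rule mult_right_mono)
      have "2 ^ l \<le> (2 * real j + 2) ^ l" by (intro power_mono) auto
      also have "\<dots> \<le> (2 * real j + 2) ^ j" using l by (intro power_increasing) auto
      finally show "2 ^ l \<le> (2 * real j + 2) ^ j" .
    qed simp
    finally have "N ^ (j - t - d) \<le> (2 * real j + 2) ^ j * real n ^ l" by (simp add: l_def)
    moreover have "Inl l \<in> rad_index n j" using True l by (auto simp: rad_index_def)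
    moreover have "bounded_coeffs N d ((real j + 1) ^ j) p"
      using p(4) C[of d] assms N_ge unfolding d by (intro bounded_coeffs_mono[OF p(4)[unfolded d]]) auto
    ultimately show ?thesis
      using p u d by (intro bexI[of _ "Inl l"] exI[of _ p] exI[of _ "real n ^ l"]) (auto simp: rad_poly_def)
  next
    case False
    define l' where "l' = l - n"
    have l: "1 \<le> l'" "n + 2 * l' \<le> j" using False unfolding l'_def l_def t_def by auto
    define I where "I = (\<lambda>i. n + 2 * i) ` {..<l'} \<union> {n+2*l'..<j}"
    have lt: "l' \<le> t" "2 * t \<le> j + 1 - n" using l unfolding t_def by auto
    have sub: "(\<lambda>i. n + 2 * i) ` {..<t} \<subseteq> I"
    proof
      fix y assume "y \<in> (\<lambda>i. n + 2 * i) ` {..<t}"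
      then obtain i where i: "i < t" "y = n + 2 * i" by auto
      show "y \<in> I" using i lt by (cases "i < l'") (auto simp: I_def)
    qed
    have "card I = l' + (j - (n + 2 * l'))"
      unfolding I_def by (subst card_Un_disjoint) (auto simp: card_image inj_on_def)
    then have ci: "card I - t = d" using l False assms by (simp add: l'_def l_def)
    have "finite I" "\<And>i. i \<in> I \<Longrightarrow> i \<le> j" using l by (auto simp: I_def)
    from rad_poly_factor[OF this(1) sub this(2)] obtain p where p: "(\<Prod>i\<in>I. [:- real i, 1:]) = root_poly n t * p"
      "degree p = d" "lead_coeff p = 1" "bounded_coeffs N d ((real j + 1) ^ d) p" unfolding ci by blast
    \<comment> \<open>Here n < l <= j, so N^l is bounded in terms of j alone, and \<open>u\<close> =
      1 is large enough.\<close>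
    have "N ^ l \<le> (2 * real j + 2) ^ l" using l by (intro power_mono) (auto simp: N_def)
    also have "\<dots> \<le> (2 * real j + 2) ^ j" by (intro power_increasing) (auto simp: l_def)
    finally have "N ^ (j - t - d) \<le> (2 * real j + 2) ^ j * 1" by (simp add: l_def)
    moreover have "Inr l' \<in> rad_index n j" using l by (auto simp: rad_index_def)
    moreover have "bounded_coeffs N d ((real j + 1) ^ j) p"
      using C[of d] assms N_ge by (intro bounded_coeffs_mono[OF p(4)]) auto
    moreover have Ieq: "rad_poly n j (Inr l') = root_poly n t * p"
      using p(1) rad_poly_set[of l'] by (simp only: rad_poly_def sum.case I_def)
    ultimately show ?thesis
      using p by (intro bexI[of _ "Inr l'"] exI[of _ p] exI[of _ 1]) (auto simp: Ieq)
  qed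
qed

section \<open>The Cartesian quotients span with bounded coefficients\<close>

lemma bounded_coeffs_pCons:
  assumes "bounded_coeffs N (Suc m) C p"
  obtains c q where "p = pCons c q" "\<bar>c\<bar> \<le> C * N ^ Suc m" "bounded_coeffs N m C q"
proof -
  obtain c q where p: "p = pCons c q" by (cases p)
  have "degree q \<le> m" using assms by (auto simp: p bounded_coeffs_def split: if_splits)
  moreover have "\<bar>coeff q i\<bar> \<le> C * N ^ (m - i)" if "i \<le> m" for i
    using assms that unfolding bounded_coeffs_def p by (auto dest: spec[of _ "Suc i"])
  moreover have "\<bar>c\<bar> \<le> C * N ^ Suc m"
    using assms unfolding bounded_coeffs_def p by (auto dest: spec[of _ 0])
  ultimately show ?thesis using that p by (auto simp: bounded_coeffs_def)
qed

definition red_poly :: "nat \<Rightarrow> nat \<Rightarrow> real poly" where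
  "red_poly a b = (\<Prod>i<a. [:- (real n + 2 * real t + 2 * real i), 1:]) * (\<Prod>i<b. [:real n - 2 * real i, 1:])"

text \<open>\<open>red_poly a b\<close> is the quotient of \<open>cart_poly n (t + a) b\<close> by
  the common zeros. Its two extensions by one linear factor differ by D = 2(n + t + a - b) times
  itself. As D is at least N up to a factor in j, N times the polynomial lies in the next span; the
  product with s follows by adding back the zero \<open>E\<close> = O(N). This gap is the source of
  the uniformity in n.\<close>

lemma red_poly_step:
  assumes "a \<le> m" "Suc m \<le> j - t"
  shows "smult N (red_poly a (m - a)) \<in> bspan (2 * real j + 2) {..Suc m} (\<lambda>a. red_poly a (Suc m - a))"
    and "[:0, 1:] * red_poly a (m - a) \<in> bspan ((2 * real j + 2) * (2 * real j + 2)) {..Suc m} (\<lambda>a. red_poly a (Suc m - a))"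
proof -
  let ?b = "m - a" and ?S = "\<lambda>C. bspan C {..Suc m} (\<lambda>a. red_poly a (Suc m - a))"
  have b: "Suc m - Suc a = ?b" "Suc m - a = Suc ?b" using assms by auto
  define R where "R = red_poly a ?b"
  have R1: "red_poly (Suc a) ?b = [:- (real n + 2 * real t + 2 * real a), 1:] * R"
    by (simp add: red_poly_def R_def mult_ac del: mult_pCons_left mult_pCons_right)
  have R2: "red_poly a (Suc ?b) = [:real n - 2 * real ?b, 1:] * R"
    by (simp add: red_poly_def R_def mult_ac del: mult_pCons_left mult_pCons_right)
  define D where "D = 2 * (real n + real t + real a - real ?b)"
  \<comment> \<open>The choice of t enters here: b + t < j <= n + 2t yields D >= 2, so the two new
    factors never coincide. For j <= n one has t = 0, and D must moreover be seen to grow with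
    n.\<close>
  have t2: "j \<le> n + 2 * t" "n + 1 \<le> j \<or> (t = 0 \<and> j \<le> n)" unfolding t_def by linarith+
  have bt: "real ?b + real t + 1 \<le> real j" using assms by linarith
  have "real j \<le> real n + 2 * real t" using of_nat_mono[OF t2(1), where 'a = real] by simp
  then have "real ?b + 1 \<le> real n + real t + real a" using bt of_nat_0_le_iff[of a] by (smt (verit))
  then have D1: "D \<ge> 2" unfolding D_def by (simp add: field_simps)
  have ND: "N \<le> (real j + 1) * D"
  proof (cases "n + 1 \<le> j")
    case True
    then have "N \<le> (real j + 1) * 1" by (simp add: N_def)
    also have "\<dots> \<le> (real j + 1) * D" using D1 by (intro mult_left_mono) auto
    finally show ?thesis .
  next
    case False
    then have t0: "t = 0" "j \<le> n" using t2 by auto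
    have "real n - real j + 1 \<le> D" using bt t0 by (simp add: D_def)
    then have "(real j + 1) * (real n - real j + 1) \<le> (real j + 1) * D" by (intro mult_left_mono) auto
    \<comment> \<open>(j + 1)(n - j + 1) = j(n - j) + n + 1, which is at least N.\<close>
    moreover have "0 \<le> real j * (real n - real j)" using t0 by simp
    ultimately show ?thesis by (simp add: N_def algebra_simps)
  qed
  have e1: "red_poly (Suc a) ?b \<in> ?S 1" "red_poly a (Suc ?b) \<in> ?S 1"
    using bspan_elem[of "{..Suc m}" "Suc a" "\<lambda>a. red_poly a (Suc m - a)"]
      bspan_elem[of "{..Suc m}" a "\<lambda>a. red_poly a (Suc m - a)"] assms b by auto
  have diff: "smult D R = red_poly a (Suc ?b) + smult (-1) (red_poly (Suc a) ?b)"
    unfolding R1 R2 D_def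
    by (rule poly_eqI) (simp add: coeff_pCons algebra_simps split: nat.split)
  have "smult D R \<in> ?S (1 + 1 * 1)"
    unfolding diff by (intro bspan_add bspan_smult e1) auto
  then have "smult (N / D) (smult D R) \<in> ?S ((real j + 1) * 2)"
    using bspan_smult[of "smult D R" 2 "{..Suc m}" _ "N / D" "real j + 1"] D1 ND N_ge by (simp add: divide_le_eq)
  then show N: "smult N (red_poly a (m - a)) \<in> bspan (2 * real j + 2) {..Suc m} (\<lambda>a. red_poly a (Suc m - a))"
    using D1 by (simp add: R_def algebra_simps)
  define E where "E = real n + 2 * real t + 2 * real a"
  have "E \<le> (2 * real j + 1) * N"
  proof -
    have "real t + real a \<le> real j" using assms by linarith
    moreover have "0 \<le> real j * real n" by simp
    moreover have "(2 * real j + 1) * N = 2 * (real j * real n) + 2 * real j + real n + 1"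
      by (simp add: N_def algebra_simps)
    ultimately show ?thesis unfolding E_def by linarith
  qed
  then have EN: "\<bar>E / N\<bar> \<le> 2 * real j + 1" using N_ge by (simp add: E_def divide_le_eq)
  have "[:0, 1:] * R = red_poly (Suc a) ?b + smult (E / N) (smult N R)"
    unfolding R1 E_def[symmetric] using N_ge
    by (intro poly_eqI) (simp add: coeff_pCons algebra_simps split: nat.split)
  also have "\<dots> \<in> ?S (1 + (2 * real j + 1) * (2 * real j + 2))"
    by (rule bspan_add[OF e1(1) bspan_smult[OF N[folded R_def] EN]]) simp
  finally show "[:0, 1:] * red_poly a (m - a) \<in> bspan ((2 * real j + 2) * (2 * real j + 2)) {..Suc m} (\<lambda>a. red_poly a (Suc m - a))"
    unfolding R_def by (rule bspan_mono) (simp add: algebra_simps)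
qed

text \<open>A homogeneous Horner scheme: a form of degree m + 1 is N (c/N) + s q, where c/N and q
  are forms of degree m, and \<open>red_poly_step\<close> lifts multiplication by N and by s. One
  step costs a factor (m + 1)((2j + 2) + (2j + 2)^2), which is at most (m + 1)(2j + 3)^3.\<close>

lemma bounded_coeffs_in_red_span:
  assumes "m \<le> j - t" "bounded_coeffs N m C p" "0 \<le> C"
  shows "p \<in> bspan (C * (\<Prod>i<m. real (Suc i) * (2 * real j + 3) ^ 3)) {..m} (\<lambda>a. red_poly a (m - a))"
  using assms
proof (induction m arbitrary: p)
  case 0
  then obtain c where "p = [:c:]" "\<bar>c\<bar> \<le> C"
    unfolding bounded_coeffs_def by (metis coeff_pCons_0 degree_0_id diff_self_eq_0 le_refl le_zero_eq mult.right_neutral power_0)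
  then show ?case by (intro bspanI[of _ "\<lambda>_. c"]) (auto simp: red_poly_def)
next
  case (Suc m)
  let ?K = "\<Prod>i<m. real (Suc i) * (2 * real j + 3) ^ 3"
  let ?S = "\<lambda>C. bspan C {..Suc m} (\<lambda>a. red_poly a (Suc m - a))"
  let ?B = "2 * real j + 2"
  have K: "0 \<le> C * ?K" using Suc.prems by (intro mult_nonneg_nonneg prod_nonneg) auto
  obtain c q where p: "p = pCons c q" "\<bar>c\<bar> \<le> C * N ^ Suc m" "bounded_coeffs N m C q"
    using bounded_coeffs_pCons[OF Suc.prems(2)] by metis
  have cN: "\<bar>c\<bar> / N \<le> C * N ^ m" using p(2) N_ge by (simp add: divide_le_eq mult_ac)
  have "bounded_coeffs N m C [:c / N:]"
    using cN N_ge Suc.prems(3) by (auto simp: bounded_coeffs_def coeff_pCons split: nat.split)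
  then have c: "[:c / N:] \<in> bspan (C * ?K) {..m} (\<lambda>a. red_poly a (m - a))"
    using Suc by simp
  have q: "q \<in> bspan (C * ?K) {..m} (\<lambda>a. red_poly a (m - a))" using Suc p(3) by simp
  have 1: "[:N:] * [:c / N:] \<in> ?S (card {..m} * (C * ?K * ?B))"
    using red_poly_step(1)[OF _ Suc.prems(1)] K by (intro bspan_trans[OF bspan_mult[OF c]]) auto
  have 2: "[:0, 1:] * q \<in> ?S (card {..m} * (C * ?K * (?B * ?B)))"
    using red_poly_step(2)[OF _ Suc.prems(1)] K by (intro bspan_trans[OF bspan_mult[OF q]]) auto
  have "p = [:N:] * [:c / N:] + [:0, 1:] * q" using N_ge by (simp add: p)
  also have "\<dots> \<in> ?S (card {..m} * (C * ?K * ?B) + card {..m} * (C * ?K * (?B * ?B)))"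
    by (rule bspan_add[OF 1 2])
  finally show ?case
  proof (rule bspan_mono)
    have "?B + ?B * ?B \<le> (2 * real j + 3) ^ 3"
      by (simp add: power3_eq_cube algebra_simps)
    then have "(real (Suc m) * (C * ?K)) * (?B + ?B * ?B) \<le> (real (Suc m) * (C * ?K)) * (2 * real j + 3) ^ 3"
      using K by (intro mult_left_mono) auto
    then show "card {..m} * (C * ?K * ?B) + card {..m} * (C * ?K * (?B * ?B)) \<le> C * (\<Prod>i<Suc m. real (Suc i) * (2 * real j + 3) ^ 3)"
      by (simp add: algebra_simps)
  qed
qed

lemma root_poly_red_poly:
  "root_poly n t * red_poly a b = cart_poly n (t + a) b"
proof -
  have "(\<Prod>i<t + a. [:- (real n + 2 * real i), 1:]) = root_poly n t * (\<Prod>i<a. [:- (real n + 2 * real t + 2 * real i), 1:])"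
    by (induction a) (simp_all add: root_poly_def algebra_simps del: mult_pCons_right mult_pCons_left)
  then show ?thesis by (simp add: red_poly_def cart_poly_def mult.assoc)
qed

text \<open>The polynomials \<open>cart_poly n a (j - a)\<close> with t <= a <= j suffice; the
  others receive the coefficient 0.\<close>

lemma root_poly_bounded_in_cart_span:
  assumes "bounded_coeffs N (j - t) C p" "0 \<le> C"
  shows "root_poly n t * p \<in> bspan (C * (real (Suc j) * (2 * real j + 3) ^ 3) ^ j) {..j} (\<lambda>a. cart_poly n a (j - a))"
proof -
  let ?K = "\<Prod>i<j - t. real (Suc i) * (2 * real j + 3) ^ 3"
  obtain c where c: "\<And>a. a \<in> {..j - t} \<Longrightarrow> \<bar>c a\<bar> \<le> C * ?K" "p = (\<Sum>a\<in>{..j - t}. smult (c a) (red_poly a (j - t - a)))"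
    using bounded_coeffs_in_red_span[OF order_refl assms] by (auto elim!: bspanE)
  have K: "0 \<le> ?K" "?K \<le> (real (Suc j) * (2 * real j + 3) ^ 3) ^ j"
  proof -
    show "0 \<le> ?K" by (intro prod_nonneg) auto
    have "?K \<le> (\<Prod>i<j - t. real (Suc j) * (2 * real j + 3) ^ 3)"
      by (intro prod_mono) (auto intro!: mult_right_mono)
    also have "\<dots> = (real (Suc j) * (2 * real j + 3) ^ 3) ^ (j - t)" by simp
    also have "\<dots> \<le> (real (Suc j) * (2 * real j + 3) ^ 3) ^ j"
    proof (rule power_increasing)
      have "1 * 1 \<le> real (Suc j) * (2 * real j + 3) ^ 3" by (intro mult_mono one_le_power) auto
      then show "1 \<le> real (Suc j) * (2 * real j + 3) ^ 3" by simp
    qed simp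
    finally show "?K \<le> (real (Suc j) * (2 * real j + 3) ^ 3) ^ j" .
  qed
  have "root_poly n t * p = (\<Sum>a\<in>{..j - t}. smult (c a) (cart_poly n (t + a) (j - (t + a))))"
    unfolding c(2) sum_distrib_left mult_smult_right root_poly_red_poly by (simp add: diff_diff_add)
  also have "\<dots> = (\<Sum>a\<in>{t..j}. smult (c (a - t)) (cart_poly n a (j - a)))"
    using t_le by (intro sum.reindex_bij_witness[of _ "\<lambda>a. a - t" "\<lambda>a. t + a"]) auto
  also have "\<dots> = (\<Sum>a\<in>{..j}. smult (if t \<le> a then c (a - t) else 0) (cart_poly n a (j - a)))"
    by (intro sum.mono_neutral_cong_left) auto
  finally have eq: "root_poly n t * p = (\<Sum>a\<in>{..j}. smult (if t \<le> a then c (a - t) else 0) (cart_poly n a (j - a)))" .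
  have Cle: "C * ?K \<le> C * (real (Suc j) * (2 * real j + 3) ^ 3) ^ j"
    using K assms(2) by (intro mult_left_mono) auto
  have "\<bar>if t \<le> a then c (a - t) else 0\<bar> \<le> C * (real (Suc j) * (2 * real j + 3) ^ 3) ^ j" if "a \<in> {..j}" for a
    using order_trans[OF c(1)[of "a - t"] Cle] that assms(2) by auto
  then show ?thesis by (rule bspanI[OF _ eq])
qed

lemma rad_poly_in_cart_span:
  assumes "x \<in> rad_index n j"
  shows "rad_poly n j x \<in> bspan ((real j + 1) ^ j * (real (Suc j) * (2 * real j + 3) ^ 3) ^ j) {..j} (\<lambda>a. cart_poly n a (j - a))"
proof -
  obtain p l where p: "rad_poly n j x = root_poly n t * smult (real n ^ l) p" "l + degree p \<le> j - t"
     "bounded_coeffs N (degree p) ((real j + 1) ^ j) p" using rad_poly_cases[OF assms] by metis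
  have "bounded_coeffs N (j - t) ((real j + 1) ^ j) (smult (real n ^ l) p)"
    using p N_ge by (intro bounded_coeffs_smult_power[OF p(3), of _ l]) (auto simp: N_def intro!: power_mono)
  then show ?thesis unfolding p(1) by (rule root_poly_bounded_in_cart_span) simp
qed

text \<open>Triangular elimination from the top degree. The quotient of degree d has leading
  coefficient \<open>u\<close> with N^(j-t-d) at most a constant times \<open>u\<close>, so the
  multiplier \<open>coeff p d / u\<close> is bounded. Removing the top term enlarges the bound on
  the lower coefficients by at most 1 + (j+1)^j; the degree of homogeneity stays j - t
  throughout.\<close>

lemma root_poly_bounded_in_rad_span:
  assumes "degree p \<le> d" "d \<le> j - t" "\<And>i. i \<le> d \<Longrightarrow> \<bar>coeff p i\<bar> \<le> C * N ^ (j - t - i)" "0 \<le> C"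
  shows "root_poly n t * p \<in> bspan (C * ((2 * real j + 2) ^ j * (real (Suc d) * (1 + (real j + 1) ^ j) ^ d))) (rad_index n j) (rad_poly n j)"
  using assms
proof (induction d arbitrary: p C)
  have step: "\<exists>q x c. root_poly n t * smult (coeff p d) q = smult c (rad_poly n j x) \<and> x \<in> rad_index n j \<and> \<bar>c\<bar> \<le> C * (2 * real j + 2) ^ j
      \<and> lead_coeff q = 1 \<and> degree q = d \<and> bounded_coeffs N d ((real j + 1) ^ j) q"
    if d: "d \<le> j - t" and cd: "\<bar>coeff p d\<bar> \<le> C * N ^ (j - t - d)" and C: "0 \<le> C" for p d C
  proof -
    obtain x q u where q: "x \<in> rad_index n j" "rad_poly n j x = root_poly n t * smult u q" "lead_coeff q = 1" "degree q = d"
      "bounded_coeffs N d ((real j + 1) ^ j) q" "0 < u" "N ^ (j - t - d) \<le> (2 * real j + 2) ^ j * u"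
      using rad_poly_of_degree[OF d] by metis
    have "\<bar>coeff p d\<bar> \<le> C * ((2 * real j + 2) ^ j * u)"
      using cd mult_left_mono[OF q(7) C] by linarith
    then have "\<bar>coeff p d / u\<bar> \<le> C * (2 * real j + 2) ^ j"
      using q(6) by (simp add: divide_le_eq mult_ac)
    moreover have "root_poly n t * smult (coeff p d) q = smult (coeff p d / u) (rad_poly n j x)"
      using q(2,6) by simp
    ultimately show ?thesis using q by blast
  qed
  have elem: "smult c (rad_poly n j x) \<in> bspan A (rad_index n j) (rad_poly n j)"
    if "x \<in> rad_index n j" "\<bar>c\<bar> \<le> A" for c x A
    using bspan_smult[OF bspan_elem[OF finite_rad_index that(1), of "rad_poly n j"] that(2)] by simp
  {
    case 0
    obtain q x c where q: "root_poly n t * smult (coeff p 0) q = smult c (rad_poly n j x)" "x \<in> rad_index n j"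
      "\<bar>c\<bar> \<le> C * (2 * real j + 2) ^ j" "lead_coeff q = 1" "degree q = 0"
      using step[of 0 p C] 0 by force
    have "q = 1" using q(4,5) by (metis degree_0_id of_nat_1 one_pCons)
    moreover have "p = smult (coeff p 0) 1" using 0 by (metis degree_0_id le_zero_eq mult.right_neutral one_pCons smult_0_right smult_pCons)
    ultimately show ?case using elem[OF q(2,3)] q(1) by simp
  next
    case (Suc d)
    let ?Q = "(real j + 1) ^ j"
    obtain q x c where q: "root_poly n t * smult (coeff p (Suc d)) q = smult c (rad_poly n j x)" "x \<in> rad_index n j"
      "\<bar>c\<bar> \<le> C * (2 * real j + 2) ^ j" "lead_coeff q = 1" "degree q = Suc d" "bounded_coeffs N (Suc d) ?Q q"
      using step[of "Suc d" p C] Suc.prems by force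
    define r where "r = p - smult (coeff p (Suc d)) q"
    have dr: "degree r \<le> d"
    proof (rule degree_le, intro allI impI)
      fix i assume "d < i"
      then consider "i = Suc d" | "Suc d < i" by linarith
      then show "coeff r i = 0"
        by cases (use Suc.prems(1) q(4,5) in \<open>auto simp: r_def coeff_eq_0\<close>)
    qed
    have cr: "\<bar>coeff r i\<bar> \<le> (C * (1 + ?Q)) * N ^ (j - t - i)" if "i \<le> d" for i
    proof -
      have "\<bar>coeff p (Suc d) * coeff q i\<bar> \<le> (C * N ^ (j - t - Suc d)) * (?Q * N ^ (Suc d - i))"
        unfolding abs_mult using Suc.prems(3)[of "Suc d"] q(6) that Suc.prems(4) N_ge
        by (intro mult_mono) (auto simp: bounded_coeffs_def)
      also have "\<dots> = C * ?Q * N ^ ((j - t - Suc d) + (Suc d - i))" by (simp add: power_add)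
      also have "(j - t - Suc d) + (Suc d - i) = j - t - i" using that Suc.prems(2) by linarith
      finally have "\<bar>coeff p (Suc d) * coeff q i\<bar> \<le> C * ?Q * N ^ (j - t - i)" .
      moreover have "\<bar>coeff p i\<bar> \<le> C * N ^ (j - t - i)" using Suc.prems(3)[of i] that by simp
      ultimately show ?thesis by (simp add: r_def algebra_simps)
    qed
    have C: "0 \<le> C * (1 + ?Q)" using Suc.prems(4) by simp
    have IH: "root_poly n t * r \<in> bspan (C * (1 + ?Q) * ((2 * real j + 2) ^ j * (real (Suc d) * (1 + ?Q) ^ d))) (rad_index n j) (rad_poly n j)"
      using Suc.IH[OF dr _ cr C] Suc.prems(2) by simp
    have "root_poly n t * p = smult c (rad_poly n j x) + root_poly n t * r"
      by (simp add: q(1)[symmetric] r_def algebra_simps)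
    also have "\<dots> \<in> bspan (C * (2 * real j + 2) ^ j + C * (1 + ?Q) * ((2 * real j + 2) ^ j * (real (Suc d) * (1 + ?Q) ^ d))) (rad_index n j) (rad_poly n j)"
      by (rule bspan_add[OF elem[OF q(2,3)] IH])
    finally show ?case
    proof (rule bspan_mono)
      have "1 \<le> (1 + ?Q) ^ Suc d" by (rule one_le_power) simp
      then have "C * (2 * real j + 2) ^ j * 1 \<le> C * (2 * real j + 2) ^ j * (1 + ?Q) ^ Suc d"
        using Suc.prems(4) by (intro mult_left_mono) auto
      then show "C * (2 * real j + 2) ^ j + C * (1 + ?Q) * ((2 * real j + 2) ^ j * (real (Suc d) * (1 + ?Q) ^ d))
        \<le> C * ((2 * real j + 2) ^ j * (real (Suc (Suc d)) * (1 + ?Q) ^ Suc d))"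
        by (simp add: algebra_simps)
    qed
  }
qed

lemma cart_poly_in_rad_span:
  assumes "a \<le> j"
  shows "cart_poly n a (j - a) \<in> bspan ((2 * real j + 2) ^ j * ((2 * real j + 2) ^ j * (real (Suc j) * (1 + (real j + 1) ^ j) ^ j)))
     (rad_index n j) (rad_poly n j)"
proof -
  let ?Q = "1 + (real j + 1) ^ j"
  obtain p where p: "cart_poly n a (j - a) = root_poly n t * p" "bounded_coeffs N (j - t) ((2 * real j + 2) ^ (j - t)) p"
    using cart_poly_factor[OF assms] by blast
  have "cart_poly n a (j - a) \<in> bspan ((2 * real j + 2) ^ (j - t) * ((2 * real j + 2) ^ j * (real (Suc (j - t)) * ?Q ^ (j - t)))) (rad_index n j) (rad_poly n j)"
    unfolding p(1) using p(2) by (intro root_poly_bounded_in_rad_span) (auto simp: bounded_coeffs_def)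
  then show ?thesis
    by (rule bspan_mono) (intro mult_mono power_increasing order_refl, auto)
qed

end

theorem cart_rad_span:
  obtains C where "C > 0"
    "\<And>n a. a \<le> j \<Longrightarrow> cart_poly (real n) a (j - a) \<in> bspan C (rad_index n j) (rad_poly n j)"
    "\<And>n x. x \<in> rad_index n j \<Longrightarrow> rad_poly n j x \<in> bspan C {..j} (\<lambda>a. cart_poly (real n) a (j - a))"
proof -
  let ?C1 = "(2 * real j + 2) ^ j * ((2 * real j + 2) ^ j * (real (Suc j) * (1 + (real j + 1) ^ j) ^ j))"
  let ?C2 = "(real j + 1) ^ j * (real (Suc j) * (2 * real j + 3) ^ 3) ^ j"
  show ?thesis
  proof (rule that[of "max 1 (max ?C1 ?C2)"])
    show "cart_poly (real n) a (j - a) \<in> bspan (max 1 (max ?C1 ?C2)) (rad_index n j) (rad_poly n j)" if "a \<le> j" for n a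
      by (rule bspan_mono[OF cart_poly_in_rad_span[OF that]]) simp
    show "rad_poly n j x \<in> bspan (max 1 (max ?C1 ?C2)) {..j} (\<lambda>a. cart_poly (real n) a (j - a))" if "x \<in> rad_index n j" for n x
      by (rule bspan_mono[OF rad_poly_in_cart_span[OF that]]) simp
  qed simp
qed

section \<open>Polar and cylindrical coordinates\<close>

text \<open>\<open>nn_integral_substitution_aux\<close> concerns compact intervals. The line is
  exhausted by the intervals from -(n+1) to n+1, images under tan of those from \<open>- a n\<close>
  to \<open>a n\<close>, and monotone convergence passes to the limit.\<close>

lemma nn_integral_tan_substitution:
  assumes [measurable]: "G \<in> borel_measurable borel"
  shows "(\<integral>\<^sup>+t. G t \<partial>lborel) = (\<integral>\<^sup>+\<theta>. G (tan \<theta>) * ennreal (1 / (cos \<theta>)\<^sup>2) * indicator {-pi/2<..<pi/2} \<theta> \<partial>lborel)"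
proof -
  define a where "a n = arctan (real (Suc n))" for n
  have a: "-pi/2 < a n" "a n < pi/2" "0 \<le> a n" "tan (a n) = real (Suc n)" "tan (- a n) = - real (Suc n)" for n
    using arctan[of "real (Suc n)"] zero_le_arctan_iff[of "real (Suc n)"] by (auto simp: a_def)
  have sub: "{- a n..a n} \<subseteq> {-pi/2<..<pi/2}" for n
    using a[of n] by auto
  have cpos: "cos \<theta> \<noteq> 0" if "\<theta> \<in> {-pi/2<..<pi/2}" for \<theta> using cos_gt_zero_pi[of \<theta>] that by auto
  have "(\<integral>\<^sup>+t. G t * indicator {- real (Suc n)..real (Suc n)} t \<partial>lborel)
    = (\<integral>\<^sup>+\<theta>. G (tan \<theta>) * ennreal (1 / (cos \<theta>)\<^sup>2) * indicator {- a n..a n} \<theta> \<partial>lborel)" for n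
  proof -
    have "- a n < a n" by (simp add: a_def)
    then have "(\<integral>\<^sup>+t. G t * indicator {tan (- a n)..tan (a n)} t \<partial>lborel)
      = (\<integral>\<^sup>+\<theta>. G (tan \<theta>) * ennreal (1 / (cos \<theta>)\<^sup>2) * indicator {- a n..a n} \<theta> \<partial>lborel)"
    proof (intro nn_integral_substitution_aux)
      fix x assume "x \<in> {- a n..a n}"
      then have "cos x \<noteq> 0" using sub[of n] cpos by blast
      then show "(tan has_real_derivative 1 / (cos x)\<^sup>2) (at x)"
        using DERIV_tan[of x] by (simp add: inverse_eq_divide)
    next
      show "continuous_on {- a n..a n} (\<lambda>\<theta>. 1 / (cos \<theta>)\<^sup>2)"
        using sub[of n] cpos by (intro continuous_intros) auto
    qed auto
    then show ?thesis using a by simp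
  qed
  then have "(SUP n. \<integral>\<^sup>+t. G t * indicator {- real (Suc n)..real (Suc n)} t \<partial>lborel)
    = (SUP n. \<integral>\<^sup>+\<theta>. G (tan \<theta>) * ennreal (1 / (cos \<theta>)\<^sup>2) * indicator {- a n..a n} \<theta> \<partial>lborel)" by simp
  moreover have "(SUP n. \<integral>\<^sup>+t. G t * indicator {- real (Suc n)..real (Suc n)} t \<partial>lborel) = (\<integral>\<^sup>+t. G t \<partial>lborel)"
  proof -
    have "(SUP n. G t * indicator {- real (Suc n)..real (Suc n)} t) = G t" for t
    proof (rule antisym)
      obtain n :: nat where "\<bar>t\<bar> \<le> real n" using real_arch_simple by blast
      then have "\<bar>t\<bar> \<le> real (Suc n)" by simp
      then have "G t = G t * indicator {- real (Suc n)..real (Suc n)} t" by (auto simp: indicator_def)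
      then show "G t \<le> (SUP n. G t * indicator {- real (Suc n)..real (Suc n)} t)"
        by (intro SUP_upper2[of n]) (simp_all only: UNIV_I order_refl)
    qed (auto intro!: SUP_least simp: indicator_def)
    then have "(\<integral>\<^sup>+t. G t \<partial>lborel) = (\<integral>\<^sup>+t. (SUP n. G t * indicator {- real (Suc n)..real (Suc n)} t) \<partial>lborel)" by simp
    also have "\<dots> = (SUP n. \<integral>\<^sup>+t. G t * indicator {- real (Suc n)..real (Suc n)} t \<partial>lborel)"
      by (intro nn_integral_monotone_convergence_SUP)
        (auto simp: incseq_def le_fun_def indicator_def intro!: mult_left_mono)
    finally show ?thesis ..
  qed
  moreover have "(SUP n. \<integral>\<^sup>+\<theta>. G (tan \<theta>) * ennreal (1 / (cos \<theta>)\<^sup>2) * indicator {- a n..a n} \<theta> \<partial>lborel)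
    = (\<integral>\<^sup>+\<theta>. G (tan \<theta>) * ennreal (1 / (cos \<theta>)\<^sup>2) * indicator {-pi/2<..<pi/2} \<theta> \<partial>lborel)"
  proof -
    let ?H = "\<lambda>\<theta>. G (tan \<theta>) * ennreal (1 / (cos \<theta>)\<^sup>2)"
    have tm [measurable]: "tan \<in> borel_measurable (borel :: real measure)"
      unfolding tan_def by measurable
    have mono: "m \<le> n \<Longrightarrow> a m \<le> a n" for m n unfolding a_def by (subst arctan_le_iff) simp
    have "(SUP n. ?H \<theta> * indicator {- a n..a n} \<theta>) = ?H \<theta> * indicator {-pi/2<..<pi/2} \<theta>" for \<theta>
    proof (rule antisym)
      show "(SUP n. ?H \<theta> * indicator {- a n..a n} \<theta>) \<le> ?H \<theta> * indicator {-pi/2<..<pi/2} \<theta>"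
        by (intro SUP_least mult_left_mono indicator_leI) (use sub in blast, simp)
      show "?H \<theta> * indicator {-pi/2<..<pi/2} \<theta> \<le> (SUP n. ?H \<theta> * indicator {- a n..a n} \<theta>)"
      proof (cases "\<theta> \<in> {-pi/2<..<pi/2}")
        case True
        obtain n :: nat where "\<bar>tan \<theta>\<bar> \<le> real n" using real_arch_simple by blast
        then have n: "\<bar>tan \<theta>\<bar> \<le> real (Suc n)" by simp
        have "arctan (tan \<theta>) = \<theta>" using True by (intro arctan_tan) auto
        then have "\<theta> \<le> a n" "- a n \<le> \<theta>"
          using n arctan_le_iff[of "tan \<theta>" "real (Suc n)"] arctan_le_iff[of "- real (Suc n)" "tan \<theta>"] by (auto simp: a_def arctan_minus abs_le_iff simp del: of_nat_Suc)
        then have "?H \<theta> * indicator {-pi/2<..<pi/2} \<theta> = ?H \<theta> * indicator {- a n..a n} \<theta>" using True by simp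
        then show ?thesis by (intro SUP_upper2[of n]) (simp_all only: UNIV_I order_refl)
      qed simp
    qed
    then have "(\<integral>\<^sup>+\<theta>. ?H \<theta> * indicator {-pi/2<..<pi/2} \<theta> \<partial>lborel) = (\<integral>\<^sup>+\<theta>. (SUP n. ?H \<theta> * indicator {- a n..a n} \<theta>) \<partial>lborel)" by simp
    also have "\<dots> = (SUP n. \<integral>\<^sup>+\<theta>. ?H \<theta> * indicator {- a n..a n} \<theta> \<partial>lborel)"
    proof (intro nn_integral_monotone_convergence_SUP)
      show "incseq (\<lambda>n \<theta>. ?H \<theta> * indicator {- a n..a n} \<theta>)"
        unfolding incseq_def le_fun_def
      proof (intro allI impI mult_left_mono)
        fix m n :: nat and \<theta> assume "m \<le> n"
        then show "indicator {- a m..a m} \<theta> \<le> (indicator {- a n..a n} \<theta> :: ennreal)"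
          using mono[of m n] by (auto simp: indicator_def)
      qed simp
    qed measurable
    finally show ?thesis ..
  qed
  ultimately show ?thesis by simp
qed

text \<open>Only one-dimensional substitutions occur: y = x t, then after an exchange of the
  integrals t = tan \<theta>, and x = r cos \<theta> for fixed \<theta>. The factors x = r cos
  \<theta>, 1/cos^2 and cos multiply to r.\<close>

lemma nn_integral_polar_right:
  fixes f :: "real \<times> real \<Rightarrow> ennreal"
  assumes [measurable]: "f \<in> borel_measurable borel"
  shows "(\<integral>\<^sup>+x. \<integral>\<^sup>+y. f (x, y) * indicator {0<..} x \<partial>lborel \<partial>lborel)
    = (\<integral>\<^sup>+r. \<integral>\<^sup>+\<theta>. ennreal r * f (r * cos \<theta>, r * sin \<theta>) * indicator {0<..} r * indicator {-pi/2<..<pi/2} \<theta> \<partial>lborel \<partial>lborel)"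
proof -
  have fm [measurable]: "f \<in> borel_measurable (borel \<Otimes>\<^sub>M borel)" by (simp add: borel_prod)
  have "(\<integral>\<^sup>+y. f (x, y) * indicator {0<..} x \<partial>lborel) = (\<integral>\<^sup>+t. ennreal x * f (x, x * t) * indicator {0<..} x \<partial>lborel)" for x :: real
  proof (cases "x > 0")
    case True
    then show ?thesis
      using nn_integral_real_affine[of "\<lambda>y. f (x, y)" x 0] by (simp add: nn_integral_cmult)
  qed simp
  then have "(\<integral>\<^sup>+x. \<integral>\<^sup>+y. f (x, y) * indicator {0<..} x \<partial>lborel \<partial>lborel)
    = (\<integral>\<^sup>+x. \<integral>\<^sup>+t. ennreal x * f (x, x * t) * indicator {0<..} x \<partial>lborel \<partial>lborel)" by simp
  also have "\<dots> = (\<integral>\<^sup>+t. \<integral>\<^sup>+x. ennreal x * f (x, x * t) * indicator {0<..} x \<partial>lborel \<partial>lborel)"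
    by (rule lborel_pair.Fubini'[symmetric]) measurable
  also have "\<dots> = (\<integral>\<^sup>+\<theta>. (\<integral>\<^sup>+x. ennreal x * f (x, x * tan \<theta>) * indicator {0<..} x \<partial>lborel) * ennreal (1 / (cos \<theta>)\<^sup>2) * indicator {-pi/2<..<pi/2} \<theta> \<partial>lborel)"
    by (rule nn_integral_tan_substitution) measurable
  also have "\<dots> = (\<integral>\<^sup>+\<theta>. \<integral>\<^sup>+r. ennreal r * f (r * cos \<theta>, r * sin \<theta>) * indicator {0<..} r * indicator {-pi/2<..<pi/2} \<theta> \<partial>lborel \<partial>lborel)"
  proof (rule nn_integral_cong)
    fix \<theta> :: real
    show "(\<integral>\<^sup>+x. ennreal x * f (x, x * tan \<theta>) * indicator {0<..} x \<partial>lborel) * ennreal (1 / (cos \<theta>)\<^sup>2) * indicator {-pi/2<..<pi/2} \<theta>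
       = (\<integral>\<^sup>+r. ennreal r * f (r * cos \<theta>, r * sin \<theta>) * indicator {0<..} r * indicator {-pi/2<..<pi/2} \<theta> \<partial>lborel)"
    proof (cases "\<theta> \<in> {-pi/2<..<pi/2}")
      case True
      then have c: "cos \<theta> > 0" by (intro cos_gt_zero_pi) auto
      have "(\<integral>\<^sup>+x. ennreal x * f (x, x * tan \<theta>) * indicator {0<..} x \<partial>lborel)
        = ennreal (cos \<theta>) * (\<integral>\<^sup>+r. ennreal (cos \<theta> * r) * f (cos \<theta> * r, cos \<theta> * r * tan \<theta>) * indicator {0<..} (cos \<theta> * r) \<partial>lborel)"
        using nn_integral_real_affine[of "\<lambda>x. ennreal x * f (x, x * tan \<theta>) * indicator {0<..} x" "cos \<theta>" 0] c by simp
      also have "\<dots> = ennreal (cos \<theta>) * (\<integral>\<^sup>+r. ennreal (cos \<theta>) * (ennreal r * f (r * cos \<theta>, r * sin \<theta>) * indicator {0<..} r) \<partial>lborel)"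
      proof -
        have "ennreal (cos \<theta> * r) * f (cos \<theta> * r, cos \<theta> * r * tan \<theta>) * indicator {0<..} (cos \<theta> * r)
          = ennreal (cos \<theta>) * (ennreal r * f (r * cos \<theta>, r * sin \<theta>) * indicator {0<..} r)" for r
        proof (cases "r > 0")
          case True
          then have "cos \<theta> * r * tan \<theta> = r * sin \<theta>" using c by (simp add: tan_def)
          then show ?thesis using True c by (simp add: ennreal_mult' mult_ac)
        next
          case False
          then show ?thesis using c by (auto simp: zero_less_mult_iff)
        qed
        then show ?thesis by (simp only:)
      qed
      also have "\<dots> = ennreal ((cos \<theta>)\<^sup>2) * (\<integral>\<^sup>+r. ennreal r * f (r * cos \<theta>, r * sin \<theta>) * indicator {0<..} r \<partial>lborel)"
        using c by (simp add: nn_integral_cmult power2_eq_square ennreal_mult' mult.assoc)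
      finally show ?thesis
        using True c by (simp add: mult.commute mult.assoc[symmetric] ennreal_mult'[symmetric])
    qed simp
  qed
  also have "\<dots> = (\<integral>\<^sup>+r. \<integral>\<^sup>+\<theta>. ennreal r * f (r * cos \<theta>, r * sin \<theta>) * indicator {0<..} r * indicator {-pi/2<..<pi/2} \<theta> \<partial>lborel \<partial>lborel)"
    by (rule lborel_pair.Fubini') measurable
  finally show ?thesis .
qed

text \<open>The left half plane is the point reflection of the right one, which shifts \<theta> by
  pi, and the line x = 0 is a null set. This is the origin of the angular interval from -pi/2 to 3
  pi/2.\<close>

lemma nn_integral_polar:
  fixes f :: "real \<times> real \<Rightarrow> ennreal"
  assumes [measurable]: "f \<in> borel_measurable borel"
  shows "(\<integral>\<^sup>+p. f p \<partial>lborel)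
    = (\<integral>\<^sup>+r. \<integral>\<^sup>+\<theta>. ennreal r * f (r * cos \<theta>, r * sin \<theta>) * indicator {0<..} r * indicator {-pi/2..3*pi/2} \<theta> \<partial>lborel \<partial>lborel)"
proof -
  have fm [measurable]: "f \<in> borel_measurable (borel \<Otimes>\<^sub>M borel)" by (simp add: borel_prod)
  have neg: "(\<integral>\<^sup>+x. g (- x) \<partial>lborel) = (\<integral>\<^sup>+x. g x \<partial>lborel)" if [measurable]: "g \<in> borel_measurable borel" for g :: "real \<Rightarrow> ennreal"
    using nn_integral_real_affine[OF that, of "-1" 0] by simp
  let ?h = "\<lambda>r \<theta>. ennreal r * f (r * cos \<theta>, r * sin \<theta>) * indicator {0<..} r"
  have "(\<integral>\<^sup>+p. f p \<partial>lborel) = (\<integral>\<^sup>+x. \<integral>\<^sup>+y. f (x, y) \<partial>lborel \<partial>lborel)"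
    by (simp add: lborel_prod[symmetric] lborel.nn_integral_fst)
  also have "\<dots> = (\<integral>\<^sup>+x. (\<integral>\<^sup>+y. f (x, y) * indicator {0<..} x \<partial>lborel) + (\<integral>\<^sup>+y. f (x, y) * indicator {..<0} x \<partial>lborel) \<partial>lborel)"
  proof (rule nn_integral_cong_AE)
    show "AE x in lborel. (\<integral>\<^sup>+y. f (x, y) \<partial>lborel) = (\<integral>\<^sup>+y. f (x, y) * indicator {0<..} x \<partial>lborel) + (\<integral>\<^sup>+y. f (x, y) * indicator {..<0} x \<partial>lborel)"
      using AE_lborel_singleton[of "0::real"] by eventually_elim (auto simp: indicator_def)
  qed
  also have "\<dots> = (\<integral>\<^sup>+x. \<integral>\<^sup>+y. f (x, y) * indicator {0<..} x \<partial>lborel \<partial>lborel) + (\<integral>\<^sup>+x. \<integral>\<^sup>+y. f (x, y) * indicator {..<0} x \<partial>lborel \<partial>lborel)"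
    by (rule nn_integral_add) measurable
  also have "(\<integral>\<^sup>+x. \<integral>\<^sup>+y. f (x, y) * indicator {..<0} x \<partial>lborel \<partial>lborel)
     = (\<integral>\<^sup>+x. \<integral>\<^sup>+y. f (- x, - y) * indicator {0<..} x \<partial>lborel \<partial>lborel)"
  proof -
    have "(\<integral>\<^sup>+x. \<integral>\<^sup>+y. f (x, y) * indicator {..<0} x \<partial>lborel \<partial>lborel)
       = (\<integral>\<^sup>+x. \<integral>\<^sup>+y. f (- x, y) * indicator {..<0} (- x) \<partial>lborel \<partial>lborel)"
      by (rule neg[symmetric]) measurable
    also have "\<dots> = (\<integral>\<^sup>+x. \<integral>\<^sup>+y. f (- x, - y) * indicator {..<0} (- x) \<partial>lborel \<partial>lborel)"
      by (intro nn_integral_cong neg[symmetric]) measurable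
    finally show ?thesis by (simp add: indicator_def)
  qed
  also have "\<dots> = (\<integral>\<^sup>+r. \<integral>\<^sup>+\<theta>. ennreal r * f (- (r * cos \<theta>), - (r * sin \<theta>)) * indicator {0<..} r * indicator {-pi/2<..<pi/2} \<theta> \<partial>lborel \<partial>lborel)"
  proof -
    have "(\<lambda>(x, y). f (- x, - y)) \<in> borel_measurable borel"
      unfolding borel_prod[symmetric] by measurable
    from nn_integral_polar_right[OF this] show ?thesis by simp
  qed
  also have "(\<integral>\<^sup>+x. \<integral>\<^sup>+y. f (x, y) * indicator {0<..} x \<partial>lborel \<partial>lborel)
     = (\<integral>\<^sup>+r. \<integral>\<^sup>+\<theta>. ?h r \<theta> * indicator {-pi/2<..<pi/2} \<theta> \<partial>lborel \<partial>lborel)"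
    by (rule nn_integral_polar_right) simp
  also have "(\<integral>\<^sup>+r. \<integral>\<^sup>+\<theta>. ennreal r * f (- (r * cos \<theta>), - (r * sin \<theta>)) * indicator {0<..} r * indicator {-pi/2<..<pi/2} \<theta> \<partial>lborel \<partial>lborel)
     = (\<integral>\<^sup>+r. \<integral>\<^sup>+\<theta>. ?h r \<theta> * indicator {pi/2<..<3*pi/2} \<theta> \<partial>lborel \<partial>lborel)"
  proof (rule nn_integral_cong)
    fix r :: real
    have "(\<integral>\<^sup>+\<theta>. ?h r \<theta> * indicator {pi/2<..<3*pi/2} \<theta> \<partial>lborel)
       = (\<integral>\<^sup>+\<theta>. ?h r (pi + \<theta>) * indicator {pi/2<..<3*pi/2} (pi + \<theta>) \<partial>lborel)"
      using nn_integral_real_affine[of "\<lambda>\<theta>. ?h r \<theta> * indicator {pi/2<..<3*pi/2} \<theta>" 1 pi] by simp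
    also have "\<dots> = (\<integral>\<^sup>+\<theta>. ennreal r * f (- (r * cos \<theta>), - (r * sin \<theta>)) * indicator {0<..} r * indicator {-pi/2<..<pi/2} \<theta> \<partial>lborel)"
      by (intro nn_integral_cong) (auto simp: indicator_def)
    finally show "(\<integral>\<^sup>+\<theta>. ennreal r * f (- (r * cos \<theta>), - (r * sin \<theta>)) * indicator {0<..} r * indicator {-pi/2<..<pi/2} \<theta> \<partial>lborel)
      = (\<integral>\<^sup>+\<theta>. ?h r \<theta> * indicator {pi/2<..<3*pi/2} \<theta> \<partial>lborel)" ..
  qed
  also have "(\<integral>\<^sup>+r. \<integral>\<^sup>+\<theta>. ?h r \<theta> * indicator {-pi/2<..<pi/2} \<theta> \<partial>lborel \<partial>lborel) + (\<integral>\<^sup>+r. \<integral>\<^sup>+\<theta>. ?h r \<theta> * indicator {pi/2<..<3*pi/2} \<theta> \<partial>lborel \<partial>lborel)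
     = (\<integral>\<^sup>+r. (\<integral>\<^sup>+\<theta>. ?h r \<theta> * indicator {-pi/2<..<pi/2} \<theta> \<partial>lborel) + (\<integral>\<^sup>+\<theta>. ?h r \<theta> * indicator {pi/2<..<3*pi/2} \<theta> \<partial>lborel) \<partial>lborel)"
    by (rule nn_integral_add[symmetric]) measurable
  also have "\<dots> = (\<integral>\<^sup>+r. \<integral>\<^sup>+\<theta>. ?h r \<theta> * indicator {-pi/2..3*pi/2} \<theta> \<partial>lborel \<partial>lborel)"
  proof (rule nn_integral_cong)
    fix r :: real
    have "(\<integral>\<^sup>+\<theta>. ?h r \<theta> * indicator {-pi/2<..<pi/2} \<theta> \<partial>lborel) + (\<integral>\<^sup>+\<theta>. ?h r \<theta> * indicator {pi/2<..<3*pi/2} \<theta> \<partial>lborel)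
      = (\<integral>\<^sup>+\<theta>. ?h r \<theta> * indicator {-pi/2<..<pi/2} \<theta> + ?h r \<theta> * indicator {pi/2<..<3*pi/2} \<theta> \<partial>lborel)"
      by (rule nn_integral_add[symmetric]) measurable
    also have "\<dots> = (\<integral>\<^sup>+\<theta>. ?h r \<theta> * indicator {-pi/2..3*pi/2} \<theta> \<partial>lborel)"
    proof (rule nn_integral_cong_AE)
      show "AE \<theta> in lborel. ?h r \<theta> * indicator {-pi/2<..<pi/2} \<theta> + ?h r \<theta> * indicator {pi/2<..<3*pi/2} \<theta> = ?h r \<theta> * indicator {-pi/2..3*pi/2} \<theta>"
        using AE_lborel_singleton[of "-pi/2"] AE_lborel_singleton[of "pi/2"] AE_lborel_singleton[of "3*pi/2"]
        by eventually_elim (auto simp: indicator_def)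
    qed
    finally show "(\<integral>\<^sup>+\<theta>. ?h r \<theta> * indicator {-pi/2<..<pi/2} \<theta> \<partial>lborel) + (\<integral>\<^sup>+\<theta>. ?h r \<theta> * indicator {pi/2<..<3*pi/2} \<theta> \<partial>lborel)
       = (\<integral>\<^sup>+\<theta>. ?h r \<theta> * indicator {-pi/2..3*pi/2} \<theta> \<partial>lborel)" .
  qed
  finally show ?thesis .
qed

text \<open>\<open>J\<close> embeds the space of the meridian coordinates, \<open>er\<close> is the direction of \<open>r\<close> there, and \<open>J er\<close> and \<open>ey\<close> are the
  directions of \<open>x\<close> and \<open>y\<close>. Both the spatial and the planar case are instances.\<close>

locale cylindrical =
  fixes J :: "'b::euclidean_space \<Rightarrow> 'a::euclidean_space" and er :: 'b and ey :: 'a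
  assumes J: "linear J" and er: "er \<in> Basis" and ey: "ey \<in> Basis"
    and J_Basis: "J ` Basis = Basis - {ey}" and J_inj: "inj_on J Basis"
    and nn_integral_cyl: "\<And>f. f \<in> borel_measurable borel \<Longrightarrow> (\<integral>\<^sup>+v. f v \<partial>lborel) =
      (\<integral>\<^sup>+b. \<integral>\<^sup>+\<theta>. ennreal (b \<bullet> er) *
         f (J b + (b \<bullet> er * (cos \<theta> - 1)) *\<^sub>R J er + (b \<bullet> er * sin \<theta>) *\<^sub>R ey)
         * indicator {0<..} (b \<bullet> er) * indicator {-pi/2..3*pi/2} \<theta> \<partial>lborel \<partial>lborel)"
begin

abbreviation "ex \<equiv> J er"
abbreviation "R b \<equiv> b \<bullet> er"

text \<open>\<open>J b\<close> rotated by \<theta> in the plane of \<open>ex\<close> and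
  \<open>ey\<close>. The term cos \<theta> - 1 arises because \<open>J b\<close> already contains
  \<open>R b\<close> times \<open>ex\<close>. For fixed \<theta> the map is linear in b, which makes
  the results on families of linear maps applicable.\<close>

definition pol :: "real \<Rightarrow> 'b \<Rightarrow> 'a" where
  "pol \<theta> b = J b + (R b * (cos \<theta> - 1)) *\<^sub>R ex + (R b * sin \<theta>) *\<^sub>R ey"

definition rho :: "'a \<Rightarrow> real" where
  "rho v = sqrt ((v \<bullet> ex)\<^sup>2 + (v \<bullet> ey)\<^sup>2)"

definition rad :: "'a \<Rightarrow> 'b" where
  "rad v = (\<Sum>b\<in>Basis. (v \<bullet> J b) *\<^sub>R b) + (rho v - v \<bullet> ex) *\<^sub>R er"

text \<open>On the axis, \<open>dir v = 0\<close>.\<close>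

definition dir :: "'a \<Rightarrow> complex" where
  "dir v = Complex (v \<bullet> ex) (v \<bullet> ey) / complex_of_real (rho v)"

definition off_axis :: "'a set" where "off_axis = {v. 0 < rho v}"

definition revolve :: "'b set \<Rightarrow> 'a set" where "revolve \<Omega> = {v \<in> off_axis. rad v \<in> \<Omega>}"

lemma J_in_Basis: "b \<in> Basis \<Longrightarrow> J b \<in> Basis" "b \<in> Basis \<Longrightarrow> J b \<noteq> ey"
  using J_Basis by auto

lemma ex_Basis: "ex \<in> Basis" and ex_ne: "ex \<noteq> ey"
  using J_in_Basis er by auto

lemma Basis_eq: "Basis = insert ey (J ` Basis)"
  using J_Basis ey by auto

lemma J_inner_Basis: "b \<in> Basis \<Longrightarrow> c \<in> Basis \<Longrightarrow> J b \<bullet> J c = (if b = c then 1 else 0)"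
  using inner_Basis[OF J_in_Basis(1) J_in_Basis(1), of b c] J_inj by (auto simp: inj_on_eq_iff)

lemma J_sum: "J b = (\<Sum>c\<in>Basis. (b \<bullet> c) *\<^sub>R J c)"
proof -
  have "J (\<Sum>c\<in>Basis. (b \<bullet> c) *\<^sub>R c) = (\<Sum>c\<in>Basis. (b \<bullet> c) *\<^sub>R J c)"
    by (simp add: linear_sum[OF J] linear_cmul[OF J])
  then show ?thesis by (simp add: euclidean_representation)
qed

lemma J_inner: "c \<in> Basis \<Longrightarrow> J b \<bullet> J c = b \<bullet> c"
proof -
  assume c: "c \<in> Basis"
  have "J b \<bullet> J c = (\<Sum>d\<in>Basis. (b \<bullet> d) * (if d = c then 1 else 0))"
    by (subst J_sum) (simp add: inner_sum_left J_inner_Basis c cong: sum.cong)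
  then show ?thesis using c by (simp add: if_distrib cong: if_cong)
qed

lemma J_inner_ey [simp]: "J b \<bullet> ey = 0"
proof -
  have "J c \<bullet> ey = 0" if "c \<in> Basis" for c
    using inner_Basis[OF J_in_Basis(1)[OF that] ey] J_in_Basis(2)[OF that] by simp
  then show ?thesis by (subst J_sum) (simp add: inner_sum_left)
qed

lemma ey_inner_J [simp]: "ey \<bullet> J b = 0"
  using J_inner_ey[of b] by (simp add: inner_commute del: J_inner_ey)

lemma ex_inner [simp]: "ex \<bullet> ex = 1" "ey \<bullet> ey = 1" "er \<bullet> er = 1"
  using ex_Basis ey er by (auto simp: inner_Basis)

lemma pol_inner: "c \<in> Basis \<Longrightarrow> pol \<theta> b \<bullet> J c = b \<bullet> c + (if c = er then R b * (cos \<theta> - 1) else 0)"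
  by (auto simp: pol_def inner_add_left J_inner_Basis er J_inner)

lemma pol_ex: "pol \<theta> b \<bullet> ex = R b * cos \<theta>"
  using pol_inner[OF er, of \<theta> b] by (simp add: algebra_simps)

lemma pol_ey: "pol \<theta> b \<bullet> ey = R b * sin \<theta>"
  by (simp add: pol_def inner_add_left)

lemma rho_pol: "0 \<le> R b \<Longrightarrow> rho (pol \<theta> b) = R b"
  unfolding rho_def pol_ex pol_ey
  by (simp add: power_mult_distrib distrib_left[symmetric] real_sqrt_mult del: distrib_left)

lemma rad_inner: "c \<in> Basis \<Longrightarrow> rad v \<bullet> c = (if c = er then rho v else v \<bullet> J c)"
proof -
  assume c: "c \<in> Basis"
  have "(\<Sum>b\<in>Basis. (v \<bullet> J b) *\<^sub>R b) \<bullet> c = v \<bullet> J c"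
    using c by (simp add: inner_sum_left inner_Basis if_distrib cong: if_cong)
  then show ?thesis using c er by (auto simp: rad_def inner_add_left inner_Basis)
qed

lemma R_rad: "R (rad v) = rho v" using rad_inner[OF er] by simp

lemma rad_pol: "0 \<le> R b \<Longrightarrow> rad (pol \<theta> b) = b"
  by (rule euclidean_eqI) (auto simp: rad_inner rho_pol pol_inner)

lemma dir_pol: "0 < R b \<Longrightarrow> dir (pol \<theta> b) = cis \<theta>"
  by (auto simp: dir_def rho_pol pol_ex pol_ey complex_eq_iff Re_divide Im_divide power2_eq_square)

lemma pol_rad:
  assumes "0 < rho v" "dir v = cis \<theta>"
  shows "pol \<theta> (rad v) = v"
proof (rule euclidean_eqI)
  have "Complex (v \<bullet> ex) (v \<bullet> ey) = complex_of_real (rho v) * cis \<theta>"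
    using assms by (simp add: dir_def field_simps)
  then have xy: "v \<bullet> ex = rho v * cos \<theta>" "v \<bullet> ey = rho v * sin \<theta>" by (auto simp: complex_eq_iff)
  fix e :: 'a assume "e \<in> Basis"
  then consider "e = ey" | c where "e = J c" "c \<in> Basis" using Basis_eq by auto
  then show "pol \<theta> (rad v) \<bullet> e = v \<bullet> e"
    by cases (auto simp: pol_ey R_rad xy pol_inner rad_inner algebra_simps)
qed

lemma norm_dir: "0 < rho v \<Longrightarrow> norm (dir v) = 1"
  by (simp add: dir_def norm_divide complex_norm rho_def[symmetric])

lemma revolve_obtain:
  assumes "v \<in> revolve \<Omega>"
  obtains \<theta> where "\<theta> \<in> {-pi..pi}" "v = pol \<theta> (rad v)" "rad v \<in> \<Omega>" "0 < rho v"
proof -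
  have v: "0 < rho v" "rad v \<in> \<Omega>" using assms by (auto simp: revolve_def off_axis_def)
  have "dir v \<noteq> 0" using norm_dir[OF v(1)] by auto
  then have "dir v = cis (Arg (dir v))" using cis_Arg[of "dir v"] norm_dir[OF v(1)] by (simp add: sgn_eq)
  then show ?thesis using that[of "Arg (dir v)"] pol_rad[OF v(1)] v Arg_bounded[of "dir v"] by auto
qed

lemma continuous_rho: "continuous_on S rho"
  unfolding rho_def by (intro continuous_intros)

lemma continuous_rad: "continuous_on S rad"
  unfolding rad_def by (intro continuous_intros continuous_rho)

lemma open_off_axis: "open off_axis"
  unfolding off_axis_def by (intro open_Collect_less continuous_intros continuous_rho)

lemma open_revolve: "open \<Omega> \<Longrightarrow> open (revolve \<Omega>)"
  using open_Int[OF open_off_axis open_vimage[OF _ continuous_rad]] by (simp add: revolve_def Collect_conj_eq vimage_def)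

section \<open>Averages of test functions over circles\<close>

lemma pol_linear: "linear (pol \<theta>)"
  unfolding pol_def
  by (rule linearI) (auto simp: linear_add[OF J] linear_cmul[OF J] inner_add_left algebra_simps)

lemma pol_continuous: "continuous_on UNIV (\<lambda>\<theta>. pol \<theta> b)"
  unfolding pol_def by (intro continuous_intros)

lemmas continuous_pol = continuous_linear_family[of pol, OF pol_linear pol_continuous]

lemma pol_in_revolve: "0 < R b \<Longrightarrow> pol \<theta> b \<in> revolve \<Omega> \<longleftrightarrow> b \<in> \<Omega>"
  by (simp add: revolve_def off_axis_def rho_pol rad_pol)

text \<open>Up to the factor 2 pi, the Fourier coefficient of index -k of \<open>\<phi>\<close> on
  the circle through b. It is smooth on the whole space, negative radii included.\<close>

definition coef :: "int \<Rightarrow> ('a \<Rightarrow> complex) \<Rightarrow> 'b \<Rightarrow> complex" where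
  "coef k \<phi> b = integral {-pi/2..3*pi/2} (\<lambda>\<theta>. cis (of_int k * \<theta>) * \<phi> (pol \<theta> b))"

text \<open>The transpose of the lift w -> e^(ik \<theta>) w, Jacobian included; see
  \<open>integral_lift_fun\<close>. The value 0 for r <= 0 is imposed because \<open>coef\<close>
  need not vanish at negative radii.\<close>

definition avg :: "int \<Rightarrow> ('a \<Rightarrow> complex) \<Rightarrow> 'b \<Rightarrow> complex" where
  "avg k \<phi> b = (if 0 < R b then complex_of_real (R b) * coef k \<phi> b else 0)"

lemma cont_cis: "continuous_on S (\<lambda>\<theta>. cis (of_int k * \<theta>))"
  unfolding cis_conv_exp by (intro continuous_intros)

lemma smooth_upto_coef: "smooth \<phi> \<Longrightarrow> smooth_upto n UNIV (coef k \<phi>)"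
  unfolding coef_def by (rule smooth_upto_param_integral[OF pol_linear pol_continuous cont_cis])

lemma smooth_upto_R: "smooth_upto n S (\<lambda>b. complex_of_real (R b))"
  by (rule smooth_upto_inner)

lemma open_R_pos: "open {b. 0 < R b}"
  by (intro open_Collect_less continuous_intros)

lemma avg_support:
  assumes "\<And>v. v \<notin> K \<Longrightarrow> \<phi> v = 0" "b \<notin> rad ` K"
  shows "avg k \<phi> b = 0"
proof (cases "0 < R b")
  case True
  have "pol \<theta> b \<notin> K" for \<theta> using rad_pol[of b \<theta>] True assms(2) by (metis imageI less_imp_le)
  then show ?thesis using assms(1) by (simp add: avg_def coef_def)
qed (simp add: avg_def)

text \<open>The average is supported in the image of \<open>K\<close> under \<open>rad\<close>, a
  compact subset of \<Omega> and thus away from r = 0, where the definition by cases could spoil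
  smoothness.\<close>

lemma avg_test:
  assumes \<Omega>: "\<Omega> \<subseteq> {b. 0 < R b}" and \<phi>: "\<phi> \<in> test_functions (revolve \<Omega>)"
  shows "avg k \<phi> \<in> test_functions \<Omega>"
proof -
  obtain K where K: "smooth \<phi>" "compact K" "K \<subseteq> revolve \<Omega>" "\<And>v. v \<notin> K \<Longrightarrow> \<phi> v = 0"
    using test_functionsE[OF \<phi>] by metis
  have K': "compact (rad ` K)" "rad ` K \<subseteq> \<Omega>"
    using K compact_continuous_image[OF continuous_rad] by (auto simp: revolve_def)
  have z: "avg k \<phi> b = 0" if "b \<notin> rad ` K" for b by (rule avg_support[OF K(4) that])
  show ?thesis
  proof (rule test_functionsI[OF _ K' z])
    have "smooth_upto n {b. 0 < R b} (avg k \<phi>)" for n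
    proof (rule iffD2[OF smooth_upto_cong[OF open_R_pos]])
      show "avg k \<phi> b = complex_of_real (R b) * coef k \<phi> b" if "b \<in> {b. 0 < R b}" for b
        using that by (simp add: avg_def)
      show "smooth_upto n {b. 0 < R b} (\<lambda>b. complex_of_real (R b) * coef k \<phi> b)"
        by (intro smooth_upto_mult open_R_pos smooth_upto_R smooth_upto_subset[OF smooth_upto_coef[OF K(1)]]) auto
    qed
    then have "smooth_upto n UNIV (avg k \<phi>)" for n
      using K' \<Omega> z by (intro smooth_upto_compact_support[OF open_R_pos compact_imp_closed[OF K'(1)]]) auto
    then show "smooth (avg k \<phi>)" by (simp add: smooth_iff)
  qed
qed

lemma coef_integrable:
  assumes "smooth \<phi>" "continuous_on UNIV a"
  shows "(\<lambda>\<theta>. a \<theta> * \<phi> (pol \<theta> b)) integrable_on {-pi/2..3*pi/2}"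
  by (rule integrable_param[OF pol_linear pol_continuous assms(2,1)])

lemma pdiff_coef:
  assumes "smooth \<phi>"
  shows "pdiff h (coef k \<phi>) b = integral {-pi/2..3*pi/2} (\<lambda>\<theta>. cis (of_int k * \<theta>) * pdiff (pol \<theta> h) \<phi> (pol \<theta> b))"
  unfolding coef_def
  by (rule pdiff_eq[OF has_derivative_param_integral[OF pol_linear pol_continuous cont_cis assms]])

lemma pdiff_lin: "smooth \<phi> \<Longrightarrow> pdiff (s *\<^sub>R u + t *\<^sub>R u') \<phi> v = of_real s * pdiff u \<phi> v + of_real t * pdiff u' \<phi> v"
  using linear_add[OF has_derivative_linear[OF smooth_has_derivative[of \<phi> v]], of "s *\<^sub>R u" "t *\<^sub>R u'"]
    linear_cmul[OF has_derivative_linear[OF smooth_has_derivative[of \<phi> v]]]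
  by (simp add: scaleR_conv_of_real)

lemma pdiff_coef_er:
  assumes "smooth \<phi>"
  shows "pdiff er (coef k \<phi>) b = integral {-pi/2..3*pi/2} (\<lambda>\<theta>. cis (of_int k * \<theta>) *
     (of_real (cos \<theta>) * pdiff ex \<phi> (pol \<theta> b) + of_real (sin \<theta>) * pdiff ey \<phi> (pol \<theta> b)))"
proof -
  have "pol \<theta> er = cos \<theta> *\<^sub>R ex + sin \<theta> *\<^sub>R ey" for \<theta> by (simp add: pol_def algebra_simps)
  then show ?thesis by (simp add: pdiff_coef[OF assms] pdiff_lin[OF assms])
qed

text \<open>The inner factor is the \<theta>-derivative of \<open>\<phi> (pol \<theta> b)\<close>,
  and the integral is taken over a full period. The boundary terms cancel because the frequency is
  an integer.\<close>

lemma coef_by_parts: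
  assumes "smooth \<phi>"
  shows "integral {-pi/2..3*pi/2} (\<lambda>\<theta>. cis (of_int k * \<theta>) * (of_real (R b) *
     (of_real (- sin \<theta>) * pdiff ex \<phi> (pol \<theta> b) + of_real (cos \<theta>) * pdiff ey \<phi> (pol \<theta> b)))) = - \<i> * of_int k * coef k \<phi> b"
proof -
  let ?f = "\<lambda>\<theta>. cis (of_int k * \<theta>) * \<phi> (pol \<theta> b)"
  let ?g = "\<lambda>\<theta>. cis (of_int k * \<theta>) * (of_real (R b) *
     (of_real (- sin \<theta>) * pdiff ex \<phi> (pol \<theta> b) + of_real (cos \<theta>) * pdiff ey \<phi> (pol \<theta> b)))"
  have D: "(?f has_vector_derivative \<i> * of_int k * ?f \<theta> + ?g \<theta>) (at \<theta> within S)" for \<theta> S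
  proof -
    have p: "((\<lambda>\<theta>. pol \<theta> b) has_vector_derivative ((R b * - sin \<theta>) *\<^sub>R ex + (R b * cos \<theta>) *\<^sub>R ey)) (at \<theta>)"
      unfolding pol_def has_vector_derivative_def by (auto intro!: derivative_eq_intros simp: algebra_simps)
    have "((\<lambda>\<theta>. \<phi> (pol \<theta> b)) has_derivative (\<lambda>s. pdiff (s *\<^sub>R ((R b * - sin \<theta>) *\<^sub>R ex + (R b * cos \<theta>) *\<^sub>R ey)) \<phi> (pol \<theta> b))) (at \<theta>)"
      using diff_chain_at[OF p[unfolded has_vector_derivative_def] smooth_has_derivative[OF assms]] by (simp add: o_def)
    then have 1: "((\<lambda>\<theta>. \<phi> (pol \<theta> b)) has_vector_derivative pdiff ((R b * - sin \<theta>) *\<^sub>R ex + (R b * cos \<theta>) *\<^sub>R ey) \<phi> (pol \<theta> b)) (at \<theta>)"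
      unfolding has_vector_derivative_def using linear_cmul[OF has_derivative_linear[OF smooth_has_derivative[OF assms]]] by simp
    have 2: "((\<lambda>\<theta>. cis (of_int k * \<theta>)) has_vector_derivative \<i> * of_int k * cis (of_int k * \<theta>)) (at \<theta>)"
    proof -
      have "((\<lambda>z. exp (\<i> * of_int k * z)) has_field_derivative \<i> * of_int k * exp (\<i> * of_int k * of_real \<theta>)) (at (of_real \<theta>))"
        by (auto intro!: derivative_eq_intros)
      from has_vector_derivative_real_field[OF this] show ?thesis
        by (simp add: cis_conv_exp mult_ac)
    qed
    show ?thesis
      by (rule has_vector_derivative_eq_rhs[OF has_vector_derivative_at_within[OF has_vector_derivative_mult[OF 2 1], of S, unfolded pdiff_lin[OF assms]]])
        (simp add: algebra_simps)
  qed
  have "((\<lambda>\<theta>. \<i> * of_int k * ?f \<theta> + ?g \<theta>) has_integral (?f (3*pi/2) - ?f (-pi/2))) {-pi/2..3*pi/2}"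
    by (rule fundamental_theorem_of_calculus) (use D in auto)
  moreover have "?f (3*pi/2) = ?f (-pi/2)"
  proof -
    have s: "3*pi/2 = -pi/2 + 2*pi" by simp
    have 1: "cos (-pi/2 + 2*pi) = cos (-pi/2)" "sin (-pi/2 + 2*pi) = sin (-pi/2)" using cos_periodic sin_periodic by blast+
    have "cis (of_int k * (-pi/2 + 2*pi)) = cis (of_int k * (-pi/2)) * cis (of_int k * (2 * pi))"
      by (subst cis_mult, rule arg_cong[of _ _ cis], simp only: ring_distribs)
    also have "cis (of_int k * (2 * pi)) = 1"
      using cis_multiple_2pi[of "of_int k"] by (simp add: mult_ac)
    finally have "cis (of_int k * (-pi/2 + 2*pi)) = cis (of_int k * (-pi/2))" by (simp only: mult_1_right)
    then show ?thesis unfolding s pol_def 1 by (simp only:)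
  qed
  ultimately have 0: "((\<lambda>\<theta>. \<i> * of_int k * ?f \<theta> + ?g \<theta>) has_integral 0) {-pi/2..3*pi/2}" by simp
  have "(?f has_integral coef k \<phi> b) {-pi/2..3*pi/2}"
    unfolding coef_def by (intro integrable_integral coef_integrable assms cont_cis)
  then have "((\<lambda>\<theta>. \<i> * of_int k * ?f \<theta>) has_integral \<i> * of_int k * coef k \<phi> b) {-pi/2..3*pi/2}"
    by (rule has_integral_mult_right)
  from has_integral_diff[OF 0 this] show ?thesis by (intro integral_unique) simp
qed

text \<open>In polar coordinates d_x + i d_y = e^(i \<theta>) (d_r + (i/r) d_\<theta>). The
  exponential turns the index k - 1 into k, and integration by parts turns the angular derivative
  into k/r. The second identity is the same for d_x - i d_y.\<close>

lemma coef_cart: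
  assumes "smooth \<phi>" "0 < R b"
  shows "coef (k - 1) (pdiff ex \<phi>) b + \<i> * coef (k - 1) (pdiff ey \<phi>) b = pdiff er (coef k \<phi>) b + of_int k / of_real (R b) * coef k \<phi> b"
    and "coef (k + 1) (pdiff ex \<phi>) b - \<i> * coef (k + 1) (pdiff ey \<phi>) b = pdiff er (coef k \<phi>) b - of_int k / of_real (R b) * coef k \<phi> b"
proof -
  let ?S = "{-pi/2..3*pi/2}"
  define a where "a \<theta> = pdiff ex \<phi> (pol \<theta> b)" for \<theta>
  define c where "c \<theta> = pdiff ey \<phi> (pol \<theta> b)" for \<theta>
  define e where "e \<theta> = cis (of_int k * \<theta>)" for \<theta>
  have i: "(\<lambda>\<theta>. g \<theta> * a \<theta>) integrable_on ?S" "(\<lambda>\<theta>. g \<theta> * c \<theta>) integrable_on ?S" if "continuous_on UNIV g" for g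
    unfolding a_def c_def using coef_integrable[OF smooth_pdiff[OF assms(1)] that] ex_Basis ey by auto
  have ce: "continuous_on UNIV (\<lambda>\<theta>. e \<theta> * of_real (cos \<theta>))" "continuous_on UNIV (\<lambda>\<theta>. e \<theta> * of_real (sin \<theta>))"
    "continuous_on UNIV (\<lambda>\<theta>. e \<theta> * of_real (- sin \<theta>))"
    unfolding e_def by (intro continuous_intros cont_cis)+
  \<comment> \<open>The moments of the two Cartesian derivatives against e cos and e sin. All
    quantities in the claim are combinations of these four numbers.\<close>
  define P where "P = integral ?S (\<lambda>\<theta>. e \<theta> * of_real (cos \<theta>) * a \<theta>)"
  define Q where "Q = integral ?S (\<lambda>\<theta>. e \<theta> * of_real (sin \<theta>) * a \<theta>)"
  define P' where "P' = integral ?S (\<lambda>\<theta>. e \<theta> * of_real (cos \<theta>) * c \<theta>)"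
  define Q' where "Q' = integral ?S (\<lambda>\<theta>. e \<theta> * of_real (sin \<theta>) * c \<theta>)"
  have h: "((\<lambda>\<theta>. e \<theta> * of_real (cos \<theta>) * a \<theta>) has_integral P) ?S" "((\<lambda>\<theta>. e \<theta> * of_real (sin \<theta>) * a \<theta>) has_integral Q) ?S"
    "((\<lambda>\<theta>. e \<theta> * of_real (cos \<theta>) * c \<theta>) has_integral P') ?S" "((\<lambda>\<theta>. e \<theta> * of_real (sin \<theta>) * c \<theta>) has_integral Q') ?S"
    unfolding P_def Q_def P'_def Q'_def using i ce by (auto intro!: integrable_integral)
  have D: "pdiff er (coef k \<phi>) b = P + Q'"
    unfolding pdiff_coef_er[OF assms(1)] a_def[symmetric] c_def[symmetric] e_def[symmetric]
    by (rule integral_unique) (use has_integral_add[OF h(1,4)] in \<open>simp add: algebra_simps\<close>)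
  have "integral ?S (\<lambda>\<theta>. e \<theta> * (of_real (R b) * (of_real (- sin \<theta>) * a \<theta> + of_real (cos \<theta>) * c \<theta>))) = of_real (R b) * (P' - Q)"
    by (rule integral_unique) (use has_integral_mult_right[OF has_integral_diff[OF h(3,2)], of "of_real (R b)"] in \<open>simp add: algebra_simps\<close>)
  with coef_by_parts[OF assms(1), of k b] have B: "of_int k / of_real (R b) * coef k \<phi> b = \<i> * (P' - Q)"
    using assms(2) unfolding a_def[symmetric] c_def[symmetric] e_def[symmetric]
    by (simp add: field_simps)
  have m: "cis (of_int (k - 1) * \<theta>) = e \<theta> * (of_real (cos \<theta>) - \<i> * of_real (sin \<theta>))"
    "cis (of_int (k + 1) * \<theta>) = e \<theta> * (of_real (cos \<theta>) + \<i> * of_real (sin \<theta>))" for \<theta>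
  proof -
    have "cis (of_int (k - 1) * \<theta>) = e \<theta> * cis (- \<theta>)" "cis (of_int (k + 1) * \<theta>) = e \<theta> * cis \<theta>"
      unfolding e_def cis_mult by (simp_all add: algebra_simps)
    then show "cis (of_int (k - 1) * \<theta>) = e \<theta> * (of_real (cos \<theta>) - \<i> * of_real (sin \<theta>))"
      "cis (of_int (k + 1) * \<theta>) = e \<theta> * (of_real (cos \<theta>) + \<i> * of_real (sin \<theta>))"
      by (simp_all add: complex_eq_iff)
  qed
  have cc: "coef (k - 1) (pdiff ex \<phi>) b = P - \<i> * Q" "coef (k - 1) (pdiff ey \<phi>) b = P' - \<i> * Q'"
    "coef (k + 1) (pdiff ex \<phi>) b = P + \<i> * Q" "coef (k + 1) (pdiff ey \<phi>) b = P' + \<i> * Q'"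
    unfolding coef_def m a_def[symmetric] c_def[symmetric]
    by (rule integral_unique, rule has_integral_eq[OF _ has_integral_diff[OF h(1) has_integral_mult_right[OF h(2), of \<i>]]], simp add: algebra_simps,
        rule integral_unique, rule has_integral_eq[OF _ has_integral_diff[OF h(3) has_integral_mult_right[OF h(4), of \<i>]]], simp add: algebra_simps,
        rule integral_unique, rule has_integral_eq[OF _ has_integral_add[OF h(1) has_integral_mult_right[OF h(2), of \<i>]]], simp add: algebra_simps,
        rule integral_unique, rule has_integral_eq[OF _ has_integral_add[OF h(3) has_integral_mult_right[OF h(4), of \<i>]]], simp add: algebra_simps)
  show "coef (k - 1) (pdiff ex \<phi>) b + \<i> * coef (k - 1) (pdiff ey \<phi>) b = pdiff er (coef k \<phi>) b + of_int k / of_real (R b) * coef k \<phi> b"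
    "coef (k + 1) (pdiff ex \<phi>) b - \<i> * coef (k + 1) (pdiff ey \<phi>) b = pdiff er (coef k \<phi>) b - of_int k / of_real (R b) * coef k \<phi> b"
    unfolding D B cc by (simp_all add: algebra_simps)
qed

lemma pdiff_avg_er:
  assumes "smooth \<phi>" "0 < R b"
  shows "pdiff er (avg k \<phi>) b = coef k \<phi> b + of_real (R b) * pdiff er (coef k \<phi>) b"
proof -
  have "pdiff er (avg k \<phi>) b = pdiff er (\<lambda>b. complex_of_real (R b) * coef k \<phi> b) b"
    using assms by (intro pdiff_cong[OF open_R_pos]) (auto simp: avg_def)
  also have "\<dots> = complex_of_real (R b) * pdiff er (coef k \<phi>) b + pdiff er (\<lambda>b. complex_of_real (R b)) b * coef k \<phi> b"
    using smooth_upto_at[OF smooth_upto_coef[OF assms(1), of 0]] smooth_upto_at[OF smooth_upto_R[of 0 UNIV]]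
    by (intro pdiff_mult) auto
  also have "pdiff er (\<lambda>b. complex_of_real (R b)) b = 1"
    by (subst pdiff_eq[where D="\<lambda>h. complex_of_real (R h)"]) (auto intro!: derivative_eq_intros)
  finally show ?thesis by simp
qed

text \<open>\<open>F\<close> and \<open>G\<close> are the averages of (d_x + i d_y) \<phi> and (d_x
  - i d_y) \<phi>. The factor k, where \<open>coef_cart\<close> would give k + 1 or k - 1, comes
  from moving the Jacobian under the derivative: r d_r c = d_r (r c) - c.\<close>

lemma avg_pdiff_cart:
  fixes k :: int
  assumes \<Omega>: "\<Omega> \<subseteq> {b. 0 < R b}" and \<phi>: "\<phi> \<in> test_functions (revolve \<Omega>)"
  defines "F \<equiv> \<lambda>b. pdiff er (avg (k + 1) \<phi>) b + of_int k * (of_real (1 / R b) * avg (k + 1) \<phi> b)"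
    and "G \<equiv> \<lambda>b. pdiff er (avg (k - 1) \<phi>) b - of_int k * (of_real (1 / R b) * avg (k - 1) \<phi> b)"
  shows "avg k (pdiff ex \<phi>) b = (F b + G b) / 2" and "avg k (pdiff ey \<phi>) b = (F b - G b) / (2 * \<i>)"
proof -
  have s: "smooth \<phi>" using \<phi> test_functionsE by metis
  have "avg k (pdiff ex \<phi>) b + \<i> * avg k (pdiff ey \<phi>) b = F b \<and> avg k (pdiff ex \<phi>) b - \<i> * avg k (pdiff ey \<phi>) b = G b"
  proof (cases "0 < R b")
    case True
    note c1 = coef_cart(1)[OF s True, of "k + 1"] and c2 = coef_cart(2)[OF s True, of "k - 1"]
    have "of_real (R b) * (coef k (pdiff ex \<phi>) b + \<i> * coef k (pdiff ey \<phi>) b) = F b"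
      using c1 True by (simp add: F_def pdiff_avg_er[OF s True] avg_def field_simps)
    moreover have "of_real (R b) * (coef k (pdiff ex \<phi>) b - \<i> * coef k (pdiff ey \<phi>) b) = G b"
      using c2 True by (simp add: G_def pdiff_avg_er[OF s True] avg_def field_simps)
    ultimately show ?thesis using True by (simp add: avg_def algebra_simps)
  next
    case False
    have "pdiff er (avg l \<phi>) b = 0" for l
      using test_zero_outside[OF test_pdiff[OF avg_test[OF \<Omega> \<phi>] er], of b l] False \<Omega> by auto
    then show ?thesis using False by (simp add: F_def G_def avg_def)
  qed
  then have FG: "F b = avg k (pdiff ex \<phi>) b + \<i> * avg k (pdiff ey \<phi>) b" "G b = avg k (pdiff ex \<phi>) b - \<i> * avg k (pdiff ey \<phi>) b"
    by auto
  show "avg k (pdiff ex \<phi>) b = (F b + G b) / 2" "avg k (pdiff ey \<phi>) b = (F b - G b) / (2 * \<i>)"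
    unfolding FG by simp_all
qed

lemma avg_pdiff_other:
  assumes \<Omega>: "\<Omega> \<subseteq> {b. 0 < R b}" and \<phi>: "\<phi> \<in> test_functions (revolve \<Omega>)" and e: "e \<in> Basis" "e \<noteq> er"
  shows "avg k (pdiff (J e) \<phi>) b = pdiff e (avg k \<phi>) b"
proof (cases "0 < R b")
  case True
  have s: "smooth \<phi>" using \<phi> test_functionsE by metis
  have Re: "e \<bullet> er = 0" using e er by (simp add: inner_Basis)
  have "pol \<theta> e = J e" for \<theta> by (simp add: pol_def Re)
  then have c: "pdiff e (coef k \<phi>) b = coef k (pdiff (J e) \<phi>) b"
    by (simp add: pdiff_coef[OF s]) (simp add: coef_def)
  have "pdiff e (avg k \<phi>) b = pdiff e (\<lambda>b. complex_of_real (R b) * coef k \<phi> b) b"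
    using True by (intro pdiff_cong[OF open_R_pos]) (auto simp: avg_def)
  also have "\<dots> = complex_of_real (R b) * pdiff e (coef k \<phi>) b + pdiff e (\<lambda>b. complex_of_real (R b)) b * coef k \<phi> b"
    using smooth_upto_at[OF smooth_upto_coef[OF s, of 0]] smooth_upto_at[OF smooth_upto_R[of 0 UNIV]]
    by (intro pdiff_mult) auto
  also have "pdiff e (\<lambda>b. complex_of_real (R b)) b = 0"
    by (subst pdiff_eq[where D="\<lambda>h. complex_of_real (R h)"]) (auto intro!: derivative_eq_intros simp: Re)
  finally have "pdiff e (avg k \<phi>) b = complex_of_real (R b) * pdiff e (coef k \<phi>) b" by simp
  moreover have "avg k (pdiff (J e) \<phi>) b = complex_of_real (R b) * coef k (pdiff (J e) \<phi>) b"
    using True by (simp add: avg_def)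
  ultimately show ?thesis using c by simp
next
  case False
  have "pdiff e (avg k \<phi>) b = 0"
    using test_zero_outside[OF test_pdiff[OF avg_test[OF \<Omega> \<phi>] e(1)], of b k] False \<Omega> by auto
  then show ?thesis using False by (simp add: avg_def)
qed

end

section \<open>Angular lifts of functions and distributions\<close>

lemma lebesgue_measurable_AE:
  fixes f g :: "'a::euclidean_space \<Rightarrow> complex"
  assumes g: "g \<in> borel_measurable borel" and ae: "AE x in lborel. f x = g x"
  shows "f \<in> borel_measurable lebesgue"
proof (rule measurableI)
  fix A :: "complex set" assume A: "A \<in> sets borel"
  have 1: "{x. f x \<noteq> g x \<and> f x \<in> A} \<in> sets lebesgue"
    using sets_completion_AE[where M = lborel and P = "\<lambda>x. f x \<noteq> g x \<and> f x \<in> A"] AE_mp[OF ae] by (auto simp: pred_def)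
  have 2: "{x. f x \<noteq> g x} \<in> sets lebesgue"
    using sets_completion_AE[where M = lborel and P = "\<lambda>x. f x \<noteq> g x"] ae by (auto simp: pred_def)
  have 3: "g -` A \<in> sets lebesgue" using measurable_sets[OF measurable_completion, of g lborel borel A] g A by simp
  have "f -` A \<inter> space lebesgue = {x. f x \<noteq> g x \<and> f x \<in> A} \<union> (g -` A - {x. f x \<noteq> g x})" by auto
  then show "f -` A \<inter> space lebesgue \<in> sets lebesgue" using 1 2 3 by auto
qed simp

lemma lebesgue_on_measurable_AE:
  fixes f g :: "'a::euclidean_space \<Rightarrow> complex"
  assumes "\<Omega> \<in> sets borel" "g \<in> borel_measurable borel" "AE x in lborel. x \<in> \<Omega> \<longrightarrow> f x = g x"
  shows "f \<in> borel_measurable (lebesgue_on \<Omega>)"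
proof -
  have "(\<lambda>x. indicator \<Omega> x *\<^sub>R f x) \<in> borel_measurable lebesgue"
  proof (rule lebesgue_measurable_AE)
    show "(\<lambda>x. indicator \<Omega> x *\<^sub>R g x) \<in> borel_measurable borel" using assms by measurable
    show "AE x in lborel. indicator \<Omega> x *\<^sub>R f x = indicator \<Omega> x *\<^sub>R g x"
      using assms(3) by eventually_elim (auto simp: indicator_def)
  qed
  then show ?thesis using assms(1) by (subst borel_measurable_restrict_space_iff) auto
qed

lemma distr_of_borel_version:
  fixes f g :: "'a::euclidean_space \<Rightarrow> complex"
  assumes "\<Omega> \<in> sets borel" "g \<in> borel_measurable borel" "AE x in lborel. x \<in> \<Omega> \<longrightarrow> f x = g x"
    "\<phi> \<in> test_functions \<Omega>"
  shows "distr_of \<Omega> f \<phi> = (\<integral>x. g x * \<phi> x \<partial>lborel)"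
  using distr_of_cong_AE[OF assms(1,3) lebesgue_on_measurable_AE[OF assms(1-3)]
      borel_measurable_lebesgue_on[OF assms(2)] test_measurable[OF assms(4)]]
    distr_of_lborel[OF assms(1,2,4)] by simp

lemma distr_of_restrict:
  fixes f :: "'a::euclidean_space \<Rightarrow> complex"
  assumes "U \<in> sets borel" "D \<in> sets borel" "U \<subseteq> D" "\<phi> \<in> test_functions U"
  shows "distr_of D f \<phi> = distr_of U f \<phi>"
proof -
  have "distr_of D f \<phi> = (\<integral>x. indicator D x *\<^sub>R (f x * \<phi> x) \<partial>lebesgue)"
    unfolding distr_of_def using assms by (intro integral_restrict_space) auto
  also have "\<dots> = (\<integral>x. indicator U x *\<^sub>R (f x * \<phi> x) \<partial>lebesgue)"
    using test_zero_outside[OF assms(4)] assms(3) by (intro Bochner_Integration.integral_cong) (auto split: split_indicator)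
  also have "\<dots> = distr_of U f \<phi>"
    unfolding distr_of_def using assms by (intro integral_restrict_space[symmetric]) auto
  finally show ?thesis .
qed

lemma power_int_measurable [measurable]:
  fixes f :: "'a \<Rightarrow> complex"
  assumes [measurable]: "f \<in> borel_measurable M"
  shows "(\<lambda>x. f x powi k) \<in> borel_measurable M"
  unfolding power_int_def by (cases "0 \<le> k") simp_all

lemma integral_cis_period:
  "((\<lambda>\<theta>. cis (of_int m * \<theta>)) has_integral (if m = 0 then 2 * pi else 0)) {-pi/2..3*pi/2}"
proof (cases "m = 0")
  case True
  then show ?thesis
    using has_integral_const_real[of "1::complex" "-pi/2" "3*pi/2"] by (simp add: scaleR_conv_of_real field_simps)
next
  case False
  let ?F = "\<lambda>\<theta>. cis (of_int m * \<theta>) / (\<i> * of_int m)"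
  have "(?F has_vector_derivative cis (of_int m * \<theta>)) (at \<theta> within S)" for \<theta> S
  proof -
    have "((\<lambda>z. exp (\<i> * of_int m * z) / (\<i> * of_int m)) has_field_derivative exp (\<i> * of_int m * of_real \<theta>)) (at (of_real \<theta>))"
      using False by (auto intro!: derivative_eq_intros)
    from has_vector_derivative_real_field[OF this] show ?thesis
      by (simp add: cis_conv_exp mult_ac)
  qed
  then have "((\<lambda>\<theta>. cis (of_int m * \<theta>)) has_integral ?F (3*pi/2) - ?F (-pi/2)) {-pi/2..3*pi/2}"
    by (intro fundamental_theorem_of_calculus) auto
  moreover have "cis (of_int m * (3*pi/2)) = cis (of_int m * (-pi/2))"
  proof -
    have "of_int m * (3*pi/2) = of_int m * (-pi/2) + of_int m * (2*pi)" by (simp add: algebra_simps)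
    then have "cis (of_int m * (3*pi/2)) = cis (of_int m * (-pi/2)) * cis (of_int m * (2*pi))" by (simp only: cis_mult)
    also have "cis (of_int m * (2 * pi)) = 1" using cis_multiple_2pi[of "of_int m"] by (simp add: mult_ac)
    finally show ?thesis by (simp only: mult_1_right)
  qed
  ultimately show ?thesis using False by simp
qed

section \<open>Lifting functions and distributions to the rotated domain\<close>

context cylindrical
begin

lemma coef_lift:
  fixes c :: complex
  assumes "0 < R b"
  shows "integral {-pi/2..3*pi/2} (\<lambda>\<theta>. cis (of_int k * \<theta>) * (dir (pol \<theta> b) powi l * c)) = (if k + l = 0 then 2 * pi * c else 0)"
proof -
  have eq: "cis (of_int k * \<theta>) * (dir (pol \<theta> b) powi l * c) = cis (of_int (k + l) * \<theta>) * c" for \<theta>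
    using assms by (simp add: dir_pol cis_power_int cis_mult[symmetric] ring_distribs)
  show ?thesis
    unfolding eq integral_unique[OF has_integral_mult_left[OF integral_cis_period[of "k + l"], of c]] by simp
qed

text \<open>A power of the unit vector \<open>dir\<close> plays the part of e^(ik \<theta>): it is
  smooth off the axis, whereas an argument function jumps.\<close>

definition lift_fun :: "int \<Rightarrow> ('b \<Rightarrow> complex) \<Rightarrow> 'a \<Rightarrow> complex" where
  "lift_fun k w v = dir v powi k * w (rad v)"

lemma lift_fun_pol: "0 < R b \<Longrightarrow> lift_fun k w (pol \<theta> b) = cis (of_int k * \<theta>) * w b"
  by (simp add: lift_fun_def dir_pol rad_pol cis_power_int)

lemma pol_measurable [measurable]: "(\<lambda>(b, \<theta>). pol \<theta> b) \<in> borel_measurable (borel \<Otimes>\<^sub>M borel)"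
  unfolding borel_prod split_beta
  by (intro borel_measurable_continuous_onI continuous_pol continuous_intros)

lemma rad_measurable [measurable]: "rad \<in> borel_measurable borel"
  by (intro borel_measurable_continuous_onI continuous_rad)

lemma dir_measurable [measurable]: "dir \<in> borel_measurable borel"
proof -
  have [measurable]: "rho \<in> borel_measurable borel" by (intro borel_measurable_continuous_onI continuous_rho)
  show ?thesis unfolding dir_def Complex_eq by measurable
qed

lemma lift_fun_measurable [measurable]:
  "w \<in> borel_measurable borel \<Longrightarrow> lift_fun k w \<in> borel_measurable borel"
  unfolding lift_fun_def by (intro borel_measurable_times power_int_measurable dir_measurable measurable_compose[OF rad_measurable])

definition wt :: "'b \<Rightarrow> real \<Rightarrow> real" where
  "wt b \<theta> = R b * indicator {0<..} (R b) * indicator {-pi/2..3*pi/2} \<theta>"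

lemma wt_nonneg: "0 \<le> wt b \<theta>" by (simp add: wt_def indicator_def)

lemma wt_measurable [measurable]: "(\<lambda>(b, \<theta>). wt b \<theta>) \<in> borel_measurable (borel \<Otimes>\<^sub>M borel)"
  unfolding wt_def by measurable

lemma wt_pos: "wt b \<theta> \<noteq> 0 \<Longrightarrow> 0 < R b"
  by (auto simp: wt_def indicator_def split: if_splits)

lemma nn_cyl:
  assumes "f \<in> borel_measurable borel"
  shows "(\<integral>\<^sup>+v. f v \<partial>lborel) = (\<integral>\<^sup>+b. \<integral>\<^sup>+\<theta>. ennreal (wt b \<theta>) * f (pol \<theta> b) \<partial>lborel \<partial>lborel)"
  unfolding nn_integral_cyl[OF assms] pol_def wt_def
  by (intro nn_integral_cong) (auto simp: indicator_def)

text \<open>The coordinate formula for nonnegative functions says that Lebesgue measure is an image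
  measure. In this form it carries over to Bochner integrals.\<close>

lemma lborel_eq_distr:
  "lborel = distr (density (lborel \<Otimes>\<^sub>M lborel) (\<lambda>x. ennreal (wt (fst x) (snd x)))) borel (\<lambda>x. pol (snd x) (fst x))"
    (is "_ = distr (density ?M ?w) _ ?p")
proof (rule measure_eqI)
  fix A :: "'a set" assume "A \<in> sets lborel"
  then have [measurable]: "A \<in> sets borel" by simp
  have [measurable]: "?p \<in> borel_measurable ?M" "(\<lambda>x. wt (fst x) (snd x)) \<in> borel_measurable ?M"
    using pol_measurable wt_measurable by (simp_all add: split_beta)
  have "emeasure (distr (density ?M ?w) borel ?p) A = (\<integral>\<^sup>+v. indicator A v \<partial>distr (density ?M ?w) borel ?p)" by simp
  also have "\<dots> = (\<integral>\<^sup>+x. indicator A (?p x) \<partial>density ?M ?w)" by (rule nn_integral_distr) measurable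
  also have "\<dots> = (\<integral>\<^sup>+x. ?w x * indicator A (?p x) \<partial>?M)" by (rule nn_integral_density) measurable
  also have "\<dots> = (\<integral>\<^sup>+b. \<integral>\<^sup>+\<theta>. ennreal (wt b \<theta>) * indicator A (pol \<theta> b) \<partial>lborel \<partial>lborel)"
    by (subst lborel.nn_integral_fst[symmetric]) auto
  also have "\<dots> = (\<integral>\<^sup>+v. indicator A v \<partial>lborel)" by (rule nn_cyl[symmetric]) measurable
  also have "\<dots> = emeasure lborel A" by simp
  finally show "emeasure lborel A = emeasure (distr (density ?M ?w) borel ?p) A" ..
qed simp

lemma integral_cyl:
  fixes F :: "'a \<Rightarrow> complex"
  assumes F: "integrable lborel F"
  shows "(\<integral>v. F v \<partial>lborel) = (\<integral>b. (\<integral>\<theta>. wt b \<theta> *\<^sub>R F (pol \<theta> b) \<partial>lborel) \<partial>lborel)"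
proof -
  let ?M = "lborel \<Otimes>\<^sub>M lborel :: ('b \<times> real) measure"
  let ?p = "\<lambda>x. pol (snd x) (fst x)" and ?w = "\<lambda>x. wt (fst x) (snd x)"
  have [measurable]: "?p \<in> borel_measurable ?M" "?w \<in> borel_measurable ?M"
    using pol_measurable wt_measurable by (simp_all add: split_beta)
  have Fm [measurable]: "F \<in> borel_measurable borel" using F by auto
  have L: "lborel = distr (density ?M ?w) borel ?p"
    by (rule lborel_eq_distr)
  have "integrable (distr (density ?M ?w) borel ?p) F" using F L by simp
  then have "integrable (density ?M ?w) (\<lambda>x. F (?p x))" by (subst (asm) integrable_distr_eq) auto
  then have i: "integrable ?M (\<lambda>x. ?w x *\<^sub>R F (?p x))"
    by (subst (asm) integrable_density) (auto simp: wt_nonneg)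
  have "(\<integral>v. F v \<partial>lborel) = (\<integral>v. F v \<partial>distr (density ?M ?w) borel ?p)" using L by simp
  also have "\<dots> = (\<integral>x. F (?p x) \<partial>density ?M ?w)" by (rule integral_distr) auto
  also have "\<dots> = (\<integral>x. ?w x *\<^sub>R F (?p x) \<partial>?M)" by (rule integral_density) (auto simp: wt_nonneg)
  also have "\<dots> = (\<integral>b. (\<integral>\<theta>. wt b \<theta> *\<^sub>R F (pol \<theta> b) \<partial>lborel) \<partial>lborel)"
    using lborel_pair.integral_fst'[OF i] by simp
  finally show ?thesis .
qed

lemma integral_wt_avg:
  assumes "smooth \<phi>"
  shows "(\<integral>\<theta>. wt b \<theta> *\<^sub>R (cis (of_int k * \<theta>) * \<phi> (pol \<theta> b)) \<partial>lborel) = avg k \<phi> b"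
proof (cases "0 < R b")
  case True
  let ?g = "\<lambda>\<theta>. cis (of_int k * \<theta>) * \<phi> (pol \<theta> b)"
  have c: "continuous_on {-pi/2..3*pi/2} ?g"
    by (intro continuous_on_mult cont_cis continuous_on_compose2[OF smooth_continuous[OF assms, of UNIV]]
        continuous_pol continuous_on_id continuous_on_const) auto
  have "set_integrable lborel {-pi/2..3*pi/2} ?g"
    unfolding set_integrable_def by (rule borel_integrable_compact[OF _ c]) simp
  from set_borel_integral_eq_integral(2)[OF this]
  have "(\<integral>\<theta>. indicator {-pi/2..3*pi/2} \<theta> *\<^sub>R ?g \<theta> \<partial>lborel) = coef k \<phi> b"
    by (simp add: set_lebesgue_integral_def coef_def)
  then have "(\<integral>\<theta>. R b *\<^sub>R (indicator {-pi/2..3*pi/2} \<theta> *\<^sub>R ?g \<theta>) \<partial>lborel) = R b *\<^sub>R coef k \<phi> b"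
    by (simp only: integral_scaleR_right)
  then show ?thesis using True by (simp add: wt_def avg_def scaleR_conv_of_real mult.assoc)
qed (simp add: wt_def avg_def)

abbreviation "wR \<equiv> \<lambda>b. 2 * pi * R b"

lemma pos_weight_one: "pos_weight D (\<lambda>_. 1)" by (simp add: pos_weight_def)

lemma pos_weight_wR: "\<Omega> \<subseteq> {b. 0 < R b} \<Longrightarrow> pos_weight \<Omega> wR"
  by (auto simp: pos_weight_def intro!: continuous_intros)

lemma nn_integral_wt: "0 < R b \<Longrightarrow> (\<integral>\<^sup>+\<theta>. ennreal (wt b \<theta>) * c \<partial>lborel) = ennreal (wR b) * c"
proof -
  assume b: "0 < R b"
  have "(\<integral>\<^sup>+\<theta>. ennreal (wt b \<theta>) * c \<partial>lborel) = (\<integral>\<^sup>+\<theta>. (ennreal (R b) * c) * indicator {-pi/2..3*pi/2} \<theta> \<partial>lborel)"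
    using b by (intro nn_integral_cong) (auto simp: wt_def indicator_def)
  also have "\<dots> = (ennreal (R b) * c) * emeasure lborel {-pi/2..3*pi/2}"
    by (simp add: nn_integral_cmult_indicator)
  also have "emeasure lborel {-pi/2..3*pi/2} = ennreal (2 * pi)" by simp
  finally show ?thesis using b by (simp add: ennreal_mult' mult_ac)
qed

lemma L2_sq_lift_fun:
  assumes \<Omega>: "open \<Omega>" "\<Omega> \<subseteq> {b. 0 < R b}" and w [measurable]: "w \<in> borel_measurable borel"
  shows "L2_sq (revolve \<Omega>) (\<lambda>_. 1) (lift_fun k w) = L2_sq \<Omega> wR w"
proof -
  have [measurable]: "\<Omega> \<in> sets borel" "revolve \<Omega> \<in> sets borel" using \<Omega> open_revolve by auto
  have "L2_sq (revolve \<Omega>) (\<lambda>_. 1) (lift_fun k w) =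
    (\<integral>\<^sup>+v. ennreal (1 * (norm (lift_fun k w v))\<^sup>2) * indicator (revolve \<Omega>) v \<partial>lborel)" by (rule L2_sq_lborel) simp
  also have "\<dots> = (\<integral>\<^sup>+b. \<integral>\<^sup>+\<theta>. ennreal (wt b \<theta>) * (ennreal (1 * (norm (lift_fun k w (pol \<theta> b)))\<^sup>2) * indicator (revolve \<Omega>) (pol \<theta> b)) \<partial>lborel \<partial>lborel)"
    by (rule nn_cyl) measurable
  also have "\<dots> = (\<integral>\<^sup>+b. ennreal (wR b * (norm (w b))\<^sup>2) * indicator \<Omega> b \<partial>lborel)"
  proof (rule nn_integral_cong)
    fix b
    show "(\<integral>\<^sup>+\<theta>. ennreal (wt b \<theta>) * (ennreal (1 * (norm (lift_fun k w (pol \<theta> b)))\<^sup>2) * indicator (revolve \<Omega>) (pol \<theta> b)) \<partial>lborel)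
      = ennreal (wR b * (norm (w b))\<^sup>2) * indicator \<Omega> b"
    proof (cases "0 < R b")
      case True
      have ind: "indicator (revolve \<Omega>) (pol \<theta> b) = (indicator \<Omega> b :: ennreal)" for \<theta>
        using pol_in_revolve[OF True] by (simp add: indicator_def)
      show ?thesis using nn_integral_wt[OF True, of "ennreal ((norm (w b))\<^sup>2) * indicator \<Omega> b"] True
        by (simp add: ind lift_fun_pol norm_mult ennreal_mult' mult_ac)
    next
      case False
      then show ?thesis using \<Omega> by (auto simp: wt_def indicator_def)
    qed
  qed
  also have "\<dots> = L2_sq \<Omega> wR w" by (rule L2_sq_lborel[symmetric]) simp
  finally show ?thesis .
qed

text \<open>Fubini in cylindrical coordinates: \<open>w b\<close> leaves the angular integral, and
  what remains inside is \<open>avg k \<phi> b\<close>.\<close>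

lemma integral_lift_fun:
  assumes \<Omega>: "open \<Omega>" "\<Omega> \<subseteq> {b. 0 < R b}" and w [measurable]: "w \<in> borel_measurable borel"
    and fin: "L2_sq \<Omega> wR w < \<infinity>" and \<phi>: "\<phi> \<in> test_functions (revolve \<Omega>)"
  shows "(\<integral>v. lift_fun k w v * \<phi> v \<partial>lborel) = (\<integral>b. w b * avg k \<phi> b \<partial>lborel)"
proof -
  have s: "smooth \<phi>" using \<phi> test_functionsE by metis
  have rb: "revolve \<Omega> \<in> sets borel" using open_revolve[OF \<Omega>(1)] by simp
  have "integrable lborel (\<lambda>v. lift_fun k w v * \<phi> v)"
    using fin w by (intro L2_integrable_test[OF rb pos_weight_one \<phi>]) (auto simp: L2_sq_lift_fun[OF \<Omega> w])
  from integral_cyl[OF this]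
  have "(\<integral>v. lift_fun k w v * \<phi> v \<partial>lborel) = (\<integral>b. (\<integral>\<theta>. wt b \<theta> *\<^sub>R (lift_fun k w (pol \<theta> b) * \<phi> (pol \<theta> b)) \<partial>lborel) \<partial>lborel)" .
  also have "\<dots> = (\<integral>b. (\<integral>\<theta>. w b * (wt b \<theta> *\<^sub>R (cis (of_int k * \<theta>) * \<phi> (pol \<theta> b))) \<partial>lborel) \<partial>lborel)"
  proof (intro Bochner_Integration.integral_cong refl)
    fix b \<theta>
    show "wt b \<theta> *\<^sub>R (lift_fun k w (pol \<theta> b) * \<phi> (pol \<theta> b)) = w b * (wt b \<theta> *\<^sub>R (cis (of_int k * \<theta>) * \<phi> (pol \<theta> b)))"
      using lift_fun_pol[of b k w \<theta>] wt_pos[of b \<theta>] by (cases "wt b \<theta> = 0") auto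
  qed
  also have "\<dots> = (\<integral>b. w b * avg k \<phi> b \<partial>lborel)"
    by (simp only: integral_mult_right_zero integral_wt_avg[OF s])
  finally show ?thesis .
qed

text \<open>The distribution \<open>e\<^sup>i\<^sup>k\<^sup>\<theta> T\<close>; the Jacobian \<open>r\<close> is part of \<open>avg\<close>.\<close>

definition cyl_lift :: "int \<Rightarrow> 'b distr \<Rightarrow> 'a distr" where
  "cyl_lift k T \<phi> = T (avg k \<phi>)"

text \<open>A representative of \<open>T\<close> lifts to one of the lifted distribution with the
  same norm, as |e^(ik \<theta>)| = 1. For linear \<open>T\<close> the reverse inequality is a case
  of \<open>cyl_component_norm\<close>.\<close>

lemma distr_L2_sq_cyl_lift_le:
  assumes \<Omega>: "open \<Omega>" "\<Omega> \<subseteq> {b. 0 < R b}"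
  shows "distr_L2_sq (revolve \<Omega>) (\<lambda>_. 1) (cyl_lift k T) \<le> distr_L2_sq \<Omega> wR T"
  unfolding distr_L2_sq_eq_INF[OF open_revolve[OF \<Omega>(1)] pos_weight_one] distr_L2_sq_eq_INF[OF \<Omega>(1) pos_weight_wR[OF \<Omega>(2)]]
proof (rule INF_mono)
  fix g assume g: "g \<in> L2_reps \<Omega> wR T"
  then have [measurable]: "g \<in> borel_measurable borel" by (simp add: L2_reps_def)
  have L: "L2_sq (revolve \<Omega>) (\<lambda>_. 1) (lift_fun k g) = L2_sq \<Omega> wR g" by (rule L2_sq_lift_fun[OF \<Omega>]) simp
  have "lift_fun k g \<in> L2_reps (revolve \<Omega>) (\<lambda>_. 1) (cyl_lift k T)"
    using g L avg_test[OF \<Omega>(2)] integral_lift_fun[OF \<Omega>] by (simp add: L2_reps_def cyl_lift_def)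
  then show "\<exists>h\<in>L2_reps (revolve \<Omega>) (\<lambda>_. 1) (cyl_lift k T). L2_sq (revolve \<Omega>) (\<lambda>_. 1) h \<le> L2_sq \<Omega> wR g"
    using L by (intro bexI[of _ "lift_fun k g"]) auto
qed

text \<open>Inside the rotated domain \<open>rad\<close> pulls null sets back to null sets: in
  cylindrical coordinates the preimage lies over the null set for every angle. The exceptional set
  is enlarged to a Borel one so that its preimage can be measured.\<close>

lemma lift_fun_cong_AE:
  assumes ae: "AE x in lborel. x \<in> \<Omega> \<longrightarrow> w x = w' x" and \<Omega>: "open \<Omega>"
  shows "AE v in lborel. v \<in> revolve \<Omega> \<longrightarrow> lift_fun k w v = lift_fun k w' v"
proof -
  have rb [measurable]: "revolve \<Omega> \<in> sets borel" using \<Omega> open_revolve by auto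
  obtain N where N: "N \<in> null_sets lborel" "{x. \<not> (x \<in> \<Omega> \<longrightarrow> w x = w' x)} \<subseteq> N"
    using ae by (auto elim!: AE_E simp: null_sets_def)
  then have [measurable]: "N \<in> sets borel" by auto
  show ?thesis
  proof (rule AE_I')
    have "emeasure lborel (revolve \<Omega> \<inter> rad -` N) = (\<integral>\<^sup>+v. indicator (revolve \<Omega> \<inter> rad -` N) v \<partial>lborel)"
      using measurable_sets[OF rad_measurable, of N] by simp
    also have "\<dots> = (\<integral>\<^sup>+b. \<integral>\<^sup>+\<theta>. ennreal (wt b \<theta>) * indicator (revolve \<Omega> \<inter> rad -` N) (pol \<theta> b) \<partial>lborel \<partial>lborel)"
      using measurable_sets[OF rad_measurable, of N] by (intro nn_cyl) simp
    also have "\<dots> \<le> (\<integral>\<^sup>+b. \<infinity> * indicator N b \<partial>lborel)"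
    proof (rule nn_integral_mono)
      fix b
      show "(\<integral>\<^sup>+\<theta>. ennreal (wt b \<theta>) * indicator (revolve \<Omega> \<inter> rad -` N) (pol \<theta> b) \<partial>lborel) \<le> \<infinity> * indicator N b"
      proof (cases "b \<in> N")
        case False
        have "ennreal (wt b \<theta>) * indicator (revolve \<Omega> \<inter> rad -` N) (pol \<theta> b) = 0" for \<theta>
          using wt_pos[of b \<theta>] rad_pol[of b \<theta>] False by (cases "wt b \<theta> = 0") auto
        then have "(\<integral>\<^sup>+\<theta>. ennreal (wt b \<theta>) * indicator (revolve \<Omega> \<inter> rad -` N) (pol \<theta> b) \<partial>lborel) = (\<integral>\<^sup>+\<theta>. 0 \<partial>(lborel :: real measure))"
          by (simp only:)
        then show ?thesis by simp
      qed simp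
    qed
    also have "\<dots> = 0" using N(1) by (simp add: nn_integral_cmult_indicator null_sets_def)
    finally show "revolve \<Omega> \<inter> rad -` N \<in> null_sets lborel"
      using measurable_sets[OF rad_measurable, of N] by (simp add: null_sets_def)
    show "{v \<in> space lborel. \<not> (v \<in> revolve \<Omega> \<longrightarrow> lift_fun k w v = lift_fun k w' v)} \<subseteq> revolve \<Omega> \<inter> rad -` N"
      using N(2) by (auto simp: lift_fun_def revolve_def)
  qed
qed

lemma cyl_lift_distr_of:
  assumes \<Omega>: "open \<Omega>" "\<Omega> \<subseteq> {b. 0 < R b}" and w: "w \<in> borel_measurable (lebesgue_on \<Omega>)" "L2_sq \<Omega> wR w < \<infinity>"
    and \<phi>: "\<phi> \<in> test_functions (revolve \<Omega>)" and u: "\<And>v. v \<in> revolve \<Omega> \<Longrightarrow> u v = lift_fun k w v"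
  shows "cyl_lift k (distr_of \<Omega> w) \<phi> = distr_of (revolve \<Omega>) u \<phi>"
proof -
  have \<Omega>b [measurable]: "\<Omega> \<in> sets borel" and rb [measurable]: "revolve \<Omega> \<in> sets borel" using \<Omega> open_revolve by auto
  obtain w' where [measurable]: "w' \<in> borel_measurable borel" and ae: "AE x in lborel. x \<in> \<Omega> \<longrightarrow> w x = w' x"
    using lebesgue_on_borel_version[OF \<Omega>b w(1)] by metis
  have "AE v in lborel. v \<in> revolve \<Omega> \<longrightarrow> u v = lift_fun k w' v"
    using lift_fun_cong_AE[OF ae \<Omega>(1), of k] by eventually_elim (simp add: u)
  then have "distr_of (revolve \<Omega>) u \<phi> = (\<integral>v. lift_fun k w' v * \<phi> v \<partial>lborel)"
    using \<phi> by (intro distr_of_borel_version) auto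
  also have "\<dots> = (\<integral>b. w' b * avg k \<phi> b \<partial>lborel)"
    using w(2) L2_sq_cong_AE[OF \<Omega>b ae] by (intro integral_lift_fun[OF \<Omega> _ _ \<phi>]) auto
  also have "\<dots> = distr_of \<Omega> w (avg k \<phi>)"
    by (rule distr_of_borel_version[OF \<Omega>b _ ae avg_test[OF \<Omega>(2) \<phi>], symmetric]) simp
  finally show ?thesis by (simp add: cyl_lift_def)
qed

text \<open>The square of \<open>rho\<close> is a polynomial, positive off the axis, so all powers
  of \<open>rho\<close> are compositions with \<open>powr\<close> on the positive half line.\<close>

lemma smooth_upto_rho_powr: "smooth_upto n off_axis (\<lambda>v. complex_of_real (((v \<bullet> ex)\<^sup>2 + (v \<bullet> ey)\<^sup>2) powr a))"
proof (rule smooth_upto_compose[OF open_off_axis open_greaterThan _ _ smooth_upto_powr])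
  show "(\<lambda>v. (v \<bullet> ex)\<^sup>2 + (v \<bullet> ey)\<^sup>2) ` off_axis \<subseteq> {0<..}"
    by (auto simp: off_axis_def rho_def)
  show "smooth_upto n off_axis (\<lambda>x. complex_of_real (((x \<bullet> ex)\<^sup>2 + (x \<bullet> ey)\<^sup>2) \<bullet> b))" if "b \<in> Basis" for b n
    using that by (auto intro!: smooth_upto_add smooth_upto_power open_off_axis smooth_upto_inner)
qed

lemma smooth_upto_rho: "smooth_upto n off_axis (\<lambda>v. complex_of_real (rho v))"
proof (rule iffD2[OF smooth_upto_cong[OF open_off_axis] smooth_upto_rho_powr[of n "1/2"]])
  fix v assume "v \<in> off_axis"
  show "complex_of_real (rho v) = complex_of_real (((v \<bullet> ex)\<^sup>2 + (v \<bullet> ey)\<^sup>2) powr (1/2))"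
    by (simp add: rho_def powr_half_sqrt)
qed

lemma smooth_upto_dir: "smooth_upto n off_axis dir" "smooth_upto n off_axis (\<lambda>v. cnj (dir v))"
proof -
  have inv: "1 / rho v = ((v \<bullet> ex)\<^sup>2 + (v \<bullet> ey)\<^sup>2) powr (-1/2)" if "v \<in> off_axis" for v
    using that by (simp add: rho_def powr_minus_divide powr_half_sqrt)
  have "smooth_upto n off_axis (\<lambda>v. (complex_of_real (v \<bullet> ex) + c * complex_of_real (v \<bullet> ey)) * complex_of_real (((v \<bullet> ex)\<^sup>2 + (v \<bullet> ey)\<^sup>2) powr (-1/2)))" for c
    by (intro smooth_upto_mult smooth_upto_add open_off_axis smooth_upto_inner smooth_upto_rho_powr smooth_upto_const)
  note 1 = this
  show "smooth_upto n off_axis dir"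
    by (rule iffD2[OF smooth_upto_cong[OF open_off_axis] 1[of \<i>]]) (simp only: inv[symmetric], simp add: dir_def Complex_eq)
  show "smooth_upto n off_axis (\<lambda>v. cnj (dir v))"
    by (rule iffD2[OF smooth_upto_cong[OF open_off_axis] 1[of "-\<i>"]]) (simp only: inv[symmetric], simp add: dir_def Complex_eq)
qed

lemma smooth_upto_dir_power: "smooth_upto n off_axis (\<lambda>v. dir v powi k)"
proof (cases "0 \<le> k")
  case True
  then show ?thesis unfolding power_int_def by (simp add: smooth_upto_power open_off_axis smooth_upto_dir)
next
  case False
  show ?thesis
  proof (rule iffD2[OF smooth_upto_cong[OF open_off_axis]])
    show "dir v powi k = cnj (dir v) ^ nat (- k)" if "v \<in> off_axis" for v
    proof -
      have "dir v * cnj (dir v) = 1" using norm_dir[of v] that complex_norm_square[of "dir v"] by (simp add: off_axis_def)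
      then have "inverse (dir v) = cnj (dir v)" by (metis inverse_unique)
      then show ?thesis using False by (simp add: power_int_def)
    qed
    show "smooth_upto n off_axis (\<lambda>v. cnj (dir v) ^ nat (- k))"
      by (intro smooth_upto_power open_off_axis smooth_upto_dir)
  qed
qed

lemma smooth_upto_rad:
  assumes "smooth \<psi>"
  shows "smooth_upto n off_axis (\<lambda>v. \<psi> (rad v))"
proof (rule smooth_upto_compose[OF open_off_axis open_UNIV, where f = \<psi> and g = rad])
  show "smooth_upto n off_axis (\<lambda>v. complex_of_real (rad v \<bullet> b))" if "b \<in> Basis" for b n
    using that by (cases "b = er") (auto simp: rad_inner intro: smooth_upto_rho smooth_upto_inner)
  show "smooth_upto n UNIV \<psi>" using assms by (simp add: smooth_iff)
qed simp

text \<open>The support lies in the image under \<open>pol\<close> of a full period of angles times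
  the support of \<open>\<psi>\<close>, which is compact and off the axis.\<close>

lemma lift_fun_test:
  assumes \<Omega>: "\<Omega> \<subseteq> {b. 0 < R b}" and \<psi>: "\<psi> \<in> test_functions \<Omega>"
  shows "lift_fun k \<psi> \<in> test_functions (revolve \<Omega>)"
proof -
  obtain K where K: "smooth \<psi>" "compact K" "K \<subseteq> \<Omega>" "\<And>b. b \<notin> K \<Longrightarrow> \<psi> b = 0"
    using test_functionsE[OF \<psi>] by metis
  define K' where "K' = (\<lambda>x. pol (fst x) (snd x)) ` ({-pi..pi} \<times> K)"
  have c: "compact K'"
    unfolding K'_def by (intro compact_continuous_image continuous_pol continuous_intros compact_Times K) simp
  have sub: "K' \<subseteq> revolve \<Omega>" unfolding K'_def using K(3) \<Omega> by (auto simp: pol_in_revolve subset_iff)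
  have z: "lift_fun k \<psi> v = 0" if "v \<notin> K'" for v
  proof (rule ccontr)
    assume "lift_fun k \<psi> v \<noteq> 0"
    then have "rad v \<in> K" using K(4) by (auto simp: lift_fun_def)
    then have "v \<in> revolve K" using K(3) \<Omega> R_rad[of v] by (auto simp: revolve_def off_axis_def subset_iff)
    then obtain \<theta> where "\<theta> \<in> {-pi..pi}" "v = pol \<theta> (rad v)" by (rule revolve_obtain)
    then show False using \<open>rad v \<in> K\<close> that unfolding K'_def by (metis (mono_tags, lifting) SigmaI fst_conv image_eqI snd_conv)
  qed
  show ?thesis
  proof (rule test_functionsI[OF _ c sub z])
    have "smooth_upto n off_axis (lift_fun k \<psi>)" for n
      unfolding lift_fun_def by (intro smooth_upto_mult open_off_axis smooth_upto_dir_power smooth_upto_rad K(1))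
    then have "smooth_upto n UNIV (lift_fun k \<psi>)" for n
      using sub z by (intro smooth_upto_compact_support[OF open_off_axis compact_imp_closed[OF c]]) (auto simp: revolve_def)
    then show "smooth (lift_fun k \<psi>)" by (simp add: smooth_iff)
  qed
qed

lemma avg_lift_fun:
  assumes "\<Omega> \<subseteq> {b. 0 < R b}" "\<psi> \<in> test_functions \<Omega>"
  shows "avg k (lift_fun l \<psi>) b = (if k + l = 0 then complex_of_real (wR b) * \<psi> b else 0)"
proof (cases "0 < R b")
  case True
  then show ?thesis
    using coef_lift[OF True, of k l "\<psi> b"] by (simp add: avg_def coef_def lift_fun_def rad_pol mult_ac)
next
  case False
  then have "\<psi> b = 0" using test_zero_outside[OF assms(2)] assms(1) by blast
  then show ?thesis using False by (simp add: avg_def)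
qed

end

text \<open>\<open>distr\<close> is the type of all functionals. Linearity on test functions is a
  separate property, used whenever the transpose of an operator produces a sum of test
  functions.\<close>

definition linear_distr :: "'a::euclidean_space set \<Rightarrow> 'a distr \<Rightarrow> bool" where
  "linear_distr \<Omega> T \<longleftrightarrow>
     (\<forall>\<phi>\<in>test_functions \<Omega>. \<forall>\<psi>\<in>test_functions \<Omega>. T (\<lambda>x. \<phi> x + \<psi> x) = T \<phi> + T \<psi>) \<and>
     (\<forall>\<phi>\<in>test_functions \<Omega>. \<forall>c. T (\<lambda>x. c * \<phi> x) = c * T \<phi>)"

lemma linear_distr_add:
  "linear_distr \<Omega> T \<Longrightarrow> \<phi> \<in> test_functions \<Omega> \<Longrightarrow> \<psi> \<in> test_functions \<Omega> \<Longrightarrow> T (\<lambda>x. \<phi> x + \<psi> x) = T \<phi> + T \<psi>"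
  by (simp add: linear_distr_def)

lemma linear_distr_cmult:
  "linear_distr \<Omega> T \<Longrightarrow> \<phi> \<in> test_functions \<Omega> \<Longrightarrow> T (\<lambda>x. c * \<phi> x) = c * T \<phi>"
  by (simp add: linear_distr_def)

lemma linear_distr_zero: "linear_distr \<Omega> T \<Longrightarrow> T (\<lambda>x. 0) = 0"
  using linear_distr_cmult[of \<Omega> T "\<lambda>x. 0" 0] test_zero[of \<Omega>] by simp

lemma linear_distr_diff:
  assumes "linear_distr \<Omega> T" "e \<in> Basis"
  shows "linear_distr \<Omega> (distr_diff e T)"
proof -
  have 1: "pdiff e (\<lambda>x. \<phi> x + \<psi> x) = (\<lambda>x. pdiff e \<phi> x + pdiff e \<psi> x)"
    if "\<phi> \<in> test_functions \<Omega>" "\<psi> \<in> test_functions \<Omega>" for \<phi> \<psi>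
    using pdiff_add[OF test_differentiable[OF that(1)] test_differentiable[OF that(2)]] by (intro ext) simp
  have 2: "pdiff e (\<lambda>x. c * \<phi> x) = (\<lambda>x. c * pdiff e \<phi> x)" if "\<phi> \<in> test_functions \<Omega>" for \<phi> c
    using pdiff_cmult[OF test_differentiable[OF that]] by (intro ext) simp
  show ?thesis
    using assms(1) test_pdiff[OF _ assms(2)] by (auto simp: linear_distr_def distr_diff_def 1 2)
qed

lemma linear_distr_mult:
  assumes "linear_distr \<Omega> T" "open \<Omega>" "\<And>n. smooth_upto n \<Omega> (\<lambda>x. complex_of_real (h x))"
  shows "linear_distr \<Omega> (distr_mult h T)"
  unfolding linear_distr_def distr_mult_def
proof (intro conjI ballI allI)
  fix \<phi> \<psi> and c :: complex assume t: "\<phi> \<in> test_functions \<Omega>" "\<psi> \<in> test_functions \<Omega>"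
  show "T (\<lambda>x. of_real (h x) * (\<phi> x + \<psi> x)) = T (\<lambda>x. of_real (h x) * \<phi> x) + T (\<lambda>x. of_real (h x) * \<psi> x)"
    using assms(1) test_mult[OF t(1) assms(2,3)] test_mult[OF t(2) assms(2,3)]
    by (simp add: linear_distr_def distrib_left)
next
  fix \<phi> and c :: complex assume t: "\<phi> \<in> test_functions \<Omega>"
  have "(\<lambda>x. of_real (h x) * (c * \<phi> x)) = (\<lambda>x. c * (of_real (h x) * \<phi> x))" by (simp add: mult_ac)
  then show "T (\<lambda>x. of_real (h x) * (c * \<phi> x)) = c * T (\<lambda>x. of_real (h x) * \<phi> x)"
    using assms(1) test_mult[OF t assms(2,3)] by (simp add: linear_distr_def)
qed

lemma linear_distr_of_L2:
  assumes "open \<Omega>" "pos_weight \<Omega> \<rho>" "w \<in> borel_measurable (lebesgue_on \<Omega>)" "L2_sq \<Omega> \<rho> w < \<infinity>"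
  shows "linear_distr \<Omega> (distr_of \<Omega> w)"
proof -
  have \<Omega>: "\<Omega> \<in> sets borel" using assms by simp
  obtain g where g: "g \<in> borel_measurable borel" "AE x in lborel. x \<in> \<Omega> \<longrightarrow> w x = g x"
    using lebesgue_on_borel_version[OF \<Omega> assms(3)] by metis
  have fin: "L2_sq \<Omega> \<rho> g < \<infinity>" using assms(4) L2_sq_cong_AE[OF \<Omega> g(2)] by simp
  note eq = distr_of_borel_version[OF \<Omega> g]
  note int = L2_integrable_test[OF \<Omega> assms(2) _ g(1) fin]
  show ?thesis
    unfolding linear_distr_def
    by (auto simp: eq test_add test_cmult distrib_left int mult.left_commute[of "g _"])
qed

context cylindrical
begin

text \<open>Bessel's inequality for a single angular frequency.\<close>

lemma cyl_component_norm:
  assumes \<Omega>: "open \<Omega>" "\<Omega> \<subseteq> {b. 0 < R b}" and I: "finite I" "inj_on l I" "q0 \<in> I"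
    and S: "\<And>q. q \<in> I \<Longrightarrow> linear_distr \<Omega> (S q)" and c: "c q0 \<noteq> 0"
    and V: "\<And>\<phi>. \<phi> \<in> test_functions (revolve \<Omega>) \<Longrightarrow> V \<phi> = (\<Sum>q\<in>I. c q * cyl_lift (l q) (S q) \<phi>)"
  shows "ennreal ((norm (c q0))\<^sup>2) * distr_L2_sq \<Omega> wR (S q0) \<le> distr_L2_sq (revolve \<Omega>) (\<lambda>_. 1) V"
  unfolding distr_L2_sq_eq_INF[OF open_revolve[OF \<Omega>(1)] pos_weight_one]
proof (rule INF_greatest)
  fix G assume G: "G \<in> L2_reps (revolve \<Omega>) (\<lambda>_. 1) V"
  then have [measurable]: "G \<in> borel_measurable borel" and Gfin: "L2_sq (revolve \<Omega>) (\<lambda>_. 1) G < \<infinity>"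
    and GV: "\<And>\<phi>. \<phi> \<in> test_functions (revolve \<Omega>) \<Longrightarrow> V \<phi> = (\<integral>v. G v * \<phi> v \<partial>lborel)"
    by (auto simp: L2_reps_def)
  have [measurable]: "\<Omega> \<in> sets borel" "revolve \<Omega> \<in> sets borel" using \<Omega> open_revolve by auto
  define m where "m = l q0"
  \<comment> \<open>The angular Fourier coefficient of \<open>G\<close> at frequency m, Jacobian
    included. Divided by \<open>c q0\<close> and by 2 pi r it becomes the candidate \<open>g\<close>
    that represents \<open>S q0\<close>.\<close>
  define H where "H b = (\<integral>\<theta>. wt b \<theta> *\<^sub>R (cis (of_int (- m) * \<theta>) * G (pol \<theta> b)) \<partial>lborel)" for b
  define g where "g b = H b / (c q0 * of_real (wR b))" for b
  have meas: "(\<lambda>(b, \<theta>). wt b \<theta> *\<^sub>R (cis (of_int (- m) * \<theta>) * G (pol \<theta> b))) \<in> borel_measurable (borel \<Otimes>\<^sub>M borel)"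
  proof -
    have [measurable]: "(\<lambda>\<theta>. cis (of_int (- m) * \<theta>)) \<in> borel_measurable borel"
      by (intro borel_measurable_continuous_onI cont_cis)
    have [measurable]: "(\<lambda>x. pol (snd x) (fst x)) \<in> borel_measurable (borel \<Otimes>\<^sub>M borel)" "(\<lambda>x. wt (fst x) (snd x)) \<in> borel_measurable (borel \<Otimes>\<^sub>M borel)"
      using pol_measurable wt_measurable by (simp_all add: split_beta)
    show ?thesis unfolding split_beta by measurable
  qed
  have Hm [measurable]: "H \<in> borel_measurable borel"
    using lborel.borel_measurable_lebesgue_integral[of "\<lambda>b \<theta>. wt b \<theta> *\<^sub>R (cis (of_int (- m) * \<theta>) * G (pol \<theta> b))" borel] meas
    unfolding H_def[abs_def] by simp
  have gm [measurable]: "g \<in> borel_measurable borel" unfolding g_def by measurable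
  have Gb [measurable]: "(\<lambda>\<theta>. G (pol \<theta> b)) \<in> borel_measurable borel" "(\<lambda>\<theta>. wt b \<theta>) \<in> borel_measurable borel" for b
    using measurable_compose[OF borel_measurable_continuous_onI[OF pol_continuous, of b]] by (auto simp: wt_def)
  \<comment> \<open>Cauchy-Schwarz in \<theta> with respect to the weight \<open>wt b\<close>, whose
    total mass is 2 pi r.\<close>
  have H_le: "ennreal ((norm (H b))\<^sup>2) \<le> ennreal (wR b) * (\<integral>\<^sup>+\<theta>. ennreal (wt b \<theta>) * ennreal ((norm (G (pol \<theta> b)))\<^sup>2) \<partial>lborel)"
    if b: "0 < R b" for b
  proof -
    let ?f = "\<lambda>\<theta>. ennreal (sqrt (wt b \<theta>))" and ?k = "\<lambda>\<theta>. ennreal (sqrt (wt b \<theta>) * norm (G (pol \<theta> b)))"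
    have "ennreal (norm (H b)) \<le> (\<integral>\<^sup>+\<theta>. norm (wt b \<theta> *\<^sub>R (cis (of_int (- m) * \<theta>) * G (pol \<theta> b))) \<partial>lborel)"
    proof (cases "integrable lborel (\<lambda>\<theta>. wt b \<theta> *\<^sub>R (cis (of_int (- m) * \<theta>) * G (pol \<theta> b)))")
      case True
      then show ?thesis unfolding H_def by (rule integral_norm_bound_ennreal)
    next
      \<comment> \<open>The Bochner integral of a non-integrable function is 0 by convention, so the
        bound is trivial.\<close>
      case False
      then show ?thesis by (simp add: H_def not_integrable_integral_eq)
    qed
    also have "\<dots> = (\<integral>\<^sup>+\<theta>. ?f \<theta> * ?k \<theta> \<partial>lborel)"
    proof (rule nn_integral_cong)
      fix \<theta>
      have "norm (wt b \<theta> *\<^sub>R (cis (of_int (- m) * \<theta>) * G (pol \<theta> b))) = sqrt (wt b \<theta>) * (sqrt (wt b \<theta>) * norm (G (pol \<theta> b)))"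
        using wt_nonneg[of b \<theta>] by (simp add: norm_mult mult.assoc[symmetric])
      then show "ennreal (norm (wt b \<theta> *\<^sub>R (cis (of_int (- m) * \<theta>) * G (pol \<theta> b)))) = ?f \<theta> * ?k \<theta>"
        using wt_nonneg[of b \<theta>] by (simp only: ennreal_mult'[symmetric] real_sqrt_ge_zero)
    qed
    finally have "(ennreal (norm (H b)))\<^sup>2 \<le> (\<integral>\<^sup>+\<theta>. ?f \<theta> * ?k \<theta> \<partial>lborel)\<^sup>2"
      by (intro power_mono) auto
    also have "\<dots> \<le> (\<integral>\<^sup>+\<theta>. (?f \<theta>)\<^sup>2 \<partial>lborel) * (\<integral>\<^sup>+\<theta>. (?k \<theta>)\<^sup>2 \<partial>lborel)"
      by (rule Cauchy_Schwarz_nn_integral) measurable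
    also have "(\<integral>\<^sup>+\<theta>. (?f \<theta>)\<^sup>2 \<partial>lborel) = (\<integral>\<^sup>+\<theta>. ennreal (wt b \<theta>) * 1 \<partial>lborel)"
      using wt_nonneg by (intro nn_integral_cong) (simp add: ennreal_power)
    also have "\<dots> = ennreal (wR b) * 1" by (rule nn_integral_wt[OF b])
    also have "(\<integral>\<^sup>+\<theta>. (?k \<theta>)\<^sup>2 \<partial>lborel) = (\<integral>\<^sup>+\<theta>. ennreal (wt b \<theta>) * ennreal ((norm (G (pol \<theta> b)))\<^sup>2) \<partial>lborel)"
    proof (rule nn_integral_cong)
      fix \<theta>
      have "(?k \<theta>)\<^sup>2 = ennreal ((sqrt (wt b \<theta>) * norm (G (pol \<theta> b)))\<^sup>2)" using wt_nonneg by (simp add: ennreal_power)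
      also have "\<dots> = ennreal (wt b \<theta> * (norm (G (pol \<theta> b)))\<^sup>2)" using wt_nonneg[of b \<theta>] by (simp add: power_mult_distrib)
      finally show "(?k \<theta>)\<^sup>2 = ennreal (wt b \<theta>) * ennreal ((norm (G (pol \<theta> b)))\<^sup>2)" using wt_nonneg[of b \<theta>] by (simp add: ennreal_mult')
    qed
    finally show ?thesis by (simp add: ennreal_power)
  qed
  have "ennreal ((norm (c q0))\<^sup>2) * L2_sq \<Omega> wR g = (\<integral>\<^sup>+b. ennreal ((norm (c q0))\<^sup>2) * (ennreal (wR b * (norm (g b))\<^sup>2) * indicator \<Omega> b) \<partial>lborel)"
    by (subst L2_sq_lborel) (auto simp: nn_integral_cmult)
  also have "\<dots> \<le> (\<integral>\<^sup>+b. \<integral>\<^sup>+\<theta>. ennreal (wt b \<theta>) * (ennreal (1 * (norm (G (pol \<theta> b)))\<^sup>2) * indicator (revolve \<Omega>) (pol \<theta> b)) \<partial>lborel \<partial>lborel)"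
  proof (rule nn_integral_mono)
    fix b
    show "ennreal ((norm (c q0))\<^sup>2) * (ennreal (wR b * (norm (g b))\<^sup>2) * indicator \<Omega> b)
      \<le> (\<integral>\<^sup>+\<theta>. ennreal (wt b \<theta>) * (ennreal (1 * (norm (G (pol \<theta> b)))\<^sup>2) * indicator (revolve \<Omega>) (pol \<theta> b)) \<partial>lborel)"
    proof (cases "b \<in> \<Omega>")
      case True
      then have b: "0 < R b" using \<Omega> by auto
      have ind: "indicator (revolve \<Omega>) (pol \<theta> b) = (1 :: ennreal)" for \<theta>
        using pol_in_revolve[OF b] True by (simp add: indicator_def)
      have e: "(norm (c q0))\<^sup>2 * (wR b * (norm (g b))\<^sup>2) = (1 / wR b) * (norm (H b))\<^sup>2"
        using b c by (simp add: g_def norm_divide norm_mult power_divide power_mult_distrib) (simp add: power2_eq_square field_simps)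
      have "ennreal ((norm (c q0))\<^sup>2) * (ennreal (wR b * (norm (g b))\<^sup>2) * indicator \<Omega> b) = ennreal ((norm (c q0))\<^sup>2 * (wR b * (norm (g b))\<^sup>2))"
        using True by (simp only: ennreal_mult'[OF zero_le_power2] indicator_simps mult_1_right)
      also have "\<dots> = ennreal (1 / wR b) * ennreal ((norm (H b))\<^sup>2)"
        unfolding e using b by (intro ennreal_mult') simp
      also have "\<dots> \<le> ennreal (1 / wR b) * (ennreal (wR b) * (\<integral>\<^sup>+\<theta>. ennreal (wt b \<theta>) * ennreal ((norm (G (pol \<theta> b)))\<^sup>2) \<partial>lborel))"
        by (intro mult_left_mono H_le[OF b]) simp
      also have "\<dots> = (\<integral>\<^sup>+\<theta>. ennreal (wt b \<theta>) * ennreal ((norm (G (pol \<theta> b)))\<^sup>2) \<partial>lborel)"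
      proof -
        have "ennreal (1 / wR b) * ennreal (wR b) = ennreal (1 / wR b * wR b)" using b by (intro ennreal_mult'[symmetric]) simp
        also have "\<dots> = 1" using b by simp
        finally show ?thesis by (simp only: mult.assoc[symmetric] mult_1_left)
      qed
      finally show ?thesis by (simp add: ind)
    qed simp
  qed
  also have "\<dots> = (\<integral>\<^sup>+v. ennreal (1 * (norm (G v))\<^sup>2) * indicator (revolve \<Omega>) v \<partial>lborel)"
    by (rule nn_cyl[symmetric]) measurable
  also have "\<dots> = L2_sq (revolve \<Omega>) (\<lambda>_. 1) G" by (rule L2_sq_lborel[symmetric]) simp
  finally have L: "ennreal ((norm (c q0))\<^sup>2) * L2_sq \<Omega> wR g \<le> L2_sq (revolve \<Omega>) (\<lambda>_. 1) G" .
  have "ennreal ((norm (c q0))\<^sup>2) * L2_sq \<Omega> wR g < \<infinity>" using L Gfin by (rule le_less_trans)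
  then have gfin: "L2_sq \<Omega> wR g < \<infinity>" using c by (auto simp: ennreal_mult_less_top)
  have "S q0 \<psi> = (\<integral>b. g b * \<psi> b \<partial>lborel)" if \<psi>: "\<psi> \<in> test_functions \<Omega>" for \<psi>
  proof -
    have "smooth_upto n {b. 0 < R b} (\<lambda>b. complex_of_real (R b powr (-1)))" for n
    proof (rule smooth_upto_compose[OF open_R_pos open_greaterThan _ _ smooth_upto_powr])
      show "(\<lambda>b. R b) ` {b. 0 < R b} \<subseteq> {0<..}" by auto
      show "smooth_upto n {b. 0 < R b} (\<lambda>x. complex_of_real (R x \<bullet> b))" if "b \<in> Basis" for b n
        using that by (simp add: smooth_upto_R)
    qed
    then have "smooth_upto n {b. 0 < R b} (\<lambda>b. complex_of_real (1 / (2 * pi)) * complex_of_real (R b powr (-1)))" for n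
      by (intro smooth_upto_mult open_R_pos smooth_upto_const)
    then have si: "smooth_upto n \<Omega> (\<lambda>b. complex_of_real (1 / (2 * pi)) * complex_of_real (R b powr (-1)))" for n
      using \<Omega> smooth_upto_subset by blast
    \<comment> \<open>\<open>\<psi>\<close> divided by 2 pi r, which undoes the factor produced by
      \<open>avg_lift_fun\<close>. Tested with e^(-im \<theta>) times this function,
      \<open>V\<close> retains only the component \<open>q0\<close>, because the frequencies are
      distinct.\<close>
    define \<psi>1 where "\<psi>1 b = complex_of_real (1 / (2 * pi)) * complex_of_real (R b powr (-1)) * \<psi> b" for b
    have t1: "\<psi>1 \<in> test_functions \<Omega>" unfolding \<psi>1_def[abs_def] by (rule test_mult[OF \<psi> \<Omega>(1) si])
    have \<psi>1: "complex_of_real (wR b) * \<psi>1 b = \<psi> b" for b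
    proof (cases "b \<in> \<Omega>")
      case True
      then have "0 < R b" using \<Omega> by auto
      then show ?thesis by (simp add: \<psi>1_def powr_minus field_simps)
    next
      case False
      then show ?thesis using test_zero_outside[OF \<psi>] test_zero_outside[OF t1] by simp
    qed
    let ?\<Phi> = "lift_fun (- m) \<psi>1"
    have t: "?\<Phi> \<in> test_functions (revolve \<Omega>)" by (rule lift_fun_test[OF \<Omega>(2) t1])
    have "V ?\<Phi> = (\<Sum>q\<in>I. if q = q0 then c q0 * S q0 \<psi> else 0)"
      unfolding V[OF t]
    proof (rule sum.cong)
      fix q assume q: "q \<in> I"
      have "(l q + - m = 0) = (q = q0)" using I(2,3) q by (auto simp: m_def inj_on_def)
      then have "avg (l q) ?\<Phi> = (if q = q0 then \<psi> else (\<lambda>_. 0))"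
        using avg_lift_fun[OF \<Omega>(2) t1, of "l q" "- m"] \<psi>1 by auto
      then show "c q * cyl_lift (l q) (S q) ?\<Phi> = (if q = q0 then c q0 * S q0 \<psi> else 0)"
        using linear_distr_zero[OF S[OF q]] by (auto simp: cyl_lift_def)
    qed simp
    then have VS: "V ?\<Phi> = c q0 * S q0 \<psi>" using I by simp
    have "integrable lborel (\<lambda>v. G v * ?\<Phi> v)"
      using Gfin by (intro L2_integrable_test[OF _ pos_weight_one t]) auto
    from integral_cyl[OF this] have "(\<integral>v. G v * ?\<Phi> v \<partial>lborel) = (\<integral>b. (\<integral>\<theta>. wt b \<theta> *\<^sub>R (G (pol \<theta> b) * ?\<Phi> (pol \<theta> b)) \<partial>lborel) \<partial>lborel)" .
    also have "\<dots> = (\<integral>b. (\<integral>\<theta>. \<psi>1 b * (wt b \<theta> *\<^sub>R (cis (of_int (- m) * \<theta>) * G (pol \<theta> b))) \<partial>lborel) \<partial>lborel)"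
    proof (intro Bochner_Integration.integral_cong refl)
      fix b \<theta>
      show "wt b \<theta> *\<^sub>R (G (pol \<theta> b) * ?\<Phi> (pol \<theta> b)) = \<psi>1 b * (wt b \<theta> *\<^sub>R (cis (of_int (- m) * \<theta>) * G (pol \<theta> b)))"
        using lift_fun_pol[of b "- m" \<psi>1 \<theta>] wt_pos[of b \<theta>] by (cases "wt b \<theta> = 0") auto
    qed
    also have "\<dots> = (\<integral>b. \<psi>1 b * H b \<partial>lborel)" by (simp only: integral_mult_right_zero H_def)
    also have "\<dots> = (\<integral>b. c q0 * (g b * \<psi> b) \<partial>lborel)"
    proof (intro Bochner_Integration.integral_cong refl)
      fix b
      show "\<psi>1 b * H b = c q0 * (g b * \<psi> b)"
      proof (cases "b \<in> \<Omega>")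
        case True
        then have "0 < R b" using \<Omega> by auto
        then show ?thesis using c by (simp add: g_def \<psi>1[symmetric])
      next
        case False
        then show ?thesis using test_zero_outside[OF \<psi>] test_zero_outside[OF t1] by simp
      qed
    qed
    also have "\<dots> = c q0 * (\<integral>b. g b * \<psi> b \<partial>lborel)" by (rule integral_mult_right_zero)
    finally show ?thesis using VS GV[OF t] c by simp
  qed
  then have "g \<in> L2_reps \<Omega> wR (S q0)" using gfin by (simp add: L2_reps_def)
  then have "distr_L2_sq \<Omega> wR (S q0) \<le> L2_sq \<Omega> wR g"
    by (rule distr_L2_sq_le[OF \<Omega>(1) pos_weight_wR[OF \<Omega>(2)]])
  then have "ennreal ((norm (c q0))\<^sup>2) * distr_L2_sq \<Omega> wR (S q0) \<le> ennreal ((norm (c q0))\<^sup>2) * L2_sq \<Omega> wR g"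
    by (intro mult_left_mono) auto
  also note L
  finally show "ennreal ((norm (c q0))\<^sup>2) * distr_L2_sq \<Omega> wR (S q0) \<le> L2_sq (revolve \<Omega>) (\<lambda>_. 1) G" .
qed

end

section \<open>Ladder operators\<close>

context cylindrical
begin

definition euler :: "'b distr \<Rightarrow> 'b distr" where
  "euler T = distr_mult R (distr_diff er T)"

text \<open>The operator \<open>r\<^sup>-\<^sup>j p(r \<partial>\<^sub>r)\<close>.\<close>

definition radop :: "nat \<Rightarrow> real poly \<Rightarrow> 'b distr \<Rightarrow> 'b distr" where
  "radop j p T \<phi> = (\<Sum>i\<le>degree p. complex_of_real (coeff p i) * (euler ^^ i) T (\<lambda>b. complex_of_real ((1 / R b) ^ j) * \<phi> b))"

lemma radop_degree_le:
  assumes "degree p \<le> N"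
  shows "radop j p T \<phi> = (\<Sum>i\<le>N. complex_of_real (coeff p i) * (euler ^^ i) T (\<lambda>b. complex_of_real ((1 / R b) ^ j) * \<phi> b))"
  unfolding radop_def using assms by (intro sum.mono_neutral_left) (auto simp: coeff_eq_0)

lemma radop_add: "radop j (p + q) T \<phi> = radop j p T \<phi> + radop j q T \<phi>"
proof -
  let ?N = "max (degree p) (degree q)"
  have "degree (p + q) \<le> ?N" by (rule degree_add_le) auto
  then show ?thesis
    by (simp add: radop_degree_le[of "p + q" ?N] radop_degree_le[of p ?N] radop_degree_le[of q ?N]
        distrib_right sum.distrib)
qed

lemma radop_smult: "radop j (smult c p) T \<phi> = complex_of_real c * radop j p T \<phi>"
  using degree_smult_le[of c p] by (simp add: radop_degree_le[of "smult c p" "degree p"] radop_def sum_distrib_left mult.assoc)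

lemma radop_zero [simp]: "radop j 0 T \<phi> = 0" by (simp add: radop_def)

lemma radop_sum: "radop j (\<Sum>i\<in>I. smult (c i) (q i)) T \<phi> = (\<Sum>i\<in>I. complex_of_real (c i) * radop j (q i) T \<phi>)"
  by (induction I rule: infinite_finite_induct) (auto simp: radop_add radop_smult)

lemma radop_pCons_0: "radop j (pCons 0 p) T \<phi> = (\<Sum>i\<le>degree p. complex_of_real (coeff p i) * (euler ^^ Suc i) T (\<lambda>b. complex_of_real ((1 / R b) ^ j) * \<phi> b))"
proof -
  have "degree (pCons 0 p) \<le> Suc (degree p)" by (rule degree_pCons_le)
  from radop_degree_le[OF this] show ?thesis
    by (subst (asm) sum.atMost_Suc_shift) (simp del: funpow.simps(2))
qed

lemma radop_one: "radop 0 1 T \<phi> = T \<phi>" by (simp add: radop_def)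

lemma radop_rinv: "distr_mult (\<lambda>b. 1 / R b) (radop j p T) \<phi> = radop (Suc j) p T \<phi>"
  by (simp add: distr_mult_def radop_def mult_ac)

lemma smooth_upto_rinv_pow: "smooth_upto n {b. 0 < R b} (\<lambda>b. complex_of_real ((1 / R b) ^ j))"
proof -
  have "smooth_upto n {b. 0 < R b} (\<lambda>b. complex_of_real (R b powr (-1)))"
  proof (rule smooth_upto_compose[OF open_R_pos open_greaterThan _ _ smooth_upto_powr])
    show "(\<lambda>b. R b) ` {b. 0 < R b} \<subseteq> {0<..}" by auto
    show "smooth_upto n {b. 0 < R b} (\<lambda>x. complex_of_real (R x \<bullet> b))" if "b \<in> Basis" for b n
      using that by (simp add: smooth_upto_R)
  qed
  then have "smooth_upto n {b. 0 < R b} (\<lambda>b. complex_of_real (R b powr (-1)) ^ j)"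
    by (intro smooth_upto_power open_R_pos)
  then show ?thesis
    by (rule iffD1[OF smooth_upto_cong[OF open_R_pos], rotated]) (simp add: powr_minus_divide)
qed

lemma pdiff_rinv_pow:
  assumes "0 < R b"
  shows "pdiff er (\<lambda>b. complex_of_real ((1 / R b) ^ j)) b = - of_nat j * complex_of_real ((1 / R b) ^ Suc j)"
proof -
  have D: "((\<lambda>b. (1 / R b) ^ j) has_derivative (\<lambda>h. - real j * (1 / R b) ^ Suc j * R h)) (at b)"
    using assms by (auto intro!: derivative_eq_intros simp: fun_eq_iff)
      (cases j; simp add: field_simps power2_eq_square)
  have "((\<lambda>b. complex_of_real ((1 / R b) ^ j)) has_derivative (\<lambda>h. complex_of_real (- real j * (1 / R b) ^ Suc j * R h))) (at b)"
    by (rule bounded_linear.has_derivative[OF bounded_linear_of_real D])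
  from pdiff_eq[OF this, of er] show ?thesis by simp
qed

text \<open>The outcome of j steps on e^(ik \<theta>) T of which q raise and j - q lower the
  frequency; by \<open>ladder_term_diff\<close> their order does not show.\<close>

definition ladder_term :: "int \<Rightarrow> 'b distr \<Rightarrow> nat \<Rightarrow> nat \<Rightarrow> 'a distr" where
  "ladder_term k T j q = cyl_lift (k + 2 * int q - int j) (radop j (cart_poly (of_int k) q (j - q)) T)"

definition cart_diff :: "nat \<Rightarrow> nat \<Rightarrow> 'a distr \<Rightarrow> 'a distr" where
  "cart_diff a b V = (distr_diff ex ^^ a) ((distr_diff ey ^^ b) V)"

text \<open>The part of order j appears in three guises: Cartesian derivatives
  (\<open>cart_norm\<close>), single frequency components (\<open>ladder_norm\<close>) and terms of
  the radial expression (\<open>radial_norm\<close>). The second links the other two.\<close>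

definition cart_norm :: "'b set \<Rightarrow> nat \<Rightarrow> int \<Rightarrow> 'b distr \<Rightarrow> ennreal" where
  "cart_norm \<Omega> j k T = (\<Sum>a\<le>j. distr_L2_sq (revolve \<Omega>) (\<lambda>_. 1) (cart_diff a (j - a) (cyl_lift k T)))"

definition ladder_norm :: "'b set \<Rightarrow> nat \<Rightarrow> int \<Rightarrow> 'b distr \<Rightarrow> ennreal" where
  "ladder_norm \<Omega> j k T = (\<Sum>q\<le>j. distr_L2_sq \<Omega> wR (radop j (cart_poly (of_int k) q (j - q)) T))"

definition radial_norm :: "'b set \<Rightarrow> nat \<Rightarrow> nat \<Rightarrow> 'b distr \<Rightarrow> ennreal" where
  "radial_norm \<Omega> j n T = (\<Sum>x\<in>rad_index n j. distr_L2_sq \<Omega> wR (radop j (rad_poly n j x) T))"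

context
  fixes \<Omega> :: "'b set" assumes \<Omega>: "open \<Omega>" "\<Omega> \<subseteq> {b. 0 < R b}"
begin

lemma rinv_smooth: "smooth_upto n \<Omega> (\<lambda>b. complex_of_real ((1 / R b) ^ j))"
  using smooth_upto_subset[OF smooth_upto_rinv_pow] \<Omega>(2) by blast

lemma rinv_test: "\<phi> \<in> test_functions \<Omega> \<Longrightarrow> (\<lambda>b. complex_of_real ((1 / R b) ^ j) * \<phi> b) \<in> test_functions \<Omega>"
  by (rule test_mult[OF _ \<Omega>(1) rinv_smooth])

lemma linear_euler_pow:
  assumes "linear_distr \<Omega> T"
  shows "linear_distr \<Omega> ((euler ^^ i) T)"
proof (induction i)
  case (Suc i)
  then show ?case
    unfolding funpow.simps o_def euler_def
    by (intro linear_distr_mult linear_distr_diff er \<Omega> smooth_upto_R)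
qed (use assms in simp)

lemma linear_radop:
  assumes T: "linear_distr \<Omega> T"
  shows "linear_distr \<Omega> (radop j p T)"
proof -
  have a: "(\<lambda>b. complex_of_real ((1 / R b) ^ j) * (\<phi> b + \<psi> b)) = (\<lambda>b. complex_of_real ((1 / R b) ^ j) * \<phi> b + complex_of_real ((1 / R b) ^ j) * \<psi> b)" for \<phi> \<psi>
    by (simp add: distrib_left)
  have c: "(\<lambda>b. complex_of_real ((1 / R b) ^ j) * (c * \<phi> b)) = (\<lambda>b. c * (complex_of_real ((1 / R b) ^ j) * \<phi> b))" for c \<phi>
    by (simp add: mult_ac)
  show ?thesis
    unfolding linear_distr_def radop_def a c
    using linear_distr_add[OF linear_euler_pow[OF T] rinv_test rinv_test] linear_distr_cmult[OF linear_euler_pow[OF T] rinv_test]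
    by (simp add: distrib_left sum.distrib sum_distrib_left mult_ac)
qed

lemma pdiff_rinv_test:
  assumes \<phi>: "\<phi> \<in> test_functions \<Omega>"
  shows "pdiff er (\<lambda>b. complex_of_real ((1 / R b) ^ j) * \<phi> b) =
    (\<lambda>b. complex_of_real ((1 / R b) ^ j) * pdiff er \<phi> b + (- of_nat j) * (complex_of_real ((1 / R b) ^ Suc j) * \<phi> b))"
proof
  fix b
  show "pdiff er (\<lambda>b. complex_of_real ((1 / R b) ^ j) * \<phi> b) b =
    complex_of_real ((1 / R b) ^ j) * pdiff er \<phi> b + (- of_nat j) * (complex_of_real ((1 / R b) ^ Suc j) * \<phi> b)"
  proof (cases "b \<in> \<Omega>")
    case True
    then have b: "0 < R b" using \<Omega> by auto
    have "(\<lambda>b. complex_of_real ((1 / R b) ^ j)) differentiable (at b)"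
      using smooth_upto_at[OF smooth_upto_rinv_pow[of 0 j] open_R_pos] b by simp
    from pdiff_mult[OF this test_differentiable[OF \<phi>], of er] show ?thesis
      by (simp only: pdiff_rinv_pow[OF b] mult.assoc)
  next
    case False
    then show ?thesis
      using test_zero_outside[OF test_pdiff[OF rinv_test[OF \<phi>, of j] er] False] test_zero_outside[OF test_pdiff[OF \<phi> er] False]
        test_zero_outside[OF \<phi> False] by simp
  qed
qed

text \<open>On functions this is d_r (r^(-j) p(s) w) = r^(-j-1) (s - j) p(s) w with s = r d_r. Here
  it is read off on test functions, where differentiating r^(-j) yields the term with -j.\<close>

lemma radop_diff:
  assumes T: "linear_distr \<Omega> T" and \<phi>: "\<phi> \<in> test_functions \<Omega>"
  shows "distr_diff er (radop j p T) \<phi> = radop (Suc j) ([:- real j, 1:] * p) T \<phi>"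
proof -
  have key: "(euler ^^ Suc i) T (\<lambda>b. complex_of_real ((1 / R b) ^ Suc j) * \<phi> b)
     = - (euler ^^ i) T (\<lambda>b. complex_of_real ((1 / R b) ^ j) * pdiff er \<phi> b)
       + of_nat j * (euler ^^ i) T (\<lambda>b. complex_of_real ((1 / R b) ^ Suc j) * \<phi> b)" for i
  proof -
    let ?S = "(euler ^^ i) T"
    have S: "linear_distr \<Omega> ?S" by (rule linear_euler_pow[OF T])
    have "complex_of_real (R b) * (complex_of_real ((1 / R b) ^ Suc j) * \<phi> b) = complex_of_real ((1 / R b) ^ j) * \<phi> b" for b
    proof (cases "b \<in> \<Omega>")
      case True
      then have "0 < R b" using \<Omega> by auto
      then show ?thesis by simp
    qed (simp add: test_zero_outside[OF \<phi>])
    then have "(euler ^^ Suc i) T (\<lambda>b. complex_of_real ((1 / R b) ^ Suc j) * \<phi> b) = - ?S (pdiff er (\<lambda>b. complex_of_real ((1 / R b) ^ j) * \<phi> b))"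
      by (simp add: euler_def distr_mult_def distr_diff_def)
    also have "?S (pdiff er (\<lambda>b. complex_of_real ((1 / R b) ^ j) * \<phi> b)) =
      ?S (\<lambda>b. complex_of_real ((1 / R b) ^ j) * pdiff er \<phi> b) + (- of_nat j) * ?S (\<lambda>b. complex_of_real ((1 / R b) ^ Suc j) * \<phi> b)"
      unfolding pdiff_rinv_test[OF \<phi>]
      using linear_distr_add[OF S rinv_test[OF test_pdiff[OF \<phi> er], of j] test_cmult[OF rinv_test[OF \<phi>, of "Suc j"], of "- of_nat j"]]
        linear_distr_cmult[OF S rinv_test[OF \<phi>, of "Suc j"], of "- of_nat j"] by simp
    finally show ?thesis by simp
  qed
  have "[:- real j, 1:] * p = pCons 0 p + smult (- real j) p" by simp
  then have "radop (Suc j) ([:- real j, 1:] * p) T \<phi> = radop (Suc j) (pCons 0 p) T \<phi> + of_real (- real j) * radop (Suc j) p T \<phi>"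
    by (simp only: radop_add radop_smult)
  also have "\<dots> = (\<Sum>i\<le>degree p. complex_of_real (coeff p i) * - (euler ^^ i) T (\<lambda>b. complex_of_real ((1 / R b) ^ j) * pdiff er \<phi> b))"
    unfolding radop_pCons_0 key radop_def[of "Suc j" p] sum_distrib_left sum.distrib[symmetric]
    by (intro sum.cong refl) (simp add: algebra_simps del: power_Suc)
  also have "\<dots> = distr_diff er (radop j p T) \<phi>"
    by (simp add: distr_diff_def radop_def sum_negf)
  finally show ?thesis ..
qed

lemma radop_rinv_apply: "radop j p T (\<lambda>b. complex_of_real (1 / R b) * \<phi> b) = radop (Suc j) p T \<phi>"
  using radop_rinv[of j p T \<phi>] by (simp add: distr_mult_def)

text \<open>On e^(ik \<theta>) v, the operator d_x + i d_y gives e^(i(k+1) \<theta>) (d_r - k/r) v,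
  and d_x - i d_y gives e^(i(k-1) \<theta>) (d_r + k/r) v. By \<open>radop_diff\<close> these are
  the factors s - (j + k) and s - (j - k), with results \<open>A\<close> and \<open>B\<close>; half
  their sum and their difference over 2i recover d_x and d_y.\<close>

lemma cyl_lift_ladder:
  fixes k :: int and j :: nat and p :: "real poly"
  assumes T: "linear_distr \<Omega> T" and \<phi>: "\<phi> \<in> test_functions (revolve \<Omega>)"
  defines "A \<equiv> cyl_lift (k + 1) (radop (Suc j) ([:- (real j + of_int k), 1:] * p) T) \<phi>"
    and "B \<equiv> cyl_lift (k - 1) (radop (Suc j) ([:of_int k - real j, 1:] * p) T) \<phi>"
  shows "distr_diff ex (cyl_lift k (radop j p T)) \<phi> = (A + B) / 2"
    and "distr_diff ey (cyl_lift k (radop j p T)) \<phi> = (A - B) / (2 * \<i>)"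
proof -
  let ?S = "radop j p T"
  have S: "linear_distr \<Omega> ?S" by (rule linear_radop[OF T])
  define a where "a = avg (k + 1) \<phi>"
  define b where "b = avg (k - 1) \<phi>"
  have t: "a \<in> test_functions \<Omega>" "b \<in> test_functions \<Omega>" unfolding a_def b_def by (rule avg_test[OF \<Omega>(2) \<phi>])+
  have r: "(\<lambda>x. complex_of_real (1 / R x) * f x) \<in> test_functions \<Omega>" if "f \<in> test_functions \<Omega>" for f
    using rinv_test[OF that, of 1] by simp
  define F where "F x = pdiff er a x + of_int k * (complex_of_real (1 / R x) * a x)" for x
  define G where "G x = pdiff er b x + (- of_int k) * (complex_of_real (1 / R x) * b x)" for x
  have tF: "F \<in> test_functions \<Omega>" "G \<in> test_functions \<Omega>"
    unfolding F_def[abs_def] G_def[abs_def] by (intro test_add test_cmult test_pdiff er t r)+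
  have SFG: "?S (\<lambda>x. pdiff er f x + c * (complex_of_real (1 / R x) * f x)) = - radop (Suc j) ([:- real j, 1:] * p) T f + c * radop (Suc j) p T f"
    if f: "f \<in> test_functions \<Omega>" for f c
  proof -
    have "?S (\<lambda>x. pdiff er f x + c * (complex_of_real (1 / R x) * f x)) = ?S (pdiff er f) + c * ?S (\<lambda>x. complex_of_real (1 / R x) * f x)"
      using linear_distr_add[OF S test_pdiff[OF f er] test_cmult[OF r[OF f], of c]] linear_distr_cmult[OF S r[OF f], of c] by simp
    also have "?S (pdiff er f) = - radop (Suc j) ([:- real j, 1:] * p) T f"
      using arg_cong[OF radop_diff[OF T f, of j p], of uminus] by (simp only: distr_diff_def minus_minus)
    finally show ?thesis by (simp only: radop_rinv_apply)
  qed
  have split: "radop (Suc j) ([:c - real j, 1:] * p) T f = radop (Suc j) ([:- real j, 1:] * p) T f + of_real c * radop (Suc j) p T f" for c f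
  proof -
    have "[:c - real j, 1:] * p = [:- real j, 1:] * p + smult c p" by (simp add: smult_diff_left)
    then show ?thesis by (simp only: radop_add radop_smult)
  qed
  have A: "?S F = - A"
    using split[of "- of_int k" a] SFG[OF t(1), of "of_int k"]
    by (simp add: A_def cyl_lift_def a_def F_def[abs_def] add.commute del: mult_pCons_left)
  have B: "?S G = - B"
    using split[of "of_int k" b] SFG[OF t(2), of "- of_int k"]
    by (simp add: B_def cyl_lift_def b_def G_def[abs_def] add.commute del: mult_pCons_left)
  have comb: "?S (\<lambda>x. c * F x + d * G x) = c * ?S F + d * ?S G" for c d
    by (simp only: linear_distr_add[OF S test_cmult[OF tF(1)] test_cmult[OF tF(2)]] linear_distr_cmult[OF S tF(1)] linear_distr_cmult[OF S tF(2)])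
  have "avg k (pdiff ex \<phi>) = (\<lambda>x. (1/2) * F x + (1/2) * G x)"
  proof
    fix x
    have "avg k (pdiff ex \<phi>) x = (F x + G x) / 2"
      using avg_pdiff_cart(1)[OF \<Omega>(2) \<phi>, of k x] by (simp add: F_def G_def a_def b_def)
    then show "avg k (pdiff ex \<phi>) x = (1/2) * F x + (1/2) * G x" by (simp add: add_divide_distrib)
  qed
  then have "distr_diff ex (cyl_lift k ?S) \<phi> = - ((1/2) * ?S F + (1/2) * ?S G)"
    by (simp only: distr_diff_def cyl_lift_def comb)
  then show "distr_diff ex (cyl_lift k ?S) \<phi> = (A + B) / 2" unfolding A B by (simp add: field_simps)
  have "avg k (pdiff ey \<phi>) = (\<lambda>x. (1/(2*\<i>)) * F x + (-1/(2*\<i>)) * G x)"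
  proof
    fix x
    have "avg k (pdiff ey \<phi>) x = (F x - G x) / (2 * \<i>)"
      using avg_pdiff_cart(2)[OF \<Omega>(2) \<phi>, of k x] by (simp add: F_def G_def a_def b_def)
    then show "avg k (pdiff ey \<phi>) x = (1/(2*\<i>)) * F x + (-1/(2*\<i>)) * G x" by (simp add: diff_divide_distrib right_diff_distrib)
  qed
  then have "distr_diff ey (cyl_lift k ?S) \<phi> = - ((1/(2*\<i>)) * ?S F + (-1/(2*\<i>)) * ?S G)"
    by (simp only: distr_diff_def cyl_lift_def comb)
  then show "distr_diff ey (cyl_lift k ?S) \<phi> = (A - B) / (2 * \<i>)" unfolding A B by (simp add: diff_divide_distrib right_diff_distrib)
qed

text \<open>After q raising and j - q lowering steps the frequency is k + 2q - j. The next raising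
  factor has its zero at j + (k + 2q - j) = k + 2q, the next lowering factor at 2(j - q) - k. Each
  depends only on the number of earlier steps in its own direction, so the order of steps is
  immaterial and the product is \<open>cart_poly\<close>.\<close>

lemma ladder_term_diff:
  assumes T: "linear_distr \<Omega> T" and \<phi>: "\<phi> \<in> test_functions (revolve \<Omega>)" and q: "q \<le> j"
  shows "distr_diff ex (ladder_term k T j q) \<phi> = (ladder_term k T (Suc j) (Suc q) \<phi> + ladder_term k T (Suc j) q \<phi>) / 2"
    and "distr_diff ey (ladder_term k T j q) \<phi> = (ladder_term k T (Suc j) (Suc q) \<phi> - ladder_term k T (Suc j) q \<phi>) / (2 * \<i>)"
proof -
  let ?k = "k + 2 * int q - int j"
  have p1: "[:- (real j + of_int ?k), 1:] * cart_poly (of_int k) q (j - q) = cart_poly (of_int k) (Suc q) (j - q)"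
    by (simp add: cart_poly_def mult_ac del: mult_pCons_left mult_pCons_right)
  have p2: "[:of_int ?k - real j, 1:] * cart_poly (of_int k) q (j - q) = cart_poly (of_int k) q (Suc j - q)"
  proof -
    have "of_int ?k - real j = of_int k - 2 * real (j - q)" using q by simp
    then show ?thesis using q by (simp add: cart_poly_def Suc_diff_le mult_ac del: mult_pCons_left mult_pCons_right)
  qed
  have k1: "?k + 1 = k + 2 * int (Suc q) - int (Suc j)" "?k - 1 = k + 2 * int q - int (Suc j)" by simp_all
  show "distr_diff ex (ladder_term k T j q) \<phi> = (ladder_term k T (Suc j) (Suc q) \<phi> + ladder_term k T (Suc j) q \<phi>) / 2"
    "distr_diff ey (ladder_term k T j q) \<phi> = (ladder_term k T (Suc j) (Suc q) \<phi> - ladder_term k T (Suc j) q \<phi>) / (2 * \<i>)"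
    unfolding ladder_term_def cyl_lift_ladder[OF T \<phi>] p1 p2 k1 by simp_all
qed

text \<open>\<open>d\<close> is \<open>c\<close> shifted by one place, so the rule for d_x is
  Pascal's rule with a factor 1/2. Vanishing of \<open>c\<close> beyond j closes the upper end of
  the sums.\<close>

lemma distr_diff_ladder_sum:
  assumes T: "linear_distr \<Omega> T"
    and V: "\<And>\<phi>. \<phi> \<in> test_functions (revolve \<Omega>) \<Longrightarrow> V \<phi> = (\<Sum>q\<le>j. c q * ladder_term k T j q \<phi>)"
    and c: "\<And>q. j < q \<Longrightarrow> c q = 0" and \<phi>: "\<phi> \<in> test_functions (revolve \<Omega>)"
  defines "d \<equiv> \<lambda>q. case q of 0 \<Rightarrow> 0 | Suc q \<Rightarrow> c q"
  shows "distr_diff ex V \<phi> = (\<Sum>q\<le>Suc j. ((d q + c q) / 2) * ladder_term k T (Suc j) q \<phi>)"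
    and "distr_diff ey V \<phi> = (\<Sum>q\<le>Suc j. ((d q - c q) / (2 * \<i>)) * ladder_term k T (Suc j) q \<phi>)"
proof -
  let ?L = "\<lambda>q. ladder_term k T (Suc j) q \<phi>"
  have D: "distr_diff e V \<phi> = (\<Sum>q\<le>j. c q * distr_diff e (ladder_term k T j q) \<phi>)" if "e \<in> Basis" for e
    using V[OF test_pdiff[OF \<phi> that]] by (simp add: distr_diff_def sum_negf)
  have s1: "(\<Sum>q\<le>j. c q * ?L (Suc q)) = (\<Sum>q\<le>Suc j. d q * ?L q)"
    by (subst sum.atMost_Suc_shift) (simp add: d_def)
  have s2: "(\<Sum>q\<le>j. c q * ?L q) = (\<Sum>q\<le>Suc j. c q * ?L q)"
    by (simp add: c)
  have "distr_diff ex V \<phi> = ((\<Sum>q\<le>j. c q * ?L (Suc q)) + (\<Sum>q\<le>j. c q * ?L q)) / 2"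
    unfolding D[OF ex_Basis] sum.distrib[symmetric] sum_divide_distrib
    by (intro sum.cong refl) (simp add: ladder_term_diff[OF T \<phi>] distrib_left)
  also have "\<dots> = (\<Sum>q\<le>Suc j. ((d q + c q) / 2) * ?L q)"
    unfolding s1 s2 sum.distrib[symmetric] sum_divide_distrib by (intro sum.cong refl) (simp add: distrib_right add_divide_distrib)
  finally show "distr_diff ex V \<phi> = (\<Sum>q\<le>Suc j. ((d q + c q) / 2) * ?L q)" .
  have "distr_diff ey V \<phi> = ((\<Sum>q\<le>j. c q * ?L (Suc q)) - (\<Sum>q\<le>j. c q * ?L q)) / (2 * \<i>)"
    unfolding D[OF ey] sum_subtractf[symmetric] sum_divide_distrib
    by (intro sum.cong refl) (simp add: ladder_term_diff[OF T \<phi>] right_diff_distrib)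
  also have "\<dots> = (\<Sum>q\<le>Suc j. ((d q - c q) / (2 * \<i>)) * ?L q)"
    unfolding s1 s2 sum_subtractf[symmetric] sum_divide_distrib by (intro sum.cong refl) (simp add: left_diff_distrib diff_divide_distrib)
  finally show "distr_diff ey V \<phi> = (\<Sum>q\<le>Suc j. ((d q - c q) / (2 * \<i>)) * ?L q)" .
qed

text \<open>The coefficients stay bounded by 1 because each derivative takes half a sum or half a
  difference of two of them. For powers of d_x alone they are binomial over 2^a, hence nonzero for
  every q <= a; the converse estimate relies on this.\<close>

lemma cart_diff_ladder:
  assumes T: "linear_distr \<Omega> T"
  obtains c where "\<And>q. norm (c q) \<le> 1" "b = 0 \<Longrightarrow> (\<And>q. c q = of_nat (a choose q) / 2 ^ a)"
    "\<And>\<phi>. \<phi> \<in> test_functions (revolve \<Omega>) \<Longrightarrow> cart_diff a b (cyl_lift k T) \<phi> = (\<Sum>q\<le>a + b. c q * ladder_term k T (a + b) q \<phi>)"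
proof -
  have half: "norm ((x + y) / 2) \<le> 1" "norm ((x - y) / (2 * \<i>)) \<le> 1" if "norm x \<le> 1" "norm y \<le> 1" for x y :: complex
    using that norm_triangle_ineq[of x y] norm_triangle_ineq4[of x y] by (auto simp: norm_divide norm_mult)
  have dn: "norm (case q of 0 \<Rightarrow> 0 | Suc q \<Rightarrow> c q) \<le> 1" if "\<And>q. norm (c q) \<le> 1" for c :: "nat \<Rightarrow> complex" and q
    using that by (cases q) auto
  \<comment> \<open>The y-derivatives act innermost. The clause for b = 0 is the top row of Pascal's
    triangle, from which the x-derivatives continue.\<close>
  have y: "\<exists>c. (\<forall>q. norm (c q) \<le> 1) \<and> (\<forall>q>b. c q = 0) \<and> (b = 0 \<longrightarrow> (\<forall>q. c q = of_nat (0 choose q))) \<and>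
    (\<forall>\<phi>\<in>test_functions (revolve \<Omega>). (distr_diff ey ^^ b) (cyl_lift k T) \<phi> = (\<Sum>q\<le>b. c q * ladder_term k T b q \<phi>))" for b
  proof (induction b)
    case 0
    have "radop 0 1 T = T" by (rule ext) (rule radop_one)
    then show ?case
      by (intro exI[of _ "\<lambda>q. of_nat (0 choose q)"]) (auto simp: ladder_term_def cart_poly_def binomial_eq_0 split: if_splits intro: order_trans[OF _ order_refl] simp del: binomial_0_Suc, (case_tac q; simp)+)
  next
    case (Suc b)
    then obtain c where c: "\<And>q. norm (c q) \<le> 1" "\<And>q. b < q \<Longrightarrow> c q = 0"
      "\<And>\<phi>. \<phi> \<in> test_functions (revolve \<Omega>) \<Longrightarrow> (distr_diff ey ^^ b) (cyl_lift k T) \<phi> = (\<Sum>q\<le>b. c q * ladder_term k T b q \<phi>)"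
      by blast
    let ?d = "\<lambda>q. case q of 0 \<Rightarrow> 0 | Suc q \<Rightarrow> c q"
    show ?case
    proof (intro exI[of _ "\<lambda>q. (?d q - c q) / (2 * \<i>)"] conjI allI impI ballI)
      show "norm ((?d q - c q) / (2 * \<i>)) \<le> 1" for q by (intro half dn c(1))
      show "(?d q - c q) / (2 * \<i>) = 0" if "Suc b < q" for q using that c(2) by (cases q) auto
      show "(distr_diff ey ^^ Suc b) (cyl_lift k T) \<phi> = (\<Sum>q\<le>Suc b. (?d q - c q) / (2 * \<i>) * ladder_term k T (Suc b) q \<phi>)"
        if "\<phi> \<in> test_functions (revolve \<Omega>)" for \<phi>
        using distr_diff_ladder_sum(2)[OF T c(3,2) that] by simp
    qed simp
  qed
  have x: "\<exists>c. (\<forall>q. norm (c q) \<le> 1) \<and> (\<forall>q>a + b. c q = 0) \<and> (b = 0 \<longrightarrow> (\<forall>q. c q = of_nat (a choose q) / 2 ^ a)) \<and>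
    (\<forall>\<phi>\<in>test_functions (revolve \<Omega>). cart_diff a b (cyl_lift k T) \<phi> = (\<Sum>q\<le>a + b. c q * ladder_term k T (a + b) q \<phi>))" for a
  proof (induction a)
    case 0
    then show ?case using y[of b] by (simp add: cart_diff_def)
  next
    case (Suc a)
    then obtain c where c: "\<And>q. norm (c q) \<le> 1" "\<And>q. a + b < q \<Longrightarrow> c q = 0"
      "b = 0 \<longrightarrow> (\<forall>q. c q = of_nat (a choose q) / 2 ^ a)"
      "\<And>\<phi>. \<phi> \<in> test_functions (revolve \<Omega>) \<Longrightarrow> cart_diff a b (cyl_lift k T) \<phi> = (\<Sum>q\<le>a + b. c q * ladder_term k T (a + b) q \<phi>)"
      by blast
    let ?d = "\<lambda>q. case q of 0 \<Rightarrow> 0 | Suc q \<Rightarrow> c q"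
    show ?case
    proof (intro exI[of _ "\<lambda>q. (?d q + c q) / 2"] conjI allI impI ballI)
      show "norm ((?d q + c q) / 2) \<le> 1" for q by (intro half dn c(1))
      show "(?d q + c q) / 2 = 0" if "Suc a + b < q" for q using that c(2) by (cases q) auto
      show "(?d q + c q) / 2 = of_nat (Suc a choose q) / 2 ^ Suc a" if "b = 0" for q
        using c(3) that by (cases q) (auto simp: add_divide_distrib mult.commute)
      show "cart_diff (Suc a) b (cyl_lift k T) \<phi> = (\<Sum>q\<le>Suc a + b. (?d q + c q) / 2 * ladder_term k T (Suc a + b) q \<phi>)"
        if "\<phi> \<in> test_functions (revolve \<Omega>)" for \<phi>
        using distr_diff_ladder_sum(1)[OF T c(4,2) that] by (simp add: cart_diff_def)
    qed
  qed
  obtain c where c: "\<forall>q. norm (c q) \<le> 1" "b = 0 \<longrightarrow> (\<forall>q. c q = of_nat (a choose q) / 2 ^ a)"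
    "\<forall>\<phi>\<in>test_functions (revolve \<Omega>). cart_diff a b (cyl_lift k T) \<phi> = (\<Sum>q\<le>a + b. c q * ladder_term k T (a + b) q \<phi>)"
    using x[of a] by blast
  show thesis by (rule that[of c]) (use c in auto)
qed

section \<open>Comparison of the Cartesian, ladder and radial norms\<close>

lemma radop_bspan_norm:
  assumes T: "linear_distr \<Omega> T" and p: "p \<in> bspan C I q" and I: "finite I" "I \<noteq> {}" and C: "C > 0"
  shows "distr_L2_sq \<Omega> wR (radop j p T) \<le> ennreal (C\<^sup>2 * card I) * (\<Sum>i\<in>I. distr_L2_sq \<Omega> wR (radop j (q i) T))"
proof -
  obtain c where c: "\<And>i. i \<in> I \<Longrightarrow> \<bar>c i\<bar> \<le> C" "p = (\<Sum>i\<in>I. smult (c i) (q i))"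
    using p by (auto elim!: bspanE)
  show ?thesis
    by (rule distr_L2_sq_lincomb[OF \<Omega>(1) pos_weight_wR[OF \<Omega>(2)] I C, of "\<lambda>i. complex_of_real (c i)"])
      (use c in \<open>auto simp: radop_sum\<close>)
qed

lemma sum_le_const:
  fixes f :: "'i \<Rightarrow> ennreal"
  assumes "\<And>i. i \<in> I \<Longrightarrow> f i \<le> c"
  shows "sum f I \<le> of_nat (card I) * c"
  using sum_bounded_above[of I f c] assms by simp

lemma ladder_norm_uminus: "ladder_norm \<Omega> j (- k) T = ladder_norm \<Omega> j k T"
  unfolding ladder_norm_def
  by (rule sum.reindex_bij_witness[of _ "\<lambda>q. j - q" "\<lambda>q. j - q"]) (auto simp: cart_poly_uminus)

lemma cart_norm_le_ladder_norm:
  assumes T: "linear_distr \<Omega> T"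
  shows "cart_norm \<Omega> j k T \<le> ennreal ((real j + 1)\<^sup>2) * ladder_norm \<Omega> j k T"
proof -
  have "distr_L2_sq (revolve \<Omega>) (\<lambda>_. 1) (cart_diff a (j - a) (cyl_lift k T)) \<le> ennreal (real j + 1) * ladder_norm \<Omega> j k T"
    if a: "a \<in> {..j}" for a
  proof -
    obtain c where c: "\<And>q. norm (c q) \<le> 1"
      "\<And>\<phi>. \<phi> \<in> test_functions (revolve \<Omega>) \<Longrightarrow> cart_diff a (j - a) (cyl_lift k T) \<phi> = (\<Sum>q\<le>a + (j - a). c q * ladder_term k T (a + (j - a)) q \<phi>)"
      using cart_diff_ladder[OF T] by metis
    have "distr_L2_sq (revolve \<Omega>) (\<lambda>_. 1) (cart_diff a (j - a) (cyl_lift k T))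
      \<le> ennreal ((1::real)\<^sup>2 * real (card {..j})) * (\<Sum>q\<le>j. distr_L2_sq (revolve \<Omega>) (\<lambda>_. 1) (ladder_term k T j q))"
      using a c by (intro distr_L2_sq_lincomb[OF open_revolve[OF \<Omega>(1)] pos_weight_one, of _ _ c]) auto
    also have "\<dots> \<le> ennreal ((1::real)\<^sup>2 * real (card {..j})) * ladder_norm \<Omega> j k T"
      unfolding ladder_norm_def ladder_term_def
      by (intro mult_left_mono sum_mono distr_L2_sq_cyl_lift_le \<Omega>) auto
    finally show ?thesis by (simp add: add.commute)
  qed
  then have "cart_norm \<Omega> j k T \<le> of_nat (card {..j}) * (ennreal (real j + 1) * ladder_norm \<Omega> j k T)"
    unfolding cart_norm_def by (rule sum_le_const)
  also have "of_nat (card {..j}) = ennreal (real j + 1)" by (simp add: ennreal_of_nat_eq_real_of_nat add.commute)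
  finally show ?thesis by (simp only: mult.assoc[symmetric] ennreal_mult'[symmetric] power2_eq_square)
qed

text \<open>The single derivative d_x^j contains every ladder component, each at a frequency of its
  own and with a coefficient of at least 2^(-j). \<open>cyl_component_norm\<close> extracts them one
  by one at the cost of the factor 4^j.\<close>

lemma ladder_norm_le_cart_norm:
  assumes T: "linear_distr \<Omega> T"
  shows "ladder_norm \<Omega> j k T \<le> ennreal ((real j + 1) * 4 ^ j) * cart_norm \<Omega> j k T"
proof -
  have "distr_L2_sq \<Omega> wR (radop j (cart_poly (of_int k) q (j - q)) T) \<le> ennreal (4 ^ j) * cart_norm \<Omega> j k T"
    if q: "q \<in> {..j}" for q
  proof -
    obtain c where c: "\<And>q. c q = of_nat (j choose q) / (2 ^ j :: complex)"
      "\<And>\<phi>. \<phi> \<in> test_functions (revolve \<Omega>) \<Longrightarrow> cart_diff j 0 (cyl_lift k T) \<phi> = (\<Sum>q\<le>j + 0. c q * ladder_term k T (j + 0) q \<phi>)"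
      using cart_diff_ladder[OF T, of 0 j k] by metis
    have "1 \<le> real (j choose q)" using q by (simp add: Suc_leI)
    then have n: "norm (c q) \<ge> 1 / 2 ^ j" by (simp add: c norm_divide norm_power divide_right_mono)
    have "(1 / 2 ^ j)\<^sup>2 \<le> (norm (c q))\<^sup>2" by (intro power_mono n) simp
    then have n2: "1 \<le> 4 ^ j * (norm (c q))\<^sup>2"
      by (simp add: power_divide field_simps power2_eq_square power_mult_distrib[symmetric])
    have "0 < 1 / (2::real) ^ j" by simp
    then have "c q \<noteq> 0" using less_le_trans[OF _ n] by (metis norm_zero less_irrefl)
    have "ennreal ((norm (c q))\<^sup>2) * distr_L2_sq \<Omega> wR (radop j (cart_poly (of_int k) q (j - q)) T)
      \<le> distr_L2_sq (revolve \<Omega>) (\<lambda>_. 1) (cart_diff j 0 (cyl_lift k T))"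
    proof (rule cyl_component_norm[OF \<Omega>, where I = "{..j}" and l = "\<lambda>q. k + 2 * int q - int j"
          and c = c and ?q0.0 = q and S = "\<lambda>q. radop j (cart_poly (of_int k) q (j - q)) T"])
      show "cart_diff j 0 (cyl_lift k T) \<phi> = (\<Sum>q\<in>{..j}. c q * cyl_lift (k + 2 * int q - int j) (radop j (cart_poly (of_int k) q (j - q)) T) \<phi>)"
        if "\<phi> \<in> test_functions (revolve \<Omega>)" for \<phi>
        using c(2)[OF that] by (simp add: ladder_term_def)
    qed (use q \<open>c q \<noteq> 0\<close> linear_radop[OF T] in \<open>auto simp: inj_on_def\<close>)
    also have "\<dots> \<le> cart_norm \<Omega> j k T"
      unfolding cart_norm_def using member_le_sum[of j "{..j}" "\<lambda>a. distr_L2_sq (revolve \<Omega>) (\<lambda>_. 1) (cart_diff a (j - a) (cyl_lift k T))"] by simp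
    finally have *: "ennreal ((norm (c q))\<^sup>2) * distr_L2_sq \<Omega> wR (radop j (cart_poly (of_int k) q (j - q)) T) \<le> cart_norm \<Omega> j k T" .
    have "1 * distr_L2_sq \<Omega> wR (radop j (cart_poly (of_int k) q (j - q)) T) \<le> ennreal (4 ^ j * (norm (c q))\<^sup>2) * distr_L2_sq \<Omega> wR (radop j (cart_poly (of_int k) q (j - q)) T)"
      using n2 by (intro mult_right_mono) (auto simp: ennreal_leI[of 1, simplified])
    also have "\<dots> = ennreal (4 ^ j) * (ennreal ((norm (c q))\<^sup>2) * distr_L2_sq \<Omega> wR (radop j (cart_poly (of_int k) q (j - q)) T))"
      by (subst ennreal_mult') (auto simp: mult.assoc)
    also have "\<dots> \<le> ennreal (4 ^ j) * cart_norm \<Omega> j k T" by (intro mult_left_mono *) simp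
    finally show ?thesis by simp
  qed
  then have "ladder_norm \<Omega> j k T \<le> of_nat (card {..j}) * (ennreal (4 ^ j) * cart_norm \<Omega> j k T)"
    unfolding ladder_norm_def by (rule sum_le_const)
  also have "of_nat (card {..j}) = ennreal (real j + 1)" by (simp add: ennreal_of_nat_eq_real_of_nat add.commute)
  finally show ?thesis by (subst ennreal_mult') (auto simp: mult.assoc)
qed

text \<open>Bounded spans become norm inequalities through \<open>radop_bspan_norm\<close>. The sign
  of k is removed by conjugation, which permutes the ladder components.\<close>

lemma ladder_norm_radial_norm:
  assumes T: "linear_distr \<Omega> T" and C: "C > 0"
    "\<And>a. a \<le> j \<Longrightarrow> cart_poly (real n) a (j - a) \<in> bspan C (rad_index n j) (rad_poly n j)"
    "\<And>x. x \<in> rad_index n j \<Longrightarrow> rad_poly n j x \<in> bspan C {..j} (\<lambda>a. cart_poly (real n) a (j - a))"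
    and k: "\<bar>k\<bar> = int n"
  shows "ladder_norm \<Omega> j k T \<le> ennreal ((real j + 1) * (C\<^sup>2 * (2 * (real j + 1)))) * radial_norm \<Omega> j n T"
    and "radial_norm \<Omega> j n T \<le> ennreal ((2 * (real j + 1)) * (C\<^sup>2 * (real j + 1))) * ladder_norm \<Omega> j k T"
proof -
  have k: "ladder_norm \<Omega> j k T = ladder_norm \<Omega> j (int n) T"
  proof (cases "0 \<le> k")
    case False
    then have "k = - int n" using k by simp
    then show ?thesis by (simp add: ladder_norm_uminus)
  qed (use k in simp)
  have ne: "rad_index n j \<noteq> {}" by (auto simp: rad_index_def)
  have card: "real (card (rad_index n j)) \<le> 2 * (real j + 1)" using of_nat_mono[OF card_rad_index[of n j], where 'a = real] by simp
  have card': "of_nat (card (rad_index n j)) \<le> ennreal (2 * (real j + 1))"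
    unfolding ennreal_of_nat_eq_real_of_nat by (rule ennreal_leI[OF card])
  have j1: "of_nat (card {..j}) = ennreal (real j + 1)" by (simp add: ennreal_of_nat_eq_real_of_nat add.commute)
  have "distr_L2_sq \<Omega> wR (radop j (cart_poly (of_int (int n)) q (j - q)) T) \<le> ennreal (C\<^sup>2 * (2 * (real j + 1))) * radial_norm \<Omega> j n T"
    if "q \<in> {..j}" for q
  proof -
    have "distr_L2_sq \<Omega> wR (radop j (cart_poly (of_int (int n)) q (j - q)) T) \<le> ennreal (C\<^sup>2 * card (rad_index n j)) * radial_norm \<Omega> j n T"
      unfolding radial_norm_def using that C by (intro radop_bspan_norm[OF T _ finite_rad_index ne]) auto
    also have "\<dots> \<le> ennreal (C\<^sup>2 * (2 * (real j + 1))) * radial_norm \<Omega> j n T"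
      using card by (intro mult_right_mono ennreal_leI mult_left_mono) auto
    finally show ?thesis .
  qed
  then have "ladder_norm \<Omega> j (int n) T \<le> of_nat (card {..j}) * (ennreal (C\<^sup>2 * (2 * (real j + 1))) * radial_norm \<Omega> j n T)"
    unfolding ladder_norm_def by (rule sum_le_const)
  then show "ladder_norm \<Omega> j k T \<le> ennreal ((real j + 1) * (C\<^sup>2 * (2 * (real j + 1)))) * radial_norm \<Omega> j n T"
    unfolding k j1 by (subst ennreal_mult') (auto simp: mult.assoc)
  have "distr_L2_sq \<Omega> wR (radop j (rad_poly n j x) T) \<le> ennreal (C\<^sup>2 * (real j + 1)) * ladder_norm \<Omega> j (int n) T"
    if "x \<in> rad_index n j" for x
  proof -
    have "distr_L2_sq \<Omega> wR (radop j (rad_poly n j x) T) \<le> ennreal (C\<^sup>2 * card {..j}) * (\<Sum>a\<in>{..j}. distr_L2_sq \<Omega> wR (radop j (cart_poly (real n) a (j - a)) T))"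
      using that C by (intro radop_bspan_norm[OF T]) auto
    then show ?thesis by (simp add: ladder_norm_def add.commute)
  qed
  then have "radial_norm \<Omega> j n T \<le> of_nat (card (rad_index n j)) * (ennreal (C\<^sup>2 * (real j + 1)) * ladder_norm \<Omega> j (int n) T)"
    unfolding radial_norm_def by (rule sum_le_const)
  also have "\<dots> \<le> ennreal (2 * (real j + 1)) * (ennreal (C\<^sup>2 * (real j + 1)) * ladder_norm \<Omega> j (int n) T)"
    by (intro mult_right_mono card') simp
  finally show "radial_norm \<Omega> j n T \<le> ennreal ((2 * (real j + 1)) * (C\<^sup>2 * (real j + 1))) * ladder_norm \<Omega> j k T"
    unfolding k by (subst ennreal_mult') (auto simp: mult.assoc)
qed

end

theorem cart_norm_radial_norm:
  obtains C where "C > 0"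
    "\<And>\<Omega> k n T. open \<Omega> \<Longrightarrow> \<Omega> \<subseteq> {b. 0 < R b} \<Longrightarrow> linear_distr \<Omega> T \<Longrightarrow> \<bar>k\<bar> = int n \<Longrightarrow>
       cart_norm \<Omega> j k T \<le> ennreal C * radial_norm \<Omega> j n T"
    "\<And>\<Omega> k n T. open \<Omega> \<Longrightarrow> \<Omega> \<subseteq> {b. 0 < R b} \<Longrightarrow> linear_distr \<Omega> T \<Longrightarrow> \<bar>k\<bar> = int n \<Longrightarrow>
       radial_norm \<Omega> j n T \<le> ennreal C * cart_norm \<Omega> j k T"
proof -
  obtain B where B: "B > 0"
    "\<And>n a. a \<le> j \<Longrightarrow> cart_poly (real n) a (j - a) \<in> bspan B (rad_index n j) (rad_poly n j)"
    "\<And>n x. x \<in> rad_index n j \<Longrightarrow> rad_poly n j x \<in> bspan B {..j} (\<lambda>a. cart_poly (real n) a (j - a))"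
    using cart_rad_span[of j] by metis
  let ?A = "(real j + 1)\<^sup>2 * ((real j + 1) * (B\<^sup>2 * (2 * (real j + 1))))"
  let ?D = "(2 * (real j + 1)) * (B\<^sup>2 * (real j + 1)) * ((real j + 1) * 4 ^ j)"
  show thesis
  proof (rule that[of "max 1 (max ?A ?D)"])
    fix \<Omega> :: "'b set" and k n T
    assume a: "open \<Omega>" "\<Omega> \<subseteq> {b. 0 < R b}" "linear_distr \<Omega> T" "\<bar>k\<bar> = int n"
    note LR = ladder_norm_radial_norm[OF a(1-3) B(1) B(2)[of _ n] B(3)[of _ n] a(4)]
    have "cart_norm \<Omega> j k T \<le> ennreal ((real j + 1)\<^sup>2) * ladder_norm \<Omega> j k T" by (rule cart_norm_le_ladder_norm[OF a(1-3)])
    also have "\<dots> \<le> ennreal ((real j + 1)\<^sup>2) * (ennreal ((real j + 1) * (B\<^sup>2 * (2 * (real j + 1)))) * radial_norm \<Omega> j n T)"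
      by (intro mult_left_mono LR(1)) auto
    also have "\<dots> = ennreal ?A * radial_norm \<Omega> j n T" by (subst ennreal_mult'[of "(real j + 1)\<^sup>2"]) (auto simp: mult.assoc)
    also have "\<dots> \<le> ennreal (max 1 (max ?A ?D)) * radial_norm \<Omega> j n T" by (intro mult_right_mono ennreal_leI) auto
    finally show "cart_norm \<Omega> j k T \<le> ennreal (max 1 (max ?A ?D)) * radial_norm \<Omega> j n T" .
    have "radial_norm \<Omega> j n T \<le> ennreal ((2 * (real j + 1)) * (B\<^sup>2 * (real j + 1))) * ladder_norm \<Omega> j k T" by (intro LR(2)) auto
    also have "\<dots> \<le> ennreal ((2 * (real j + 1)) * (B\<^sup>2 * (real j + 1))) * (ennreal ((real j + 1) * 4 ^ j) * cart_norm \<Omega> j k T)"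
      by (intro mult_left_mono ladder_norm_le_cart_norm[OF a(1-3)]) auto
    also have "\<dots> = ennreal ?D * cart_norm \<Omega> j k T" by (subst ennreal_mult'[of "(2 * (real j + 1)) * (B\<^sup>2 * (real j + 1))"]) (auto simp: mult.assoc)
    also have "\<dots> \<le> ennreal (max 1 (max ?A ?D)) * cart_norm \<Omega> j k T" by (intro mult_right_mono ennreal_leI) auto
    finally show "radial_norm \<Omega> j n T \<le> ennreal (max 1 (max ?A ?D)) * cart_norm \<Omega> j k T" .
  qed simp
qed

end

section \<open>Removability of the axis\<close>

text \<open>The class of these functions is closed under differentiation, which gives their smoothness by induction.\<close>

definition flat_fun :: "real poly \<Rightarrow> real \<Rightarrow> real" where
  "flat_fun p x = (if 0 < x then poly p (1 / x) * exp (- (1 / x)) else 0)"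

lemma poly_times_exp_minus_tendsto_0:
  fixes p :: "real poly"
  shows "((\<lambda>u. poly p u * exp (- u)) \<longlongrightarrow> 0) at_top"
proof -
  have "((\<lambda>u. \<Sum>i\<le>degree p. coeff p i * (u ^ i / exp u)) \<longlongrightarrow> (\<Sum>i\<le>degree p. coeff p i * 0)) at_top"
    by (intro tendsto_sum tendsto_mult tendsto_const tendsto_power_div_exp_0)
  moreover have "(\<lambda>u. \<Sum>i\<le>degree p. coeff p i * (u ^ i / exp u)) = (\<lambda>u. poly p u * exp (- u))"
    by (rule ext) (simp add: poly_altdef sum_distrib_right exp_minus divide_inverse mult.assoc)
  ultimately show ?thesis by simp
qed

text \<open>With u = 1/x the derivative of p(u) e^(-u) is u^2 (p - p')(u) e^(-u). At 0 the
  difference quotient from the right is u p(u) e^(-u) and tends to 0.\<close>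

lemma flat_fun_derivative:
  "(flat_fun p has_real_derivative flat_fun ([:0, 0, 1:] * (p - pderiv p)) x) (at x)"
proof -
  consider "x < 0" | "x = 0" | "0 < x" by linarith
  then show ?thesis
  proof cases
    case 1
    have "((\<lambda>x. 0) has_real_derivative 0) (at x)" by simp
    then have "(flat_fun p has_real_derivative 0) (at x)"
      by (rule has_field_derivative_transform_within_open[where S = "{..<0}"]) (use 1 in \<open>auto simp: flat_fun_def\<close>)
    then show ?thesis using 1 by (simp add: flat_fun_def)
  next
    case 2
    have r: "((\<lambda>h. flat_fun p h / h) \<longlongrightarrow> 0) (at_right 0)"
      unfolding filterlim_at_right_to_top
    proof (rule Lim_transform_eventually[OF poly_times_exp_minus_tendsto_0[of "[:0, 1:] * p"]])
      show "\<forall>\<^sub>F u in at_top. poly ([:0, 1:] * p) u * exp (- u) = flat_fun p (inverse u) / inverse u"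
        using eventually_gt_at_top[of 0] by eventually_elim (simp add: flat_fun_def field_simps)
    qed
    have l: "((\<lambda>h. flat_fun p h / h) \<longlongrightarrow> 0) (at_left 0)"
      by (rule Lim_transform_eventually[OF tendsto_const])
        (auto simp: flat_fun_def eventually_at_filter intro!: always_eventually)
    have "((\<lambda>h. flat_fun p h / h) \<longlongrightarrow> 0) (at 0)" using l r by (simp add: filterlim_split_at)
    then show ?thesis using 2 by (simp add: has_field_derivative_iff flat_fun_def)
  next
    case 3
    have "((\<lambda>x. poly p (1 / x) * exp (- (1 / x))) has_real_derivative
        poly ([:0, 0, 1:] * (p - pderiv p)) (1 / x) * exp (- (1 / x))) (at x)"
      using 3 by (auto intro!: derivative_eq_intros simp: field_simps power2_eq_square)
    then have "(flat_fun p has_real_derivative poly ([:0, 0, 1:] * (p - pderiv p)) (1 / x) * exp (- (1 / x))) (at x)"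
      by (rule has_field_derivative_transform_within_open[where S = "{0<..}"]) (use 3 in \<open>auto simp: flat_fun_def\<close>)
    then show ?thesis using 3 by (simp add: flat_fun_def)
  qed
qed

lemma smooth_upto_flat_fun: "smooth_upto n UNIV (\<lambda>x. complex_of_real (flat_fun p x))"
proof (induction n arbitrary: p)
  have D: "((\<lambda>x. complex_of_real (flat_fun p x)) has_vector_derivative complex_of_real (flat_fun ([:0, 0, 1:] * (p - pderiv p)) x)) (at x)" for p x
    using has_vector_derivative_of_real[OF flat_fun_derivative[of p x]] by simp
  have d: "(\<lambda>x. complex_of_real (flat_fun p x)) differentiable_on UNIV" for p
    using D by (auto simp: differentiable_on_def has_vector_derivative_def differentiable_def)
  {
    case 0
    show ?case using d by simp
  next
    case (Suc n)
    have "pdiff 1 (\<lambda>x. complex_of_real (flat_fun p x)) = (\<lambda>x. complex_of_real (flat_fun ([:0, 0, 1:] * (p - pderiv p)) x))"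
      using pdiff_eq_vector[OF D] by blast
    then show ?case using d Suc by simp
  }
qed

text \<open>The flat function f is nested in itself: g(t) = f(1) - f(1 - t) is at most 0 for t <= 0
  and equals f(1) for t >= 1. So f(g(t)) / f(f(1)) steps from 0 to 1, and the only division is by a
  constant.\<close>

lemma smooth_step:
  obtains \<eta> :: "real \<Rightarrow> complex" where "smooth \<eta>" "\<And>t. t \<le> 0 \<Longrightarrow> \<eta> t = 0" "\<And>t. 1 \<le> t \<Longrightarrow> \<eta> t = 1" "\<And>t. norm (\<eta> t) \<le> 1"
proof -
  define f where "f = flat_fun 1"
  have f: "f x = (if 0 < x then exp (- (1 / x)) else 0)" for x by (simp add: f_def flat_fun_def)
  have mono: "f x \<le> f y" if "x \<le> y" for x y using that by (auto simp: f frac_le)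
  have pos: "0 < f 1" "0 < f (f 1)" "0 \<le> f x" for x by (auto simp: f)
  define g where "g t = f 1 - f (1 - t)" for t
  define \<eta> where "\<eta> t = complex_of_real (f (g t)) * complex_of_real (1 / f (f 1))" for t
  show ?thesis
  proof (rule that)
    have "smooth_upto n UNIV (\<lambda>t. complex_of_real (f (g t)))" for n
    proof (rule smooth_upto_compose[OF open_UNIV open_UNIV, where f = "\<lambda>x. complex_of_real (f x)" and g = g])
      show "smooth_upto n UNIV (\<lambda>x. complex_of_real (f x))" unfolding f_def by (rule smooth_upto_flat_fun)
      have "smooth_upto n UNIV (\<lambda>t. complex_of_real (f (1 - t)))" for n
      proof (rule smooth_upto_compose[OF open_UNIV open_UNIV, where f = "\<lambda>x. complex_of_real (f x)" and g = "\<lambda>t. 1 - t"])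
        show "smooth_upto n UNIV (\<lambda>x. complex_of_real (f x))" unfolding f_def by (rule smooth_upto_flat_fun)
        show "smooth_upto n UNIV (\<lambda>x. complex_of_real ((1 - x) \<bullet> b))" if "b \<in> Basis" for n and b :: real
          using that smooth_upto_add[OF open_UNIV smooth_upto_const smooth_upto_uminus[OF open_UNIV smooth_upto_inner[of n UNIV "1::real"]], of 1]
          by simp
      qed simp
      note s1 = this
      show "smooth_upto n UNIV (\<lambda>x. complex_of_real (g x \<bullet> b))" if "b \<in> Basis" for b n
        using that smooth_upto_add[OF open_UNIV smooth_upto_const smooth_upto_uminus[OF open_UNIV s1[of n]], of "complex_of_real (f 1)"]
        by (simp add: g_def)
    qed simp
    then show "smooth \<eta>" unfolding smooth_iff \<eta>_def by (intro allI smooth_upto_mult) auto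
    show "\<eta> t = 0" if "t \<le> 0" for t
    proof -
      have "g t \<le> 0" using mono[of 1 "1 - t"] that by (simp add: g_def)
      then show ?thesis by (simp add: \<eta>_def f)
    qed
    show "\<eta> t = 1" if "1 \<le> t" for t
    proof -
      have "g t = f 1" using that by (simp add: g_def) (simp add: f)
      then show ?thesis using pos by (simp add: \<eta>_def flip: of_real_mult)
    qed
    show "norm (\<eta> t) \<le> 1" for t
    proof -
      have "f (g t) \<le> f (f 1)" using mono[of "g t" "f 1"] pos(3)[of "1 - t"] by (simp add: g_def)
      then show ?thesis using pos by (simp add: \<eta>_def norm_divide divide_le_eq)
    qed
  qed
qed

section \<open>Cutoff functions near the axis\<close>

context cylindrical
begin

lemma rho_sq: "(rho v)\<^sup>2 = (v \<bullet> ex)\<^sup>2 + (v \<bullet> ey)\<^sup>2" by (simp add: rho_def)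

lemma rho_nonneg: "0 \<le> rho v" by (simp add: rho_def)

lemma smooth_upto_rho_sq: "smooth_upto n S (\<lambda>v. complex_of_real ((rho v)\<^sup>2))"
  unfolding rho_sq of_real_add of_real_power
  by (rule smooth_upto_subset[of n UNIV]) (auto intro!: smooth_upto_add smooth_upto_power smooth_upto_inner)

lemma pdiff_rho_sq: "pdiff e (\<lambda>v. complex_of_real ((rho v)\<^sup>2)) v = complex_of_real (2 * (v \<bullet> ex) * (e \<bullet> ex) + 2 * (v \<bullet> ey) * (e \<bullet> ey))"
proof -
  have "((\<lambda>v. (v \<bullet> ex)\<^sup>2 + (v \<bullet> ey)\<^sup>2) has_derivative (\<lambda>e. 2 * (v \<bullet> ex) * (e \<bullet> ex) + 2 * (v \<bullet> ey) * (e \<bullet> ey))) (at v)"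
    by (auto intro!: derivative_eq_intros simp: fun_eq_iff)
  from pdiff_eq[OF bounded_linear.has_derivative[OF bounded_linear_of_real this]]
  show ?thesis unfolding rho_sq by simp
qed

text \<open>The cutoff is a smooth step applied to (n+1)^2 rho^2 - 1; squaring \<open>rho\<close>
  keeps it smooth across the axis. The transition happens within 1 <= (n+1) rho <= 2, where the
  partial derivatives of (n+1)^2 rho^2 are at most 8 (n+1), whence the value of
  \<open>M\<close>.\<close>

lemma axis_cutoff:
  obtains \<kappa> :: "nat \<Rightarrow> 'a \<Rightarrow> complex" and M where "0 \<le> M" "\<And>n. smooth (\<kappa> n)" "\<And>n v. norm (\<kappa> n v) \<le> 1"
    "\<And>n v. rho v \<le> 1 / real (Suc n) \<Longrightarrow> \<kappa> n v = 0" "\<And>v. 0 < rho v \<Longrightarrow> (\<lambda>n. \<kappa> n v) \<longlonglongrightarrow> 1"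
    "\<And>n v e. e \<in> Basis \<Longrightarrow> norm (pdiff e (\<kappa> n) v) \<le> M * real (Suc n)"
    "\<And>n v e. e \<in> Basis \<Longrightarrow> 2 / real (Suc n) < rho v \<Longrightarrow> pdiff e (\<kappa> n) v = 0"
proof -
  obtain \<eta> :: "real \<Rightarrow> complex" where \<eta>: "smooth \<eta>" "\<And>t. t \<le> 0 \<Longrightarrow> \<eta> t = 0" "\<And>t. 1 \<le> t \<Longrightarrow> \<eta> t = 1" "\<And>t. norm (\<eta> t) \<le> 1"
    using smooth_step by metis
  have c: "continuous_on {0..1} (pdiff 1 \<eta>)" by (rule smooth_continuous[OF smooth_pdiff[OF \<eta>(1)]]) simp
  obtain B where B: "0 < B" "\<And>t. t \<in> {0..1} \<Longrightarrow> norm (pdiff 1 \<eta> t) \<le> B"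
    using compact_imp_bounded[OF compact_continuous_image[OF c compact_Icc]] by (auto simp: bounded_pos)
  have \<eta>0: "pdiff 1 \<eta> t = 0" if t: "t \<notin> {0..1}" for t
  proof -
    consider "t < 0" | "1 < t" using t by fastforce
    then show ?thesis
    proof cases
      case 1
      then show ?thesis using pdiff_cong[of "{..<0}" t \<eta> "\<lambda>_. 0" 1] \<eta>(2) by (simp add: pdiff_const)
    next
      case 2
      then show ?thesis using pdiff_cong[of "{1<..}" t \<eta> "\<lambda>_. 1" 1] \<eta>(3) by (simp add: pdiff_const)
    qed
  qed
  define s where "s n v = (real (Suc n))\<^sup>2 * (rho v)\<^sup>2 - 1" for n v
  define \<kappa> where "\<kappa> n v = \<eta> (s n v)" for n v
  have ss: "smooth_upto m UNIV (\<lambda>v. complex_of_real (s n v \<bullet> b))" if "b \<in> Basis" for m n and b :: real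
  proof -
    have "smooth_upto m UNIV (\<lambda>v. complex_of_real ((real (Suc n))\<^sup>2) * complex_of_real ((rho v)\<^sup>2) + (-1))"
      by (intro smooth_upto_add smooth_upto_mult smooth_upto_rho_sq smooth_upto_const open_UNIV)
    then show ?thesis using that by (simp add: s_def)
  qed
  have sm: "smooth (\<kappa> n)" for n
    unfolding smooth_iff \<kappa>_def
  proof
    show "smooth_upto m UNIV (\<lambda>v. \<eta> (s n v))" for m
      by (rule smooth_upto_compose[OF open_UNIV open_UNIV _ ss]) (use \<eta>(1) in \<open>auto simp: smooth_iff\<close>)
  qed
  have ds: "pdiff e (\<lambda>v. complex_of_real (s n v)) v = complex_of_real ((real (Suc n))\<^sup>2 * (2 * (v \<bullet> ex) * (e \<bullet> ex) + 2 * (v \<bullet> ey) * (e \<bullet> ey)))" for e n v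
  proof -
    have dr: "(\<lambda>v. complex_of_real ((rho v)\<^sup>2)) differentiable (at v)" using smooth_upto_at[OF smooth_upto_rho_sq[of 0 UNIV]] by simp
    have "pdiff e (\<lambda>v. complex_of_real (s n v)) v = pdiff e (\<lambda>v. complex_of_real ((real (Suc n))\<^sup>2) * complex_of_real ((rho v)\<^sup>2) + (-1)) v"
      by (simp add: s_def)
    also have "\<dots> = complex_of_real ((real (Suc n))\<^sup>2) * pdiff e (\<lambda>v. complex_of_real ((rho v)\<^sup>2)) v"
    proof -
      have "(\<lambda>v. complex_of_real ((real (Suc n))\<^sup>2) * complex_of_real ((rho v)\<^sup>2)) differentiable (at v)"
        by (intro differentiable_mult dr) simp
      then show ?thesis by (subst pdiff_add) (simp_all add: pdiff_const pdiff_cmult[OF dr] del: of_real_power)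
    qed
    finally show ?thesis by (simp only: pdiff_rho_sq of_real_mult)
  qed
  have dchi: "pdiff e (\<kappa> n) v = pdiff 1 \<eta> (s n v) * complex_of_real ((real (Suc n))\<^sup>2 * (2 * (v \<bullet> ex) * (e \<bullet> ex) + 2 * (v \<bullet> ey) * (e \<bullet> ey)))" for e n v
  proof -
    have "\<eta> differentiable (at (s n v))"
      using smooth_has_derivative[OF \<eta>(1), of "s n v"] unfolding differentiable_def by blast
    moreover have "(\<lambda>v. complex_of_real (s n v \<bullet> b)) differentiable (at v)" if "b \<in> Basis" for b :: real
      using smooth_upto_at[OF ss[OF that, of 0 n]] by simp
    ultimately have "pdiff e (\<lambda>v. \<eta> (s n v)) v = (\<Sum>b\<in>Basis. pdiff b \<eta> (s n v) * pdiff e (\<lambda>v. complex_of_real (s n v \<bullet> b)) v)"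
      by (rule pdiff_compose(2))
    then show ?thesis using ds[of e n v] unfolding \<kappa>_def[abs_def] by simp
  qed
  have range: "1 / real (Suc n) \<le> rho v \<and> rho v \<le> 2 / real (Suc n)" if "s n v \<in> {0..1}" for n v
  proof -
    have 1: "1 \<le> (real (Suc n) * rho v)\<^sup>2" "(real (Suc n) * rho v)\<^sup>2 \<le> 2\<^sup>2"
      using that by (auto simp: s_def power_mult_distrib)
    have "1 \<le> real (Suc n) * rho v" using 1(1) rho_nonneg[of v] power2_le_imp_le[of 1 "real (Suc n) * rho v"] by simp
    moreover have "real (Suc n) * rho v \<le> 2" by (rule power2_le_imp_le[OF 1(2)]) simp
    ultimately show ?thesis by (simp add: field_simps)
  qed
  show thesis
  proof (rule that[of "8 * B" \<kappa>])
    show "0 \<le> 8 * B" using B by simp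
    show "smooth (\<kappa> n)" for n by (rule sm)
    show "norm (\<kappa> n v) \<le> 1" for n v by (simp add: \<kappa>_def \<eta>(4))
    show "\<kappa> n v = 0" if "rho v \<le> 1 / real (Suc n)" for n v
    proof -
      have "real (Suc n) * rho v \<le> 1" using that by (simp add: field_simps)
      then have "(real (Suc n) * rho v)\<^sup>2 \<le> 1\<^sup>2" using rho_nonneg by (intro power_mono) auto
      then show ?thesis using \<eta>(2) by (simp add: \<kappa>_def s_def power_mult_distrib)
    qed
    show "(\<lambda>n. \<kappa> n v) \<longlonglongrightarrow> 1" if "0 < rho v" for v
    proof (rule tendsto_eventually)
      obtain N where N: "2 / rho v < real N" using reals_Archimedean2 by blast
      show "\<forall>\<^sub>F n in sequentially. \<kappa> n v = 1"
        using eventually_ge_at_top[of N]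
      proof eventually_elim
        case (elim n)
        then have "2 / rho v < real (Suc n)" using N by linarith
        then have "2 \<le> real (Suc n) * rho v" using that by (simp add: field_simps)
        then have "2\<^sup>2 \<le> (real (Suc n) * rho v)\<^sup>2" by (intro power_mono) auto
        then show ?case using \<eta>(3) by (simp add: \<kappa>_def s_def power_mult_distrib)
      qed
    qed
    show "pdiff e (\<kappa> n) v = 0" if "2 / real (Suc n) < rho v" for n v e
      using range[of n v] that \<eta>0[of "s n v"] by (force simp: dchi)
    show "norm (pdiff e (\<kappa> n) v) \<le> 8 * B * real (Suc n)" if e: "e \<in> Basis" for n v e
    proof (cases "s n v \<in> {0..1}")
      case True
      have x: "\<bar>v \<bullet> ex\<bar> \<le> rho v" "\<bar>v \<bullet> ey\<bar> \<le> rho v"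
        unfolding rho_def by (auto intro!: real_le_rsqrt)
      have e1: "\<bar>e \<bullet> ex\<bar> \<le> 1" "\<bar>e \<bullet> ey\<bar> \<le> 1" using e ex_Basis ey by (auto simp: inner_Basis)
      have "\<bar>(v \<bullet> ex) * (e \<bullet> ex)\<bar> \<le> rho v * 1" "\<bar>(v \<bullet> ey) * (e \<bullet> ey)\<bar> \<le> rho v * 1"
        unfolding abs_mult using x e1 rho_nonneg by (intro mult_mono; simp)+
      then have "\<bar>2 * (v \<bullet> ex) * (e \<bullet> ex) + 2 * (v \<bullet> ey) * (e \<bullet> ey)\<bar> \<le> 4 * rho v" by linarith
      also have "\<dots> \<le> 4 * (2 / real (Suc n))" using range[OF True] by (intro mult_left_mono) auto
      finally have "\<bar>(real (Suc n))\<^sup>2 * (2 * (v \<bullet> ex) * (e \<bullet> ex) + 2 * (v \<bullet> ey) * (e \<bullet> ey))\<bar> \<le> (real (Suc n))\<^sup>2 * (4 * (2 / real (Suc n)))"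
        unfolding abs_mult by (intro mult_mono) auto
      also have "\<dots> = 8 * real (Suc n)" by (simp add: power2_eq_square del: of_nat_Suc)
      finally have "norm (pdiff e (\<kappa> n) v) \<le> B * (8 * real (Suc n))"
        unfolding dchi norm_mult norm_of_real using B True by (intro mult_mono) auto
      then show ?thesis by (simp add: mult_ac)
    next
      case False
      then show ?thesis using \<eta>0[OF False] B by (simp add: dchi)
    qed
  qed
qed

text \<open>In cylindrical coordinates the tube lies over a box with radial side d and other sides 2
  L, and there the Jacobian integrates to at most 2 pi d over the angle. The two factors d express
  codimension two.\<close>

lemma tube_volume:
  assumes "compact K"
  obtains C where "0 \<le> C" "\<And>d. 0 < d \<Longrightarrow> measure lborel (K \<inter> {v. rho v \<le> d}) \<le> C * d\<^sup>2"
proof -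
  obtain L where L: "0 < L" "\<And>v. v \<in> K \<Longrightarrow> norm (rad v) \<le> L"
    using compact_imp_bounded[OF compact_continuous_image[OF continuous_rad assms]] by (auto simp: bounded_pos)
  have Kb [measurable]: "K \<in> sets borel" using assms by (simp add: borel_compact)
  have rm [measurable]: "rho \<in> borel_measurable borel" by (intro borel_measurable_continuous_onI continuous_rho)
  define lo :: 'b where "lo = (\<Sum>b\<in>Basis. (if b = er then 0 else - L) *\<^sub>R b)"
  define hi :: "real \<Rightarrow> 'b" where "hi d = (\<Sum>b\<in>Basis. (if b = er then d else L) *\<^sub>R b)" for d
  have lo: "lo \<bullet> b = (if b = er then 0 else - L)" and hi: "hi d \<bullet> b = (if b = er then d else L)" if "b \<in> Basis" for b d
    using that unfolding lo_def hi_def by (simp_all only: inner_sum_left_Basis)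
  define C where "C = 2 * pi * (\<Prod>b\<in>Basis - {er}. 2 * L)"
  show thesis
  proof (rule that[of C])
    show "0 \<le> C" using L unfolding C_def by (intro mult_nonneg_nonneg prod_nonneg) auto
    fix d :: real assume d: "0 < d"
    let ?A = "K \<inter> {v. rho v \<le> d}"
    have Am [measurable]: "?A \<in> sets borel" by measurable
    have "emeasure lborel ?A = (\<integral>\<^sup>+v. indicator ?A v \<partial>lborel)" by simp
    also have "\<dots> = (\<integral>\<^sup>+b. \<integral>\<^sup>+\<theta>. ennreal (wt b \<theta>) * indicator ?A (pol \<theta> b) \<partial>lborel \<partial>lborel)" by (rule nn_cyl) measurable
    also have "\<dots> \<le> (\<integral>\<^sup>+b. ennreal (2 * pi * d) * indicator (cbox lo (hi d)) b \<partial>lborel)"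
    proof (rule nn_integral_mono)
      fix b
      show "(\<integral>\<^sup>+\<theta>. ennreal (wt b \<theta>) * indicator ?A (pol \<theta> b) \<partial>lborel) \<le> ennreal (2 * pi * d) * indicator (cbox lo (hi d)) b"
      proof (cases "0 < R b \<and> b \<in> cbox lo (hi d)")
        case True
        have "(\<integral>\<^sup>+\<theta>. ennreal (wt b \<theta>) * indicator ?A (pol \<theta> b) \<partial>lborel) \<le> (\<integral>\<^sup>+\<theta>. ennreal (wt b \<theta>) * 1 \<partial>lborel)"
          by (intro nn_integral_mono mult_left_mono) (auto simp: indicator_def)
        also have "\<dots> = ennreal (wR b) * 1" using True by (intro nn_integral_wt) auto
        also have "\<dots> \<le> ennreal (2 * pi * d)" using True er hi[OF er] by (auto intro!: ennreal_leI simp: mem_box)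
        finally show ?thesis using True by simp
      next
        case False
        have "ennreal (wt b \<theta>) * indicator ?A (pol \<theta> b) = 0" for \<theta>
        proof (rule ccontr)
          assume "ennreal (wt b \<theta>) * indicator ?A (pol \<theta> b) \<noteq> 0"
          then have "wt b \<theta> \<noteq> 0" and A: "pol \<theta> b \<in> ?A" by (auto simp: indicator_def split: if_splits)
          then have b: "0 < R b" by (intro wt_pos)
          have r: "rad (pol \<theta> b) = b" "rho (pol \<theta> b) = R b" using b by (auto intro: rad_pol rho_pol)
          have "norm b \<le> L" "R b \<le> d" using L(2)[of "pol \<theta> b"] A r by auto
          then have "\<bar>b \<bullet> c\<bar> \<le> L" if "c \<in> Basis" for c using Basis_le_norm[OF that, of b] by simp
          then have "b \<in> cbox lo (hi d)" using b \<open>R b \<le> d\<close> by (auto simp: mem_box lo hi abs_le_iff minus_le_iff)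
          then show False using False b by simp
        qed
        then have "(\<integral>\<^sup>+\<theta>. ennreal (wt b \<theta>) * indicator ?A (pol \<theta> b) \<partial>lborel) = (\<integral>\<^sup>+\<theta>. 0 \<partial>(lborel :: real measure))" by (simp only:)
        then show ?thesis by simp
      qed
    qed
    also have "\<dots> = ennreal (2 * pi * d) * emeasure lborel (cbox lo (hi d))" by (simp add: nn_integral_cmult_indicator)
    also have "emeasure lborel (cbox lo (hi d)) = ennreal (\<Prod>b\<in>Basis. (hi d - lo) \<bullet> b)"
      using d L by (intro emeasure_lborel_cbox) (auto simp: lo hi)
    also have "(\<Prod>b\<in>Basis. (hi d - lo) \<bullet> b) = d * (\<Prod>b\<in>Basis - {er}. 2 * L)"
      using er by (subst prod.remove[of _ er]) (auto simp: inner_diff_left lo hi intro!: prod.cong)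
    also have "ennreal (2 * pi * d) * ennreal (d * (\<Prod>b\<in>Basis - {er}. 2 * L)) = ennreal (C * d\<^sup>2)"
      using d L by (subst ennreal_mult'[symmetric]) (auto simp: C_def power2_eq_square mult_ac)
    finally have "emeasure lborel ?A \<le> ennreal (C * d\<^sup>2)" .
    then show "measure lborel ?A \<le> C * d\<^sup>2"
      unfolding measure_def using \<open>0 \<le> C\<close> by (intro enn2real_leI) auto
  qed
qed

lemma AE_off_axis: "AE v in lborel. v \<in> off_axis"
proof (rule AE_I'[where N = "- off_axis"])
  have [measurable]: "off_axis \<in> sets borel" using open_off_axis by simp
  have z: "ennreal (wt b \<theta>) * indicator (- off_axis) (pol \<theta> b) = 0" for b \<theta>
    using wt_pos[of b \<theta>] by (cases "wt b \<theta> = 0") (auto simp: off_axis_def rho_pol)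
  have "emeasure lborel (- off_axis) = (\<integral>\<^sup>+v. indicator (- off_axis) v \<partial>lborel)" by simp
  also have "\<dots> = (\<integral>\<^sup>+b. \<integral>\<^sup>+\<theta>. ennreal (wt b \<theta>) * indicator (- off_axis) (pol \<theta> b) \<partial>lborel \<partial>lborel)"
    by (rule nn_cyl) measurable
  also have "\<dots> = 0" by (simp only: z nn_integral_const mult_zero_left)
  finally show "- off_axis \<in> null_sets lborel" by (simp add: null_sets_def)
qed auto

lemma cutoff_test:
  assumes D: "open D" and \<phi>: "\<phi> \<in> test_functions D" and \<kappa>: "smooth \<kappa>" "0 < d" "\<And>v. rho v \<le> d \<Longrightarrow> \<kappa> v = 0"
  shows "(\<lambda>v. \<kappa> v * \<phi> v) \<in> test_functions (D \<inter> off_axis)"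
proof -
  obtain K where K: "smooth \<phi>" "compact K" "K \<subseteq> D" "\<And>v. v \<notin> K \<Longrightarrow> \<phi> v = 0" using test_functionsE[OF \<phi>] by metis
  have cl: "closed {v. d \<le> rho v}" by (intro closed_Collect_le continuous_intros continuous_rho)
  show ?thesis
  proof (rule test_functionsI[of _ "K \<inter> {v. d \<le> rho v}"])
    show "smooth (\<lambda>v. \<kappa> v * \<phi> v)"
      using \<kappa>(1) K(1) unfolding smooth_iff by (intro allI smooth_upto_mult) auto
    show "compact (K \<inter> {v. d \<le> rho v})" using K(2) cl by (rule compact_Int_closed)
    show "K \<inter> {v. d \<le> rho v} \<subseteq> D \<inter> off_axis" using K(3) \<kappa>(2) by (auto simp: off_axis_def)
    show "\<kappa> v * \<phi> v = 0" if "v \<notin> K \<inter> {v. d \<le> rho v}" for v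
      using that K(4)[of v] \<kappa>(3)[of v] by (cases "v \<in> K") auto
  qed
qed

lemma cutoff_integral_tendsto:
  fixes F :: "'a \<Rightarrow> complex"
  assumes F: "integrable lborel F" and \<kappa>: "\<And>n. smooth (\<kappa> n)" "\<And>n v. norm (\<kappa> n v) \<le> 1" "\<And>v. 0 < rho v \<Longrightarrow> (\<lambda>n. \<kappa> n v) \<longlonglongrightarrow> 1"
  shows "(\<lambda>n. \<integral>v. \<kappa> n v * F v \<partial>lborel) \<longlonglongrightarrow> (\<integral>v. F v \<partial>lborel)"
proof (rule integral_dominated_convergence[where w = "\<lambda>v. norm (F v)"])
  show "(\<lambda>v. \<kappa> n v * F v) \<in> borel_measurable lborel" for n
  proof -
    have [measurable]: "\<kappa> n \<in> borel_measurable borel" by (intro borel_measurable_continuous_onI smooth_continuous \<kappa>(1))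
    show ?thesis using F by measurable
  qed
  show "AE v in lborel. (\<lambda>n. \<kappa> n v * F v) \<longlonglongrightarrow> F v"
    using AE_off_axis
  proof eventually_elim
    case (elim v)
    then have "(\<lambda>n. \<kappa> n v) \<longlonglongrightarrow> 1" by (intro \<kappa>(3)) (simp add: off_axis_def)
    from tendsto_mult[OF this tendsto_const[of "F v"]] show ?case by simp
  qed
  show "AE v in lborel. norm (\<kappa> n v * F v) \<le> norm (F v)" for n
    using \<kappa>(2)[of n] by (intro AE_I2) (simp add: norm_mult mult_left_le_one_le)
qed (use F in auto)

lemma L2_integrable_square_compact:
  fixes g :: "'a \<Rightarrow> complex"
  assumes "open D" "compact K" "K \<subseteq> D" and g [measurable]: "g \<in> borel_measurable borel" and fin: "L2_sq D (\<lambda>_. 1) g < \<infinity>"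
  shows "integrable lborel (\<lambda>v. indicator K v * (norm (g v))\<^sup>2)"
proof (rule integrableI_bounded)
  have [measurable]: "K \<in> sets borel" using assms by (simp add: borel_compact)
  show "(\<lambda>v. indicator K v * (norm (g v))\<^sup>2) \<in> borel_measurable lborel" by measurable
  have "(\<integral>\<^sup>+v. ennreal (norm (indicator K v * (norm (g v))\<^sup>2)) \<partial>lborel) \<le> (\<integral>\<^sup>+v. ennreal (1 * (norm (g v))\<^sup>2) * indicator D v \<partial>lborel)"
    using assms(3) by (intro nn_integral_mono) (auto simp: indicator_def)
  also have "\<dots> = L2_sq D (\<lambda>_. 1) g" using assms(1) by (intro L2_sq_lborel[symmetric]) simp
  finally show "(\<integral>\<^sup>+v. ennreal (norm (indicator K v * (norm (g v))\<^sup>2)) \<partial>lborel) < \<infinity>" using fin by (rule le_less_trans)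
qed

text \<open>Young's inequality; \<open>cutoff_gradient_tendsto\<close> uses it with a large
  parameter s.\<close>

lemma mult_le_weighted_squares: "0 < s \<Longrightarrow> x * y \<le> s * x\<^sup>2 + y\<^sup>2 / (4 * s)" for x y s :: real
proof -
  assume s: "0 < s"
  have "0 \<le> (2 * s * x - y)\<^sup>2 / (4 * s)" using s by simp
  also have "\<dots> = s * x\<^sup>2 + y\<^sup>2 / (4 * s) - x * y" using s by (simp add: power2_eq_square field_simps)
  finally show ?thesis by simp
qed

text \<open>The axis has codimension two: a cutoff gradient of size \<open>n\<close> lives on a tube of volume \<open>O(n\<^bsup>-2\<^esup>)\<close>, hence is bounded in
  \<open>L\<^sup>2\<close>, while the \<open>L\<^sup>2\<close> mass of the other factor in that tube tends to zero.\<close>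

lemma cutoff_gradient_tendsto:
  fixes g :: "'a \<Rightarrow> complex"
  assumes D: "open D" and g [measurable]: "g \<in> borel_measurable borel" and fin: "L2_sq D (\<lambda>_. 1) g < \<infinity>"
    and \<phi>: "\<phi> \<in> test_functions D" and \<kappa>: "\<And>n. smooth (\<kappa> n)" and e: "e \<in> Basis"
    and M: "0 \<le> M" "\<And>n v. norm (pdiff e (\<kappa> n) v) \<le> M * real (Suc n)" "\<And>n v. 2 / real (Suc n) < rho v \<Longrightarrow> pdiff e (\<kappa> n) v = 0"
  shows "(\<lambda>n. \<integral>v. g v * (\<phi> v * pdiff e (\<kappa> n) v) \<partial>lborel) \<longlonglongrightarrow> 0"
proof -
  obtain K where K: "compact K" "K \<subseteq> D" "\<And>v. v \<notin> K \<Longrightarrow> \<phi> v = 0" using test_functionsE[OF \<phi>] by metis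
  obtain B where B: "B > 0" "\<And>v. norm (\<phi> v) \<le> B" using test_bounded[OF \<phi>] by metis
  obtain C where C: "0 \<le> C" "\<And>d. 0 < d \<Longrightarrow> measure lborel (K \<inter> {v. rho v \<le> d}) \<le> C * d\<^sup>2" using tube_volume[OF K(1)] by metis
  have [measurable]: "K \<in> sets borel" "rho \<in> borel_measurable borel"
    using K(1) by (auto simp: borel_compact intro: borel_measurable_continuous_onI continuous_rho)
  define A where "A n = K \<inter> {v. rho v \<le> 2 / real (Suc n)}" for n
  have Am [measurable]: "A n \<in> sets borel" for n unfolding A_def by measurable
  have Afin: "emeasure lborel (A n) < \<infinity>" for n
    using emeasure_mono[of "A n" K lborel] emeasure_compact_finite[OF K(1)] by (auto simp: A_def intro: le_less_trans)
  define q where "q v = indicator K v * (norm (g v))\<^sup>2" for v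
  have q: "integrable lborel q" unfolding q_def[abs_def] by (rule L2_integrable_square_compact[OF D K(1,2) g fin])
  define I where "I n = (\<integral>v. indicator (A n) v * q v \<partial>lborel)" for n
  have Ii: "integrable lborel (\<lambda>v. indicator (A n) v * q v)" for n
    by (rule Bochner_Integration.integrable_bound[OF q]) (use q in \<open>auto simp: indicator_def\<close>)
  have I0: "I \<longlonglongrightarrow> (\<integral>v. 0 \<partial>(lborel :: 'a measure))"
    unfolding I_def
  proof (rule integral_dominated_convergence[where w = "\<lambda>v. norm (q v)"])
    show "AE v in lborel. (\<lambda>n. indicator (A n) v * q v) \<longlonglongrightarrow> 0"
      using AE_off_axis
    proof eventually_elim
      case (elim v)
      then have v: "0 < rho v" by (simp add: off_axis_def)
      obtain N where N: "2 / rho v < real N" using reals_Archimedean2 by blast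
      show ?case
      proof (rule tendsto_eventually, rule eventually_mono[OF eventually_ge_at_top[of N]])
        fix n assume "N \<le> n"
        then have "2 / rho v < real (Suc n)" using N by linarith
        then have "2 / real (Suc n) < rho v" using v by (simp add: field_simps)
        then show "indicator (A n) v * q v = 0" by (simp add: A_def)
      qed
    qed
  qed (use q in \<open>auto simp: indicator_def\<close>)
  define c0 where "c0 = (B * M)\<^sup>2 * C"
  have c0: "0 \<le> c0" using C by (simp add: c0_def)
  let ?J = "\<lambda>n. \<integral>v. g v * (\<phi> v * pdiff e (\<kappa> n) v) \<partial>lborel"
  \<comment> \<open>Young's inequality on the tube. The first term is s times the mass of
    \<open>g\<close> in the tube; in the second, the squared gradient bound cancels the tube volume
    and leaves c0/s for every n.\<close>
  have J: "norm (?J n) \<le> s * I n + c0 / s" if s: "0 < s" for s n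
  proof -
    define y where "y = B * M * real (Suc n)"
    have y0: "0 \<le> y" using B M by (simp add: y_def)
    have "norm (?J n) \<le> (\<integral>v. s * (indicator (A n) v * q v) + (y\<^sup>2 / (4 * s)) * indicator (A n) v \<partial>lborel)"
    proof (rule Bochner_Integration.integral_norm_bound_integral)
      have pm [measurable]: "pdiff e (\<kappa> n) \<in> borel_measurable borel" "\<phi> \<in> borel_measurable borel"
        using smooth_continuous[OF smooth_pdiff[OF \<kappa> e]] test_measurable[OF \<phi>] by (auto intro: borel_measurable_continuous_onI)
      have r: "integrable lborel (\<lambda>v. s * (indicator (A n) v * q v) + (y\<^sup>2 / (4 * s)) * indicator (A n) v)"
        using Ii Afin by (intro Bochner_Integration.integrable_add integrable_mult_right) (auto simp: integrable_indicator_iff)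
      then show "integrable lborel (\<lambda>v. s * (indicator (A n) v * q v) + (y\<^sup>2 / (4 * s)) * indicator (A n) v)" .
      have bd: "norm (g v * (\<phi> v * pdiff e (\<kappa> n) v)) \<le> s * (indicator (A n) v * q v) + (y\<^sup>2 / (4 * s)) * indicator (A n) v" for v
      proof (cases "v \<in> A n")
        case True
        have "norm (\<phi> v * pdiff e (\<kappa> n) v) \<le> B * (M * real (Suc n))"
          unfolding norm_mult using B(2) M(2)[of n v] B(1) by (intro mult_mono) auto
        then have "norm (g v * (\<phi> v * pdiff e (\<kappa> n) v)) \<le> norm (g v) * y"
          unfolding norm_mult[of "g v"] y_def by (intro mult_left_mono) (auto simp: mult.assoc)
        also have "\<dots> \<le> s * (norm (g v))\<^sup>2 + y\<^sup>2 / (4 * s)" by (rule mult_le_weighted_squares[OF s])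
        finally show ?thesis using True by (simp add: q_def A_def)
      next
        case False
        then have "\<phi> v * pdiff e (\<kappa> n) v = 0" using K(3)[of v] M(3)[of n v] by (auto simp: A_def)
        then show ?thesis using False by simp
      qed
      then show "norm (g v * (\<phi> v * pdiff e (\<kappa> n) v)) \<le> s * (indicator (A n) v * q v) + (y\<^sup>2 / (4 * s)) * indicator (A n) v" for v .
      show "integrable lborel (\<lambda>v. g v * (\<phi> v * pdiff e (\<kappa> n) v))"
      proof (rule Bochner_Integration.integrable_bound[OF r])
        show "(\<lambda>v. g v * (\<phi> v * pdiff e (\<kappa> n) v)) \<in> borel_measurable lborel" by measurable
        show "AE v in lborel. norm (g v * (\<phi> v * pdiff e (\<kappa> n) v)) \<le> norm (s * (indicator (A n) v * q v) + (y\<^sup>2 / (4 * s)) * indicator (A n) v)"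
          unfolding real_norm_def by (intro AE_I2 order_trans[OF bd abs_ge_self])
      qed
    qed
    also have "\<dots> = s * I n + (y\<^sup>2 / (4 * s)) * measure lborel (A n)"
      using Ii[of n] Afin[of n] unfolding I_def
      by (subst Bochner_Integration.integral_add) (auto simp: integrable_indicator_iff)
    also have "(y\<^sup>2 / (4 * s)) * measure lborel (A n) \<le> (y\<^sup>2 / (4 * s)) * (C * (2 / real (Suc n))\<^sup>2)"
      unfolding A_def using C(2)[of "2 / real (Suc n)"] s by (intro mult_left_mono) auto
    also have "\<dots> = c0 / s"
    proof -
      have "y\<^sup>2 * (2 / real (Suc n))\<^sup>2 = 4 * (B * M)\<^sup>2" unfolding y_def by (simp add: power_mult_distrib power_divide del: of_nat_Suc)
      then have "(y\<^sup>2 * (2 / real (Suc n))\<^sup>2) * C / (4 * s) = (4 * (B * M)\<^sup>2) * C / (4 * s)" by (simp only:)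
      then show ?thesis using s by (simp add: c0_def mult_ac)
    qed
    finally show ?thesis by simp
  qed
  show ?thesis
  proof (rule LIMSEQ_I)
    fix \<delta> :: real assume \<delta>: "0 < \<delta>"
    \<comment> \<open>s is fixed so large that c0/s is below half of \<delta>; n is taken large only
      after that, to make s times \<open>I n\<close> small.\<close>
    define s where "s = 2 * (c0 + 1) / \<delta>"
    have s: "0 < s" "c0 / s < \<delta> / 2"
      using \<delta> c0 by (auto simp: s_def field_simps)
    have "\<forall>\<^sub>F n in sequentially. I n < \<delta> / (2 * s)"
      using I0 \<delta> s by (intro order_tendstoD(2)) auto
    then obtain N where N: "\<And>n. N \<le> n \<Longrightarrow> I n < \<delta> / (2 * s)" by (auto simp: eventually_sequentially)
    show "\<exists>no. \<forall>n\<ge>no. norm (?J n - 0) < \<delta>"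
    proof (intro exI allI impI)
      fix n assume "N \<le> n"
      from N[OF this] have "s * I n < s * (\<delta> / (2 * s))" using s by (intro mult_strict_left_mono) auto
      then have "s * I n < \<delta> / 2" using s by simp
      then have "norm (?J n) < \<delta>" using J[OF s(1), of n] s(2) by linarith
      then show "norm (?J n - 0) < \<delta>" by simp
    qed
  qed
qed

lemma L2_reps_off_axis_extend:
  assumes D: "open D" and h: "h \<in> L2_reps (D \<inter> off_axis) (\<lambda>_. 1) S"
  shows "h \<in> borel_measurable borel" "L2_sq D (\<lambda>_. 1) h = L2_sq (D \<inter> off_axis) (\<lambda>_. 1) h" "L2_sq D (\<lambda>_. 1) h < \<infinity>"
proof -
  show "h \<in> borel_measurable borel" using h by (simp add: L2_reps_def)
  have b: "D \<in> sets borel" "D \<inter> off_axis \<in> sets borel" using D open_off_axis by auto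
  show eq: "L2_sq D (\<lambda>_. 1) h = L2_sq (D \<inter> off_axis) (\<lambda>_. 1) h"
    unfolding L2_sq_lborel[OF b(1)] L2_sq_lborel[OF b(2)]
    by (rule nn_integral_cong_AE) (use AE_off_axis in \<open>eventually_elim, simp add: indicator_def\<close>)
  show "L2_sq D (\<lambda>_. 1) h < \<infinity>" unfolding eq using h by (simp add: L2_reps_def)
qed

text \<open>A representative off the axis is tested with \<open>\<kappa> n\<close> times
  \<open>\<phi>\<close>, which is supported off the axis, and n tends to infinity. For the
  derivative there is an extra term with the gradient of the cutoff; it vanishes in the limit
  because \<open>T\<close> itself is represented by the L2 function \<open>g\<close> on all of
  D.\<close>

lemma removable_axis:
  assumes D: "open D" and T: "linear_distr D T" and g: "g \<in> L2_reps D (\<lambda>_. 1) T" and e: "e \<in> Basis"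
  shows "distr_L2_sq D (\<lambda>_. 1) T \<le> distr_L2_sq (D \<inter> off_axis) (\<lambda>_. 1) T"
    and "distr_L2_sq D (\<lambda>_. 1) (distr_diff e T) \<le> distr_L2_sq (D \<inter> off_axis) (\<lambda>_. 1) (distr_diff e T)"
proof -
  let ?U = "D \<inter> off_axis"
  have oU: "open ?U" using D open_off_axis by auto
  have Db: "D \<in> sets borel" using D by simp
  obtain \<kappa> M where \<kappa>: "0 \<le> M" "\<And>n. smooth (\<kappa> n :: 'a \<Rightarrow> complex)" "\<And>n v. norm (\<kappa> n v) \<le> 1"
    "\<And>n v. rho v \<le> 1 / real (Suc n) \<Longrightarrow> \<kappa> n v = 0" "\<And>v. 0 < rho v \<Longrightarrow> (\<lambda>n. \<kappa> n v) \<longlonglongrightarrow> 1"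
    "\<And>n v e. e \<in> Basis \<Longrightarrow> norm (pdiff e (\<kappa> n) v) \<le> M * real (Suc n)"
    "\<And>n v e. e \<in> Basis \<Longrightarrow> 2 / real (Suc n) < rho v \<Longrightarrow> pdiff e (\<kappa> n) v = 0"
    by (rule axis_cutoff) (rule that)
  have gm: "g \<in> borel_measurable borel" "L2_sq D (\<lambda>_. 1) g < \<infinity>"
    and gT: "\<And>\<phi>. \<phi> \<in> test_functions D \<Longrightarrow> T \<phi> = (\<integral>v. g v * \<phi> v \<partial>lborel)" using g by (auto simp: L2_reps_def)
  have ct: "(\<lambda>v. \<kappa> n v * \<phi> v) \<in> test_functions ?U" if "\<phi> \<in> test_functions D" for \<phi> n
    by (rule cutoff_test[OF D that \<kappa>(2), of "1 / real (Suc n)"]) (use \<kappa>(4) in auto)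
  have lim: "(\<lambda>n. \<integral>v. f v * (\<kappa> n v * \<phi> v) \<partial>lborel) \<longlonglongrightarrow> (\<integral>v. f v * \<phi> v \<partial>lborel)"
    if "f \<in> borel_measurable borel" "L2_sq D (\<lambda>_. 1) f < \<infinity>" "\<phi> \<in> test_functions D" for f \<phi>
    using cutoff_integral_tendsto[OF L2_integrable_test[OF Db pos_weight_one that(3,1,2)] \<kappa>(2,3,5)]
    by (simp add: mult.left_commute)
  show "distr_L2_sq D (\<lambda>_. 1) T \<le> distr_L2_sq ?U (\<lambda>_. 1) T"
    unfolding distr_L2_sq_eq_INF[OF oU pos_weight_one]
  proof (rule INF_greatest)
    fix h assume h: "h \<in> L2_reps ?U (\<lambda>_. 1) T"
    note hm = L2_reps_off_axis_extend[OF D h]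
    have "T \<phi> = (\<integral>v. h v * \<phi> v \<partial>lborel)" if \<phi>: "\<phi> \<in> test_functions D" for \<phi>
    proof -
      have eq: "(\<lambda>n. \<integral>v. g v * (\<kappa> n v * \<phi> v) \<partial>lborel) = (\<lambda>n. \<integral>v. h v * (\<kappa> n v * \<phi> v) \<partial>lborel)"
        using gT[OF test_mono[OF ct[OF \<phi>]]] h ct[OF \<phi>] by (auto simp: L2_reps_def)
      show ?thesis unfolding gT[OF \<phi>] by (rule LIMSEQ_unique[OF lim[OF gm \<phi>, unfolded eq] lim[OF hm(1,3) \<phi>]])
    qed
    then have "h \<in> L2_reps D (\<lambda>_. 1) T" using hm by (simp add: L2_reps_def)
    then show "distr_L2_sq D (\<lambda>_. 1) T \<le> L2_sq ?U (\<lambda>_. 1) h" unfolding hm(2)[symmetric] by (rule distr_L2_sq_le[OF D pos_weight_one])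
  qed
  show "distr_L2_sq D (\<lambda>_. 1) (distr_diff e T) \<le> distr_L2_sq ?U (\<lambda>_. 1) (distr_diff e T)"
    unfolding distr_L2_sq_eq_INF[OF oU pos_weight_one, of "distr_diff e T"]
  proof (rule INF_greatest)
    fix h assume h: "h \<in> L2_reps ?U (\<lambda>_. 1) (distr_diff e T)"
    note hm = L2_reps_off_axis_extend[OF D h]
    have "distr_diff e T \<phi> = (\<integral>v. h v * \<phi> v \<partial>lborel)" if \<phi>: "\<phi> \<in> test_functions D" for \<phi>
    proof -
      have dk: "\<kappa> n differentiable (at v)" for n v
        using smooth_has_derivative[OF \<kappa>(2), of n v] unfolding differentiable_def by blast
      have pe: "pdiff e (\<lambda>v. \<kappa> n v * \<phi> v) = (\<lambda>v. \<kappa> n v * pdiff e \<phi> v + \<phi> v * pdiff e (\<kappa> n) v)" for n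
        using pdiff_mult[OF dk test_differentiable[OF \<phi>]] by (intro ext) (simp add: mult.commute)
      have t1: "(\<lambda>v. \<kappa> n v * pdiff e \<phi> v) \<in> test_functions D" for n
        by (rule test_mono[OF ct[OF test_pdiff[OF \<phi> e]]]) simp
      have t2: "(\<lambda>v. \<phi> v * pdiff e (\<kappa> n) v) \<in> test_functions D" for n
      proof -
        have "smooth_upto m D (pdiff e (\<kappa> n))" for m
          using smooth_pdiff[OF \<kappa>(2) e] smooth_upto_subset[of m UNIV _ D] by (auto simp: smooth_iff)
        from test_mult[OF \<phi> D this] show ?thesis by (simp add: mult.commute)
      qed
      have "(\<integral>v. h v * (\<kappa> n v * \<phi> v) \<partial>lborel) = - ((\<integral>v. g v * (\<kappa> n v * pdiff e \<phi> v) \<partial>lborel) + (\<integral>v. g v * (\<phi> v * pdiff e (\<kappa> n) v) \<partial>lborel))" for n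
      proof -
        have "(\<integral>v. h v * (\<kappa> n v * \<phi> v) \<partial>lborel) = distr_diff e T (\<lambda>v. \<kappa> n v * \<phi> v)"
          using h ct[OF \<phi>, of n] by (simp add: L2_reps_def)
        also have "\<dots> = - (T (\<lambda>v. \<kappa> n v * pdiff e \<phi> v) + T (\<lambda>v. \<phi> v * pdiff e (\<kappa> n) v))"
          unfolding distr_diff_def pe linear_distr_add[OF T t1 t2] ..
        finally show ?thesis unfolding gT[OF t1] gT[OF t2] .
      qed
      then have eq: "(\<lambda>n. \<integral>v. h v * (\<kappa> n v * \<phi> v) \<partial>lborel) = (\<lambda>n. - ((\<integral>v. g v * (\<kappa> n v * pdiff e \<phi> v) \<partial>lborel) + (\<integral>v. g v * (\<phi> v * pdiff e (\<kappa> n) v) \<partial>lborel)))" by (rule ext)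
      have l: "(\<lambda>n. - ((\<integral>v. g v * (\<kappa> n v * pdiff e \<phi> v) \<partial>lborel) + (\<integral>v. g v * (\<phi> v * pdiff e (\<kappa> n) v) \<partial>lborel))) \<longlonglongrightarrow> - ((\<integral>v. g v * pdiff e \<phi> v \<partial>lborel) + 0)"
        by (intro tendsto_minus tendsto_add lim[OF gm test_pdiff[OF \<phi> e]] cutoff_gradient_tendsto[OF D gm \<phi> \<kappa>(2) e \<kappa>(1) \<kappa>(6)[OF e] \<kappa>(7)[OF e]])
      have "(\<integral>v. h v * \<phi> v \<partial>lborel) = - ((\<integral>v. g v * pdiff e \<phi> v \<partial>lborel) + 0)"
        by (rule LIMSEQ_unique[OF lim[OF hm(1,3) \<phi>, unfolded eq] l])
      then show ?thesis using gT[OF test_pdiff[OF \<phi> e]] by (simp add: distr_diff_def)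
    qed
    then have "h \<in> L2_reps D (\<lambda>_. 1) (distr_diff e T)" using hm by (simp add: L2_reps_def)
    then show "distr_L2_sq D (\<lambda>_. 1) (distr_diff e T) \<le> L2_sq ?U (\<lambda>_. 1) h" unfolding hm(2)[symmetric] by (rule distr_L2_sq_le[OF D pos_weight_one])
  qed
qed

end

section \<open>The norms on the meridian domain\<close>

text \<open>Functionals are constrained on test functions of \<Omega> only, so operator identities
  hold in this sense and not as equations between functionals.\<close>

definition eq_on_tests :: "'a::euclidean_space set \<Rightarrow> 'a distr \<Rightarrow> 'a distr \<Rightarrow> bool" where
  "eq_on_tests \<Omega> S T \<longleftrightarrow> (\<forall>\<phi>\<in>test_functions \<Omega>. S \<phi> = T \<phi>)"

lemma eq_on_tests_refl [simp]: "eq_on_tests \<Omega> T T" by (simp add: eq_on_tests_def)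

lemma eq_on_tests_trans: "eq_on_tests \<Omega> S T \<Longrightarrow> eq_on_tests \<Omega> T V \<Longrightarrow> eq_on_tests \<Omega> S V"
  by (simp add: eq_on_tests_def)

lemma eq_on_tests_norm: "eq_on_tests \<Omega> S T \<Longrightarrow> distr_L2_sq \<Omega> \<rho> S = distr_L2_sq \<Omega> \<rho> T"
  by (rule distr_L2_sq_cong) (simp add: eq_on_tests_def)

lemma eq_on_tests_diff: "eq_on_tests \<Omega> S T \<Longrightarrow> e \<in> Basis \<Longrightarrow> eq_on_tests \<Omega> (distr_diff e S) (distr_diff e T)"
  by (simp add: eq_on_tests_def distr_diff_def test_pdiff)

lemma eq_on_tests_diff_pow:
  "eq_on_tests \<Omega> S T \<Longrightarrow> e \<in> Basis \<Longrightarrow> eq_on_tests \<Omega> ((distr_diff e ^^ n) S) ((distr_diff e ^^ n) T)"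
  by (induction n) (auto intro: eq_on_tests_diff)

lemma eq_on_tests_mult:
  "eq_on_tests \<Omega> S T \<Longrightarrow> open \<Omega> \<Longrightarrow> (\<And>n. smooth_upto n \<Omega> (\<lambda>x. complex_of_real (h x)))
    \<Longrightarrow> eq_on_tests \<Omega> (distr_mult h S) (distr_mult h T)"
  by (simp add: eq_on_tests_def distr_mult_def test_mult)

lemma linear_distr_diff_pow: "linear_distr \<Omega> T \<Longrightarrow> e \<in> Basis \<Longrightarrow> linear_distr \<Omega> ((distr_diff e ^^ n) T)"
  by (induction n) (auto intro: linear_distr_diff)

section \<open>Radial operators as polynomials in the Euler operator\<close>

context cylindrical
begin

definition rinv_diff :: "'b distr \<Rightarrow> 'b distr" where
  "rinv_diff T = distr_mult (\<lambda>b. 1 / R b) (distr_diff er T)"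

context
  fixes \<Omega> :: "'b set" assumes \<Omega>: "open \<Omega>" "\<Omega> \<subseteq> {b. 0 < R b}"
begin

lemma cyl_lift_diff_other:
  assumes e: "e \<in> Basis" "e \<noteq> er"
  shows "eq_on_tests (revolve \<Omega>) ((distr_diff (J e) ^^ n) (cyl_lift k T)) (cyl_lift k ((distr_diff e ^^ n) T))"
proof (induction n)
  case (Suc n)
  have "eq_on_tests (revolve \<Omega>) (distr_diff (J e) ((distr_diff (J e) ^^ n) (cyl_lift k T))) (distr_diff (J e) (cyl_lift k ((distr_diff e ^^ n) T)))"
    by (rule eq_on_tests_diff[OF Suc J_in_Basis(1)[OF e(1)]])
  moreover have "eq_on_tests (revolve \<Omega>) (distr_diff (J e) (cyl_lift k ((distr_diff e ^^ n) T))) (cyl_lift k (distr_diff e ((distr_diff e ^^ n) T)))"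
    unfolding eq_on_tests_def
  proof
    fix \<phi> assume \<phi>: "\<phi> \<in> test_functions (revolve \<Omega>)"
    have "avg k (pdiff (J e) \<phi>) = pdiff e (avg k \<phi>)" by (rule ext) (rule avg_pdiff_other[OF \<Omega>(2) \<phi> e])
    then show "distr_diff (J e) (cyl_lift k ((distr_diff e ^^ n) T)) \<phi> = cyl_lift k (distr_diff e ((distr_diff e ^^ n) T)) \<phi>"
      by (simp add: distr_diff_def cyl_lift_def)
  qed
  ultimately show ?case by (auto intro: eq_on_tests_trans)
qed simp

lemma pdiff_R_mult:
  assumes e: "e \<in> Basis" "e \<noteq> er" and \<phi>: "\<phi> \<in> test_functions \<Omega>" and h: "\<And>b. 0 < R b \<Longrightarrow> (h has_real_derivative h' b) (at (R b))"
    and t: "(\<lambda>b. complex_of_real (h (R b)) * \<phi> b) \<in> test_functions \<Omega>"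
  shows "pdiff e (\<lambda>b. complex_of_real (h (R b)) * \<phi> b) = (\<lambda>b. complex_of_real (h (R b)) * pdiff e \<phi> b)"
proof
  fix b
  show "pdiff e (\<lambda>b. complex_of_real (h (R b)) * \<phi> b) b = complex_of_real (h (R b)) * pdiff e \<phi> b"
  proof (cases "b \<in> \<Omega>")
    case True
    then have b: "0 < R b" using \<Omega> by auto
    have "((\<lambda>b. R b) has_derivative (\<lambda>h. R h)) (at b)" by (auto intro!: derivative_eq_intros)
    from diff_chain_at[OF this h[OF b, unfolded has_field_derivative_def]]
    have "((\<lambda>b. h (R b)) has_derivative (\<lambda>x. h' b * R x)) (at b)" by (simp add: o_def)
    from bounded_linear.has_derivative[OF bounded_linear_of_real this]
    have D: "((\<lambda>b. complex_of_real (h (R b))) has_derivative (\<lambda>x. complex_of_real (h' b * R x))) (at b)" .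
    then have d: "(\<lambda>b. complex_of_real (h (R b))) differentiable (at b)" by (auto simp: differentiable_def)
    have "pdiff e (\<lambda>b. complex_of_real (h (R b))) b = 0"
      using pdiff_eq[OF D, of e] e er by (simp add: inner_Basis)
    then show ?thesis using pdiff_mult[OF d test_differentiable[OF \<phi>], of e] by simp
  next
    case False
    then show ?thesis using test_zero_outside[OF test_pdiff[OF t e(1)]] test_zero_outside[OF test_pdiff[OF \<phi> e(1)]] by simp
  qed
qed

lemma R_test: "\<phi> \<in> test_functions \<Omega> \<Longrightarrow> (\<lambda>b. complex_of_real (R b) * \<phi> b) \<in> test_functions \<Omega>"
  by (rule test_mult[OF _ \<Omega>(1) smooth_upto_R])

text \<open>The factor r is constant in the direction \<open>e\<close>, and second derivatives of
  test functions are symmetric.\<close>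

lemma euler_diff_commute:
  assumes e: "e \<in> Basis" "e \<noteq> er"
  shows "eq_on_tests \<Omega> (distr_diff e (euler T)) (euler (distr_diff e T))"
  unfolding eq_on_tests_def
proof
  fix \<phi> assume \<phi>: "\<phi> \<in> test_functions \<Omega>"
  have "pdiff er (\<lambda>b. complex_of_real (R b) * pdiff e \<phi> b) = pdiff er (pdiff e (\<lambda>b. complex_of_real (R b) * \<phi> b))"
    using pdiff_R_mult[OF e \<phi>, of "\<lambda>x. x" "\<lambda>_. 1"] R_test[OF \<phi>] by simp
  also have "\<dots> = pdiff e (pdiff er (\<lambda>b. complex_of_real (R b) * \<phi> b))"
    using test_functionsE[OF R_test[OF \<phi>]] by (intro ext pdiff_commute er e) metis
  finally show "distr_diff e (euler T) \<phi> = euler (distr_diff e T) \<phi>"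
    by (simp add: euler_def distr_diff_def distr_mult_def)
qed

lemma euler_eq_on_tests: "eq_on_tests \<Omega> S T \<Longrightarrow> eq_on_tests \<Omega> (euler S) (euler T)"
  unfolding euler_def by (intro eq_on_tests_mult eq_on_tests_diff \<Omega>(1) er smooth_upto_R)

lemma euler_pow_diff_commute:
  assumes e: "e \<in> Basis" "e \<noteq> er"
  shows "eq_on_tests \<Omega> (distr_diff e ((euler ^^ i) T)) ((euler ^^ i) (distr_diff e T))"
proof (induction i)
  case (Suc i)
  show ?case
    using eq_on_tests_trans[OF euler_diff_commute[OF e] euler_eq_on_tests[OF Suc]] by simp
qed simp

lemma radop_diff_commute:
  assumes e: "e \<in> Basis" "e \<noteq> er"
  shows "eq_on_tests \<Omega> (distr_diff e (radop j p T)) (radop j p (distr_diff e T))"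
  unfolding eq_on_tests_def
proof
  fix \<phi> assume \<phi>: "\<phi> \<in> test_functions \<Omega>"
  have t: "(\<lambda>b. complex_of_real ((1 / R b) ^ j) * \<phi> b) \<in> test_functions \<Omega>" by (rule rinv_test[OF \<Omega> \<phi>])
  have "((\<lambda>x. (1 / x) ^ j) has_real_derivative - real j * (1 / R b) ^ Suc j) (at (R b))" if "0 < R b" for b
    using that by (auto intro!: derivative_eq_intros) (cases j; simp add: field_simps power2_eq_square)
  then have "pdiff e (\<lambda>b. complex_of_real ((1 / R b) ^ j) * \<phi> b) = (\<lambda>b. complex_of_real ((1 / R b) ^ j) * pdiff e \<phi> b)"
    by (rule pdiff_R_mult[OF e \<phi> _ t])
  then have "distr_diff e (radop j p T) \<phi> = (\<Sum>i\<le>degree p. complex_of_real (coeff p i) * distr_diff e ((euler ^^ i) T) (\<lambda>b. complex_of_real ((1 / R b) ^ j) * \<phi> b))"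
    by (simp add: distr_diff_def radop_def sum_negf)
  also have "\<dots> = radop j p (distr_diff e T) \<phi>"
    using euler_pow_diff_commute[OF e] t by (simp add: radop_def eq_on_tests_def)
  finally show "distr_diff e (radop j p T) \<phi> = radop j p (distr_diff e T) \<phi>" .
qed

lemma radop_diff_pow_commute:
  assumes e: "e \<in> Basis" "e \<noteq> er"
  shows "eq_on_tests \<Omega> ((distr_diff e ^^ c) (radop j p T)) (radop j p ((distr_diff e ^^ c) T))"
proof (induction c)
  case (Suc c)
  show ?case
    using eq_on_tests_trans[OF eq_on_tests_diff[OF Suc e(1)] radop_diff_commute[OF e]] by simp
qed simp

text \<open>The zero appended by a radial derivative is the current power of 1/r, and that power
  grows by one each time.\<close>

lemma radop_diff_pow:
  assumes T: "linear_distr \<Omega> T"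
  shows "eq_on_tests \<Omega> ((distr_diff er ^^ i) (radop j p T)) (radop (j + i) ((\<Prod>s=j..<j+i. [:- real s, 1:]) * p) T)"
proof (induction i)
  case (Suc i)
  have "eq_on_tests \<Omega> (distr_diff er ((distr_diff er ^^ i) (radop j p T)))
      (distr_diff er (radop (j + i) ((\<Prod>s=j..<j+i. [:- real s, 1:]) * p) T))"
    by (rule eq_on_tests_diff[OF Suc er])
  moreover have "eq_on_tests \<Omega> (distr_diff er (radop (j + i) ((\<Prod>s=j..<j+i. [:- real s, 1:]) * p) T))
      (radop (Suc (j + i)) ([:- real (j + i), 1:] * ((\<Prod>s=j..<j+i. [:- real s, 1:]) * p)) T)"
    unfolding eq_on_tests_def using radop_diff[OF \<Omega> T] by blast
  moreover have "[:- real (j + i), 1:] * ((\<Prod>s=j..<j+i. [:- real s, 1:]) * p) = (\<Prod>s=j..<j+Suc i. [:- real s, 1:]) * p"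
    by (simp add: mult_ac del: mult_pCons_left mult_pCons_right)
  ultimately show ?case by (auto intro: eq_on_tests_trans)
qed simp

lemma rinv_smooth1: "smooth_upto n \<Omega> (\<lambda>b. complex_of_real (1 / R b))"
  using rinv_smooth[OF \<Omega>, of n 1] by simp

text \<open>Each application appends the current power n + 2l as a zero and raises that power by
  two, once for the derivative and once for the factor 1/r. This is why the zeros advance in steps
  of two.\<close>

lemma rinv_diff_radop:
  assumes T: "linear_distr \<Omega> T"
  shows "eq_on_tests \<Omega> ((rinv_diff ^^ l) (radop n 1 T)) (radop (n + 2 * l) (\<Prod>i<l. [:- real (n + 2 * i), 1:]) T)"
proof (induction l)
  case (Suc l)
  let ?p = "\<Prod>i<l. [:- real (n + 2 * i), 1:]"
  have "eq_on_tests \<Omega> (rinv_diff ((rinv_diff ^^ l) (radop n 1 T))) (rinv_diff (radop (n + 2 * l) ?p T))"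
    unfolding rinv_diff_def[of "(rinv_diff ^^ l) _"] rinv_diff_def[of "radop _ _ _"]
    by (intro eq_on_tests_mult eq_on_tests_diff Suc er \<Omega>(1) rinv_smooth1)
  moreover have "eq_on_tests \<Omega> (rinv_diff (radop (n + 2 * l) ?p T)) (distr_mult (\<lambda>b. 1 / R b) (radop (Suc (n + 2 * l)) ([:- real (n + 2 * l), 1:] * ?p) T))"
    unfolding rinv_diff_def
    by (intro eq_on_tests_mult \<Omega>(1) rinv_smooth1) (use radop_diff[OF \<Omega> T] in \<open>unfold eq_on_tests_def, blast\<close>)
  moreover have "distr_mult (\<lambda>b. 1 / R b) (radop (Suc (n + 2 * l)) ([:- real (n + 2 * l), 1:] * ?p) T)
      = radop (n + 2 * Suc l) ([:- real (n + 2 * l), 1:] * ?p) T"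
    by (rule ext) (simp only: radop_rinv mult_Suc_right add_2_eq_Suc add_Suc_right)
  moreover have "[:- real (n + 2 * l), 1:] * ?p = (\<Prod>i<Suc l. [:- real (n + 2 * i), 1:])"
    by (simp only: prod.lessThan_Suc mult.commute)
  ultimately show ?case by (simp only: funpow.simps o_apply) (blast intro: eq_on_tests_trans)
qed simp

lemma rad_poly_Inl:
  assumes T: "linear_distr \<Omega> T" and l: "l \<le> j"
  shows "eq_on_tests \<Omega> ((distr_diff er ^^ (j - l)) (radop l [:real n ^ l:] T)) (radop j (rad_poly n j (Inl l)) T)"
  using radop_diff_pow[OF T, of "j - l" l "[:real n ^ l:]"] l by (simp add: rad_poly_def mult.commute)

lemma rad_poly_Inr:
  assumes T: "linear_distr \<Omega> T" and l: "n + 2 * l \<le> j"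
  shows "eq_on_tests \<Omega> ((distr_diff er ^^ (j - n - 2 * l)) (radop (n + 2 * l) (\<Prod>i<l. [:- real (n + 2 * i), 1:]) T))
     (radop j (rad_poly n j (Inr l)) T)"
  using radop_diff_pow[OF T, of "j - n - 2 * l" "n + 2 * l" "\<Prod>i<l. [:- real (n + 2 * i), 1:]"] l
  by (simp add: rad_poly_def mult.commute)

lemma distr_of_rinv_power:
  assumes T: "linear_distr \<Omega> (distr_of \<Omega> w)"
  shows "eq_on_tests \<Omega> (distr_of \<Omega> (\<lambda>b. complex_of_real ((x / R b) ^ l) * w b)) (radop l [:x ^ l:] (distr_of \<Omega> w))"
  unfolding eq_on_tests_def
proof
  fix \<phi> assume \<phi>: "\<phi> \<in> test_functions \<Omega>"
  have "complex_of_real ((x / R b) ^ l) * w b * \<phi> b = w b * (complex_of_real (x ^ l) * (complex_of_real ((1 / R b) ^ l) * \<phi> b))" for b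
    by (simp add: power_divide)
  then have "distr_of \<Omega> (\<lambda>b. complex_of_real ((x / R b) ^ l) * w b) \<phi> = distr_of \<Omega> w (\<lambda>b. complex_of_real (x ^ l) * (complex_of_real ((1 / R b) ^ l) * \<phi> b))"
    by (simp only: distr_of_def)
  also have "\<dots> = complex_of_real (x ^ l) * distr_of \<Omega> w (\<lambda>b. complex_of_real ((1 / R b) ^ l) * \<phi> b)"
    by (rule linear_distr_cmult[OF T rinv_test[OF \<Omega> \<phi>]])
  finally show "distr_of \<Omega> (\<lambda>b. complex_of_real ((x / R b) ^ l) * w b) \<phi> = radop l [:x ^ l:] (distr_of \<Omega> w) \<phi>"
    by (simp add: radop_def)
qed

lemma rinv_diff_distr_of:
  assumes T: "linear_distr \<Omega> (distr_of \<Omega> w)"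
  shows "eq_on_tests \<Omega> ((rinv_diff ^^ l) (distr_of \<Omega> (\<lambda>b. complex_of_real ((1 / R b) ^ n) * w b)))
     (radop (n + 2 * l) (\<Prod>i<l. [:- real (n + 2 * i), 1:]) (distr_of \<Omega> w))"
proof -
  have "eq_on_tests \<Omega> ((rinv_diff ^^ i) S) ((rinv_diff ^^ i) S')" if "eq_on_tests \<Omega> S S'" for i S S'
    using that
  proof (induction i)
    case (Suc i)
    show ?case
      unfolding funpow.simps o_apply rinv_diff_def[of "(rinv_diff ^^ i) _"]
      by (intro eq_on_tests_mult eq_on_tests_diff Suc er \<Omega>(1) rinv_smooth1)
  qed simp
  from this[OF distr_of_rinv_power[OF T, of 1 n]] show ?thesis
    using rinv_diff_radop[OF T, of l n] by (auto intro: eq_on_tests_trans simp: one_pCons)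
qed

end

section \<open>Rotation-invariant domains and their meridian domains\<close>

definition mer :: "'a set \<Rightarrow> 'b set" where "mer D = {b. 0 < R b \<and> J b \<in> D}"

text \<open>Rotations are expressed through \<open>pol\<close>, and only points off the axis are
  constrained; D may contain any part of the axis.\<close>

definition rot_invariant :: "'a set \<Rightarrow> bool" where
  "rot_invariant D \<longleftrightarrow> (\<forall>b \<theta>. 0 < R b \<longrightarrow> (pol \<theta> b \<in> D \<longleftrightarrow> J b \<in> D))"

lemma mer_pos: "mer D \<subseteq> {b. 0 < R b}" by (auto simp: mer_def)

lemma open_mer:
  assumes "open D"
  shows "open (mer D)"
proof -
  have "continuous_on UNIV J" using J by (simp add: linear_continuous_on linear_conv_bounded_linear)
  from open_Int[OF open_R_pos open_vimage[OF assms this]] show ?thesis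
    by (simp add: mer_def Collect_conj_eq vimage_def)
qed

lemma revolve_mer:
  assumes "rot_invariant D"
  shows "revolve (mer D) = D \<inter> off_axis"
proof (intro set_eqI iffI)
  fix v assume "v \<in> revolve (mer D)"
  then obtain \<theta> where \<theta>: "v = pol \<theta> (rad v)" "rad v \<in> mer D" "0 < rho v" by (rule revolve_obtain)
  have "0 < R (rad v)" "J (rad v) \<in> D" using \<theta>(2) by (simp_all add: mer_def)
  then have "pol \<theta> (rad v) \<in> D" using assms unfolding rot_invariant_def by blast
  then have "v \<in> D" using \<theta>(1) by metis
  then show "v \<in> D \<inter> off_axis" using \<theta>(3) by (simp add: off_axis_def)
next
  fix v assume v: "v \<in> D \<inter> off_axis"
  then have "v \<in> revolve UNIV" by (simp add: revolve_def)
  then obtain \<theta> where \<theta>: "v = pol \<theta> (rad v)" "0 < rho v" by (rule revolve_obtain)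
  have "pol \<theta> (rad v) \<in> D" using v \<theta>(1) by (metis IntD1)
  moreover have "0 < R (rad v)" using \<theta>(2) by (simp add: R_rad)
  ultimately have "rad v \<in> mer D" using assms unfolding rot_invariant_def mer_def by blast
  then show "v \<in> revolve (mer D)" using v by (simp add: revolve_def)
qed

context
  fixes D :: "'a set" and w :: "'b \<Rightarrow> complex" and u :: "'a \<Rightarrow> complex" and k :: int
  assumes D: "open D" "rot_invariant D"
    and w: "w \<in> borel_measurable (lebesgue_on (mer D))" "L2_sq (mer D) wR w < \<infinity>"
    and u: "\<And>v. v \<in> revolve (mer D) \<Longrightarrow> u v = lift_fun k w v"
begin

lemma linear_distr_of_w: "linear_distr (mer D) (distr_of (mer D) w)"
  by (rule linear_distr_of_L2[OF open_mer[OF D(1)] pos_weight_wR[OF mer_pos] w])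

text \<open>\<open>u\<close> is prescribed off the axis only. The axis is a null set, so
  \<open>u\<close> agrees almost everywhere on D with the lift of a Borel version of
  \<open>w\<close>, whose norm is that of \<open>w\<close>.\<close>

lemma distr_of_lift:
  shows "linear_distr D (distr_of D u)" "distr_L2_sq D (\<lambda>_. 1) (distr_of D u) < \<infinity>"
    "eq_on_tests (revolve (mer D)) (distr_of D u) (cyl_lift k (distr_of (mer D) w))"
proof -
  have Db: "D \<in> sets borel" and mb: "mer D \<in> sets borel" and rb: "revolve (mer D) \<in> sets borel"
    using D(1) open_mer[OF D(1)] open_revolve[OF open_mer[OF D(1)]] by auto
  obtain w' where w': "w' \<in> borel_measurable borel" "AE x in lborel. x \<in> mer D \<longrightarrow> w x = w' x"
    using lebesgue_on_borel_version[OF mb w(1)] by metis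
  have ae: "AE v in lborel. v \<in> D \<longrightarrow> u v = lift_fun k w' v"
    using lift_fun_cong_AE[OF w'(2) open_mer[OF D(1)], of k] AE_off_axis
    by eventually_elim (simp add: u revolve_mer[OF D(2)])
  have lm: "lift_fun k w' \<in> borel_measurable borel" using w'(1) by simp
  have um: "u \<in> borel_measurable (lebesgue_on D)" by (rule lebesgue_on_measurable_AE[OF Db lm ae])
  have "L2_sq D (\<lambda>_. 1) u = L2_sq D (\<lambda>_. 1) (lift_fun k w')" by (rule L2_sq_cong_AE[OF Db ae])
  also have "\<dots> = L2_sq (revolve (mer D)) (\<lambda>_. 1) (lift_fun k w')"
    unfolding revolve_mer[OF D(2)] L2_sq_lborel[OF Db] L2_sq_lborel[OF rb[unfolded revolve_mer[OF D(2)]]]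
    by (rule nn_integral_cong_AE) (use AE_off_axis in \<open>eventually_elim, simp add: indicator_def\<close>)
  also have "\<dots> = L2_sq (mer D) wR w'" by (rule L2_sq_lift_fun[OF open_mer[OF D(1)] mer_pos w'(1)])
  also have "\<dots> = L2_sq (mer D) wR w" by (rule L2_sq_cong_AE[OF mb w'(2), symmetric])
  finally have L: "L2_sq D (\<lambda>_. 1) u < \<infinity>" using w(2) by simp
  show "linear_distr D (distr_of D u)" by (rule linear_distr_of_L2[OF D(1) pos_weight_one um L])
  have "lift_fun k w' \<in> L2_reps D (\<lambda>_. 1) (distr_of D u)"
    using lm L L2_sq_cong_AE[OF Db ae] distr_of_borel_version[OF Db lm ae] by (simp add: L2_reps_def)
  from distr_L2_sq_le[OF D(1) pos_weight_one this]
  show "distr_L2_sq D (\<lambda>_. 1) (distr_of D u) < \<infinity>"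
    using L L2_sq_cong_AE[OF Db ae, of "\<lambda>_. 1"] by (simp add: le_less_trans)
  show "eq_on_tests (revolve (mer D)) (distr_of D u) (cyl_lift k (distr_of (mer D) w))"
    unfolding eq_on_tests_def
  proof
    fix \<phi> assume \<phi>: "\<phi> \<in> test_functions (revolve (mer D))"
    have sub: "revolve (mer D) \<subseteq> D" using revolve_mer[OF D(2)] by simp
    show "distr_of D u \<phi> = cyl_lift k (distr_of (mer D) w) \<phi>"
      using distr_of_restrict[OF rb Db sub \<phi>, of u] cyl_lift_distr_of[OF open_mer[OF D(1)] mer_pos w \<phi> u] by simp
  qed
qed

end

text \<open>Extending one more derivative over the axis presupposes that the previous one is
  represented in L2 on all of D. The induction supplies this, which is why all orders up to n are
  assumed finite.\<close>

lemma axis_norm_pow: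
  assumes D: "open D" and V: "linear_distr D V" "distr_L2_sq D (\<lambda>_. 1) V \<le> distr_L2_sq (D \<inter> off_axis) (\<lambda>_. 1) V"
    and e: "e \<in> Basis" and fin: "\<And>i. i \<le> n \<Longrightarrow> distr_L2_sq (D \<inter> off_axis) (\<lambda>_. 1) ((distr_diff e ^^ i) V) < \<infinity>"
  shows "linear_distr D ((distr_diff e ^^ n) V) \<and>
    distr_L2_sq D (\<lambda>_. 1) ((distr_diff e ^^ n) V) \<le> distr_L2_sq (D \<inter> off_axis) (\<lambda>_. 1) ((distr_diff e ^^ n) V)"
  using fin
proof (induction n)
  case 0
  then show ?case using V by simp
next
  case (Suc n)
  then have IH: "linear_distr D ((distr_diff e ^^ n) V)"
    "distr_L2_sq D (\<lambda>_. 1) ((distr_diff e ^^ n) V) \<le> distr_L2_sq (D \<inter> off_axis) (\<lambda>_. 1) ((distr_diff e ^^ n) V)" by auto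
  have "distr_L2_sq D (\<lambda>_. 1) ((distr_diff e ^^ n) V) < \<infinity>" using IH(2) Suc.prems[of n] by (simp add: le_less_trans)
  then obtain g where "g \<in> L2_reps D (\<lambda>_. 1) ((distr_diff e ^^ n) V)"
    using distr_L2_sq_less_obtain[OF D pos_weight_one] by metis
  from removable_axis(2)[OF D IH(1) this e] show ?case using linear_distr_diff[OF IH(1) e] by simp
qed

lemma cart_diff_cong:
  assumes "eq_on_tests U S T" "open U"
  shows "distr_L2_sq U \<rho> (cart_diff a b S) = distr_L2_sq U \<rho> (cart_diff a b T)"
  unfolding cart_diff_def by (intro eq_on_tests_norm eq_on_tests_diff_pow assms ex_Basis ey)

context
  fixes D :: "'a set" and w :: "'b \<Rightarrow> complex" and u :: "'a \<Rightarrow> complex" and k :: int and e :: 'b and c :: nat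
  assumes D: "open D" "rot_invariant D"
    and w: "w \<in> borel_measurable (lebesgue_on (mer D))" "L2_sq (mer D) wR w < \<infinity>"
    and u: "\<And>v. v \<in> revolve (mer D) \<Longrightarrow> u v = lift_fun k w v"
    and e: "c = 0 \<or> (e \<in> Basis \<and> e \<noteq> er)"
begin

lemma cart_diff_lift_norm:
  "distr_L2_sq (D \<inter> off_axis) (\<lambda>_. 1) ((distr_diff ex ^^ a) ((distr_diff ey ^^ b) ((distr_diff (J e) ^^ c) (distr_of D u))))
    = distr_L2_sq (revolve (mer D)) (\<lambda>_. 1) (cart_diff a b (cyl_lift k ((distr_diff e ^^ c) (distr_of (mer D) w))))"
proof -
  have "eq_on_tests (revolve (mer D)) ((distr_diff (J e) ^^ c) (distr_of D u)) (cyl_lift k ((distr_diff e ^^ c) (distr_of (mer D) w)))"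
  proof (cases "c = 0")
    case True
    then show ?thesis using distr_of_lift(3)[OF D w u] by simp
  next
    case False
    then have e': "e \<in> Basis" "e \<noteq> er" using e by auto
    show ?thesis
      using eq_on_tests_trans[OF eq_on_tests_diff_pow[OF distr_of_lift(3)[OF D w u] J_in_Basis(1)[OF e'(1)]]
          cyl_lift_diff_other[OF open_mer[OF D(1)] mer_pos e']] .
  qed
  from cart_diff_cong[OF this open_revolve[OF open_mer[OF D(1)]]]
  show ?thesis by (simp add: cart_diff_def revolve_mer[OF D(2)])
qed

lemma linear_distr_diff_w: "linear_distr (mer D) ((distr_diff e ^^ c) (distr_of (mer D) w))"
  using linear_distr_of_w[OF D w u] linear_distr_diff_pow[of "mer D" _ e c] e by (cases "c = 0") auto

lemma radop_diff_w:
  "eq_on_tests (mer D) ((distr_diff e ^^ c) (radop j p (distr_of (mer D) w))) (radop j p ((distr_diff e ^^ c) (distr_of (mer D) w)))"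
  using radop_diff_pow_commute[OF open_mer[OF D(1)] mer_pos, of e c] e by (cases "c = 0") auto

lemma eq_on_tests_diff_w:
  "eq_on_tests (mer D) S T \<Longrightarrow> eq_on_tests (mer D) ((distr_diff e ^^ c) S) ((distr_diff e ^^ c) T)"
  using e by (cases "c = 0") (auto intro: eq_on_tests_diff_pow)

lemma radial_term_Inl:
  "distr_L2_sq (mer D) wR ((distr_diff er ^^ a) ((distr_diff e ^^ c) (distr_of (mer D) (\<lambda>b. complex_of_real ((real n / R b) ^ l) * w b))))
    = distr_L2_sq (mer D) wR (radop (l + a) (rad_poly n (l + a) (Inl l)) ((distr_diff e ^^ c) (distr_of (mer D) w)))"
proof (rule eq_on_tests_norm)
  have "eq_on_tests (mer D) ((distr_diff e ^^ c) (distr_of (mer D) (\<lambda>b. complex_of_real ((real n / R b) ^ l) * w b)))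
     (radop l [:real n ^ l:] ((distr_diff e ^^ c) (distr_of (mer D) w)))"
    using eq_on_tests_trans[OF eq_on_tests_diff_w[OF distr_of_rinv_power[OF open_mer[OF D(1)] mer_pos linear_distr_of_w[OF D w u]]] radop_diff_w] .
  from eq_on_tests_trans[OF eq_on_tests_diff_pow[OF this er, of a]]
    rad_poly_Inl[OF open_mer[OF D(1)] mer_pos linear_distr_diff_w, of l "l + a" n]
  show "eq_on_tests (mer D) ((distr_diff er ^^ a) ((distr_diff e ^^ c) (distr_of (mer D) (\<lambda>b. complex_of_real ((real n / R b) ^ l) * w b))))
    (radop (l + a) (rad_poly n (l + a) (Inl l)) ((distr_diff e ^^ c) (distr_of (mer D) w)))" by simp
qed

lemma radial_term_Inr:
  "distr_L2_sq (mer D) wR ((distr_diff er ^^ a) ((distr_diff e ^^ c) ((rinv_diff ^^ l) (distr_of (mer D) (\<lambda>b. complex_of_real ((1 / R b) ^ n) * w b)))))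
    = distr_L2_sq (mer D) wR (radop (n + 2 * l + a) (rad_poly n (n + 2 * l + a) (Inr l)) ((distr_diff e ^^ c) (distr_of (mer D) w)))"
proof (rule eq_on_tests_norm)
  have "eq_on_tests (mer D) ((distr_diff e ^^ c) ((rinv_diff ^^ l) (distr_of (mer D) (\<lambda>b. complex_of_real ((1 / R b) ^ n) * w b))))
     (radop (n + 2 * l) (\<Prod>i<l. [:- real (n + 2 * i), 1:]) ((distr_diff e ^^ c) (distr_of (mer D) w)))"
    using eq_on_tests_trans[OF eq_on_tests_diff_w[OF rinv_diff_distr_of[OF open_mer[OF D(1)] mer_pos linear_distr_of_w[OF D w u]]] radop_diff_w] .
  from eq_on_tests_trans[OF eq_on_tests_diff_pow[OF this er, of a]]
    rad_poly_Inr[OF open_mer[OF D(1)] mer_pos linear_distr_diff_w, of n l "n + 2 * l + a"]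
  show "eq_on_tests (mer D) ((distr_diff er ^^ a) ((distr_diff e ^^ c) ((rinv_diff ^^ l) (distr_of (mer D) (\<lambda>b. complex_of_real ((1 / R b) ^ n) * w b)))))
    (radop (n + 2 * l + a) (rad_poly n (n + 2 * l + a) (Inr l)) ((distr_diff e ^^ c) (distr_of (mer D) w)))" by simp
qed

end

lemma axis_norm_base:
  assumes "open D" "linear_distr D V" "distr_L2_sq D (\<lambda>_. 1) V < \<infinity>"
  shows "distr_L2_sq D (\<lambda>_. 1) V \<le> distr_L2_sq (D \<inter> off_axis) (\<lambda>_. 1) V"
proof -
  obtain g where "g \<in> L2_reps D (\<lambda>_. 1) V"
    using distr_L2_sq_less_obtain[OF assms(1) pos_weight_one assms(3)] by metis
  then show ?thesis by (rule removable_axis(1)[OF assms(1,2) _ ex_Basis])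
qed

theorem uniform_equivalence:
  obtains K where "K > 0"
    "\<And>\<Omega> j k n T. j \<le> m \<Longrightarrow> open \<Omega> \<Longrightarrow> \<Omega> \<subseteq> {b. 0 < R b} \<Longrightarrow> linear_distr \<Omega> T \<Longrightarrow> \<bar>k\<bar> = int n \<Longrightarrow>
       cart_norm \<Omega> j k T \<le> ennreal K * radial_norm \<Omega> j n T \<and> radial_norm \<Omega> j n T \<le> ennreal K * cart_norm \<Omega> j k T"
proof -
  have "\<exists>C>0. \<forall>\<Omega> k n T. open \<Omega> \<longrightarrow> \<Omega> \<subseteq> {b. 0 < R b} \<longrightarrow> linear_distr \<Omega> T \<longrightarrow> \<bar>k\<bar> = int n \<longrightarrow>
      cart_norm \<Omega> j k T \<le> ennreal C * radial_norm \<Omega> j n T \<and> radial_norm \<Omega> j n T \<le> ennreal C * cart_norm \<Omega> j k T" for j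
    by (rule cart_norm_radial_norm[of j]) blast
  then obtain C where C: "\<And>j. 0 < C j" "\<And>j \<Omega> k n T. open \<Omega> \<Longrightarrow> \<Omega> \<subseteq> {b. 0 < R b} \<Longrightarrow> linear_distr \<Omega> T \<Longrightarrow> \<bar>k\<bar> = int n \<Longrightarrow>
      cart_norm \<Omega> j k T \<le> ennreal (C j) * radial_norm \<Omega> j n T \<and> radial_norm \<Omega> j n T \<le> ennreal (C j) * cart_norm \<Omega> j k T"
    by metis
  show thesis
  proof (rule that[of "\<Sum>j\<le>m. C j"])
    show "0 < (\<Sum>j\<le>m. C j)" using C(1) by (intro sum_pos) auto
    fix \<Omega> j k n T assume a: "j \<le> m" "open \<Omega>" "\<Omega> \<subseteq> {b. 0 < R b}" "linear_distr \<Omega> T" "\<bar>k\<bar> = int n"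
    have "C j \<le> (\<Sum>j\<le>m. C j)" using a(1) C(1) by (intro member_le_sum) (auto intro: less_imp_le)
    then have le: "ennreal (C j) * x \<le> ennreal (\<Sum>j\<le>m. C j) * x" for x by (intro mult_right_mono ennreal_leI) auto
    show "cart_norm \<Omega> j k T \<le> ennreal (\<Sum>j\<le>m. C j) * radial_norm \<Omega> j n T \<and> radial_norm \<Omega> j n T \<le> ennreal (\<Sum>j\<le>m. C j) * cart_norm \<Omega> j k T"
      using C(2)[OF a(2-5), of j] le order_trans by blast
  qed
qed

end

section \<open>Reindexing of the finite sums\<close>

lemma sum_nested_pairs:
  fixes f :: "nat \<Rightarrow> nat \<Rightarrow> 'c::comm_monoid_add"
  assumes "finite C" "\<And>c. c \<in> C \<Longrightarrow> c \<le> m"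
  shows "(\<Sum>c\<in>C. \<Sum>j\<le>m - c. f c j) = (\<Sum>(c, j)\<in>{(c, j). c \<in> C \<and> c + j \<le> m}. f c j)"
proof -
  have "(SIGMA c:C. {..m - c}) = {(c, j). c \<in> C \<and> c + j \<le> m}" using assms(2) by force
  then show ?thesis using sum.Sigma[of C "\<lambda>c. {..m - c}" f] assms(1) by simp
qed

lemma sum_triples:
  fixes f :: "nat \<Rightarrow> nat \<Rightarrow> nat \<Rightarrow> 'c::comm_monoid_add"
  assumes "finite C" "\<And>c. c \<in> C \<Longrightarrow> c \<le> m"
  shows "(\<Sum>(a, b, c)\<in>{(a, b, c). c \<in> C \<and> a + b + c \<le> m}. f a b c) = (\<Sum>c\<in>C. \<Sum>j\<le>m - c. \<Sum>a\<le>j. f a (j - a) c)"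
proof -
  have "(\<Sum>c\<in>C. \<Sum>j\<le>m - c. \<Sum>a\<le>j. f a (j - a) c) = (\<Sum>(c, j)\<in>{(c, j). c \<in> C \<and> c + j \<le> m}. \<Sum>a\<le>j. f a (j - a) c)"
    by (rule sum_nested_pairs[OF assms])
  also have "\<dots> = (\<Sum>((c, j), a)\<in>(SIGMA (c, j):{(c, j). c \<in> C \<and> c + j \<le> m}. {..j}). f a (j - a) c)"
  proof -
    have "finite {(c, j). c \<in> C \<and> c + j \<le> m}" by (rule finite_subset[of _ "C \<times> {..m}"]) (use assms in auto)
    from sum.Sigma[OF this, of "\<lambda>(c, j). {..j}" "\<lambda>(c, j) a. f a (j - a) c"] show ?thesis
      by (auto simp: split_def)
  qed
  also have "\<dots> = (\<Sum>(a, b, c)\<in>{(a, b, c). c \<in> C \<and> a + b + c \<le> m}. f a b c)"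
    by (rule sum.reindex_bij_witness[where i = "\<lambda>(a, b, c). ((c, a + b), a)" and j = "\<lambda>((c, j), a). (a, j - a, c)"]) auto
  finally show ?thesis ..
qed

text \<open>The left side is grouped by the radial term l, as in the norm to be estimated. The right
  side is grouped by the axial order c and the remaining total order j, which is l + a or n + 2l +
  a; the bound on a + c becomes c + j <= m.\<close>

lemma sum_rad_index:
  fixes f :: "nat + nat \<Rightarrow> nat \<Rightarrow> nat \<Rightarrow> 'c::comm_monoid_add"
  assumes C: "finite C" "\<And>c. c \<in> C \<Longrightarrow> c \<le> m"
  shows "(\<Sum>l\<in>{0..min n m}. \<Sum>(a, c)\<in>{(a, c). c \<in> C \<and> a + c \<le> m - l}. f (Inl l) (l + a) c)
      + (\<Sum>l\<in>{l. 1 \<le> l \<and> n + 2 * l \<le> m}. \<Sum>(a, c)\<in>{(a, c). c \<in> C \<and> a + c \<le> m - n - 2 * l}. f (Inr l) (n + 2 * l + a) c)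
    = (\<Sum>c\<in>C. \<Sum>j\<le>m - c. \<Sum>x\<in>rad_index n j. f x j c)"
proof -
  have fin: "finite {(a, c). c \<in> C \<and> a + c \<le> i}" for i :: nat
    by (rule finite_subset[of _ "{..i} \<times> C"]) (use C(1) in auto)
  have finl: "finite {l. 1 \<le> l \<and> n + 2 * l \<le> j}" for j by (rule finite_subset[of _ "{..j}"]) auto
  have finp: "finite {(c, j). c \<in> C \<and> c + j \<le> m}" by (rule finite_subset[of _ "C \<times> {..m}"]) (use C in auto)
  have "(\<Sum>x\<in>rad_index n j. f x j c) = (\<Sum>l\<le>min n j. f (Inl l) j c) + (\<Sum>l\<in>{l. 1 \<le> l \<and> n + 2 * l \<le> j}. f (Inr l) j c)" for j c
    unfolding rad_index_def by (subst sum.union_disjoint) (auto simp: finl finl[simplified] sum.reindex o_def)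
  then have "(\<Sum>c\<in>C. \<Sum>j\<le>m - c. \<Sum>x\<in>rad_index n j. f x j c)
    = (\<Sum>(c, j)\<in>{(c, j). c \<in> C \<and> c + j \<le> m}. \<Sum>l\<le>min n j. f (Inl l) j c)
    + (\<Sum>(c, j)\<in>{(c, j). c \<in> C \<and> c + j \<le> m}. \<Sum>l\<in>{l. 1 \<le> l \<and> n + 2 * l \<le> j}. f (Inr l) j c)"
    by (simp add: sum.distrib sum_nested_pairs[OF C])
  moreover have "(\<Sum>(c, j)\<in>{(c, j). c \<in> C \<and> c + j \<le> m}. \<Sum>l\<le>min n j. f (Inl l) j c)
    = (\<Sum>l\<in>{0..min n m}. \<Sum>(a, c)\<in>{(a, c). c \<in> C \<and> a + c \<le> m - l}. f (Inl l) (l + a) c)"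
  proof -
    have "(\<Sum>(c, j)\<in>{(c, j). c \<in> C \<and> c + j \<le> m}. \<Sum>l\<le>min n j. f (Inl l) j c)
      = (\<Sum>((c, j), l)\<in>(SIGMA (c, j):{(c, j). c \<in> C \<and> c + j \<le> m}. {..min n j}). f (Inl l) j c)"
      using sum.Sigma[OF finp, of "\<lambda>(c, j). {..min n j}" "\<lambda>(c, j) l. f (Inl l) j c"] by (auto simp: split_def)
    also have "\<dots> = (\<Sum>(l, a, c)\<in>(SIGMA l:{0..min n m}. {(a, c). c \<in> C \<and> a + c \<le> m - l}). f (Inl l) (l + a) c)"
      by (rule sum.reindex_bij_witness[where i = "\<lambda>(l, a, c). ((c, l + a), l)" and j = "\<lambda>((c, j), l). (l, j - l, c)"]) auto
    also have "\<dots> = (\<Sum>l\<in>{0..min n m}. \<Sum>(a, c)\<in>{(a, c). c \<in> C \<and> a + c \<le> m - l}. f (Inl l) (l + a) c)"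
      using sum.Sigma[of "{0..min n m}" "\<lambda>l. {(a, c). c \<in> C \<and> a + c \<le> m - l}" "\<lambda>l (a, c). f (Inl l) (l + a) c"] fin
      by (auto simp: split_def)
    finally show ?thesis .
  qed
  moreover have "(\<Sum>(c, j)\<in>{(c, j). c \<in> C \<and> c + j \<le> m}. \<Sum>l\<in>{l. 1 \<le> l \<and> n + 2 * l \<le> j}. f (Inr l) j c)
    = (\<Sum>l\<in>{l. 1 \<le> l \<and> n + 2 * l \<le> m}. \<Sum>(a, c)\<in>{(a, c). c \<in> C \<and> a + c \<le> m - n - 2 * l}. f (Inr l) (n + 2 * l + a) c)"
  proof -
    have "(\<Sum>(c, j)\<in>{(c, j). c \<in> C \<and> c + j \<le> m}. \<Sum>l\<in>{l. 1 \<le> l \<and> n + 2 * l \<le> j}. f (Inr l) j c)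
      = (\<Sum>((c, j), l)\<in>(SIGMA (c, j):{(c, j). c \<in> C \<and> c + j \<le> m}. {l. 1 \<le> l \<and> n + 2 * l \<le> j}). f (Inr l) j c)"
      using sum.Sigma[OF finp, of "\<lambda>(c, j). {l. 1 \<le> l \<and> n + 2 * l \<le> j}" "\<lambda>(c, j) l. f (Inr l) j c"] finl by (auto simp: split_def)
    also have "\<dots> = (\<Sum>(l, a, c)\<in>(SIGMA l:{l. 1 \<le> l \<and> n + 2 * l \<le> m}. {(a, c). c \<in> C \<and> a + c \<le> m - n - 2 * l}). f (Inr l) (n + 2 * l + a) c)"
      by (rule sum.reindex_bij_witness[where i = "\<lambda>(l, a, c). ((c, n + 2 * l + a), l)" and j = "\<lambda>((c, j), l). (l, j - n - 2 * l, c)"]) auto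
    also have "\<dots> = (\<Sum>l\<in>{l. 1 \<le> l \<and> n + 2 * l \<le> m}. \<Sum>(a, c)\<in>{(a, c). c \<in> C \<and> a + c \<le> m - n - 2 * l}. f (Inr l) (n + 2 * l + a) c)"
      using sum.Sigma[of "{l. 1 \<le> l \<and> n + 2 * l \<le> m}" "\<lambda>l. {(a, c). c \<in> C \<and> a + c \<le> m - n - 2 * l}" "\<lambda>l (a, c). f (Inr l) (n + 2 * l + a) c"] fin finl
      by (auto simp: split_def)
    finally show ?thesis .
  qed
  ultimately show ?thesis by simp
qed

section \<open>The full Sobolev norm and the full radial expression\<close>

context cylindrical
begin

definition cyl_sobolev :: "nat \<Rightarrow> 'a set \<Rightarrow> nat set \<Rightarrow> 'b \<Rightarrow> 'a distr \<Rightarrow> ennreal" where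
  "cyl_sobolev m D C e V = (\<Sum>(a, b, c)\<in>{(a, b, c). c \<in> C \<and> a + b + c \<le> m}.
     distr_L2_sq D (\<lambda>_. 1) ((distr_diff ex ^^ a) ((distr_diff ey ^^ b) ((distr_diff (J e) ^^ c) V))))"

definition mer_sobolev :: "nat \<Rightarrow> 'b set \<Rightarrow> nat set \<Rightarrow> 'b \<Rightarrow> 'b distr \<Rightarrow> ennreal" where
  "mer_sobolev j \<Omega> C e T = (\<Sum>(a, c)\<in>{(a, c). c \<in> C \<and> a + c \<le> j}.
     distr_L2_sq \<Omega> wR ((distr_diff er ^^ a) ((distr_diff e ^^ c) T)))"

definition radial_sum :: "nat \<Rightarrow> 'b set \<Rightarrow> nat set \<Rightarrow> 'b \<Rightarrow> nat \<Rightarrow> ('b \<Rightarrow> complex) \<Rightarrow> ennreal" where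
  "radial_sum m \<Omega> C e n w =
     (\<Sum>l\<in>{0..min n m}. mer_sobolev (m - l) \<Omega> C e (distr_of \<Omega> (\<lambda>b. complex_of_real ((real n / R b) ^ l) * w b)))
   + (\<Sum>l\<in>{l. 1 \<le> l \<and> n + 2 * l \<le> m}. mer_sobolev (m - n - 2 * l) \<Omega> C e
        ((rinv_diff ^^ l) (distr_of \<Omega> (\<lambda>b. complex_of_real ((1 / R b) ^ n) * w b))))"

text \<open>Two cases are treated at once: \<open>C = {0}\<close> when there is no direction besides the radial one, and
  \<open>C = {..m}\<close> when \<open>e\<close> is such a direction.\<close>

context
  fixes D :: "'a set" and w :: "'b \<Rightarrow> complex" and u :: "'a \<Rightarrow> complex" and k :: int
    and C :: "nat set" and m :: nat and e :: 'b
  assumes D: "open D" "rot_invariant D"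
    and w: "w \<in> borel_measurable (lebesgue_on (mer D))" "L2_sq (mer D) wR w < \<infinity>"
    and u: "\<And>v. v \<in> revolve (mer D) \<Longrightarrow> u v = lift_fun k w v"
    and C: "C = {0} \<or> (C = {..m} \<and> e \<in> Basis \<and> e \<noteq> er)"
begin

lemma C_finite: "finite C" "c \<in> C \<Longrightarrow> c \<le> m" using C by auto

lemma C_direction: "c \<in> C \<Longrightarrow> c = 0 \<or> (e \<in> Basis \<and> e \<noteq> er)" using C by auto

lemma C_down: "c \<in> C \<Longrightarrow> i \<le> c \<Longrightarrow> i \<in> C" using C by auto

text \<open>Only a finite off-axis sum requires an argument. The derivatives are extended over the
  axis from the inside out, along \<open>J e\<close>, \<open>ey\<close> and \<open>ex\<close>. All
  lower orders demanded by \<open>axis_norm_pow\<close> are terms of the finite sum, since the index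
  set is closed downwards.\<close>

lemma cyl_sobolev_off_axis: "cyl_sobolev m D C e (distr_of D u) = cyl_sobolev m (D \<inter> off_axis) C e (distr_of D u)"
proof (rule antisym)
  show "cyl_sobolev m (D \<inter> off_axis) C e (distr_of D u) \<le> cyl_sobolev m D C e (distr_of D u)"
    unfolding cyl_sobolev_def using D(1) open_off_axis
    by (intro sum_mono) (auto intro!: distr_L2_sq_mono_domain pos_weight_one simp: open_Int)
  let ?N = "\<lambda>D a b c. distr_L2_sq D (\<lambda>_. 1) ((distr_diff ex ^^ a) ((distr_diff ey ^^ b) ((distr_diff (J e) ^^ c) (distr_of D u))))"
  let ?M = "\<lambda>a b c. distr_L2_sq (D \<inter> off_axis) (\<lambda>_. 1) ((distr_diff ex ^^ a) ((distr_diff ey ^^ b) ((distr_diff (J e) ^^ c) (distr_of D u))))"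
  show "cyl_sobolev m D C e (distr_of D u) \<le> cyl_sobolev m (D \<inter> off_axis) C e (distr_of D u)"
  proof (cases "cyl_sobolev m (D \<inter> off_axis) C e (distr_of D u) < \<infinity>")
    case True
    have fin: "?M a b c < \<infinity>" if "c \<in> C" "a + b + c \<le> m" for a b c
    proof -
      have "finite {(a, b, c). c \<in> C \<and> a + b + c \<le> m}"
        by (rule finite_subset[of _ "{..m} \<times> {..m} \<times> {..m}"]) auto
      from member_le_sum[OF _ _ this, of "(a, b, c)" "\<lambda>(a, b, c). ?M a b c"]
      have "?M a b c \<le> cyl_sobolev m (D \<inter> off_axis) C e (distr_of D u)" using that by (simp add: cyl_sobolev_def)
      then show ?thesis using True by (rule le_less_trans)
    qed
    show ?thesis unfolding cyl_sobolev_def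
    proof (rule sum_mono, clarify)
      fix a b c assume c: "c \<in> C" "a + b + c \<le> m"
      note base = distr_of_lift(1)[OF D w u] axis_norm_base[OF D(1) distr_of_lift(1,2)[OF D w u]]
      have 1: "linear_distr D ((distr_diff (J e) ^^ c) (distr_of D u)) \<and> ?N D 0 0 c \<le> ?M 0 0 c"
      proof (cases "c = 0")
        case True
        then show ?thesis using base by simp
      next
        case False
        then have e: "J e \<in> Basis" using C_direction[OF c(1)] J_in_Basis by auto
        have "distr_L2_sq (D \<inter> off_axis) (\<lambda>_. 1) ((distr_diff (J e) ^^ i) (distr_of D u)) < \<infinity>" if "i \<le> c" for i
          using fin[of i 0 0] C_down[OF c(1) that] c(2) that by simp
        from axis_norm_pow[OF D(1) base e this] show ?thesis by simp
      qed
      have 2: "linear_distr D ((distr_diff ey ^^ b) ((distr_diff (J e) ^^ c) (distr_of D u))) \<and> ?N D 0 b c \<le> ?M 0 b c"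
        using axis_norm_pow[OF D(1) _ _ ey, of "(distr_diff (J e) ^^ c) (distr_of D u)" b] 1 fin[of c 0] c by simp
      show "?N D a b c \<le> ?M a b c"
        using axis_norm_pow[OF D(1) _ _ ex_Basis, of "(distr_diff ey ^^ b) ((distr_diff (J e) ^^ c) (distr_of D u))" a] 2 fin[of c _ b] c by simp
    qed
  qed (simp add: less_top[symmetric])
qed

lemma cyl_sobolev_cart_norm:
  "cyl_sobolev m D C e (distr_of D u) = (\<Sum>c\<in>C. \<Sum>j\<le>m - c. cart_norm (mer D) j k ((distr_diff e ^^ c) (distr_of (mer D) w)))"
proof -
  have "cyl_sobolev m D C e (distr_of D u) = (\<Sum>c\<in>C. \<Sum>j\<le>m - c. \<Sum>a\<le>j.
      distr_L2_sq (D \<inter> off_axis) (\<lambda>_. 1) ((distr_diff ex ^^ a) ((distr_diff ey ^^ (j - a)) ((distr_diff (J e) ^^ c) (distr_of D u)))))"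
    unfolding cyl_sobolev_off_axis unfolding cyl_sobolev_def by (rule sum_triples[OF C_finite])
  then show ?thesis
    by (simp add: cart_diff_lift_norm[OF D w u C_direction] cart_norm_def)
qed

lemma radial_sum_radial_norm:
  "radial_sum m (mer D) C e n w = (\<Sum>c\<in>C. \<Sum>j\<le>m - c. radial_norm (mer D) j n ((distr_diff e ^^ c) (distr_of (mer D) w)))"
proof -
  let ?f = "\<lambda>x j c. distr_L2_sq (mer D) wR (radop j (rad_poly n j x) ((distr_diff e ^^ c) (distr_of (mer D) w)))"
  have "radial_sum m (mer D) C e n w =
     (\<Sum>l\<in>{0..min n m}. \<Sum>(a, c)\<in>{(a, c). c \<in> C \<and> a + c \<le> m - l}. ?f (Inl l) (l + a) c)
   + (\<Sum>l\<in>{l. 1 \<le> l \<and> n + 2 * l \<le> m}. \<Sum>(a, c)\<in>{(a, c). c \<in> C \<and> a + c \<le> m - n - 2 * l}. ?f (Inr l) (n + 2 * l + a) c)"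
    unfolding radial_sum_def mer_sobolev_def
  proof (rule arg_cong2[where f = "(+)"]; rule sum.cong[OF refl], rule sum.cong[OF refl], clarify)
    fix l a c assume "c \<in> C"
    from radial_term_Inl[OF D w u C_direction[OF this]]
    show "distr_L2_sq (mer D) wR ((distr_diff er ^^ a) ((distr_diff e ^^ c) (distr_of (mer D) (\<lambda>b. complex_of_real ((real n / R b) ^ l) * w b))))
      = ?f (Inl l) (l + a) c" .
  next
    fix l a c assume "c \<in> C"
    from radial_term_Inr[OF D w u C_direction[OF this]]
    show "distr_L2_sq (mer D) wR ((distr_diff er ^^ a) ((distr_diff e ^^ c) ((rinv_diff ^^ l) (distr_of (mer D) (\<lambda>b. complex_of_real ((1 / R b) ^ n) * w b)))))
      = ?f (Inr l) (n + 2 * l + a) c" .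
  qed
  also have "\<dots> = (\<Sum>c\<in>C. \<Sum>j\<le>m - c. \<Sum>x\<in>rad_index n j. ?f x j c)" by (rule sum_rad_index[OF C_finite])
  finally show ?thesis by (simp add: radial_norm_def)
qed

end

text \<open>K is fixed before the domain, the function and the frequency. \<open>u\<close> need only
  agree with \<open>lift_fun\<close> off the axis, because a lift through \<open>Arg\<close> may
  take other values on it.\<close>

definition equiv_constant :: "nat \<Rightarrow> real \<Rightarrow> bool" where
  "equiv_constant m K \<longleftrightarrow> (\<forall>D w u k C e. open D \<longrightarrow> rot_invariant D \<longrightarrow>
     w \<in> borel_measurable (lebesgue_on (mer D)) \<longrightarrow> L2_sq (mer D) wR w < \<infinity> \<longrightarrow>
     (\<forall>v\<in>revolve (mer D). u v = lift_fun k w v) \<longrightarrow> C = {0} \<or> (C = {..m} \<and> e \<in> Basis \<and> e \<noteq> er) \<longrightarrow>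
     ennreal (1 / K) * cyl_sobolev m D C e (distr_of D u) \<le> radial_sum m (mer D) C e (nat \<bar>k\<bar>) w \<and>
     radial_sum m (mer D) C e (nat \<bar>k\<bar>) w \<le> ennreal K * cyl_sobolev m D C e (distr_of D u))"

lemma equiv_constant_exists: "\<exists>K>0. equiv_constant m K"
proof -
  obtain K where K: "K > 0" 
    "\<And>\<Omega> j k n T. j \<le> m \<Longrightarrow> open \<Omega> \<Longrightarrow> \<Omega> \<subseteq> {b. 0 < R b} \<Longrightarrow> linear_distr \<Omega> T \<Longrightarrow> \<bar>k\<bar> = int n \<Longrightarrow>
       cart_norm \<Omega> j k T \<le> ennreal K * radial_norm \<Omega> j n T \<and> radial_norm \<Omega> j n T \<le> ennreal K * cart_norm \<Omega> j k T"
    by (rule uniform_equivalence) (rule that)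
  have "equiv_constant m K"
    unfolding equiv_constant_def
  proof (intro allI impI)
    fix D :: "'a set" and w :: "'b \<Rightarrow> complex" and u :: "'a \<Rightarrow> complex" and k :: int and C :: "nat set" and e :: 'b
    assume D: "open D" "rot_invariant D"
      and w: "w \<in> borel_measurable (lebesgue_on (mer D))" "L2_sq (mer D) wR w < \<infinity>"
      and "\<forall>v\<in>revolve (mer D). u v = lift_fun k w v"
      and C: "C = {0} \<or> (C = {..m} \<and> e \<in> Basis \<and> e \<noteq> er)"
    then have u: "\<And>v. v \<in> revolve (mer D) \<Longrightarrow> u v = lift_fun k w v" by blast
    let ?H = "cyl_sobolev m D C e (distr_of D u)" and ?S = "radial_sum m (mer D) C e (nat \<bar>k\<bar>) w"
    have lin: "linear_distr (mer D) ((distr_diff e ^^ c) (distr_of (mer D) w))" if "c \<in> C" for c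
      by (rule linear_distr_diff_w[OF D w u]) (use C that in auto)
    note H = cyl_sobolev_cart_norm[OF D w u C] and S = radial_sum_radial_norm[OF D w u C]
    have b: "cart_norm (mer D) j k ((distr_diff e ^^ c) (distr_of (mer D) w)) \<le> ennreal K * radial_norm (mer D) j (nat \<bar>k\<bar>) ((distr_diff e ^^ c) (distr_of (mer D) w)) \<and>
       radial_norm (mer D) j (nat \<bar>k\<bar>) ((distr_diff e ^^ c) (distr_of (mer D) w)) \<le> ennreal K * cart_norm (mer D) j k ((distr_diff e ^^ c) (distr_of (mer D) w))"
      if "c \<in> C" "j \<le> m - c" for c j
      by (rule K(2)[OF _ open_mer[OF D(1)] mer_pos lin[OF that(1)]]) (use that in auto)
    have "?H \<le> ennreal K * ?S"
      using b by (auto simp: H S sum_distrib_left intro!: sum_mono)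
    then have "ennreal (1 / K) * ?H \<le> ennreal (1 / K) * (ennreal K * ?S)" by (rule mult_left_mono) simp
    also have "\<dots> = ?S" using K(1) by (simp add: mult.assoc[symmetric] ennreal_mult[symmetric])
    finally have "ennreal (1 / K) * ?H \<le> ?S" .
    moreover have "?S \<le> ennreal K * ?H"
      using b by (auto simp: H S sum_distrib_left intro!: sum_mono)
    ultimately show "ennreal (1 / K) * ?H \<le> ?S \<and> ?S \<le> ennreal K * ?H" by blast
  qed
  with K(1) show ?thesis by blast
qed

end

section \<open>Domains in three and two dimensions\<close>

lemma nn_integral_lborel_pair:
  fixes f :: "'a::euclidean_space \<times> 'b::euclidean_space \<Rightarrow> ennreal"
  assumes "f \<in> borel_measurable borel"
  shows "(\<integral>\<^sup>+v. f v \<partial>lborel) = (\<integral>\<^sup>+x. \<integral>\<^sup>+y. f (x, y) \<partial>lborel \<partial>lborel)"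
    and "(\<integral>\<^sup>+v. f v \<partial>lborel) = (\<integral>\<^sup>+y. \<integral>\<^sup>+x. f (x, y) \<partial>lborel \<partial>lborel)"
proof -
  have "f \<in> borel_measurable (lborel \<Otimes>\<^sub>M lborel)" using assms by (simp add: lborel_prod)
  from lborel.nn_integral_fst[OF this] lborel_pair.nn_integral_snd[of f, OF this]
  show "(\<integral>\<^sup>+v. f v \<partial>lborel) = (\<integral>\<^sup>+x. \<integral>\<^sup>+y. f (x, y) \<partial>lborel \<partial>lborel)"
    "(\<integral>\<^sup>+v. f v \<partial>lborel) = (\<integral>\<^sup>+y. \<integral>\<^sup>+x. f (x, y) \<partial>lborel \<partial>lborel)"
    by (simp_all add: lborel_prod)
qed

lemma borel_measurable_nn_integral_borel:
  fixes f :: "'a::euclidean_space \<Rightarrow> 'b::euclidean_space \<Rightarrow> ennreal"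
  assumes "(\<lambda>v. f (fst v) (snd v)) \<in> borel_measurable borel"
  shows "(\<lambda>x. \<integral>\<^sup>+y. f x y \<partial>lborel) \<in> borel_measurable borel"
proof -
  have "case_prod f \<in> borel_measurable (borel \<Otimes>\<^sub>M lborel)"
  proof (subst measurable_cong_sets[OF sets_pair_measure_cong[OF refl sets_lborel] refl])
    show "case_prod f \<in> borel_measurable (borel \<Otimes>\<^sub>M borel)" using assms by (simp add: split_def borel_prod)
  qed
  from lborel.borel_measurable_nn_integral[OF this] show ?thesis .
qed

text \<open>Triples nest to the right, so x and y are regrouped as a pair. Planar polar coordinates
  are applied for fixed z, with the z-integral outermost, and r and z are then joined to a meridian
  point.\<close>

lemma nn_integral_cylinder:
  fixes f :: "real \<times> real \<times> real \<Rightarrow> ennreal"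
  assumes f: "f \<in> borel_measurable borel"
  shows "(\<integral>\<^sup>+v. f v \<partial>lborel) = (\<integral>\<^sup>+(r, z). \<integral>\<^sup>+\<theta>. ennreal r * f (r * cos \<theta>, r * sin \<theta>, z)
     * indicator {0<..} r * indicator {-pi/2..3*pi/2} \<theta> \<partial>lborel \<partial>lborel)"
proof -
  have comp: "(\<lambda>v. f (g v)) \<in> borel_measurable borel" if "continuous_on UNIV g" for g :: "'x::euclidean_space \<Rightarrow> _"
    using measurable_compose[OF borel_measurable_continuous_onI[OF that] f] .
  have "(\<integral>\<^sup>+v. f v \<partial>lborel) = (\<integral>\<^sup>+x. \<integral>\<^sup>+q. f (x, q) \<partial>lborel \<partial>lborel)"
    by (rule nn_integral_lborel_pair(1)[OF f])
  also have "\<dots> = (\<integral>\<^sup>+x. \<integral>\<^sup>+y. \<integral>\<^sup>+z. f (x, y, z) \<partial>lborel \<partial>lborel \<partial>lborel)"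
    by (intro nn_integral_cong nn_integral_lborel_pair(1) comp continuous_intros)
  also have "\<dots> = (\<integral>\<^sup>+p. \<integral>\<^sup>+z. f (fst p, snd p, z) \<partial>lborel \<partial>lborel)"
    by (subst nn_integral_lborel_pair(1)) (simp_all, intro borel_measurable_nn_integral_borel comp continuous_intros)
  also have "\<dots> = (\<integral>\<^sup>+z. \<integral>\<^sup>+p. f (fst p, snd p, z) \<partial>lborel \<partial>lborel)"
  proof -
    have "(\<lambda>w. f (fst (fst w), snd (fst w), snd w)) \<in> borel_measurable borel" by (intro comp continuous_intros)
    from nn_integral_lborel_pair[OF this] show ?thesis by simp
  qed
  also have "\<dots> = (\<integral>\<^sup>+z. \<integral>\<^sup>+r. \<integral>\<^sup>+\<theta>. ennreal r * f (r * cos \<theta>, r * sin \<theta>, z)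
     * indicator {0<..} r * indicator {-pi/2..3*pi/2} \<theta> \<partial>lborel \<partial>lborel \<partial>lborel)"
  proof (rule nn_integral_cong)
    fix z
    have "(\<lambda>p. f (fst p, snd p, z)) \<in> borel_measurable borel" by (intro comp continuous_intros)
    from nn_integral_polar[OF this]
    show "(\<integral>\<^sup>+p. f (fst p, snd p, z) \<partial>lborel) = (\<integral>\<^sup>+r. \<integral>\<^sup>+\<theta>. ennreal r * f (r * cos \<theta>, r * sin \<theta>, z)
     * indicator {0<..} r * indicator {-pi/2..3*pi/2} \<theta> \<partial>lborel \<partial>lborel)" by simp
  qed
  also have "\<dots> = (\<integral>\<^sup>+q. \<integral>\<^sup>+\<theta>. ennreal (fst q) * f (fst q * cos \<theta>, fst q * sin \<theta>, snd q)
     * indicator {0<..} (fst q) * indicator {-pi/2..3*pi/2} \<theta> \<partial>lborel \<partial>lborel)"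
  proof -
    have "(\<lambda>v. ennreal (fst (fst v)) * f (fst (fst v) * cos (snd v), fst (fst v) * sin (snd v), snd (fst v))
       * indicator {0<..} (fst (fst v)) * indicator {-pi/2..3*pi/2} (snd v)) \<in> borel_measurable (borel :: ((real \<times> real) \<times> real) measure)"
    proof (intro borel_measurable_times_ennreal comp continuous_intros)
      have c: "continuous_on UNIV (\<lambda>v :: (real \<times> real) \<times> real. fst (fst v))" "continuous_on UNIV (snd :: (real \<times> real) \<times> real \<Rightarrow> _)"
        by (intro continuous_intros)+
      show "(\<lambda>v. ennreal (fst (fst v))) \<in> borel_measurable (borel :: ((real \<times> real) \<times> real) measure)"
        "(\<lambda>v. indicator {0<..} (fst (fst v)) :: ennreal) \<in> borel_measurable (borel :: ((real \<times> real) \<times> real) measure)"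
        using measurable_compose[OF borel_measurable_continuous_onI[OF c(1)], of ennreal borel]
          measurable_compose[OF borel_measurable_continuous_onI[OF c(1)], of "indicator {0<..}" borel] by simp_all
      show "(\<lambda>v. indicator {-pi/2..3*pi/2} (snd v) :: ennreal) \<in> borel_measurable (borel :: ((real \<times> real) \<times> real) measure)"
        using measurable_compose[OF borel_measurable_continuous_onI[OF c(2)], of "indicator {-pi/2..3*pi/2}" borel] by simp
    qed
    from nn_integral_lborel_pair(2)[OF borel_measurable_nn_integral_borel[OF this]] show ?thesis by simp
  qed
  finally show ?thesis by (simp add: split_def)
qed

lemma cylindrical_3d: "cylindrical (\<lambda>(r :: real, z :: real). (r, 0 :: real, z)) (1, 0) (0, 1, 0)"
proof (rule cylindrical.intro)
  show "linear (\<lambda>(r :: real, z :: real). (r, 0 :: real, z))" by (rule linearI) auto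
  show "(1, 0) \<in> (Basis :: (real \<times> real) set)" "(0, 1, 0) \<in> (Basis :: (real \<times> real \<times> real) set)"
    by (auto simp: Basis_prod_def)
  show "(\<lambda>(r :: real, z :: real). (r, 0 :: real, z)) ` Basis = Basis - {(0, 1, 0)}"
    "inj_on (\<lambda>(r :: real, z :: real). (r, 0 :: real, z)) Basis"
    by (auto simp: Basis_prod_def inj_on_def image_iff zero_prod_def)
  fix f :: "real \<times> real \<times> real \<Rightarrow> ennreal" assume "f \<in> borel_measurable borel"
  from nn_integral_cylinder[OF this]
  show "(\<integral>\<^sup>+v. f v \<partial>lborel) = (\<integral>\<^sup>+b. \<integral>\<^sup>+\<theta>. ennreal (b \<bullet> (1, 0)) *
      f ((case b of (r, z) \<Rightarrow> (r, 0, z)) + (b \<bullet> (1, 0) * (cos \<theta> - 1)) *\<^sub>R (case (1, 0) of (r, z) \<Rightarrow> (r, 0, z)) + (b \<bullet> (1, 0) * sin \<theta>) *\<^sub>R (0, 1, 0))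
      * indicator {0<..} (b \<bullet> (1, 0)) * indicator {-pi/2..3*pi/2} \<theta> \<partial>lborel \<partial>lborel)"
    by (simp add: split_def right_diff_distrib inner_prod_def)
qed

lemma cylindrical_2d: "cylindrical (\<lambda>r :: real. (r, 0 :: real)) 1 (0, 1)"
proof (rule cylindrical.intro)
  show "linear (\<lambda>r :: real. (r, 0 :: real))" by (rule linearI) auto
  show "1 \<in> (Basis :: real set)" "(0, 1) \<in> (Basis :: (real \<times> real) set)" by (auto simp: Basis_prod_def)
  show "(\<lambda>r :: real. (r, 0 :: real)) ` Basis = Basis - {(0, 1)}" "inj_on (\<lambda>r :: real. (r, 0 :: real)) Basis"
    by (auto simp: Basis_prod_def zero_prod_def)
  fix f :: "real \<times> real \<Rightarrow> ennreal" assume "f \<in> borel_measurable borel"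
  from nn_integral_polar[OF this]
  show "(\<integral>\<^sup>+v. f v \<partial>lborel) = (\<integral>\<^sup>+b. \<integral>\<^sup>+\<theta>. ennreal (b \<bullet> 1) *
      f ((b, 0) + (b \<bullet> 1 * (cos \<theta> - 1)) *\<^sub>R (1, 0) + (b \<bullet> 1 * sin \<theta>) *\<^sub>R (0, 1))
      * indicator {0<..} (b \<bullet> 1) * indicator {-pi/2..3*pi/2} \<theta> \<partial>lborel \<partial>lborel)"
    by (simp add: right_diff_distrib)
qed

section \<open>Identification with the stated norms\<close>

context cylindrical
begin

text \<open>Links the concrete lifts to \<open>dir\<close>: off the axis, \<open>dir v\<close> is
  the unit complex number with the argument of (x, y).\<close>

lemma lift_fun_Arg:
  assumes "0 < rho v"
  shows "lift_fun k w v = cis (of_int k * Arg (Complex (v \<bullet> ex) (v \<bullet> ey))) * w (rad v)"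
proof -
  let ?z = "Complex (v \<bullet> ex) (v \<bullet> ey)"
  have n: "norm ?z = rho v" by (simp add: complex_norm rho_def)
  then have "?z \<noteq> 0" using assms by auto
  then have "dir v = cis (Arg ?z)" by (simp add: cis_Arg sgn_eq dir_def n)
  then show ?thesis by (simp add: lift_fun_def cis_power_int)
qed

end

lemma axisymmetric_equiv:
  "\<exists>c C :: real. 0 < c \<and> 0 < C \<and>
       (\<forall>(k :: int) (D :: (real \<times> real \<times> real) set) (w :: real \<times> real \<Rightarrow> complex).
          axisymmetric_domain D \<longrightarrow> w \<in> L2_1 (meridian D) \<longrightarrow>
          (let \<Omega> = meridian D; n = nat \<bar>k\<bar>;
               S = (\<Sum>l\<in>{0..min n m}.
                      H1_sq (m - l) \<Omega>
                        (distr_of \<Omega> (\<lambda>(r, z). complex_of_real ((real n / r) ^ l) * w (r, z))))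
                 + (\<Sum>l\<in>{l. 1 \<le> l \<and> n + 2 * l \<le> m}.
                      H1_sq (m - n - 2 * l) \<Omega>
                        ((rinv_dr ^^ l)
                           (distr_of \<Omega> (\<lambda>(r, z). complex_of_real ((1 / r) ^ n) * w (r, z)))))
           in ennreal c * Hk_sq m k D w \<le> S \<and> S \<le> ennreal C * Hk_sq m k D w))"
proof -
  interpret cyl: cylindrical "\<lambda>(r :: real, z :: real). (r, 0 :: real, z)" "(1, 0)" "(0, 1, 0)"
    by (rule cylindrical_3d)
  obtain K where K: "K > 0" "cyl.equiv_constant m K" using cyl.equiv_constant_exists by blast
  have inner: "b \<bullet> (1, 0) = fst b" for b :: "real \<times> real" by (simp add: inner_prod_def)
  have mer: "cyl.mer D = meridian D" for D by (auto simp: cyl.mer_def meridian_def inner)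
  have wR: "cyl.wR = weight_rz" by (auto simp: weight_rz_def inner)
  have rinv: "cyl.rinv_diff = rinv_dr"
    by (intro ext) (simp add: cyl.rinv_diff_def rinv_dr_def inner split_def)
  have rad: "cyl.rad (x, y, z) = (sqrt (x\<^sup>2 + y\<^sup>2), z)" for x y z
    by (simp add: cyl.rad_def Basis_prod_def cyl.rho_def inner_prod_def)
  \<comment> \<open>For j <= m the constraint c <= m follows from a + c <= j, so the index sets
    coincide.\<close>
  have H1: "cyl.mer_sobolev j \<Omega> {..m} (0, 1) T = H1_sq j \<Omega> T" if "j \<le> m" for j \<Omega> T
    unfolding cyl.mer_sobolev_def H1_sq_def wR using that by (intro sum.cong) auto
  have S: "cyl.radial_sum m \<Omega> {..m} (0, 1) n w =
      (\<Sum>l\<in>{0..min n m}. H1_sq (m - l) \<Omega> (distr_of \<Omega> (\<lambda>(r, z). complex_of_real ((real n / r) ^ l) * w (r, z))))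
    + (\<Sum>l\<in>{l. 1 \<le> l \<and> n + 2 * l \<le> m}. H1_sq (m - n - 2 * l) \<Omega>
        ((rinv_dr ^^ l) (distr_of \<Omega> (\<lambda>(r, z). complex_of_real ((1 / r) ^ n) * w (r, z)))))" for \<Omega> n w
    by (simp add: cyl.radial_sum_def H1 rinv inner split_def)
  have H: "cyl.cyl_sobolev m D {..m} (0, 1) (distr_of D u) = H_sq_3d m D u" for D u
    unfolding cyl.cyl_sobolev_def H_sq_3d_def by (intro sum.cong) auto
  show ?thesis
  proof (rule exI[of _ "1 / K"], rule exI[of _ K], intro conjI allI impI)
    show "0 < 1 / K" "0 < K" using K(1) by simp_all
    fix k D and w :: "real \<times> real \<Rightarrow> complex" assume D: "axisymmetric_domain D" and w: "w \<in> L2_1 (meridian D)"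
    have "cyl.rot_invariant D"
      unfolding cyl.rot_invariant_def
    proof (intro allI impI)
      fix b :: "real \<times> real" and \<theta>
      obtain r z where b: "b = (r, z)" by (cases b)
      have pol: "cyl.pol \<theta> b = rot_z \<theta> (r, 0, z)"
        by (simp add: b cyl.pol_def inner rot_z_def right_diff_distrib)
      have inv: "rot_z (- \<theta>) (rot_z \<theta> (r, 0, z)) = (r, 0, z)"
        by (simp add: rot_z_def power2_eq_square[symmetric] mult.assoc distrib_left[symmetric])
      have "rot_z t p \<in> D" if "p \<in> D" for t p using D that by (auto simp: axisymmetric_domain_def)
      from this[of "(r, 0, z)" \<theta>] this[of "rot_z \<theta> (r, 0, z)" "- \<theta>"]
      show "(cyl.pol \<theta> b \<in> D) = ((case b of (r, z) \<Rightarrow> (r, 0, z)) \<in> D)"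
        unfolding pol by (auto simp: inv b)
    qed
    moreover have "lift k w v = cyl.lift_fun k w v" if "v \<in> cyl.revolve (cyl.mer D)" for v
    proof -
      have "0 < cyl.rho v" using that by (simp add: cyl.revolve_def cyl.off_axis_def)
      from cyl.lift_fun_Arg[OF this] show ?thesis by (cases v) (simp add: lift_def rad inner_prod_def)
    qed
    moreover have "{..m} = {0} \<or> ({..m} = {..m} \<and> (0, 1) \<in> (Basis :: (real \<times> real) set) \<and> (0, 1) \<noteq> (1 :: real, 0 :: real))"
      by (auto simp: Basis_prod_def)
    ultimately have "ennreal (1 / K) * cyl.cyl_sobolev m D {..m} (0, 1) (distr_of D (lift k w)) \<le> cyl.radial_sum m (cyl.mer D) {..m} (0, 1) (nat \<bar>k\<bar>) w \<and>
      cyl.radial_sum m (cyl.mer D) {..m} (0, 1) (nat \<bar>k\<bar>) w \<le> ennreal K * cyl.cyl_sobolev m D {..m} (0, 1) (distr_of D (lift k w))"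
      using D w by (intro K(2)[unfolded cyl.equiv_constant_def, rule_format]) (auto simp: axisymmetric_domain_def mer wR L2_1_def)
    then show "let \<Omega> = meridian D; n = nat \<bar>k\<bar>;
           S = (\<Sum>l\<in>{0..min n m}.
                  H1_sq (m - l) \<Omega> (distr_of \<Omega> (\<lambda>(r, z). complex_of_real ((real n / r) ^ l) * w (r, z))))
             + (\<Sum>l\<in>{l. 1 \<le> l \<and> n + 2 * l \<le> m}.
                  H1_sq (m - n - 2 * l) \<Omega>
                    ((rinv_dr ^^ l) (distr_of \<Omega> (\<lambda>(r, z). complex_of_real ((1 / r) ^ n) * w (r, z)))))
       in ennreal (1 / K) * Hk_sq m k D w \<le> S \<and> S \<le> ennreal K * Hk_sq m k D w"
      unfolding Let_def Hk_sq_def S H mer .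
  qed
qed

lemma disc_or_annulus_open:
  assumes "disc_or_annulus D"
  shows "open D"
proof -
  have "open {p :: real \<times> real. ereal (norm p) < R}" for R
    by (intro open_Collect_less continuous_on_ereal continuous_intros)
  moreover have "open {p :: real \<times> real. \<rho> < norm p}" for \<rho> :: real
    by (intro open_Collect_less continuous_intros)
  ultimately show ?thesis using assms by (auto simp: disc_or_annulus_def Collect_conj_eq)
qed

lemma disc_or_annulus_norm:
  assumes "disc_or_annulus D" "norm p = norm q"
  shows "p \<in> D \<longleftrightarrow> q \<in> D"
  using assms by (auto simp: disc_or_annulus_def)

text \<open>The meridian domain is an interval, without any direction besides the radial one. This
  is the case C = {0}, and 0 is passed as a placeholder for the direction \<open>e\<close>, along
  which zero derivatives are taken.\<close>

lemma disc_or_annulus_equiv: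
  "\<exists>c C :: real. 0 < c \<and> 0 < C \<and>
       (\<forall>(k :: int) (D :: (real \<times> real) set) (w :: real \<Rightarrow> complex).
          disc_or_annulus D \<longrightarrow> w \<in> L2_1_2d (meridian_2d D) \<longrightarrow>
          (let \<Omega> = meridian_2d D; n = nat \<bar>k\<bar>;
               S = (\<Sum>l\<in>{0..min n m}.
                      H1_sq_2d (m - l) \<Omega>
                        (distr_of \<Omega> (\<lambda>r. complex_of_real ((real n / r) ^ l) * w r)))
                 + (\<Sum>l\<in>{l. 1 \<le> l \<and> n + 2 * l \<le> m}.
                      H1_sq_2d (m - n - 2 * l) \<Omega>
                        ((rinv_dr_2d ^^ l)
                           (distr_of \<Omega> (\<lambda>r. complex_of_real ((1 / r) ^ n) * w r))))
           in ennreal c * Hk_sq_2d m k D w \<le> S \<and> S \<le> ennreal C * Hk_sq_2d m k D w))"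
proof -
  interpret cyl: cylindrical "\<lambda>r :: real. (r, 0 :: real)" 1 "(0, 1)"
    by (rule cylindrical_2d)
  obtain K where K: "K > 0" "cyl.equiv_constant m K" using cyl.equiv_constant_exists by blast
  have mer: "cyl.mer D = meridian_2d D" for D by (auto simp: cyl.mer_def meridian_2d_def)
  have wR: "(\<lambda>r. 2 * pi * r) = weight_r" by (auto simp: weight_r_def)
  have rinv: "cyl.rinv_diff = rinv_dr_2d"
    by (intro ext) (simp add: cyl.rinv_diff_def rinv_dr_2d_def)
  have rad: "cyl.rad (x, y) = sqrt (x\<^sup>2 + y\<^sup>2)" for x y
    by (simp add: cyl.rad_def cyl.rho_def inner_prod_def)
  have H1: "cyl.mer_sobolev j \<Omega> {0} 0 T = H1_sq_2d j \<Omega> T" for j \<Omega> T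
    unfolding cyl.mer_sobolev_def H1_sq_2d_def inner_real_def mult_1_right wR
    by (rule sum.reindex_bij_witness[where i = "\<lambda>a. (a, 0)" and j = fst]) auto
  have S: "cyl.radial_sum m \<Omega> {0} 0 n w =
      (\<Sum>l\<in>{0..min n m}. H1_sq_2d (m - l) \<Omega> (distr_of \<Omega> (\<lambda>r. complex_of_real ((real n / r) ^ l) * w r)))
    + (\<Sum>l\<in>{l. 1 \<le> l \<and> n + 2 * l \<le> m}. H1_sq_2d (m - n - 2 * l) \<Omega>
        ((rinv_dr_2d ^^ l) (distr_of \<Omega> (\<lambda>r. complex_of_real ((1 / r) ^ n) * w r))))" for \<Omega> n w
    by (simp add: cyl.radial_sum_def H1 rinv)
  have H: "cyl.cyl_sobolev m D {0} 0 (distr_of D u) = H_sq_2d m D u" for D u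
    unfolding cyl.cyl_sobolev_def H_sq_2d_def
    by (rule sum.reindex_bij_witness[where i = "\<lambda>(a, b). (a, b, 0)" and j = "\<lambda>(a, b, c). (a, b)"]) auto
  show ?thesis
  proof (rule exI[of _ "1 / K"], rule exI[of _ K], intro conjI allI impI)
    show "0 < 1 / K" "0 < K" using K(1) by simp_all
    fix k D and w :: "real \<Rightarrow> complex" assume D: "disc_or_annulus D" and w: "w \<in> L2_1_2d (meridian_2d D)"
    have "cyl.rot_invariant D"
      unfolding cyl.rot_invariant_def
    proof (intro allI impI)
      fix r \<theta> :: real
      have "cyl.pol \<theta> r = (r * cos \<theta>, r * sin \<theta>)" by (simp add: cyl.pol_def right_diff_distrib)
      then have "norm (cyl.pol \<theta> r) = norm (r, 0 :: real)"
        by (simp add: norm_prod_def power_mult_distrib distrib_left[symmetric] del: distrib_left)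
      from disc_or_annulus_norm[OF D this] show "(cyl.pol \<theta> r \<in> D) = ((r, 0) \<in> D)" .
    qed
    moreover have "lift_2d k w v = cyl.lift_fun k w v" if "v \<in> cyl.revolve (cyl.mer D)" for v
    proof -
      have "0 < cyl.rho v" using that by (simp add: cyl.revolve_def cyl.off_axis_def)
      from cyl.lift_fun_Arg[OF this] show ?thesis by (cases v) (simp add: lift_2d_def rad inner_prod_def)
    qed
    moreover have "L2_sq (cyl.mer D) cyl.wR w < \<infinity>" "w \<in> borel_measurable (lebesgue_on (cyl.mer D))"
      using w unfolding L2_1_2d_def inner_real_def mult_1_right wR mer by auto
    ultimately have "ennreal (1 / K) * cyl.cyl_sobolev m D {0} 0 (distr_of D (lift_2d k w)) \<le> cyl.radial_sum m (cyl.mer D) {0} 0 (nat \<bar>k\<bar>) w \<and>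
      cyl.radial_sum m (cyl.mer D) {0} 0 (nat \<bar>k\<bar>) w \<le> ennreal K * cyl.cyl_sobolev m D {0} 0 (distr_of D (lift_2d k w))"
      using disc_or_annulus_open[OF D] by (intro K(2)[unfolded cyl.equiv_constant_def, rule_format]) (auto simp del: inner_real_def)
    then show "let \<Omega> = meridian_2d D; n = nat \<bar>k\<bar>;
           S = (\<Sum>l\<in>{0..min n m}.
                  H1_sq_2d (m - l) \<Omega> (distr_of \<Omega> (\<lambda>r. complex_of_real ((real n / r) ^ l) * w r)))
             + (\<Sum>l\<in>{l. 1 \<le> l \<and> n + 2 * l \<le> m}.
                  H1_sq_2d (m - n - 2 * l) \<Omega>
                    ((rinv_dr_2d ^^ l) (distr_of \<Omega> (\<lambda>r. complex_of_real ((1 / r) ^ n) * w r))))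
       in ennreal (1 / K) * Hk_sq_2d m k D w \<le> S \<and> S \<le> ennreal K * Hk_sq_2d m k D w"
      unfolding Let_def Hk_sq_2d_def S H mer .
  qed
qed

theorem theorem1p1:
  fixes m :: nat
  shows
    "(\<exists>c C :: real. 0 < c \<and> 0 < C \<and>
       (\<forall>(k :: int) (D :: (real \<times> real \<times> real) set) (w :: real \<times> real \<Rightarrow> complex).
          axisymmetric_domain D \<longrightarrow> w \<in> L2_1 (meridian D) \<longrightarrow>
          (let \<Omega> = meridian D; n = nat \<bar>k\<bar>;
               S = (\<Sum>l\<in>{0..min n m}.
                      H1_sq (m - l) \<Omega>
                        (distr_of \<Omega> (\<lambda>(r, z). complex_of_real ((real n / r) ^ l) * w (r, z))))
                 + (\<Sum>l\<in>{l. 1 \<le> l \<and> n + 2 * l \<le> m}.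
                      H1_sq (m - n - 2 * l) \<Omega>
                        ((rinv_dr ^^ l)
                           (distr_of \<Omega> (\<lambda>(r, z). complex_of_real ((1 / r) ^ n) * w (r, z)))))
           in ennreal c * Hk_sq m k D w \<le> S \<and> S \<le> ennreal C * Hk_sq m k D w)))
   \<and> (\<exists>c C :: real. 0 < c \<and> 0 < C \<and>
       (\<forall>(k :: int) (D :: (real \<times> real) set) (w :: real \<Rightarrow> complex).
          disc_or_annulus D \<longrightarrow> w \<in> L2_1_2d (meridian_2d D) \<longrightarrow>
          (let \<Omega> = meridian_2d D; n = nat \<bar>k\<bar>;
               S = (\<Sum>l\<in>{0..min n m}.
                      H1_sq_2d (m - l) \<Omega>
                        (distr_of \<Omega> (\<lambda>r. complex_of_real ((real n / r) ^ l) * w r)))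
                 + (\<Sum>l\<in>{l. 1 \<le> l \<and> n + 2 * l \<le> m}.
                      H1_sq_2d (m - n - 2 * l) \<Omega>
                        ((rinv_dr_2d ^^ l)
                           (distr_of \<Omega> (\<lambda>r. complex_of_real ((1 / r) ^ n) * w r))))
           in ennreal c * Hk_sq_2d m k D w \<le> S \<and> S \<le> ennreal C * Hk_sq_2d m k D w)))"
  by (intro conjI axisymmetric_equiv disc_or_annulus_equiv)

end
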